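(* Let $G=\mathrm{SL}_3(\mathbb{R})$, $\Gamma=\mathrm{SL}_3(\mathbb{Z})$, $X=G/\Gamma$. Let $F=\{g_t:t\in\mathbb{R}\}$ be a one-parameter diagonalizable subgroup of $G$, let $F^+=\{g_t:t\ge 0\}$, and let $$H=H(F^+):=\{h\in G:\lim_{t\to+\infty}g_t^{-1}hg_t=e\}.$$ Then for any $\Lambda\in X$, the set $$\{h\in H: h\Lambda\in E(F^+)\},\qquad\text{where } E(F^+)=\{\Lambda'\in X: F^+\Lambda'\text{ is bounded}\},$$ is HAW on $H$.
   Context: A one-parameter subgroup is the image of a continuous homomorphism $t\mapsto g_t$ from $\mathbb{R}$ to $G$; it is diagonalizable if its elements are diagonalizable over $\mathbb{C}$ (not necessarily over $\mathbb{R}$). $G$ acts on $X$ by left translations, and a subset of $X$ is bounded if it is contained in a compact subset of $X$. $e$ is the identity of $G$. $H(F^+)$ (the expanding horospherical subgroup of $G$ relative to $F^+$) is a closed subgroup of $G$, regarded as a manifold. Hyperplane absolute game. Let $W\subset\mathbb{R}^d$ be open, $S\subset\mathbb{R}^d$ a target set, $\beta\in(0,\frac13)$. For an affine hyperplane $L\subset\mathbb{R}^d$ and $\rho>0$ put $L^{(\rho)}=\{\mathbf{x}\in\mathbb{R}^d:\mathrm{dist}(\mathbf{x},L)<\rho\}$. Bob begins by choosing a closed ball $B_0\subset W$ of radius $\rho_0>0$. After Bob chooses a closed ball $B_i$ of radius $\rho_i$, Alice chooses a hyperplane neighborhood $L_i^{(\rho_i')}$ with $\rho_i'\le\beta\rho_i$,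 and then Bob chooses a closed ball $B_{i+1}\subset B_i\setminus L_i^{(\rho_i')}$ of radius $\rho_{i+1}\ge\beta\rho_i$. Alice wins if and only if $\bigcap_{i=0}^\infty B_i\cap S\neq\varnothing$. The set $S$ is HAW (hyperplane absolute winning) on $W$ if for every $\beta\in(0,\frac13)$ Alice has a winning strategy. HAW on a manifold. Let $M$ be a $d$-dimensional $C^1$ manifold with a $C^1$ atlas $\{(U_\alpha,\varphi_\alpha)\}$ ($\varphi_\alpha$ a $C^1$ diffeomorphism from $U_\alpha$ onto an open subset of $\mathbb{R}^d$). A subset $S\subset M$ is HAW on $M$ if for each $\alpha$ the set $\varphi_\alpha(S\cap U_\alpha)$ is HAW on $\varphi_\alpha(U_\alpha)$. (This is independent of the choice of atlas.) *)

theory Defs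
  imports "HOL-Analysis.Analysis"
begin

section \<open>The homogeneous space \<open>SL\<^sub>3(\<real>)/SL\<^sub>3(\<int>)\<close>\<close>

type_synonym mat3 = "real^3^3"

definition SL3R :: "mat3 set" where
  "SL3R = {A. det A = 1}"

definition SL3Z :: "mat3 set" where
  "SL3Z = {A \<in> SL3R. \<forall>i j. A $ i $ j \<in> \<int>}"

definition left_coset :: "mat3 \<Rightarrow> mat3 set" where
  "left_coset A = (\<lambda>C. A ** C) ` SL3Z"

definition X3 :: "mat3 set set" where
  "X3 = left_coset ` SL3R"

definition act :: "mat3 \<Rightarrow> mat3 set \<Rightarrow> mat3 set" where
  "act A \<Lambda> = (\<lambda>B. A ** B) ` \<Lambda>"

lemma act_left_coset: "act A (left_coset B) = left_coset (A ** B)"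
  by (simp add: act_def left_coset_def image_image matrix_mul_assoc)

definition X3_topology :: "mat3 set topology" where
  "X3_topology =
     topology (\<lambda>\<U>. \<U> \<subseteq> X3 \<and> openin (top_of_set SL3R) {A \<in> SL3R. left_coset A \<in> \<U>})"

lemma openin_X3_topology:
  "openin X3_topology \<U> \<longleftrightarrow>
     \<U> \<subseteq> X3 \<and> openin (top_of_set SL3R) {A \<in> SL3R. left_coset A \<in> \<U>}"
proof -
  let ?P = "\<lambda>\<U>. \<U> \<subseteq> X3 \<and> openin (top_of_set SL3R) {A \<in> SL3R. left_coset A \<in> \<U>}"
  have "istopology ?P"
    unfolding istopology_def
  proof (intro conjI allI impI)
    fix S T assume S: "?P S" and T: "?P T"
    show "S \<inter> T \<subseteq> X3" using S by blast
    have "openin (top_of_set SL3R)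
        ({A \<in> SL3R. left_coset A \<in> S} \<inter> {A \<in> SL3R. left_coset A \<in> T})"
      by (rule openin_Int[OF conjunct2[OF S] conjunct2[OF T]])
    also have "{A \<in> SL3R. left_coset A \<in> S} \<inter> {A \<in> SL3R. left_coset A \<in> T} =
        {A \<in> SL3R. left_coset A \<in> S \<inter> T}" by blast
    finally show "openin (top_of_set SL3R) {A \<in> SL3R. left_coset A \<in> S \<inter> T}" .
  next
    fix K assume K: "\<forall>S\<in>K. ?P S"
    show "\<Union>K \<subseteq> X3" using K by blast
    have "openin (top_of_set SL3R) (\<Union>S\<in>K. {A \<in> SL3R. left_coset A \<in> S})"
    proof (rule openin_Union)
      fix R assume "R \<in> (\<lambda>S. {A \<in> SL3R. left_coset A \<in> S}) ` K"
      then obtain S where "S \<in> K" "R = {A \<in> SL3R. left_coset A \<in> S}" by (rule imageE)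
      then show "openin (top_of_set SL3R) R" using K by (simp only:)
    qed
    also have "(\<Union>S\<in>K. {A \<in> SL3R. left_coset A \<in> S}) = {A \<in> SL3R. left_coset A \<in> \<Union>K}"
      by blast
    finally show "openin (top_of_set SL3R) {A \<in> SL3R. left_coset A \<in> \<Union>K}" .
  qed
  then show ?thesis
    by (simp only: X3_topology_def topology_inverse')
qed

lemma topspace_X3_topology: "topspace X3_topology = X3"
proof
  show "topspace X3_topology \<subseteq> X3"
    using openin_topspace[of X3_topology] by (simp only: openin_X3_topology)
  have "{A \<in> SL3R. left_coset A \<in> X3} = SL3R" by (auto simp: X3_def)
  then have "openin X3_topology X3" by (simp only: openin_X3_topology) simp
  then show "X3 \<subseteq> topspace X3_topology" by (rule openin_subset)
qed

lemma quotient_map_left_coset: "quotient_map (top_of_set SL3R) X3_topology left_coset"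
  unfolding quotient_map_def topspace_X3_topology openin_X3_topology
  by (simp add: X3_def)

section \<open>Diagonalizable one-parameter subgroups\<close>

definition diagonalizable_over_C :: "mat3 \<Rightarrow> bool" where
  "diagonalizable_over_C A \<longleftrightarrow>
     (\<exists>P D :: complex^3^3. invertible P \<and> (\<forall>i j. i \<noteq> j \<longrightarrow> D $ i $ j = 0) \<and>
        (\<chi> i j. complex_of_real (A $ i $ j)) = P ** D ** matrix_inv P)"

definition one_parameter_subgroup :: "(real \<Rightarrow> mat3) \<Rightarrow> bool" where
  "one_parameter_subgroup g \<longleftrightarrow>
     continuous_on UNIV g \<and> range g \<subseteq> SL3R \<and> (\<forall>s t. g (s + t) = g s ** g t)"

definition expanding_horospherical :: "(real \<Rightarrow> mat3) \<Rightarrow> mat3 set" where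
  "expanding_horospherical g =
     {h \<in> SL3R. ((\<lambda>t. matrix_inv (g t) ** h ** g t) \<longlongrightarrow> mat 1) at_top}"

definition bounded_in_X3 :: "mat3 set set \<Rightarrow> bool" where
  "bounded_in_X3 \<S> \<longleftrightarrow> (\<exists>K. compactin X3_topology K \<and> \<S> \<subseteq> K)"

definition bounded_orbit_points :: "mat3 set \<Rightarrow> mat3 set set" where
  "bounded_orbit_points Fp = {\<Lambda> \<in> X3. bounded_in_X3 ((\<lambda>A. act A \<Lambda>) ` Fp)}"

section \<open>The hyperplane absolute game\<close>

text \<open>
  The dimension of the manifold below depends on the one-parameter subgroup, so \<open>\<real>\<^sup>d\<close> has to be
  available for a variable \<open>d\<close>, including \<open>d = 0\<close>.  The game is therefore played on a linear
  subspace \<open>V\<close> of a Euclidean space, with the induced inner product; an orthonormal basis of \<open>V\<close>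
  identifies it isometrically with \<open>\<real>\<^sup>d\<close>, where \<open>d = dim V\<close>, and \<open>V = UNIV\<close> is allowed.

  For \<open>dim V > 0\<close> the hyperplanes defined here are exactly the affine hyperplanes of \<open>V\<close>.
  For \<open>dim V = 0\<close> the only one is the empty set, whose neighbourhoods are empty, so that Alice
  then still has a (void) move.
\<close>

definition hyperplane_in :: "'a::euclidean_space set \<Rightarrow> 'a set \<Rightarrow> bool" where
  "hyperplane_in V L \<longleftrightarrow> affine L \<and> L \<subseteq> V \<and> aff_dim L = int (dim V) - 1"

definition nbhd_in :: "'a::euclidean_space set \<Rightarrow> 'a set \<Rightarrow> real \<Rightarrow> 'a set" where
  "nbhd_in V L r = {x \<in> V. \<exists>y\<in>L. dist x y < r}"

text \<open>
  A move of Bob is the pair of the centre and the radius of his ball, a move of Alice the pair of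
  the hyperplane and the width of its neighbourhood.
\<close>

definition ball_of :: "'a::euclidean_space set \<Rightarrow> 'a \<times> real \<Rightarrow> 'a set" where
  "ball_of V B = cball (fst B) (snd B) \<inter> V"

text \<open>
  A strategy maps the list of Bob's moves so far to Alice's answer.  Its answers have to be
  legal after every list of balls, so Alice cannot win by making a move that leaves Bob
  without an answer.
\<close>

definition alice_strategy ::
    "'a::euclidean_space set \<Rightarrow> real \<Rightarrow> (('a \<times> real) list \<Rightarrow> 'a set \<times> real) \<Rightarrow> bool" where
  "alice_strategy V \<beta> \<sigma> \<longleftrightarrow>
     (\<forall>Bs. Bs \<noteq> [] \<and> (\<forall>B \<in> set Bs. fst B \<in> V \<and> 0 < snd B) \<longrightarrow>
        hyperplane_in V (fst (\<sigma> Bs)) \<and> 0 < snd (\<sigma> Bs) \<and> snd (\<sigma> Bs) \<le> \<beta> * snd (last Bs))"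

definition bob_play ::
    "'a::euclidean_space set \<Rightarrow> 'a set \<Rightarrow> real \<Rightarrow> (('a \<times> real) list \<Rightarrow> 'a set \<times> real) \<Rightarrow>
     (nat \<Rightarrow> 'a \<times> real) \<Rightarrow> bool" where
  "bob_play V W \<beta> \<sigma> B \<longleftrightarrow>
     (\<forall>i. fst (B i) \<in> V \<and> 0 < snd (B i)) \<and> ball_of V (B 0) \<subseteq> W \<and>
     (\<forall>i. let (L, r) = \<sigma> (map B [0..<Suc i]) in
        ball_of V (B (Suc i)) \<subseteq> ball_of V (B i) - nbhd_in V L r \<and>
        snd (B (Suc i)) \<ge> \<beta> * snd (B i))"

definition HAW :: "'a::euclidean_space set \<Rightarrow> 'a set \<Rightarrow> 'a set \<Rightarrow> bool" where
  "HAW V W S \<longleftrightarrow>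
     (\<forall>\<beta>. 0 < \<beta> \<and> \<beta> < 1/3 \<longrightarrow>
        (\<exists>\<sigma>. alice_strategy V \<beta> \<sigma> \<and>
           (\<forall>B. bob_play V W \<beta> \<sigma> B \<longrightarrow> (\<Inter>i. ball_of V (B i)) \<inter> S \<noteq> {})))"

section \<open>HAW subsets of \<open>C\<^sup>1\<close> submanifolds\<close>

definition C1_immersion_on ::
    "'a::euclidean_space set \<Rightarrow> 'a set \<Rightarrow> ('a \<Rightarrow> 'b::euclidean_space) \<Rightarrow> bool" where
  "C1_immersion_on V W \<psi> \<longleftrightarrow>
     (\<exists>D. (\<forall>x\<in>W. (\<psi> has_derivative D x) (at x within W) \<and> inj_on (D x) V) \<and>
          (\<forall>v\<in>V. continuous_on W (\<lambda>x. D x v)))"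

text \<open>
  The charts of the \<open>C\<^sup>1\<close> structure that a subset \<open>M\<close> of a Euclidean space inherits as an embedded
  submanifold: \<open>\<phi>\<close> is a \<open>C\<^sup>1\<close> diffeomorphism from \<open>U\<close>, open in \<open>M\<close>, onto an open subset of \<open>V\<close>.
\<close>

definition C1_chart ::
    "'a::euclidean_space set \<Rightarrow> 'b::euclidean_space set \<Rightarrow> 'b set \<Rightarrow> ('b \<Rightarrow> 'a) \<Rightarrow> bool" where
  "C1_chart V M U \<phi> \<longleftrightarrow>
     openin (top_of_set M) U \<and> openin (top_of_set V) (\<phi> ` U) \<and>
     (\<exists>\<psi>. homeomorphism U (\<phi> ` U) \<phi> \<psi> \<and> C1_immersion_on V (\<phi> ` U) \<psi>)"

definition C1_atlas ::
    "'a::euclidean_space set \<Rightarrow> 'b::euclidean_space set \<Rightarrow> ('b set \<times> ('b \<Rightarrow> 'a)) set \<Rightarrow> bool" where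
  "C1_atlas V M \<A> \<longleftrightarrow>
     subspace V \<and> (\<forall>(U, \<phi>) \<in> \<A>. C1_chart V M U \<phi>) \<and> (\<Union>(U, \<phi>) \<in> \<A>. U) = M"

text \<open>
  The first conjunct says that \<open>M\<close> is a \<open>C\<^sup>1\<close> submanifold; the second imposes the HAW condition in
  every atlas.  Subspaces of the ambient space suffice as models \<open>V\<close>, since they include the
  tangent spaces of \<open>M\<close>.
\<close>

definition HAW_on_manifold :: "'a::euclidean_space set \<Rightarrow> 'a set \<Rightarrow> bool" where
  "HAW_on_manifold M S \<longleftrightarrow>
     (\<exists>(V :: 'a set) \<A>. C1_atlas V M \<A>) \<and>
     (\<forall>(V :: 'a set) \<A>. C1_atlas V M \<A> \<longrightarrow>
        (\<forall>(U, \<phi>) \<in> \<A>. HAW V (\<phi> ` U) (\<phi> ` (S \<inter> U))))"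

end

theory Submission
  imports Defs
begin

text \<open>
  Write \<open>g 1 = P a K P\<^sup>-\<^sup>1\<close> with \<open>a = diag (exp l1, exp l2, exp l3)\<close>, \<open>l1 \<ge> l2 \<ge> l3\<close>, and \<open>K\<close> orthogonal
  commuting with \<open>a\<close>; then \<open>H\<close> is a translate of a linear space of nilpotent matrices, and an orbit is
  bounded if and only if the vectors of the lattice stay away from \<open>0\<close> under the powers of \<open>a\<close>.
  Duality allows one to assume \<open>l2 \<ge> 0\<close>.

  If a lattice vector \<open>v\<close> becomes short for the first time at time \<open>t\<close>, Minkowski's argument attaches to it an
  orthogonal dual lattice vector \<open>c\<close> that is controlled at time \<open>t\<close>.  The essential point is that on a small
  ball all vectors \<open>v\<close> with comparable parameters share the same plane \<open>c\<close>: otherwise the cross product of two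
  such planes would have been short at an earlier time.  So the dangerous points of a ball lie
  near the surface on which the last coordinate of the transformed \<open>c\<close> vanishes, and at small scales
  such a surface is nearly a hyperplane.  The widths of these neighbourhoods are summable at every scale in the
  sense of the potential game, in which Alice avoids many neighbourhoods simultaneously by always
  deleting the slab of largest total weight; this yields a strategy for the absolute game.
\<close>

section \<open>Short vectors and bases of lattices\<close>

text \<open>The scale \<open>R n\<close> fixes only the product of
  \<open>exp ((l1 + l2) * t)\<close> and \<open>G x c\<close>, so one scale carries many classes
  \<open>k\<close>, one for each factor 16 in the relative size of \<open>G x c\<close>, and their
  widths have to be summed. The first \<open>2 * m\<close> classes have width about
  \<open>eps m * R n\<close> each; the sum of their \<open>\<gamma>\<close>-th powers is of order
  \<open>m * eps m powr \<gamma>\<close>, which is small because \<open>eps m\<close> is exponential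
  in \<open>m\<close>. For later classes equal widths would not do. There \<open>c\<close> is so
  short that cross products stay short even on a ball larger by the factor \<open>M m k\<close>;
  relative to this larger scale the width is smaller by the same factor, and the remaining sum is
  geometric. The order of choices matters: \<open>\<beta>\<close> determines a finite net of slabs,
  the net determines \<open>\<kappa>\<close>, \<open>\<gamma>\<close>, \<open>\<eta>\<close>, and
  only then is \<open>eps m\<close> chosen. Flatness of the surfaces must be uniform in
  \<open>c\<close>. It is, because \<open>G x c\<close> is both the size of the gradient of the last
  coordinate and the unit in which all error terms are measured.\<close>

lemma reduced_basis_product_le:
  fixes b1 b2 b3 :: "real^3"
  assumes le: "norm b1 \<le> norm b3" "norm b2 \<le> norm b3"
    and b12: "\<And>m::int. norm b2 \<le> norm (b2 + of_int m *\<^sub>R b1)"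
    and b21: "\<And>m::int. norm b1 \<le> norm (b1 + of_int m *\<^sub>R b2)"
    and b3: "\<And>m n::int. norm b3 \<le> norm (b3 + of_int m *\<^sub>R b1 + of_int n *\<^sub>R b2)"
    and det: "b3 \<bullet> (cross3 b1 b2) \<noteq> 0"
  shows "(norm b1 * norm b2 * norm b3)\<^sup>2 \<le> (16/3) * (b3 \<bullet> (cross3 b1 b2))\<^sup>2"
proof -
  define n where "n = cross3 b1 b2"
  define g11 g22 g33 g12 where g: "g11 = b1 \<bullet> b1" "g22 = b2 \<bullet> b2" "g33 = b3 \<bullet> b3" "g12 = b1 \<bullet> b2"
  have n0: "n \<noteq> 0" using det n_def by auto
  have key: "\<bar>x \<bullet> y\<bar> \<le> (y \<bullet> y) / 2" if h: "\<And>m::int. norm x \<le> norm (x + of_int m *\<^sub>R y)" for x y :: "real^3"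
  proof -
    have "(norm x)\<^sup>2 \<le> (norm (x + of_int 1 *\<^sub>R y))\<^sup>2" by (intro power_mono h) auto
    moreover have "(norm x)\<^sup>2 \<le> (norm (x + of_int (-1) *\<^sub>R y))\<^sup>2" by (intro power_mono h) auto
    ultimately show ?thesis
      by (simp add: power2_norm_eq_inner algebra_simps inner_commute)
  qed
  \<comment> \<open>Size reduction in both directions bounds \<open>g12\<close> by half of each
    diagonal entry, so the squared area \<open>n \<bullet> n\<close> keeps at least 3/4 of
    \<open>g11 * g22\<close>.\<close>
  have g12a: "\<bar>g12\<bar> \<le> g11 / 2" using key[of b2 b1] b12 g by (simp add: inner_commute)
  have g12b: "\<bar>g12\<bar> \<le> g22 / 2" using key[of b1 b2] b21 g by simp
  have gpos: "0 \<le> g11" "0 \<le> g22" "0 \<le> g33" using g by auto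
  have g13: "g11 \<le> g33" "g22 \<le> g33"
    using power_mono[OF le(1), of 2] power_mono[OF le(2), of 2] by (auto simp: g power2_norm_eq_inner)
  have "g12\<^sup>2 = \<bar>g12\<bar> * \<bar>g12\<bar>" by (simp add: power2_eq_square)
  also have "\<dots> \<le> (g11/2) * (g22/2)" by (intro mult_mono g12a g12b) (use gpos in auto)
  finally have g12sq: "g12\<^sup>2 \<le> g11 * g22 / 4" by simp
  have nn: "n \<bullet> n = g11 * g22 - g12\<^sup>2"
    using norm_cross_dot[of b1 b2] by (simp add: n_def g power2_norm_eq_inner[symmetric] power_mult_distrib)
  have nn': "n \<bullet> n \<ge> (3/4) * (g11 * g22)" using g12sq nn by simp
  have npos: "n \<bullet> n > 0" using n0 by simp
  define w where "w = cross3 b3 n"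
  define x y where "x = - (b2 \<bullet> w) / (n \<bullet> n)" and "y = (b1 \<bullet> w) / (n \<bullet> n)"
  define e where "e = ((b3 \<bullet> n) / (n \<bullet> n)) *\<^sub>R n"
  have id1: "(n \<bullet> n) *\<^sub>R b3 = (b3 \<bullet> n) *\<^sub>R n + (b1 \<bullet> w) *\<^sub>R b2 - (b2 \<bullet> w) *\<^sub>R b1"
    unfolding w_def n_def by (simp add: cross3_simps forall_3)
  have "b3 = (1 / (n \<bullet> n)) *\<^sub>R ((n \<bullet> n) *\<^sub>R b3)" using npos by simp
  also have "\<dots> = e + x *\<^sub>R b1 + y *\<^sub>R b2"
    unfolding id1 e_def x_def y_def by (simp add: algebra_simps)
  finally have dec: "b3 = e + x *\<^sub>R b1 + y *\<^sub>R b2" .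
  \<comment> \<open>Rounding the planar coordinates moves \<open>b3\<close> by a lattice vector,
    which cannot shorten it. The remainders are at most 1/2, so the planar part has squared length
    at most \<open>3/4 * g33\<close>, and the height \<open>e\<close> is at least half as long as
    \<open>b3\<close>.\<close>
  define x' y' where "x' = x - of_int (round x)" and "y' = y - of_int (round y)"
  have x': "\<bar>x'\<bar> \<le> 1/2" "\<bar>y'\<bar> \<le> 1/2"
    unfolding x'_def y'_def using of_int_round_abs_le[of x] of_int_round_abs_le[of y] by (auto simp: abs_minus_commute)
  have eo: "e \<bullet> b1 = 0" "e \<bullet> b2 = 0"
    by (simp_all add: e_def n_def dot_cross_self)
  have "b3 + of_int (- round x) *\<^sub>R b1 + of_int (- round y) *\<^sub>R b2 = e + x' *\<^sub>R b1 + y' *\<^sub>R b2"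
    by (subst dec) (simp add: x'_def y'_def algebra_simps)
  then have "norm b3 \<le> norm (e + x' *\<^sub>R b1 + y' *\<^sub>R b2)" using b3[of "- round x" "- round y"] by simp
  then have "g33 \<le> (norm (e + x' *\<^sub>R b1 + y' *\<^sub>R b2))\<^sup>2"
    by (simp add: g power2_norm_eq_inner norm_le)
  also have "\<dots> = e \<bullet> e + x'\<^sup>2 * g11 + y'\<^sup>2 * g22 + 2 * (x' * y' * g12)"
    using eo unfolding power2_norm_eq_inner g power2_eq_square[of x'] power2_eq_square[of y']
    by (simp add: inner_add_left inner_add_right inner_commute[of b1 e] inner_commute[of b2 e] inner_commute[of b2 b1] algebra_simps)
  also have "\<dots> \<le> e \<bullet> e + (1/4) * g11 + (1/4) * g22 + g11 / 4"
  proof -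
    have "x'\<^sup>2 \<le> (1/2)\<^sup>2" "y'\<^sup>2 \<le> (1/2)\<^sup>2" using x' by (auto intro: abs_le_square_iff[THEN iffD1])
    then have a: "x'\<^sup>2 * g11 \<le> (1/4) * g11" "y'\<^sup>2 * g22 \<le> (1/4) * g22"
      using mult_right_mono[of "x'\<^sup>2" "1/4" g11] mult_right_mono[of "y'\<^sup>2" "1/4" g22] gpos
      by (simp_all add: power_divide)
    have "x' * y' * g12 \<le> \<bar>x'\<bar> * \<bar>y'\<bar> * \<bar>g12\<bar>" by (metis abs_ge_self abs_mult)
    also have "\<dots> \<le> (1/2) * (1/2) * (g11/2)" using x' g12a by (intro mult_mono) auto
    finally show ?thesis using a by simp
  qed
  also have "\<dots> \<le> e \<bullet> e + (3/4) * g33" using g13 by simp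
  finally have ge: "g33 \<le> 4 * (e \<bullet> e)" by simp
  have ee: "(e \<bullet> e) * (n \<bullet> n) = (b3 \<bullet> n)\<^sup>2"
    using npos by (simp add: e_def power2_eq_square)
  have "(norm b1 * norm b2 * norm b3)\<^sup>2 = (g11 * g22) * g33"
    by (simp add: g power_mult_distrib power2_norm_eq_inner)
  also have "\<dots> \<le> ((4/3) * (n \<bullet> n)) * (4 * (e \<bullet> e))"
    using nn' ge gpos npos by (intro mult_mono[of "g11 * g22"]) auto
  also have "\<dots> = (16/3) * (b3 \<bullet> n)\<^sup>2" using ee by (simp add: algebra_simps)
  finally show ?thesis by (simp add: n_def)
qed

section \<open>Reduced bases from a minimum over the integral matrices of determinant 1\<close>

lemma bounded_bilinear_matrix_mult3: "bounded_bilinear ((**) :: real^3^3 \<Rightarrow> real^3^3 \<Rightarrow> real^3^3)"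
  unfolding bilinear_conv_bounded_bilinear[symmetric] bilinear_def
  by (auto intro!: linearI simp: vec_eq_iff matrix_matrix_mult_def sum.distrib algebra_simps sum_distrib_left)

lemma bounded_bilinear_matrix_vector_mult3: "bounded_bilinear ((*v) :: real^3^3 \<Rightarrow> real^3 \<Rightarrow> real^3)"
  unfolding bilinear_conv_bounded_bilinear[symmetric] bilinear_def
  by (auto intro!: linearI simp: vec_eq_iff matrix_vector_mult_def sum.distrib algebra_simps sum_distrib_left)

lemma closed_SL3Z: "closed SL3Z"
proof -
  have "SL3Z = {A. det A = 1} \<inter> (\<Inter>i. \<Inter>j. {A. A $ i $ j \<in> \<int>})"
    by (auto simp: SL3Z_def SL3R_def)
  moreover have "closed {A::real^3^3. det A = 1}"
    by (intro closed_Collect_eq) (auto simp: det_3 intro!: continuous_intros)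
  moreover have "closed {A::real^3^3. A $ i $ j \<in> \<int>}" for i j
  proof -
    have "closed ((\<lambda>A::real^3^3. A $ i $ j) -` \<int>)"
      by (intro closed_vimage closed_Ints continuous_intros)
    then show ?thesis by (simp add: vimage_def)
  qed
  ultimately show ?thesis by (metis (no_types, lifting) closed_INT closed_Int)
qed

lemma SL3Z_mult: "A \<in> SL3Z \<Longrightarrow> B \<in> SL3Z \<Longrightarrow> A ** B \<in> SL3Z"
  unfolding SL3Z_def SL3R_def
  by (simp add: det_mul) (auto simp: matrix_matrix_mult_def intro!: Ints_sum Ints_mult)

lemma mat1_SL3Z: "mat 1 \<in> SL3Z"
  unfolding SL3Z_def SL3R_def by (simp add: det_I) (simp add: mat_def)

lemma norm_matrix3_columns: "(norm (M::real^3^3))\<^sup>2 = (\<Sum>j\<in>UNIV. (norm (column j M))\<^sup>2)"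
  by (simp add: power2_norm_eq_inner inner_vec_def column_def sum_3 algebra_simps)

text \<open>The longest column has to come last; the three cyclic arrangements achieve this without
  changing the determinant. The constant 4 comes from 16/3 being at most 16.\<close>

lemma minimal_basis_product_le:
  fixes M :: "real^3^3"
  assumes red: "\<And>i z. (\<And>j. z $ j \<in> \<int>) \<Longrightarrow> z $ i = 0 \<Longrightarrow> norm (column i M) \<le> norm (column i M + M *v z)"
    and det: "det M \<noteq> 0"
  shows "norm (column 1 M) * norm (column 2 M) * norm (column 3 M) \<le> 4 * \<bar>det M\<bar>"
proof -
  define b where "b i = column i M" for i
  have Mz: "M *v z = z$1 *\<^sub>R b 1 + z$2 *\<^sub>R b 2 + z$3 *\<^sub>R b 3" for z
    by (simp add: b_def matrix_vector_mult_def column_def vec_eq_iff sum_3 algebra_simps)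
  have key: "(norm (b i) * norm (b j) * norm (b k))\<^sup>2 \<le> (16/3) * (b k \<bullet> (cross3 (b i) (b j)))\<^sup>2"
    if d: "distinct [i,j,k]" and le: "norm (b i) \<le> norm (b k)" "norm (b j) \<le> norm (b k)"
      and nz: "b k \<bullet> (cross3 (b i) (b j)) \<noteq> 0" for i j k :: 3
  proof -
    define z :: "int \<Rightarrow> int \<Rightarrow> 3 \<Rightarrow> 3 \<Rightarrow> real^3"
      where "z m n i j = (\<chi> l. if l = i then of_int m else if l = j then of_int n else 0)" for m n i j
    have zi: "z m n i j $ l \<in> \<int>" for m n i j l by (simp add: z_def)
    have Mzz: "M *v z m n i j = of_int m *\<^sub>R b i + of_int n *\<^sub>R b j" if "i \<noteq> j" for m n i j
      using that exhaust_3[of i] exhaust_3[of j] unfolding Mz by (auto simp: z_def)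
    have ne: "i \<noteq> j" "j \<noteq> i" "i \<noteq> k" "k \<noteq> i" "j \<noteq> k" "k \<noteq> j" using d by auto
    show ?thesis
    proof (rule reduced_basis_product_le[OF le])
      show "norm (b j) \<le> norm (b j + of_int m *\<^sub>R b i)" for m
        using red[of "z m 0 i k" j] zi Mzz[of i k m 0] ne by (simp add: b_def z_def)
      show "norm (b i) \<le> norm (b i + of_int m *\<^sub>R b j)" for m
        using red[of "z m 0 j k" i] zi Mzz[of j k m 0] ne by (simp add: b_def z_def)
      show "norm (b k) \<le> norm (b k + of_int m *\<^sub>R b i + of_int n *\<^sub>R b j)" for m n
        using red[of "z m n i j" k] zi Mzz[of i j m n] ne by (simp add: b_def z_def add.assoc)
    qed (rule nz)
  qed
  have d1: "b 3 \<bullet> (cross3 (b 1) (b 2)) = det M" "b 1 \<bullet> (cross3 (b 2) (b 3)) = det M"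
    "b 2 \<bullet> (cross3 (b 3) (b 1)) = det M"
    by (simp_all add: b_def cross3_simps column_def)
  have "(norm (b 1) * norm (b 2) * norm (b 3))\<^sup>2 \<le> (16/3) * (det M)\<^sup>2"
  proof -
    consider "norm (b 1) \<le> norm (b 3)" "norm (b 2) \<le> norm (b 3)"
      | "norm (b 2) \<le> norm (b 1)" "norm (b 3) \<le> norm (b 1)"
      | "norm (b 3) \<le> norm (b 2)" "norm (b 1) \<le> norm (b 2)" by linarith
    then show ?thesis
      using key[of 1 2 3] key[of 2 3 1] key[of 3 1 2] det
      by cases (simp_all add: d1 mult.commute mult.left_commute)
  qed
  also have "\<dots> \<le> (4 * \<bar>det M\<bar>)\<^sup>2" by (simp add: power_mult_distrib)
  finally have "norm (b 1) * norm (b 2) * norm (b 3) \<le> 4 * \<bar>det M\<bar>" by (rule power2_le_imp_le) simp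
  then show ?thesis by (simp add: b_def)
qed

text \<open>The norm of \<open>B ** \<gamma>\<close> attains its minimum because \<open>SL3Z\<close>
  is closed and \<open>B\<close> is invertible, so that sublevel sets are compact. At a minimum no
  column can be shortened by an integral combination of the others, which is the reduction required
  for the product bound.\<close>

lemma exists_minimal_basis:
  fixes B :: "real^3^3"
  assumes det: "det B \<noteq> 0"
  obtains \<gamma> where "\<gamma> \<in> SL3Z"
    "norm (column 1 (B ** \<gamma>)) * norm (column 2 (B ** \<gamma>)) * norm (column 3 (B ** \<gamma>)) \<le> 4 * \<bar>det B\<bar>"
proof -
  interpret mm: bounded_bilinear "(**) :: real^3^3 \<Rightarrow> real^3^3 \<Rightarrow> real^3^3"
    by (rule bounded_bilinear_matrix_mult3)
  obtain B' where B': "B' ** B = mat 1"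
    using det invertible_det_nz[of B] invertible_left_inverse by blast
  define S where "S = SL3Z \<inter> {\<gamma>. norm (B ** \<gamma>) \<le> norm B}"
  have "closed S" unfolding S_def
    by (intro closed_Int closed_SL3Z closed_Collect_le) (auto intro!: continuous_intros mm.continuous_on)
  moreover have "bounded S"
  proof (rule bounded_subset)
    show "bounded ((\<lambda>X::real^3^3. B' ** X) ` cball 0 (norm B))"
      by (rule bounded_linear_image[OF bounded_cball mm.bounded_linear_right])
    show "S \<subseteq> (\<lambda>X::real^3^3. B' ** X) ` cball 0 (norm B)"
    proof
      fix \<gamma> assume "\<gamma> \<in> S"
      then have "B ** \<gamma> \<in> cball 0 (norm B)" by (simp add: S_def)
      moreover have "\<gamma> = B' ** (B ** \<gamma>)" by (simp add: matrix_mul_assoc B')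
      ultimately show "\<gamma> \<in> (\<lambda>X::real^3^3. B' ** X) ` cball 0 (norm B)" by blast
    qed
  qed
  ultimately have "compact S" by (simp add: compact_eq_bounded_closed)
  moreover have "mat 1 \<in> S" by (simp add: S_def mat1_SL3Z)
  moreover have "continuous_on S (\<lambda>\<gamma>. norm (B ** \<gamma>))"
    by (intro continuous_on_norm mm.continuous_on continuous_on_const continuous_on_id)
  ultimately obtain \<gamma> where \<gamma>: "\<gamma> \<in> S" and min: "\<And>\<gamma>'. \<gamma>' \<in> S \<Longrightarrow> norm (B ** \<gamma>) \<le> norm (B ** \<gamma>')"
    using continuous_attains_inf[of S "\<lambda>\<gamma>. norm (B ** \<gamma>)"] by blast
  have \<gamma>Z: "\<gamma> \<in> SL3Z" using \<gamma> by (simp add: S_def)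
  have min': "norm (B ** \<gamma>) \<le> norm (B ** \<gamma>')" if "\<gamma>' \<in> SL3Z" for \<gamma>'
  proof (cases "norm (B ** \<gamma>') \<le> norm B")
    case True
    then show ?thesis using min that by (simp add: S_def)
  next
    case False
    then show ?thesis using \<gamma> by (simp add: S_def)
  qed
  define M where "M = B ** \<gamma>"
  have detM: "det M = det B" using \<gamma>Z by (simp add: M_def det_mul SL3Z_def SL3R_def)
  have "norm (column 1 M) * norm (column 2 M) * norm (column 3 M) \<le> 4 * \<bar>det M\<bar>"
  proof (rule minimal_basis_product_le)
    show "det M \<noteq> 0" using det detM by simp
    fix i :: 3 and z :: "real^3" assume z: "\<And>j. z $ j \<in> \<int>" "z $ i = 0"
    \<comment> \<open>Right multiplication by this elementary matrix adds \<open>M *v z\<close> to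
      column \<open>i\<close> and leaves the other columns alone, so comparing total norms compares
      just these two columns.\<close>
    define E :: "real^3^3" where "E = (\<chi> r s. if r = s then 1 else if s = i then z $ r else 0)"
    have "det E = 1" using exhaust_3[of i] by (auto simp: E_def det_3)
    then have "E \<in> SL3Z" using z by (auto simp: SL3Z_def SL3R_def E_def)
    then have "norm M \<le> norm (M ** E)"
      using min'[of "\<gamma> ** E"] \<gamma>Z by (simp add: M_def SL3Z_mult matrix_mul_assoc)
    then have "(norm M)\<^sup>2 \<le> (norm (M ** E))\<^sup>2" by (intro power_mono) auto
    moreover have "column s (M ** E) = (if s = i then column i M + M *v z else column s M)" for s
      using z(2) exhaust_3[of i] exhaust_3[of s]
      by (auto simp: column_def E_def vec_eq_iff matrix_matrix_mult_def matrix_vector_mult_def sum_3)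
    ultimately have "(norm (column i M))\<^sup>2 \<le> (norm (column i M + M *v z))\<^sup>2"
      using exhaust_3[of i] unfolding norm_matrix3_columns by (auto simp: sum_3)
    then show "norm (column i M) \<le> norm (column i M + M *v z)"
      by (rule power2_le_imp_le) simp
  qed
  then show ?thesis using that[OF \<gamma>Z] detM by (simp add: M_def)
qed

text \<open>This takes the place of Minkowski's convex body theorem: three norms with product at
  most \<open>r ^ 3\<close> cannot all exceed \<open>r\<close>.\<close>

lemma short_integer_vector:
  fixes B :: "real^3^3"
  assumes det: "det B \<noteq> 0" and r: "r \<ge> 0" "4 * \<bar>det B\<bar> \<le> r ^ 3"
  obtains v where "v \<noteq> 0" "\<And>i. v $ i \<in> \<int>" "norm (B *v v) \<le> r"
proof -
  obtain \<gamma> where \<gamma>: "\<gamma> \<in> SL3Z" and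
    pr: "norm (column 1 (B ** \<gamma>)) * norm (column 2 (B ** \<gamma>)) * norm (column 3 (B ** \<gamma>)) \<le> 4 * \<bar>det B\<bar>"
    using exists_minimal_basis[OF det] .
  have "\<exists>i. norm (column i (B ** \<gamma>)) \<le> r"
  proof (rule ccontr)
    assume "\<not> ?thesis"
    then have "\<And>i. r < norm (column i (B ** \<gamma>))" by (simp add: not_le)
    then have "r * r * r < norm (column 1 (B ** \<gamma>)) * norm (column 2 (B ** \<gamma>)) * norm (column 3 (B ** \<gamma>))"
      using r(1) by (intro mult_strict_mono' mult_nonneg_nonneg) auto
    then show False using pr r(2) by (simp add: power3_eq_cube)
  qed
  then obtain i where i: "norm (column i (B ** \<gamma>)) \<le> r" ..
  have c: "column i (B ** \<gamma>) = B *v column i \<gamma>"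
    by (simp add: column_def vec_eq_iff matrix_matrix_mult_def matrix_vector_mult_def)
  have "column i \<gamma> \<noteq> 0"
  proof
    assume "column i \<gamma> = 0"
    then have "det \<gamma> = 0" using det_zero_column(2)[of i \<gamma>] by simp
    then show False using \<gamma> by (simp add: SL3Z_def SL3R_def)
  qed
  moreover have "column i \<gamma> $ j \<in> \<int>" for j using \<gamma> by (simp add: SL3Z_def column_def)
  ultimately show ?thesis using that i c by auto
qed

section \<open>Unipotent families and attached dual vectors\<close>

definition integral_vec :: "real^'n \<Rightarrow> bool" where
  "integral_vec v \<longleftrightarrow> (\<forall>i. v $ i \<in> \<int>)"

definition unip :: "real \<Rightarrow> real \<Rightarrow> real \<Rightarrow> real^3^3" where
  "unip p r s = vector [vector [1, p, r], vector [0, 1, s], vector [0, 0, 1]]"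

lemma unip_components [simp]:
  "unip p r s $ 1 $ 1 = 1" "unip p r s $ 1 $ 2 = p" "unip p r s $ 1 $ 3 = r"
  "unip p r s $ 2 $ 1 = 0" "unip p r s $ 2 $ 2 = 1" "unip p r s $ 2 $ 3 = s"
  "unip p r s $ 3 $ 1 = 0" "unip p r s $ 3 $ 2 = 0" "unip p r s $ 3 $ 3 = 1"
  by (simp_all add: unip_def)

lemma unip_inverse: "unip (- p) (p * s - r) (- s) ** unip p r s = mat 1"
  by (simp add: vec_eq_iff forall_3 matrix_matrix_mult_def sum_3 mat_def)

lemma integral_vec_cross3: "integral_vec c \<Longrightarrow> integral_vec d \<Longrightarrow> integral_vec (cross3 c d)"
  unfolding integral_vec_def by (auto simp: cross3_def forall_3 intro!: Ints_diff Ints_mult)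

lemma integral_vec_inner_zero:
  fixes c v :: "real^3"
  assumes "integral_vec c" "integral_vec v" "\<bar>c \<bullet> v\<bar> < 1"
  shows "c \<bullet> v = 0"
proof -
  have "c \<bullet> v \<in> \<int>" using assms by (auto simp: inner_vec_def integral_vec_def intro!: Ints_sum Ints_mult)
  then show ?thesis using assms(3) by (metis Ints_nonzero_abs_less1)
qed

text \<open>\<open>B x\<close> is a basis of the lattice attached to the point \<open>x\<close>, in
  coordinates that make the flow diagonal. Bases at two points differ by an upper unipotent factor
  whose distance from 1 is controlled by the distance of the points; the covering argument works
  from this data alone.\<close>

locale unipotent_family =
  fixes X :: "'a::metric_space set" and B Bi :: "'a \<Rightarrow> real^3^3" and D0 L bd l1 l2 :: real
  assumes inv: "x \<in> X \<Longrightarrow> Bi x ** B x = mat 1"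
    and det: "x \<in> X \<Longrightarrow> det (B x) = D0"
    and D0: "D0 \<noteq> 0"
    and bdB: "x \<in> X \<Longrightarrow> \<bar>B x $ i $ j\<bar> \<le> bd"
    and bdBi: "x \<in> X \<Longrightarrow> \<bar>Bi x $ i $ j\<bar> \<le> bd"
    and bd: "bd \<ge> 1"
    and rel: "x \<in> X \<Longrightarrow> y \<in> X \<Longrightarrow> \<exists>p r s. \<bar>p\<bar> \<le> L * dist x y \<and> \<bar>r\<bar> \<le> L * dist x y \<and> \<bar>s\<bar> \<le> L * dist x y
           \<and> B x = unip p r s ** B y"
    and L: "L \<ge> 1"
    and l: "0 \<le> l2" "l2 \<le> l1" "0 < l1"
begin

text \<open>\<open>V x v\<close> runs over the lattice and \<open>C x c\<close> over its dual as
  \<open>v\<close> and \<open>c\<close> run over the integral vectors.\<close>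

definition V where "V x v = B x *v v"
definition C where "C x c = transpose (Bi x) *v c"
text \<open>Up to sign, the two coordinates used here are the derivatives of
  \<open>C x c $ 3\<close> with respect to the unipotent coordinates \<open>r\<close> and
  \<open>s\<close>. Hence \<open>G\<close> is the size of the gradient of the function whose zeros
  form the surface of \<open>c\<close>.\<close>

definition G where "G x c = max \<bar>C x c $ 1\<bar> \<bar>C x c $ 2\<bar>"
text \<open>A lower bound for the largest coordinate of any nonzero vector of the lattice or of its
  dual: an integral vector has a coordinate of size at least 1, and undoing the basis costs at most
  the factor \<open>3 * bd\<close>.\<close>

definition c0 where "c0 = 1 / (3 * bd)"

lemma c0: "0 < c0" "c0 \<le> 1" using bd by (auto simp: c0_def)

lemma inv': "x \<in> X \<Longrightarrow> B x ** Bi x = mat 1"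
  using inv matrix_left_right_inverse by blast

lemma pairing: assumes "x \<in> X" shows "C x c \<bullet> V x v = c \<bullet> v"
proof -
  have "C x c \<bullet> V x v = c \<bullet> (Bi x *v (B x *v v))"
    unfolding C_def V_def by (metis dot_lmul_matrix transpose_matrix_vector)
  then show ?thesis using inv[OF assms] by (simp add: matrix_vector_mul_assoc)
qed

text \<open>Cross products of dual vectors are lattice vectors up to the determinant. This is how
  two different planes produce a lattice vector.\<close>

lemma cross_C: assumes "x \<in> X" shows "V x (cross3 c d) = D0 *\<^sub>R cross3 (C x c) (C x d)"
proof -
  have "det (Bi x) * D0 = 1"
    using arg_cong[OF inv[OF assms], of det] det[OF assms] by (simp add: det_mul)
  moreover have "Bi x *v cross3 (C x c) (C x d) = det (Bi x) *\<^sub>R cross3 c d"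
    using cross_matrix_mult[of "transpose (Bi x)" c d] by (simp add: C_def)
  then have "B x *v (Bi x *v cross3 (C x c) (C x d)) = det (Bi x) *\<^sub>R (B x *v cross3 c d)"
    by (simp add: matrix_vector_mult_scaleR)
  then have "cross3 (C x c) (C x d) = det (Bi x) *\<^sub>R V x (cross3 c d)"
    using inv'[OF assms] by (simp add: matrix_vector_mul_assoc V_def)
  ultimately show ?thesis by (simp add: mult.commute)
qed

text \<open>Dual vectors transform by the inverse transpose, which is lower triangular: the first
  coordinate is invariant, and the third one picks up multiples of both others.\<close>

lemma C_unip:
  assumes "x \<in> X" "y \<in> X" and B: "B x = unip p r s ** B y"
  shows "C x c $ 1 = C y c $ 1" "C x c $ 2 = C y c $ 2 - p * C y c $ 1"
    "C x c $ 3 = C y c $ 3 - s * C y c $ 2 + (p * s - r) * C y c $ 1"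
proof -
  let ?U = "unip (- p) (p * s - r) (- s)"
  have "Bi y ** ?U ** B x = mat 1"
    unfolding B by (metis assms(2) inv matrix_mul_assoc matrix_mul_lid unip_inverse)
  then have "Bi y ** ?U = Bi x"
    by (metis assms(1) inv' matrix_mul_assoc matrix_mul_lid matrix_mul_rid)
  then have "C x c = transpose ?U *v C y c"
    unfolding C_def by (metis matrix_transpose_mul matrix_vector_mul_assoc)
  then show "C x c $ 1 = C y c $ 1" "C x c $ 2 = C y c $ 2 - p * C y c $ 1"
    "C x c $ 3 = C y c $ 3 - s * C y c $ 2 + (p * s - r) * C y c $ 1"
    by (auto simp: matrix_vector_mult_def transpose_def sum_3)
qed

lemma C_components:
  assumes "x \<in> X" "y \<in> X"
  obtains p r s where "\<bar>p\<bar> \<le> L * dist x y" "\<bar>r\<bar> \<le> L * dist x y" "\<bar>s\<bar> \<le> L * dist x y"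
    "\<And>c. C x c $ 1 = C y c $ 1" "\<And>c. C x c $ 2 = C y c $ 2 - p * C y c $ 1"
    "\<And>c. C x c $ 3 = C y c $ 3 - s * C y c $ 2 + (p * s - r) * C y c $ 1"
proof -
  obtain p r s where b: "\<bar>p\<bar> \<le> L * dist x y" "\<bar>r\<bar> \<le> L * dist x y" "\<bar>s\<bar> \<le> L * dist x y"
    and B: "B x = unip p r s ** B y" using rel[OF assms] by blast
  show ?thesis by (rule that[OF b C_unip[OF assms B]])
qed

lemma lower_aux:
  fixes A A' :: "real^3^3"
  assumes "A' ** A = mat 1" "\<And>i j. \<bar>A' $ i $ j\<bar> \<le> bd" "\<And>i. \<bar>(A *v v) $ i\<bar> \<le> Q"
  shows "\<bar>v $ i\<bar> \<le> 3 * bd * Q"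
proof -
  have "\<bar>v $ i\<bar> = \<bar>(A' *v (A *v v)) $ i\<bar>" by (simp add: matrix_vector_mul_assoc assms(1))
  also have "\<dots> = \<bar>\<Sum>j\<in>UNIV. A' $ i $ j * (A *v v) $ j\<bar>"
    unfolding matrix_vector_mult_def[of A' "A *v v"] by simp
  also have "\<dots> \<le> (\<Sum>j\<in>UNIV. \<bar>A' $ i $ j * (A *v v) $ j\<bar>)" by (rule sum_abs)
  also have "\<dots> \<le> (\<Sum>j\<in>(UNIV::3 set). bd * Q)"
    unfolding abs_mult using assms(2,3) bd by (intro sum_mono mult_mono) auto
  finally show ?thesis by simp
qed

lemma integral_lower:
  fixes A A' :: "real^3^3"
  assumes "A' ** A = mat 1" "\<And>i j. \<bar>A' $ i $ j\<bar> \<le> bd" "integral_vec v" "v \<noteq> 0"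
  obtains i where "c0 \<le> \<bar>(A *v v) $ i\<bar>"
proof -
  obtain j where j: "v $ j \<noteq> 0" using assms(4) by (auto simp: vec_eq_iff)
  then have "1 \<le> \<bar>v $ j\<bar>" using assms(3) Ints_nonzero_abs_ge1 integral_vec_def by blast
  moreover obtain i where i: "\<bar>(A *v v) $ i\<bar> = Max (range (\<lambda>i. \<bar>(A *v v) $ i\<bar>))"
    using Max_in[of "range (\<lambda>i. \<bar>(A *v v) $ i\<bar>)"] by (auto simp del: Max_in)
  have "\<bar>(A *v v) $ k\<bar> \<le> \<bar>(A *v v) $ i\<bar>" for k unfolding i by (intro Max_ge) auto
  then have "\<bar>v $ j\<bar> \<le> 3 * bd * \<bar>(A *v v) $ i\<bar>" using lower_aux[OF assms(1,2)] by blast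
  ultimately have "1 \<le> 3 * bd * \<bar>(A *v v) $ i\<bar>" by linarith
  then have "c0 \<le> \<bar>(A *v v) $ i\<bar>" using bd by (simp add: c0_def divide_le_eq mult.commute)
  then show ?thesis by (rule that)
qed

lemma V_lower: assumes "x \<in> X" "integral_vec v" "v \<noteq> 0" obtains i where "c0 \<le> \<bar>V x v $ i\<bar>"
  by (rule integral_lower[OF inv[OF assms(1)] bdBi[OF assms(1)] assms(2,3), folded V_def]) (rule that)

lemma C_lower: assumes "x \<in> X" "integral_vec v" "v \<noteq> 0" obtains i where "c0 \<le> \<bar>C x v $ i\<bar>"
proof -
  have "transpose (B x) ** transpose (Bi x) = mat 1"
    by (simp add: matrix_transpose_mul[symmetric] inv[OF assms(1)])
  moreover have "\<bar>transpose (B x) $ i $ j\<bar> \<le> bd" for i j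
    using bdB[OF assms(1)] by (simp add: transpose_def)
  ultimately show ?thesis
    by (rule integral_lower[OF _ _ assms(2,3), of "transpose (B x)" "transpose (Bi x)", folded C_def]) (rule that)
qed

lemma finite_bounded_V: "finite {v. integral_vec v \<and> (\<exists>x\<in>X. \<forall>i. \<bar>V x v $ i\<bar> \<le> Q)}"
proof (rule finite_subset)
  let ?I = "real_of_int ` {- \<lceil>3 * bd * Q\<rceil> .. \<lceil>3 * bd * Q\<rceil>}"
  let ?f = "\<lambda>(a, b, c). vector [a, b, c] :: real^3"
  show "finite (?f ` (?I \<times> ?I \<times> ?I))" by simp
  show "{v. integral_vec v \<and> (\<exists>x\<in>X. \<forall>i. \<bar>V x v $ i\<bar> \<le> Q)} \<subseteq> ?f ` (?I \<times> ?I \<times> ?I)"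
  proof clarsimp
    fix v x assume v: "integral_vec v" and x: "x \<in> X" and Q: "\<forall>i. \<bar>V x v $ i\<bar> \<le> Q"
    have le: "\<bar>v $ i\<bar> \<le> 3 * bd * Q" for i
      using lower_aux[OF inv[OF x] bdBi[OF x]] Q by (auto simp: V_def)
    have mem: "v $ i \<in> ?I" for i
    proof -
      obtain n where n: "v $ i = of_int n" using v by (auto simp: integral_vec_def elim: Ints_cases)
      then have "\<bar>real_of_int n\<bar> \<le> 3 * bd * Q" using le[of i] by simp
      then have "n \<in> {- \<lceil>3 * bd * Q\<rceil> .. \<lceil>3 * bd * Q\<rceil>}" by (auto simp: abs_le_iff) linarith+
      then show ?thesis using n by auto
    qed
    have "v = ?f (v $ 1, v $ 2, v $ 3)" by (simp add: vec_eq_iff forall_3)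
    then show "v \<in> ?f ` (?I \<times> ?I \<times> ?I)" using mem by (metis (no_types, lifting) SigmaI imageI)
  qed
qed

text \<open>The contracted third coordinate is compared with 1 and not with
  \<open>\<epsilon>\<close>. A vector orthogonal to \<open>c\<close> then has two coordinates of
  order \<open>\<epsilon>\<close> and one of order 1 after rescaling, and this imbalance is the
  source of the factor \<open>\<epsilon>\<close> in the widths.\<close>

definition danger :: "real \<Rightarrow> 'a \<Rightarrow> real \<Rightarrow> bool" where
  "danger \<epsilon> x s \<longleftrightarrow> (\<exists>v. v \<noteq> 0 \<and> integral_vec v \<and> exp (l1 * s) * \<bar>V x v $ 1\<bar> \<le> \<epsilon> \<and>
     exp (l2 * s) * \<bar>V x v $ 2\<bar> \<le> \<epsilon> \<and> \<bar>V x v $ 3\<bar> \<le> exp ((l1 + l2) * s))"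

text \<open>The first danger is located only up to a unit of time, by the least integer interval
  that contains one; hence the margin \<open>t - 1\<close>. Going back in time preserves the bounds
  on the two expanded coordinates, so the time can be lowered until the bound on the third is
  attained. The first alternative is the case in which that would lead below time 0.\<close>

lemma first_danger:
  assumes "0 \<le> s" "danger \<epsilon> x s"
  obtains v where "v \<noteq> 0" "integral_vec v" "\<bar>V x v $ 1\<bar> \<le> \<epsilon>" "\<bar>V x v $ 2\<bar> \<le> \<epsilon>" "\<bar>V x v $ 3\<bar> \<le> 1"
  | v t where "t > 0" "v \<noteq> 0" "integral_vec v" "exp (l1 * t) * \<bar>V x v $ 1\<bar> \<le> \<epsilon>"
     "exp (l2 * t) * \<bar>V x v $ 2\<bar> \<le> \<epsilon>" "\<bar>V x v $ 3\<bar> = exp ((l1 + l2) * t)"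
     "\<And>s. 0 \<le> s \<Longrightarrow> s \<le> t - 1 \<Longrightarrow> \<not> danger \<epsilon> x s"
proof -
  define P where "P n \<longleftrightarrow> (\<exists>s\<ge>0. s < real n + 1 \<and> danger \<epsilon> x s)" for n
  define n where "n = (LEAST n. P n)"
  have "s < real (nat \<lfloor>s\<rfloor>) + 1" using assms(1) by linarith
  then have "P (nat \<lfloor>s\<rfloor>)" using assms by (auto simp: P_def)
  then have "P n" unfolding n_def by (rule LeastI)
  then obtain s' where s': "s' \<ge> 0" "s' < real n + 1" "danger \<epsilon> x s'" by (auto simp: P_def)
  have no: "\<not> danger \<epsilon> x r" if "0 \<le> r" "r \<le> s' - 1" for r
  proof
    assume d: "danger \<epsilon> x r"
    have rn: "r < real n" using that s'(2) by simp
    then have "n > 0" using that(1) by (cases n) auto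
    then have "P (n - 1)" using d that rn by (auto simp: P_def of_nat_diff)
    then have "n \<le> n - 1" unfolding n_def by (rule Least_le)
    then show False using \<open>n > 0\<close> by simp
  qed
  obtain v where v: "v \<noteq> 0" "integral_vec v" "exp (l1 * s') * \<bar>V x v $ 1\<bar> \<le> \<epsilon>"
     "exp (l2 * s') * \<bar>V x v $ 2\<bar> \<le> \<epsilon>" "\<bar>V x v $ 3\<bar> \<le> exp ((l1 + l2) * s')"
    using s'(3) by (auto simp: danger_def)
  have mono: "exp (l1 * r) * \<bar>V x v $ 1\<bar> \<le> \<epsilon>" "exp (l2 * r) * \<bar>V x v $ 2\<bar> \<le> \<epsilon>" if "r \<le> s'" for r
  proof -
    have "exp (l1 * r) \<le> exp (l1 * s')" "exp (l2 * r) \<le> exp (l2 * s')"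
      using that l by (auto intro!: mult_left_mono)
    then show "exp (l1 * r) * \<bar>V x v $ 1\<bar> \<le> \<epsilon>" "exp (l2 * r) * \<bar>V x v $ 2\<bar> \<le> \<epsilon>"
      using v(3,4) by (meson abs_ge_zero mult_right_mono order_trans)+
  qed
  show ?thesis
  proof (cases "\<bar>V x v $ 3\<bar> \<le> 1")
    case True
    then show ?thesis using that(1)[OF v(1,2)] mono[of 0] s'(1) by simp
  next
    case False
    define t where "t = ln \<bar>V x v $ 3\<bar> / (l1 + l2)"
    have ll: "l1 + l2 > 0" using l by linarith
    have t: "t > 0" using False ll by (simp add: t_def)
    have e: "\<bar>V x v $ 3\<bar> = exp ((l1 + l2) * t)" using False ll by (simp add: t_def)
    then have ts: "t \<le> s'" using v(5) ll by simp
    show ?thesis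
      using that(2)[OF t v(1,2) mono(1)[OF ts] mono(2)[OF ts] e] no ts by auto
  qed
qed

definition K1 where "K1 = max 1 (16 / \<bar>D0\<bar>)"

lemma K1: "1 \<le> K1" "16 / \<bar>D0\<bar> \<le> K1" by (auto simp: K1_def)

text \<open>A short vector of the rescaled dual lattice pairs with \<open>v\<close> to an integer of
  size below 1, hence to 0. Orthogonality in turn improves the bound on the third coordinate from a
  constant to a multiple of \<open>\<epsilon>\<close>.\<close>

lemma attach:
  assumes x: "x \<in> X" and t: "t \<ge> 0" and v: "integral_vec v" "exp (l1 * t) * \<bar>V x v $ 1\<bar> \<le> \<epsilon>"
     "exp (l2 * t) * \<bar>V x v $ 2\<bar> \<le> \<epsilon>" "\<bar>V x v $ 3\<bar> = exp ((l1 + l2) * t)" and \<epsilon>: "8 * K1 * \<epsilon> \<le> 1"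
  obtains c where "c \<noteq> 0" "integral_vec c" "c \<bullet> v = 0" "\<bar>C x c $ 1\<bar> \<le> K1 * exp (l1 * t)"
     "\<bar>C x c $ 2\<bar> \<le> K1 * exp (l2 * t)" "\<bar>C x c $ 3\<bar> * exp ((l1 + l2) * t) \<le> 2 * \<epsilon> * K1" "c0 \<le> G x c"
proof -
  define a b q where abq: "a = exp (l1 * t)" "b = exp (l2 * t)" "q = exp ((l1 + l2) * t)"
  have q: "q = a * b" by (simp add: abq exp_add[symmetric] algebra_simps)
  have ge1: "1 \<le> a" "1 \<le> b" "1 \<le> q" using t l by (auto simp: abq)
  have \<epsilon>0: "0 \<le> \<epsilon>" using v(2) by (meson abs_ge_zero exp_ge_zero mult_nonneg_nonneg order_trans)
  \<comment> \<open>The weights balance: the determinant is \<open>4 * K1\<close> at every time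
    \<open>t\<close>, and \<open>K1\<close> was chosen so large that the criterion for a vector of
    length \<open>K1\<close> holds.\<close>
  define Dg :: "real^3^3" where "Dg = vector [vector [1/a, 0, 0], vector [0, 1/b, 0], vector [0, 0, 4 * K1 * q]]"
  have Dg: "(Dg *v w) $ 1 = w $ 1 / a" "(Dg *v w) $ 2 = w $ 2 / b" "(Dg *v w) $ 3 = 4 * K1 * q * w $ 3" for w
    by (simp_all add: Dg_def matrix_vector_mult_def sum_3)
  have detBi: "det (Bi x) * D0 = 1"
    using arg_cong[OF inv[OF x], of det] det[OF x] by (simp add: det_mul)
  have "det Dg = 4 * K1" using ge1 by (simp add: Dg_def det_3 q)
  then have "det (Dg ** transpose (Bi x)) = 4 * K1 * det (Bi x)" by (simp add: det_mul)
  then have dd: "det (Dg ** transpose (Bi x)) = 4 * K1 / D0"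
    using detBi D0 by (simp add: field_simps)
  have "4 * \<bar>det (Dg ** transpose (Bi x))\<bar> = (16 / \<bar>D0\<bar>) * K1" using K1(1) by (simp add: dd)
  also have "\<dots> \<le> K1 * K1" using K1 by (intro mult_right_mono) auto
  also have "\<dots> \<le> K1 ^ 3" using K1(1) by (simp add: power3_eq_cube)
  finally have "4 * \<bar>det (Dg ** transpose (Bi x))\<bar> \<le> K1 ^ 3" .
  then obtain c where c: "c \<noteq> 0" "\<And>i. c $ i \<in> \<int>" "norm ((Dg ** transpose (Bi x)) *v c) \<le> K1"
    using short_integer_vector[of "Dg ** transpose (Bi x)" K1] dd D0 K1(1) by auto
  have "norm (Dg *v C x c) \<le> K1" using c(3) unfolding C_def matrix_vector_mul_assoc .
  then have comp: "\<bar>(Dg *v C x c) $ i\<bar> \<le> K1" for i by (meson component_le_norm_cart order_trans)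
  have C1: "\<bar>C x c $ 1\<bar> \<le> K1 * a" using comp[of 1] ge1 by (simp add: Dg divide_le_eq)
  have C2: "\<bar>C x c $ 2\<bar> \<le> K1 * b" using comp[of 2] ge1 by (simp add: Dg divide_le_eq)
  have C3: "\<bar>C x c $ 3\<bar> * q \<le> 1/4" using comp[of 3] ge1 K1(1) by (simp add: Dg abs_mult mult_ac)
  have p: "c \<bullet> v = C x c $ 1 * V x v $ 1 + C x c $ 2 * V x v $ 2 + C x c $ 3 * V x v $ 3"
    using pairing[OF x, of c v] by (simp add: inner_vec_def sum_3)
  have V1: "\<bar>V x v $ 1\<bar> \<le> \<epsilon> / a" "\<bar>V x v $ 2\<bar> \<le> \<epsilon> / b" "\<bar>V x v $ 3\<bar> = q"
    using v ge1 by (simp_all add: abq pos_le_divide_eq mult.commute)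
  have t1: "\<bar>C x c $ 1 * V x v $ 1\<bar> \<le> K1 * \<epsilon>"
    using mult_mono[OF C1 V1(1)] ge1 K1(1) by (simp add: abs_mult)
  have t2: "\<bar>C x c $ 2 * V x v $ 2\<bar> \<le> K1 * \<epsilon>"
    using mult_mono[OF C2 V1(2)] ge1 K1(1) by (simp add: abs_mult)
  have t3: "\<bar>C x c $ 3 * V x v $ 3\<bar> \<le> 1/4" using C3 V1(3) by (simp add: abs_mult)
  have "\<bar>c \<bullet> v\<bar> \<le> K1 * \<epsilon> + K1 * \<epsilon> + 1/4" unfolding p using t1 t2 t3 by linarith
  then have "\<bar>c \<bullet> v\<bar> < 1" using \<epsilon> by linarith
  moreover have ci: "integral_vec c" using c(2) by (simp add: integral_vec_def)
  ultimately have cv: "c \<bullet> v = 0" using integral_vec_inner_zero v(1) by blast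
  then have e3: "C x c $ 3 * V x v $ 3 = - (C x c $ 1 * V x v $ 1) - C x c $ 2 * V x v $ 2" using p by simp
  have C3q: "\<bar>C x c $ 3\<bar> * q = \<bar>C x c $ 3 * V x v $ 3\<bar>" by (simp add: abs_mult V1(3))
  have "\<bar>C x c $ 3\<bar> * q \<le> K1 * \<epsilon> + K1 * \<epsilon>" using t1 t2 unfolding C3q e3 by linarith
  then have C3': "\<bar>C x c $ 3\<bar> * q \<le> 2 * \<epsilon> * K1" by (simp add: algebra_simps)
  have "8 * \<epsilon> \<le> 8 * K1 * \<epsilon>" using K1(1) \<epsilon>0 by (simp add: mult_right_mono)
  then have \<epsilon>1: "\<epsilon> \<le> 1/2" using \<epsilon> by linarith
  \<comment> \<open>As the first two coordinates of \<open>V x v\<close> are at most 1/2,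
    orthogonality prevents the third coordinate of \<open>C x c\<close> from exceeding the other
    two. The lower bound for nonzero dual vectors therefore falls on \<open>G\<close>.\<close>
  have "\<bar>C x c $ 1 * V x v $ 1\<bar> \<le> G x c * (1/2)" "\<bar>C x c $ 2 * V x v $ 2\<bar> \<le> G x c * (1/2)"
  proof -
    have "\<bar>V x v $ 1\<bar> \<le> 1 * \<bar>V x v $ 1\<bar>" "\<bar>V x v $ 2\<bar> \<le> 1 * \<bar>V x v $ 2\<bar>" by auto
    then have "\<bar>V x v $ 1\<bar> \<le> 1/2" "\<bar>V x v $ 2\<bar> \<le> 1/2"
      using v(2,3) \<epsilon>1 ge1 mult_right_mono[OF ge1(1), of "\<bar>V x v $ 1\<bar>"] mult_right_mono[OF ge1(2), of "\<bar>V x v $ 2\<bar>"]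
      unfolding abq by linarith+
    then show "\<bar>C x c $ 1 * V x v $ 1\<bar> \<le> G x c * (1/2)" "\<bar>C x c $ 2 * V x v $ 2\<bar> \<le> G x c * (1/2)"
      using mult_mono[of "\<bar>C x c $ 1\<bar>" "G x c" "\<bar>V x v $ 1\<bar>" "1/2"]
        mult_mono[of "\<bar>C x c $ 2\<bar>" "G x c" "\<bar>V x v $ 2\<bar>" "1/2"]
      by (simp_all add: abs_mult G_def)
  qed
  then have "\<bar>C x c $ 3\<bar> * q \<le> G x c" unfolding C3q e3 by linarith
  moreover have "\<bar>C x c $ 3\<bar> * 1 \<le> \<bar>C x c $ 3\<bar> * q" using ge1 by (intro mult_left_mono) auto
  ultimately have C3G: "\<bar>C x c $ 3\<bar> \<le> G x c" by simp
  have "c0 \<le> G x c"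
  proof -
    obtain i where "c0 \<le> \<bar>C x c $ i\<bar>" using C_lower[OF x ci c(1)] .
    moreover have "\<bar>C x c $ i\<bar> \<le> G x c" using exhaust_3[of i] C3G by (auto simp: G_def)
    ultimately show ?thesis by simp
  qed
  then show ?thesis using that[OF c(1) ci cv] C1 C2 C3' by (simp add: abq)
qed

end

section \<open>Scales of the game\<close>

lemma geometric_bracket:
  fixes q z :: real
  assumes q: "0 < q" "q < 1" and z: "0 < z" "z \<le> 1"
  obtains j where "q ^ Suc j < z" "z \<le> q ^ j"
proof -
  define P where "P j \<longleftrightarrow> q ^ Suc j < z" for j
  obtain j0 where "q ^ j0 < z" using real_arch_pow_inv[OF z(1) q(2)] by blast
  moreover have "q ^ Suc j0 \<le> q ^ j0" using q by (intro power_decreasing) auto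
  ultimately have ex: "P j0" unfolding P_def by linarith
  define j where "j = (LEAST j. P j)"
  have "P j" unfolding j_def using ex by (rule LeastI)
  moreover have "z \<le> q ^ j"
  proof (cases j)
    case 0
    then show ?thesis using z by simp
  next
    case (Suc i)
    then have "\<not> P i" unfolding j_def using not_less_Least lessI by metis
    then show ?thesis using Suc by (simp add: P_def)
  qed
  ultimately show ?thesis using that by (simp add: P_def)
qed

text \<open>The last assumption keeps the entries above the diagonal of the unipotent factor between
  two points at distance at most \<open>2 * R0\<close> within 1/2.\<close>

locale game_scales = unipotent_family +
  fixes \<beta> R0 :: real
  assumes \<beta>: "0 < \<beta>" "\<beta> < 1" and R0: "0 < R0" "2 * L * R0 \<le> 1/2"
begin

definition R where "R n = R0 * \<beta> ^ n" for n :: nat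
text \<open>The uncertainty of the time within one class: 16 from the bracket defining
  \<open>k\<close>, and \<open>1 / \<beta>\<close> from the bracket defining
  \<open>n\<close>.\<close>

definition \<Theta> where "\<Theta> = 16 / \<beta>"
text \<open>So small that moving \<open>c\<close> across a ball changes the last term of its pairing
  with another vector of the class by at most \<open>M m k / 4\<close>.\<close>

definition \<nu> where "\<nu> = 1 / (24 * L * \<Theta>)"
text \<open>\<open>K2\<close> bounds the change of a dual vector across a ball, \<open>K3\<close>
  its rescaled second coordinate after that change, and \<open>K8\<close> the rescaled coordinates
  of a cross product. \<open>K9\<close> enlarges \<open>K8\<close> so that going back by the factor
  \<open>K9 / eps m\<close> takes at least one unit of time. \<open>W\<close> is the final width in
  units of \<open>eps m * R n / M m k\<close>.\<close>

definition K2 where "K2 = 2 * L * \<nu> * K1 / c0"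
definition K3 where "K3 = K1 * \<Theta> + K2"
definition K8 where "K8 = (1 + \<bar>D0\<bar>) * (K3 + (\<Theta> + 1) * K1 + (\<Theta> + 1) + \<Theta> + \<Theta> * K1 + K3)"
definition K9 where "K9 = K8 + exp l1 + 1"
definition W where "W = 2 * (K1 * \<Theta> + K3) * \<Theta> / (\<beta> * \<nu>)"
definition eps where "eps m = (1 / 2 ^ m :: real)" for m :: nat
text \<open>The subtraction is truncated: nothing is enlarged in the first \<open>2 * m\<close>
  classes.\<close>

definition M where "M m k = (2 ^ (k - 2 * m) :: real)" for m k :: nat

definition small where "small m \<longleftrightarrow> 8 * K1 * eps m \<le> 1 \<and> eps m * (K1 * \<Theta> + K3 + 2 * \<Theta> * K1) \<le> 1/2 \<and>
   K9 ^ 3 * K1 * eps m \<le> 1 \<and> K9 * K1 * eps m \<le> c0 \<and> eps m * 2 \<le> c0" for m :: nat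

text \<open>The vector \<open>v\<close> becomes short at time \<open>t\<close> and at no time before \<open>t - 1\<close>, and \<open>c\<close> is attached to it.
  The class \<open>k\<close> records how far \<open>G x c\<close> is below its maximal size \<open>exp (l1 * t)\<close>, and \<open>n\<close> the scale on
  which the surface of \<open>c\<close> traps the points endangered in this way.  The factor \<open>M m k\<close> enlarges
  that scale for large \<open>k\<close>, which makes the widths summable over \<open>k\<close>.\<close>

definition cls where "cls m n k x v t c \<longleftrightarrow> v \<noteq> 0 \<and> integral_vec v \<and> c \<noteq> 0 \<and> integral_vec c \<and> t > 0 \<and>
   exp (l1 * t) * \<bar>V x v $ 1\<bar> \<le> eps m \<and> exp (l2 * t) * \<bar>V x v $ 2\<bar> \<le> eps m \<and>
   \<bar>V x v $ 3\<bar> = exp ((l1 + l2) * t) \<and> (\<forall>s. 0 \<le> s \<longrightarrow> s \<le> t - 1 \<longrightarrow> \<not> danger (eps m) x s) \<and>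
   c \<bullet> v = 0 \<and> \<bar>C x c $ 1\<bar> \<le> K1 * exp (l1 * t) \<and> \<bar>C x c $ 2\<bar> \<le> K1 * exp (l2 * t) \<and>
   \<bar>C x c $ 3\<bar> * exp ((l1 + l2) * t) \<le> 2 * eps m * K1 \<and> c0 \<le> G x c \<and>
   K1 / 16 ^ Suc k < G x c / exp (l1 * t) \<and> G x c / exp (l1 * t) \<le> K1 / 16 ^ k \<and>
   R n < \<nu> * M m k / (exp ((l1 + l2) * t) * G x c) \<and>
   \<nu> * M m k / (exp ((l1 + l2) * t) * G x c) \<le> R n / \<beta>" for m n k :: nat

section \<open>Elementary bounds for the constants\<close>

lemma R_pos: "0 < R n" using \<beta> R0 by (simp add: R_def)
lemma R_le: "R n \<le> R0" using \<beta> R0 by (simp add: R_def mult_le_cancel_left1 power_le_one)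
lemma \<Theta>: "16 < \<Theta>" "1 \<le> \<Theta>" using \<beta> by (auto simp: \<Theta>_def field_simps)
lemma \<nu>: "0 < \<nu>" using \<Theta> L by (simp add: \<nu>_def)
lemma \<nu>_eq: "24 * L * \<nu> * \<Theta> = 1" using \<Theta> L by (simp add: \<nu>_def)
lemma K2_pos: "0 < K2" using L \<nu> K1 c0 by (simp add: K2_def)
lemma K3: "1 \<le> K3" "K1 * \<Theta> \<le> K3"
proof -
  have "1 * 1 \<le> K1 * \<Theta>" using K1 \<Theta> by (intro mult_mono) auto
  then show "1 \<le> K3" "K1 * \<Theta> \<le> K3" using K2_pos by (auto simp: K3_def)
qed
lemma eps_pos: "0 < eps m" "eps m \<le> 1" by (auto simp: eps_def)
lemma M_ge1: "1 \<le> M m k" by (simp add: M_def)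
lemma M_sq: "M m k ^ 2 \<le> 16 ^ k"
proof -
  have "M m k ^ 2 = 4 ^ (k - 2 * m)" unfolding M_def by (simp add: power2_eq_square power_mult_distrib[symmetric])
  also have "\<dots> \<le> 4 ^ k" by (intro power_increasing) auto
  also have "\<dots> \<le> (16::real) ^ k" by (intro power_mono) auto
  finally show ?thesis .
qed
lemma M_le: "M m k \<le> 2 ^ k" unfolding M_def by (intro power_increasing) auto
lemma M_le16: "M m k \<le> 16 ^ k"
  by (rule order_trans[OF M_le]) (intro power_mono, auto)

text \<open>The brackets for \<open>n\<close> and \<open>k\<close> together determine
  \<open>exp ((l1 + l2) * t) * exp (l1 * t)\<close> up to the factor \<open>\<Theta>\<close>;
  smaller exponents inherit the bound.\<close>

lemma cls_time_ratio:
  assumes "cls m n k x v t c" "cls m n k x' v' t' c'" "0 \<le> \<mu>" "\<mu> \<le> 2 * l1 + l2"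
  shows "exp (\<mu> * t) \<le> \<Theta> * exp (\<mu> * t')"
proof (cases "t \<le> t'")
  case True
  then have "exp (\<mu> * t) \<le> 1 * exp (\<mu> * t')" using assms(3) by (simp add: mult_left_mono)
  also have "\<dots> \<le> \<Theta> * exp (\<mu> * t')" using \<Theta> by (intro mult_right_mono) auto
  finally show ?thesis .
next
  case False
  define a q a' q' where aq: "a = exp (l1 * t)" "q = exp ((l1 + l2) * t)" "a' = exp (l1 * t')" "q' = exp ((l1 + l2) * t')"
  have pos: "0 < a" "0 < q" "0 < a'" "0 < q'" by (auto simp: aq)
  have G: "0 < G x c" "0 < G x' c'" using assms(1,2) c0 unfolding cls_def by auto
  have K1p: "0 < K1" using K1 by simp
  have Mp: "0 < M m k" using M_ge1[of m k] by simp
  have 1: "R n * (q * G x c) < \<nu> * M m k"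
    using assms(1) pos G unfolding cls_def aq[symmetric] by (simp add: pos_less_divide_eq)
  have 2: "K1 / 16 ^ Suc k * a < G x c"
    using assms(1) pos unfolding cls_def aq[symmetric] by (simp add: pos_less_divide_eq)
  have 3: "\<nu> * M m k \<le> R n / \<beta> * (q' * G x' c')"
    using assms(2) pos G unfolding cls_def aq[symmetric] by (simp add: pos_divide_le_eq)
  have 4: "G x' c' \<le> K1 / 16 ^ k * a'"
    using assms(2) pos unfolding cls_def aq[symmetric] by (simp add: pos_divide_le_eq)
  have "R n * (q * (K1 / 16 ^ Suc k * a)) \<le> R n * (q * G x c)"
    using 2 R_pos[of n] pos by (intro mult_left_mono) auto
  also have "\<dots> \<le> R n / \<beta> * (q' * G x' c')" using 1 3 by simp
  also have "\<dots> \<le> R n / \<beta> * (q' * (K1 / 16 ^ k * a'))"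
    using 4 R_pos[of n] pos \<beta> by (intro mult_left_mono) auto
  finally have "(R n * K1 / 16 ^ Suc k) * (q * a) \<le> (R n * K1 / 16 ^ Suc k) * (\<Theta> * (q' * a'))"
    by (simp add: \<Theta>_def algebra_simps)
  then have "q * a \<le> \<Theta> * (q' * a')" using R_pos[of n] K1p
    by (subst (asm) mult_le_cancel_left_pos) auto
  then have "exp ((2 * l1 + l2) * t) \<le> \<Theta> * exp ((2 * l1 + l2) * t')"
    by (simp add: aq exp_add[symmetric] algebra_simps)
  then have "exp ((2 * l1 + l2) * (t - t')) \<le> \<Theta>"
    by (simp add: right_diff_distrib exp_diff pos_divide_le_eq)
  moreover have "exp (\<mu> * (t - t')) \<le> exp ((2 * l1 + l2) * (t - t'))"
    using False assms(4) by (simp add: mult_right_mono)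
  ultimately have "exp (\<mu> * (t - t')) \<le> \<Theta>" by linarith
  then show ?thesis by (simp add: right_diff_distrib exp_diff pos_divide_le_eq)
qed

text \<open>Transported from \<open>x\<close> to \<open>x'\<close>, the vector \<open>c\<close>
  still satisfies the bounds of its class up to constants, except that its third coordinate may have
  grown to the order of \<open>M m k\<close>. If \<open>M m k = 1\<close>, the pairing with
  \<open>v'\<close> stays below 1 and integrality gives orthogonality. For larger
  \<open>M m k\<close> this fails, and the cross product with \<open>c'\<close> is used: were it
  nonzero, \<open>x'\<close> would have been in danger more than a unit of time before
  \<open>t'\<close>, or exactly one unit.\<close>

lemma cls_same_plane:
  assumes x: "x \<in> X" "x' \<in> X" "dist x x' \<le> 2 * R n" and small: "small m"
    and c1: "cls m n k x v t c" and c2: "cls m n k x' v' t' c'"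
  shows "c \<bullet> v' = 0" "\<bar>C x' c $ 3\<bar> \<le> (W * eps m * R n / M m k) * G x' c"
proof -
  define a b q a' b' q' where aq: "a = exp (l1 * t)" "b = exp (l2 * t)" "q = exp ((l1 + l2) * t)"
    "a' = exp (l1 * t')" "b' = exp (l2 * t')" "q' = exp ((l1 + l2) * t')"
  define \<epsilon> where "\<epsilon> = eps m"
  define g where "g = G x c"
  define \<delta> where "\<delta> = 2 * L * R n"
  note sm = small[unfolded small_def, folded \<epsilon>_def]
  have \<epsilon>: "0 < \<epsilon>" "\<epsilon> \<le> 1" using eps_pos by (auto simp: \<epsilon>_def)
  have t: "t > 0" "t' > 0" using c1 c2 by (auto simp: cls_def)
  have ge1: "1 \<le> a" "1 \<le> b" "1 \<le> q" "1 \<le> a'" "1 \<le> b'" "1 \<le> q'" using t l by (auto simp: aq)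
  have qab: "q = a * b" "q' = a' * b'" by (simp_all add: aq exp_add[symmetric] algebra_simps)
  have ra: "a \<le> \<Theta> * a'" "b \<le> \<Theta> * b'" "q \<le> \<Theta> * q'" "q' \<le> \<Theta> * q"
    using cls_time_ratio[OF c1 c2, of l1] cls_time_ratio[OF c1 c2, of l2] l
      cls_time_ratio[OF c1 c2, of "l1 + l2"] cls_time_ratio[OF c2 c1, of "l1 + l2"] by (auto simp: aq)
  note c1' = c1[unfolded cls_def, folded aq \<epsilon>_def g_def]
  note c2' = c2[unfolded cls_def, folded aq \<epsilon>_def]
  have K1p: "1 \<le> K1" by (rule K1)
  have g: "c0 \<le> g" "0 < g" using c1' c0 by auto
  have CG: "\<bar>C x c $ 1\<bar> \<le> g" "\<bar>C x c $ 2\<bar> \<le> g" by (auto simp: g_def G_def)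
  have \<delta>: "0 \<le> \<delta>" "\<delta> \<le> 1/2"
  proof -
    show "0 \<le> \<delta>" using L R_pos[of n] by (simp add: \<delta>_def)
    have "\<delta> \<le> 2 * L * R0" unfolding \<delta>_def using R_le L by (intro mult_left_mono) auto
    then show "\<delta> \<le> 1/2" using R0 by simp
  qed
  obtain p r s where b0: "\<bar>p\<bar> \<le> L * dist x' x" "\<bar>r\<bar> \<le> L * dist x' x" "\<bar>s\<bar> \<le> L * dist x' x"
    and C': "C x' c $ 1 = C x c $ 1" "C x' c $ 2 = C x c $ 2 - p * C x c $ 1"
      "C x' c $ 3 = C x c $ 3 - s * C x c $ 2 + (p * s - r) * C x c $ 1"
    using C_components[OF x(2,1)] by metis
  have "L * dist x' x \<le> \<delta>" using x(3) L by (simp add: \<delta>_def dist_commute)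
  then have prs: "\<bar>p\<bar> \<le> \<delta>" "\<bar>r\<bar> \<le> \<delta>" "\<bar>s\<bar> \<le> \<delta>" using b0 by linarith+
  \<comment> \<open>This is the defining property of the scale: the change of \<open>c\<close>
    across the ball, of size \<open>\<delta> * g\<close>, remains of order \<open>M m k\<close>
    after multiplication by \<open>q\<close>.\<close>
  have \<delta>gq: "\<delta> * g * q \<le> 2 * L * \<nu> * M m k"
  proof -
    have "R n * (q * g) < \<nu> * M m k" using c1' g ge1 by (simp add: pos_less_divide_eq)
    then have "(2 * L) * (R n * (q * g)) \<le> (2 * L) * (\<nu> * M m k)" using L by (intro mult_left_mono) auto
    then show ?thesis by (simp add: \<delta>_def mult_ac)
  qed
  have Mq: "M m k \<le> K1 / c0 * q"
  proof -
    have "g * 16 ^ k \<le> K1 * a" using c1' ge1 by (simp add: field_simps)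
    moreover have "c0 * M m k \<le> g * 16 ^ k" using g c0 M_le16[of m k] M_ge1[of m k] by (intro mult_mono) auto
    moreover have "K1 * a \<le> K1 * q" unfolding qab using ge1 K1p by (intro mult_left_mono) auto
    ultimately have "c0 * M m k \<le> K1 * q" by linarith
    then show ?thesis using c0 by (simp add: field_simps)
  qed
  have \<delta>g: "\<delta> * g \<le> K2"
  proof -
    have "\<delta> * g * q \<le> 2 * L * \<nu> * (K1 / c0 * q)"
      by (rule order_trans[OF \<delta>gq mult_left_mono[OF Mq]]) (use L \<nu> in auto)
    then have "\<delta> * g * q \<le> K2 * q" by (simp add: K2_def)
    then show ?thesis using ge1 by (subst (asm) mult_le_cancel_right_pos) auto
  qed
  have A1: "\<bar>C x' c $ 1\<bar> \<le> K1 * \<Theta> * a'"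
  proof -
    have "\<bar>C x' c $ 1\<bar> \<le> K1 * a" using c1' C' by simp
    also have "\<dots> \<le> K1 * (\<Theta> * a')" using ra K1p by (intro mult_left_mono) auto
    finally show ?thesis by simp
  qed
  have pC: "\<bar>p * C x c $ 1\<bar> \<le> \<delta> * g" unfolding abs_mult using prs CG \<delta> by (intro mult_mono) auto
  have A2: "\<bar>C x' c $ 2\<bar> \<le> K3 * b'"
  proof -
    have "\<bar>C x' c $ 2\<bar> \<le> \<bar>C x c $ 2\<bar> + \<bar>p * C x c $ 1\<bar>" unfolding C' by linarith
    also have "\<dots> \<le> K1 * b + K2" using c1' pC \<delta>g by linarith
    also have "\<dots> \<le> K1 * (\<Theta> * b') + K2 * b'"
      using ra K1p K2_pos ge1 mult_left_mono[OF ge1(5), of K2] by (intro add_mono mult_left_mono) auto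
    finally show ?thesis by (simp add: K3_def algebra_simps)
  qed
  have A3: "\<bar>C x' c $ 3\<bar> * q' \<le> 2 * \<Theta> * \<epsilon> * K1 + M m k / 4"
  proof -
    have s1: "\<bar>s * C x c $ 2\<bar> \<le> \<delta> * g" unfolding abs_mult using prs CG \<delta> by (intro mult_mono) auto
    have "\<bar>p * s - r\<bar> \<le> \<bar>p\<bar> * \<bar>s\<bar> + \<bar>r\<bar>" by (metis abs_mult abs_triangle_ineq4)
    also have "\<dots> \<le> 1 * \<delta> + \<delta>" using prs \<delta> by (intro add_mono mult_mono) auto
    finally have "\<bar>p * s - r\<bar> \<le> 2 * \<delta>" by simp
    then have s2: "\<bar>(p * s - r) * C x c $ 1\<bar> \<le> 2 * \<delta> * g"
      unfolding abs_mult using CG \<delta> by (intro mult_mono) auto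
    have "\<bar>C x' c $ 3\<bar> \<le> \<bar>C x c $ 3\<bar> + 3 * (\<delta> * g)" unfolding C' using s1 s2 by linarith
    then have "\<bar>C x' c $ 3\<bar> * q' \<le> (\<bar>C x c $ 3\<bar> + 3 * (\<delta> * g)) * (\<Theta> * q)"
      using ra ge1 \<delta> g by (intro mult_mono) auto
    also have "\<dots> = \<Theta> * (\<bar>C x c $ 3\<bar> * q + 3 * (\<delta> * g * q))" by (simp add: algebra_simps)
    also have "\<dots> \<le> \<Theta> * (2 * \<epsilon> * K1 + 3 * (2 * L * \<nu> * M m k))"
      using \<delta>gq c1' \<Theta> by (intro mult_left_mono add_mono) auto
    also have "\<dots> = 2 * \<Theta> * \<epsilon> * K1 + (24 * L * \<nu> * \<Theta>) * M m k / 4" by (simp add: algebra_simps)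
    finally show ?thesis by (simp add: \<nu>_eq)
  qed
  have p: "c \<bullet> v' = C x' c $ 1 * V x' v' $ 1 + C x' c $ 2 * V x' v' $ 2 + C x' c $ 3 * V x' v' $ 3"
    using pairing[OF x(2), of c v'] by (simp add: inner_vec_def sum_3)
  have V1: "\<bar>V x' v' $ 1\<bar> \<le> \<epsilon> / a'" "\<bar>V x' v' $ 2\<bar> \<le> \<epsilon> / b'" "\<bar>V x' v' $ 3\<bar> = q'"
    using c2' ge1 by (simp_all add: pos_le_divide_eq mult.commute)
  have t1: "\<bar>C x' c $ 1 * V x' v' $ 1\<bar> \<le> K1 * \<Theta> * \<epsilon>"
    using mult_mono[OF A1 V1(1)] ge1 K1p \<Theta> by (simp add: abs_mult)
  have t2: "\<bar>C x' c $ 2 * V x' v' $ 2\<bar> \<le> K3 * \<epsilon>"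
    using mult_mono[OF A2 V1(2)] ge1 K3 by (simp add: abs_mult)
  have t3: "\<bar>C x' c $ 3 * V x' v' $ 3\<bar> = \<bar>C x' c $ 3\<bar> * q'" using V1(3) by (simp add: abs_mult)
  have cint: "integral_vec c" "integral_vec v'" "integral_vec c'" "c' \<bullet> v' = 0" "c' \<noteq> 0" using c1' c2' by auto
  show plane: "c \<bullet> v' = 0"
  proof (cases "k \<le> 2 * m")
    case True
    then have "M m k = 1" by (simp add: M_def)
    then have "\<bar>c \<bullet> v'\<bar> \<le> K1 * \<Theta> * \<epsilon> + K3 * \<epsilon> + (2 * \<Theta> * \<epsilon> * K1 + 1 / 4)"
      unfolding p using t1 t2 t3 A3 by linarith
    also have "\<dots> = \<epsilon> * (K1 * \<Theta> + K3 + 2 * \<Theta> * K1) + 1/4" by (simp add: algebra_simps)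
    also have "\<dots> < 1" using sm by linarith
    finally show ?thesis using integral_vec_inner_zero cint by blast
  next
    case False
    \<comment> \<open>The class bounds the gradient of either dual vector by \<open>\<kappa>\<close>
      times \<open>exp (l1 * t)\<close>. Beyond the first \<open>2 * m\<close> classes,
      \<open>\<kappa>\<close> is so small that it pays for two factors \<open>Mk\<close> and for
      several divisions by \<open>\<epsilon>\<close>.\<close>
    define \<kappa> where "\<kappa> = K1 / 16 ^ k"
    define Mk where "Mk = M m k"
    have Mk: "1 \<le> Mk" using M_ge1 by (simp add: Mk_def)
    have \<kappa>: "0 < \<kappa>" using K1p by (simp add: \<kappa>_def)
    have \<kappa>M: "\<kappa> * Mk ^ 2 \<le> K1 * \<epsilon> ^ 8"
    proof -
      obtain j where j: "k = 2 * m + j" using False by (metis le_add_diff_inverse nat_le_linear)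
      have "\<kappa> * Mk ^ 2 = K1 * (1 / 256 ^ m) * (4 ^ j / 16 ^ j)"
        by (simp add: \<kappa>_def Mk_def M_def j power_add power_mult power2_eq_square power_mult_distrib[symmetric])
      also have "\<dots> \<le> K1 * (1 / 256 ^ m) * 1"
        using K1p by (intro mult_left_mono) (auto intro!: power_mono simp: divide_le_eq_1)
      also have "\<dots> = K1 * \<epsilon> ^ 8"
        by (simp add: \<epsilon>_def eps_def power_divide power_mult[symmetric] mult.commute[of m] power_mult)
      finally show ?thesis .
    qed
    have A3': "\<bar>C x' c $ 3\<bar> * q' \<le> (\<Theta> + 1) * Mk"
    proof -
      have "8 * (K1 * \<epsilon>) \<le> 1" using sm by simp
      then have "2 * \<Theta> * (\<epsilon> * K1) \<le> 2 * \<Theta> * (1/8)" using \<Theta> by (intro mult_left_mono) (auto simp: mult.commute)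
      then have "2 * \<Theta> * \<epsilon> * K1 \<le> \<Theta> * 1" using \<Theta> by simp
      also have "\<dots> \<le> \<Theta> * Mk" using Mk \<Theta> by (intro mult_left_mono) auto
      finally have "2 * \<Theta> * \<epsilon> * K1 + Mk / 4 \<le> \<Theta> * Mk + Mk" using Mk by linarith
      then show ?thesis using A3 by (simp add: Mk_def algebra_simps)
    qed
    have B1: "\<bar>C x' c' $ 1\<bar> \<le> \<kappa> * a'" "\<bar>C x' c' $ 2\<bar> \<le> K1 * b'" "\<bar>C x' c' $ 3\<bar> * q' \<le> 1"
    proof -
      have "G x' c' \<le> \<kappa> * a'" using c2' ge1 by (simp add: \<kappa>_def pos_divide_le_eq)
      then show "\<bar>C x' c' $ 1\<bar> \<le> \<kappa> * a'" by (simp add: G_def)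
      show "\<bar>C x' c' $ 2\<bar> \<le> K1 * b'" using c2' by simp
      have "8 * (K1 * \<epsilon>) \<le> 1" using sm by simp
      moreover have "\<bar>C x' c' $ 3\<bar> * q' \<le> 2 * (K1 * \<epsilon>)" using c2' by (simp add: algebra_simps)
      ultimately show "\<bar>C x' c' $ 3\<bar> * q' \<le> 1" by linarith
    qed
    have A1': "\<bar>C x' c $ 1\<bar> \<le> \<kappa> * \<Theta> * a'"
    proof -
      have "g \<le> \<kappa> * a" using c1' ge1 by (simp add: \<kappa>_def pos_divide_le_eq)
      then have "\<bar>C x' c $ 1\<bar> \<le> \<kappa> * a" using CG C' by simp
      also have "\<dots> \<le> \<kappa> * (\<Theta> * a')" using ra \<kappa> by (intro mult_left_mono) auto
      finally show ?thesis by simp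
    qed
    have d3: "\<bar>C x' c $ 3\<bar> \<le> (\<Theta> + 1) * Mk / q'" "\<bar>C x' c' $ 3\<bar> \<le> 1 / q'"
      using A3' B1(3) ge1 by (simp_all add: pos_le_divide_eq)
    define u where "u = cross3 c c'"
    define S where "S = K3 + (\<Theta> + 1) * K1 + (\<Theta> + 1) + \<Theta> + \<Theta> * K1 + K3"
    have S: "K3 + (\<Theta> + 1) * K1 \<le> S" "(\<Theta> + 1) + \<Theta> \<le> S" "\<Theta> * K1 + K3 \<le> S" "1 \<le> S"
      using K3 \<Theta> K1p mult_nonneg_nonneg[of \<Theta> K1] mult_nonneg_nonneg[of "\<Theta> + 1" K1] by (auto simp: S_def)
    define U where "U = cross3 (C x' c) (C x' c')"
    have U: "U $ 1 = C x' c $ 2 * C x' c' $ 3 - C x' c $ 3 * C x' c' $ 2"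
      "U $ 2 = C x' c $ 3 * C x' c' $ 1 - C x' c $ 1 * C x' c' $ 3"
      "U $ 3 = C x' c $ 1 * C x' c' $ 2 - C x' c $ 2 * C x' c' $ 1"
      by (simp_all add: U_def cross3_def)
    have U1: "\<bar>U $ 1\<bar> * a' \<le> S * Mk"
    proof -
      have "\<bar>C x' c $ 2 * C x' c' $ 3\<bar> \<le> (K3 * b') * (1 / q')"
        unfolding abs_mult using A2 d3 ge1 K3 by (intro mult_mono) auto
      moreover have "\<bar>C x' c $ 3 * C x' c' $ 2\<bar> \<le> ((\<Theta> + 1) * Mk / q') * (K1 * b')"
        unfolding abs_mult using B1 d3 ge1 \<Theta> Mk by (intro mult_mono) auto
      ultimately have "\<bar>U $ 1\<bar> \<le> (K3 * b') * (1 / q') + ((\<Theta> + 1) * Mk / q') * (K1 * b')"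
        unfolding U by linarith
      also have "\<dots> = (K3 + (\<Theta> + 1) * K1 * Mk) / a'" using ge1 by (simp add: qab field_simps)
      finally have "\<bar>U $ 1\<bar> * a' \<le> K3 * 1 + (\<Theta> + 1) * K1 * Mk" using ge1 by (simp add: pos_le_divide_eq)
      also have "\<dots> \<le> K3 * Mk + (\<Theta> + 1) * K1 * Mk" using K3 mult_left_mono[OF Mk, of K3] by simp
      also have "\<dots> = (K3 + (\<Theta> + 1) * K1) * Mk" by (simp add: algebra_simps)
      also have "\<dots> \<le> S * Mk" using S Mk by (intro mult_right_mono) auto
      finally show ?thesis .
    qed
    have U2: "\<bar>U $ 2\<bar> * b' \<le> S * Mk * \<kappa>"
    proof -
      have "\<bar>C x' c $ 3 * C x' c' $ 1\<bar> \<le> ((\<Theta> + 1) * Mk / q') * (\<kappa> * a')"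
        unfolding abs_mult using B1 d3 ge1 \<Theta> Mk by (intro mult_mono) auto
      moreover have "\<bar>C x' c $ 1 * C x' c' $ 3\<bar> \<le> (\<kappa> * \<Theta> * a') * (1 / q')"
        unfolding abs_mult using A1' d3 ge1 \<Theta> \<kappa> by (intro mult_mono) auto
      ultimately have "\<bar>U $ 2\<bar> \<le> ((\<Theta> + 1) * Mk / q') * (\<kappa> * a') + (\<kappa> * \<Theta> * a') * (1 / q')"
        unfolding U by linarith
      also have "\<dots> = ((\<Theta> + 1) * Mk + \<Theta>) * \<kappa> / b'" using ge1 by (simp add: qab field_simps)
      finally have "\<bar>U $ 2\<bar> * b' \<le> ((\<Theta> + 1) * Mk + \<Theta> * 1) * \<kappa>" using ge1 by (simp add: pos_le_divide_eq)
      also have "\<dots> \<le> ((\<Theta> + 1) * Mk + \<Theta> * Mk) * \<kappa>"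
        using \<Theta> Mk \<kappa> by (intro mult_right_mono add_mono mult_left_mono) auto
      also have "\<dots> = ((\<Theta> + 1) + \<Theta>) * Mk * \<kappa>" by (simp add: algebra_simps)
      also have "\<dots> \<le> S * Mk * \<kappa>" using S Mk \<kappa> by (intro mult_right_mono) auto
      finally show ?thesis .
    qed
    have U3: "\<bar>U $ 3\<bar> \<le> S * \<kappa> * q'"
    proof -
      have "\<bar>C x' c $ 1 * C x' c' $ 2\<bar> \<le> (\<kappa> * \<Theta> * a') * (K1 * b')"
        unfolding abs_mult using A1' B1 ge1 \<Theta> \<kappa> by (intro mult_mono) auto
      moreover have "\<bar>C x' c $ 2 * C x' c' $ 1\<bar> \<le> (K3 * b') * (\<kappa> * a')"
        unfolding abs_mult using A2 B1 ge1 K3 by (intro mult_mono) auto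
      ultimately have "\<bar>U $ 3\<bar> \<le> (\<kappa> * \<Theta> * a') * (K1 * b') + (K3 * b') * (\<kappa> * a')"
        unfolding U by linarith
      also have "\<dots> = (\<Theta> * K1 + K3) * \<kappa> * q'" by (simp add: qab algebra_simps)
      also have "\<dots> \<le> S * \<kappa> * q'" using S \<kappa> ge1 by (intro mult_right_mono) auto
      finally show ?thesis .
    qed
    have Vu: "V x' u $ i = D0 * U $ i" for i
      unfolding u_def U_def by (simp add: cross_C[OF x(2)])
    have K8: "K8 = (1 + \<bar>D0\<bar>) * S" by (simp add: K8_def S_def)
    have K8p: "1 \<le> K8" unfolding K8 using S mult_mono[of 1 "1 + \<bar>D0\<bar>" 1 S] by simp
    have DS: "\<bar>D0\<bar> * z \<le> K8 * y" if "z \<le> S * y" "0 \<le> y" for z y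
    proof -
      have "\<bar>D0\<bar> * z \<le> \<bar>D0\<bar> * (S * y)" using that by (intro mult_left_mono) auto
      also have "\<dots> \<le> (1 + \<bar>D0\<bar>) * (S * y)" using that S by (intro mult_right_mono) auto
      finally show ?thesis by (simp add: K8 mult_ac)
    qed
    have V1u: "\<bar>V x' u $ 1\<bar> * a' \<le> K8 * Mk"
      using DS[OF U1] Mk by (simp add: Vu abs_mult mult_ac)
    have V2u: "\<bar>V x' u $ 2\<bar> * b' \<le> K8 * (Mk * \<kappa>)"
      using DS[of "\<bar>U $ 2\<bar> * b'" "Mk * \<kappa>"] U2 Mk \<kappa> by (simp add: Vu abs_mult mult_ac)
    have V3u: "\<bar>V x' u $ 3\<bar> \<le> K8 * (\<kappa> * q')"
      using DS[of "\<bar>U $ 3\<bar>" "\<kappa> * q'"] U3 \<kappa> ge1 by (simp add: Vu abs_mult mult_ac)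
    have K9: "K8 \<le> K9" "exp l1 \<le> K9" "1 \<le> K9" using K8p by (auto simp: K9_def)
    \<comment> \<open>The factor \<open>exp (l1 * \<tau>)\<close> by which the time is set back. It
      is just large enough to bring the first coordinate of the cross product below
      \<open>\<epsilon>\<close>; \<open>Z \<ge> exp l1\<close> gives \<open>\<tau> \<ge> 1\<close>,
      and the smallness of \<open>\<kappa>\<close> keeps \<open>Z\<close> below \<open>a'\<close>,
      so the earlier time is not negative.\<close>
    define Z where "Z = K9 * Mk / \<epsilon>"
    have Z: "exp l1 \<le> Z" "1 \<le> Z" "K8 * Mk \<le> \<epsilon> * Z"
    proof -
      have "K9 * \<epsilon> \<le> K9 * 1" using \<epsilon> K9 by (intro mult_left_mono) auto
      also have "K9 * 1 \<le> K9 * Mk" using Mk K9 by (intro mult_left_mono) auto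
      finally have "K9 \<le> Z" using \<epsilon> by (simp add: Z_def pos_le_divide_eq)
      then show "exp l1 \<le> Z" "1 \<le> Z" using K9 by auto
      show "K8 * Mk \<le> \<epsilon> * Z" using K9 \<epsilon> Mk by (simp add: Z_def mult_right_mono)
    qed
    have Zk: "K9 * (\<kappa> * Z ^ 2) \<le> 1" "\<kappa> * Z \<le> c0" "K8 * (Mk * \<kappa>) \<le> \<epsilon>"
    proof -
      have e6: "\<epsilon> ^ 6 \<le> \<epsilon> ^ 1" "\<epsilon> ^ 7 \<le> \<epsilon> ^ 1" "\<epsilon> ^ 8 \<le> \<epsilon> ^ 2" 
        using \<epsilon> power_decreasing[of 1 6 \<epsilon>] power_decreasing[of 1 7 \<epsilon>] power_decreasing[of 2 8 \<epsilon>] by simp_all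
      have "K9 * (\<kappa> * Z ^ 2) = K9 ^ 3 * (\<kappa> * Mk ^ 2) / \<epsilon> ^ 2"
        by (simp add: Z_def power2_eq_square power3_eq_cube)
      also have "\<dots> \<le> K9 ^ 3 * (K1 * \<epsilon> ^ 8) / \<epsilon> ^ 2"
        using \<kappa>M K9 \<epsilon> by (intro divide_right_mono mult_left_mono) auto
      also have "\<dots> = K9 ^ 3 * K1 * \<epsilon> ^ 6" using \<epsilon> by (simp add: power2_eq_square eval_nat_numeral)
      also have "\<dots> \<le> K9 ^ 3 * K1 * \<epsilon> ^ 1" using e6 K9 K1p by (intro mult_left_mono) auto
      also have "\<dots> \<le> 1" using sm by simp
      finally show "K9 * (\<kappa> * Z ^ 2) \<le> 1" .
      have km: "\<kappa> * Mk \<le> K1 * \<epsilon> ^ 8"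
      proof -
        have "\<kappa> * Mk \<le> \<kappa> * Mk ^ 2" using \<kappa> Mk by (intro mult_left_mono) (auto simp: power2_eq_square)
        then show ?thesis using \<kappa>M by simp
      qed
      have "\<kappa> * Z = K9 * (\<kappa> * Mk) / \<epsilon>" by (simp add: Z_def)
      also have "\<dots> \<le> K9 * (K1 * \<epsilon> ^ 8) / \<epsilon>"
        using km K9 \<epsilon> by (intro divide_right_mono mult_left_mono) auto
      also have "\<dots> = K9 * K1 * \<epsilon> ^ 7" using \<epsilon> by (simp add: eval_nat_numeral)
      also have "\<dots> \<le> K9 * K1 * \<epsilon> ^ 1" using e6 K9 K1p by (intro mult_left_mono) auto
      also have "\<dots> \<le> c0" using sm by simp
      finally show "\<kappa> * Z \<le> c0" .
      have "K8 * (Mk * \<kappa>) \<le> K9 * (K1 * \<epsilon> ^ 8)"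
        using km K9 K8p Mk \<kappa> by (intro mult_mono[of K8]) (auto simp: mult.commute)
      also have "\<dots> \<le> K9 * (K1 * \<epsilon> ^ 2)" using e6 K9 K1p by (intro mult_left_mono) auto
      also have "\<dots> = (K9 * K1 * \<epsilon>) * \<epsilon>" by (simp add: power2_eq_square)
      also have "\<dots> \<le> 1 * \<epsilon>" using sm c0 \<epsilon> by (intro mult_right_mono) auto
      finally show "K8 * (Mk * \<kappa>) \<le> \<epsilon>" by simp
    qed
    have u0: "u = 0"
    proof (rule ccontr)
      assume "u \<noteq> 0"
      define \<tau> where "\<tau> = ln Z / l1"
      have eZ: "exp (l1 * \<tau>) = Z" using Z l by (simp add: \<tau>_def)
      have "exp (l1 * 1) \<le> exp (l1 * \<tau>)" using Z eZ by simp
      then have \<tau>1: "1 \<le> \<tau>" using l by simp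
      have "Z \<le> a'"
      proof -
        have "c0 \<le> \<kappa> * a'" using c2' ge1 by (simp add: \<kappa>_def pos_divide_le_eq)
        then have "\<kappa> * Z \<le> \<kappa> * a'" using Zk by simp
        then show ?thesis using \<kappa> by simp
      qed
      then have "exp (l1 * \<tau>) \<le> exp (l1 * t')" using eZ aq by simp
      then have \<tau>t: "\<tau> \<le> t'" using l by simp
      \<comment> \<open>Going back gains the factor \<open>Z\<close> in the first coordinate, and
        the second is already short. The bound for the third becomes stricter by at most
        \<open>Z ^ 2\<close>, since \<open>l2 \<le> l1\<close>, and the factor
        \<open>\<kappa>\<close> absorbs this loss.\<close>
      have "danger \<epsilon> x' (t' - \<tau>)" unfolding danger_def
      proof (intro exI[of _ u] conjI)
        show "integral_vec u" unfolding u_def using cint integral_vec_cross3 by blast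
        have "exp (l1 * (t' - \<tau>)) * \<bar>V x' u $ 1\<bar> = \<bar>V x' u $ 1\<bar> * a' / Z"
          by (simp add: right_diff_distrib exp_diff eZ aq)
        also have "\<dots> \<le> \<epsilon>" using V1u Z by (simp add: pos_divide_le_eq)
        finally show "exp (l1 * (t' - \<tau>)) * \<bar>V x' u $ 1\<bar> \<le> \<epsilon>" .
        have "exp (l2 * (t' - \<tau>)) \<le> b'" using \<tau>1 l by (simp add: aq mult_left_mono)
        then have "exp (l2 * (t' - \<tau>)) * \<bar>V x' u $ 2\<bar> \<le> b' * \<bar>V x' u $ 2\<bar>" by (intro mult_right_mono) auto
        also have "\<dots> \<le> \<epsilon>" using V2u Zk by (simp add: mult.commute)
        finally show "exp (l2 * (t' - \<tau>)) * \<bar>V x' u $ 2\<bar> \<le> \<epsilon>" .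
        have "exp ((l1 + l2) * \<tau>) \<le> exp (2 * (l1 * \<tau>))"
          using l \<tau>1 by (simp add: algebra_simps mult_right_mono)
        then have Z2: "exp ((l1 + l2) * \<tau>) \<le> Z ^ 2" by (simp add: eZ exp_double)
        have "\<bar>V x' u $ 3\<bar> * Z ^ 2 \<le> K8 * (\<kappa> * q') * Z ^ 2" using V3u by (intro mult_right_mono) auto
        also have "\<dots> \<le> K9 * (\<kappa> * q') * Z ^ 2"
          using K9 \<kappa> ge1 by (intro mult_right_mono) auto
        also have "\<dots> = (K9 * (\<kappa> * Z ^ 2)) * q'" by simp
        also have "\<dots> \<le> 1 * q'" using Zk ge1 by (intro mult_right_mono) auto
        finally have "\<bar>V x' u $ 3\<bar> * Z ^ 2 \<le> q'" by simp
        moreover have "\<bar>V x' u $ 3\<bar> * exp ((l1 + l2) * \<tau>) \<le> \<bar>V x' u $ 3\<bar> * Z ^ 2"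
          using Z2 by (intro mult_left_mono) auto
        ultimately have "\<bar>V x' u $ 3\<bar> * exp ((l1 + l2) * \<tau>) \<le> q'" by simp
        then show "\<bar>V x' u $ 3\<bar> \<le> exp ((l1 + l2) * (t' - \<tau>))"
          by (simp add: right_diff_distrib exp_diff aq pos_le_divide_eq)
      qed fact
      moreover have "\<not> danger \<epsilon> x' (t' - \<tau>)" using c2' \<tau>1 \<tau>t by auto
      ultimately show False by contradiction
    qed
    then have "cross3 c' c = 0" unfolding u_def by (metis cross_skew neg_0_equal_iff_equal)
    then have "c = 0 \<or> (\<exists>\<mu>. c = \<mu> *\<^sub>R c')" using cint(5) by (simp add: cross_eq_0 collinear_lemma)
    then obtain \<mu> where "c = \<mu> *\<^sub>R c'" by (metis scaleR_zero_left)
    then show ?thesis using cint by simp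
  qed
  \<comment> \<open>The gradient at \<open>x'\<close> is at least half of that at \<open>x\<close>,
    so the conclusion can be stated with the gradient at the point itself.\<close>
  have g': "g \<le> 2 * G x' c"
  proof -
    have "\<bar>p * C x c $ 1\<bar> \<le> 1/2 * g" using pC mult_right_mono[OF \<delta>(2), of g] g by linarith
    then have "\<bar>C x c $ 2\<bar> - g / 2 \<le> \<bar>C x' c $ 2\<bar>" unfolding C' by linarith
    moreover have "\<bar>C x c $ 1\<bar> = \<bar>C x' c $ 1\<bar>" using C' by simp
    moreover have "g = \<bar>C x c $ 1\<bar> \<or> g = \<bar>C x c $ 2\<bar>" by (auto simp: g_def G_def)
    moreover have "\<bar>C x' c $ 1\<bar> \<le> G x' c" "\<bar>C x' c $ 2\<bar> \<le> G x' c" by (auto simp: G_def)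
    ultimately show ?thesis using g by linarith
  qed
  \<comment> \<open>Orthogonality to \<open>v'\<close> bounds the third coordinate by a multiple of
    \<open>\<epsilon> / q'\<close>; the scale condition converts \<open>1 / q\<close> into a
    multiple of \<open>R n * g / M m k\<close>, which produces \<open>W\<close>.\<close>
  have "C x' c $ 3 * V x' v' $ 3 = - (C x' c $ 1 * V x' v' $ 1) - C x' c $ 2 * V x' v' $ 2"
    using p plane by simp
  then have "\<bar>C x' c $ 3\<bar> * q' \<le> K1 * \<Theta> * \<epsilon> + K3 * \<epsilon>" using t1 t2 t3 by linarith
  then have "\<Theta> * (\<bar>C x' c $ 3\<bar> * q') \<le> \<Theta> * (K1 * \<Theta> * \<epsilon> + K3 * \<epsilon>)" using \<Theta> by (intro mult_left_mono) auto
  moreover have "\<bar>C x' c $ 3\<bar> * q \<le> \<bar>C x' c $ 3\<bar> * (\<Theta> * q')" using ra by (intro mult_left_mono) auto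
  ultimately have q1: "\<bar>C x' c $ 3\<bar> * q \<le> \<Theta> * (K1 * \<Theta> + K3) * \<epsilon>" by (simp add: algebra_simps)
  have q2: "\<nu> * M m k * \<beta> \<le> R n * (q * g)"
    using c1' ge1 g \<beta> by (simp add: field_simps)
  have Mp: "0 < M m k" using M_ge1[of m k] by simp
  have S0: "0 \<le> \<Theta> * (K1 * \<Theta> + K3) * \<epsilon>" using \<Theta> K1p K3 \<epsilon> by simp
  have "(\<bar>C x' c $ 3\<bar> * (\<nu> * M m k * \<beta>)) * q \<le> (\<bar>C x' c $ 3\<bar> * (R n * (q * g))) * q"
    using q2 ge1 by (intro mult_right_mono mult_left_mono) auto
  also have "\<dots> = (\<bar>C x' c $ 3\<bar> * q) * (R n * (q * g))" by simp
  also have "\<dots> \<le> (\<Theta> * (K1 * \<Theta> + K3) * \<epsilon>) * (R n * (q * g))"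
    using q1 R_pos[of n] ge1 g by (intro mult_right_mono) auto
  also have "\<dots> = (\<Theta> * (K1 * \<Theta> + K3) * \<epsilon> * (R n * g)) * q" by simp
  finally have "\<bar>C x' c $ 3\<bar> * (\<nu> * M m k * \<beta>) \<le> \<Theta> * (K1 * \<Theta> + K3) * \<epsilon> * (R n * g)"
    using ge1 by (subst (asm) mult_le_cancel_right_pos) auto
  also have "\<dots> \<le> \<Theta> * (K1 * \<Theta> + K3) * \<epsilon> * (R n * (2 * G x' c))"
    using g' R_pos[of n] S0 by (intro mult_left_mono) auto
  finally have "\<bar>C x' c $ 3\<bar> \<le> \<Theta> * (K1 * \<Theta> + K3) * \<epsilon> * (R n * (2 * G x' c)) / (\<nu> * M m k * \<beta>)"
    using \<nu> Mp \<beta> by (simp add: pos_le_divide_eq)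
  also have "\<dots> = (W * eps m * R n / M m k) * G x' c" using \<nu> Mp \<beta> by (simp add: W_def \<epsilon>_def field_simps)
  finally show "\<bar>C x' c $ 3\<bar> \<le> (W * eps m * R n / M m k) * G x' c" .
qed

end

section \<open>Summing the widths over all classes of a scale\<close>

lemma nat_times_power_tendsto_0:
  fixes \<theta> c :: real
  assumes "0 < \<theta>" "\<theta> < 1"
  shows "(\<lambda>m. \<theta> ^ m * (2 * real m + c)) \<longlonglongrightarrow> 0"
proof -
  have "(\<lambda>m. 2 * (real m * \<theta> ^ m) + c * \<theta> ^ m) \<longlonglongrightarrow> 2 * 0 + c * 0"
    using assms by (intro tendsto_intros powser_times_n_limit_0 LIMSEQ_power_zero) auto
  moreover have "(\<lambda>m. 2 * (real m * \<theta> ^ m) + c * \<theta> ^ m) = (\<lambda>m. \<theta> ^ m * (2 * real m + c))"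
    by (simp add: fun_eq_iff algebra_simps)
  ultimately show ?thesis by simp
qed

lemma integral_orthogonal_exists:
  fixes v :: "real^3"
  assumes "integral_vec v"
  obtains c where "c \<noteq> 0" "integral_vec c" "c \<bullet> v = 0"
proof (cases "v $ 1 = 0 \<and> v $ 2 = 0")
  case True
  then show ?thesis
    by (intro that[of "axis 1 1"]) (auto simp: integral_vec_def axis_def inner_vec_def sum_3 vec_eq_iff)
next
  case False
  then show ?thesis using assms
    by (intro that[of "vector [v $ 2, - v $ 1, 0]"])
      (auto simp: integral_vec_def inner_vec_def sum_3 vec_eq_iff forall_3)
qed

context game_scales
begin

text \<open>Once \<open>exp ((l1 + l2) * t)\<close> exceeds this value, the scale of the class lies
  below \<open>R0\<close> and can be bracketed. Below it, \<open>v\<close> belongs to a finite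
  set.\<close>

definition Q where "Q = max 1 ((\<nu> / c0)\<^sup>2 * K1 / (c0 * R0\<^sup>2))"

text \<open>The shift to \<open>Suc n\<close> reserves the scale 0 for the finitely many vectors of
  the first alternative.\<close>

lemma danger_cases:
  assumes x: "x \<in> X" and s: "0 \<le> s" "danger (eps m) x s" and sm: "small m"
  obtains v where "v \<noteq> 0" "integral_vec v" "\<bar>V x v $ 1\<bar> \<le> eps m" "\<bar>V x v $ 2\<bar> \<le> eps m" "\<bar>V x v $ 3\<bar> \<le> Q"
  | n k v t c where "cls m (Suc n) k x v t c"
  using s
proof (cases rule: first_danger)
  case (1 v)
  then show ?thesis using that(1)[of v] by (auto simp: Q_def)
next
  case (2 v t)
  define a b q where aq: "a = exp (l1 * t)" "b = exp (l2 * t)" "q = exp ((l1 + l2) * t)"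
  have qab: "q = a * b" by (simp add: aq exp_add[symmetric] algebra_simps)
  have ge1: "1 \<le> a" "1 \<le> b" "1 \<le> q" using 2 l by (auto simp: aq)
  have decr: "\<bar>V x v $ 1\<bar> \<le> eps m" "\<bar>V x v $ 2\<bar> \<le> eps m"
    using 2(4,5) ge1 mult_right_mono[of 1 a "\<bar>V x v $ 1\<bar>"] mult_right_mono[of 1 b "\<bar>V x v $ 2\<bar>"]
    unfolding aq by auto
  show ?thesis
  proof (cases "q \<le> Q")
    case True
    then show ?thesis using that(1)[OF 2(2,3) decr] 2(6) by (simp add: aq)
  next
    case False
    obtain c where c: "c \<noteq> 0" "integral_vec c" "c \<bullet> v = 0" "\<bar>C x c $ 1\<bar> \<le> K1 * a"
     "\<bar>C x c $ 2\<bar> \<le> K1 * b" "\<bar>C x c $ 3\<bar> * q \<le> 2 * eps m * K1" "c0 \<le> G x c"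
      using attach[OF x _ 2(3,4,5,6)] 2(1) sm unfolding small_def aq by (metis less_eq_real_def)
    define g where "g = G x c"
    have g: "c0 \<le> g" "0 < g" using c c0 by (auto simp: g_def)
    have K1p: "1 \<le> K1" by (rule K1)
    have "K1 * b \<le> K1 * a" using l 2(1) K1p unfolding aq by (intro mult_left_mono) (auto intro: mult_right_mono)
    then have "g \<le> K1 * a" using c by (auto simp: g_def G_def)
    then have "g / a / K1 \<le> 1" "0 < g / a / K1" using ge1 K1p g by (simp_all add: pos_divide_le_eq mult.commute)
    then obtain k where k: "(1/16) ^ Suc k < g / a / K1" "g / a / K1 \<le> (1/16) ^ k"
      using geometric_bracket[of "1/16" "g / a / K1"] by auto
    have k1: "K1 / 16 ^ Suc k < g / a" "g / a \<le> K1 / 16 ^ k"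
    proof -
      have "(1/16) ^ Suc k * K1 < g / a" "g / a \<le> (1/16) ^ k * K1"
        using k K1p by (simp_all only: pos_less_divide_eq pos_divide_le_eq less_le_trans[OF zero_less_one K1p])
      then show "K1 / 16 ^ Suc k < g / a" "g / a \<le> K1 / 16 ^ k" by (simp_all add: power_one_over mult.commute)
    qed
    define \<rho> where "\<rho> = \<nu> * M m k / (q * g)"
    have \<rho>0: "0 < \<rho>" using \<nu> M_ge1[of m k] ge1 g by (simp add: \<rho>_def)
    have "16 ^ k \<le> K1 / c0 * q"
    proof -
      have "g * 16 ^ k \<le> K1 * a" using k1(2) ge1 by (simp add: field_simps)
      moreover have "c0 * 16 ^ k \<le> g * 16 ^ k" using g by (intro mult_right_mono) auto
      moreover have "K1 * a \<le> K1 * q" unfolding qab using ge1 K1p by (intro mult_left_mono) auto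
      ultimately have "c0 * 16 ^ k \<le> K1 * q" by linarith
      then show ?thesis using c0 by (simp add: field_simps)
    qed
    then have M2: "(M m k)\<^sup>2 \<le> K1 / c0 * q" using M_sq[of m k] by linarith
    \<comment> \<open>Comparing squares makes \<open>M m k\<close> affordable: its square is at most
      \<open>16 ^ k\<close>, hence of order \<open>q\<close>, while the denominator is at least of
      order \<open>q\<^sup>2\<close>.\<close>
    have "\<rho> \<le> R0"
    proof (rule power2_le_imp_le)
      have "\<rho>\<^sup>2 = \<nu>\<^sup>2 * (M m k)\<^sup>2 / (q\<^sup>2 * g\<^sup>2)" by (simp add: \<rho>_def power_divide power_mult_distrib)
      also have "\<dots> \<le> \<nu>\<^sup>2 * (K1 / c0 * q) / (q\<^sup>2 * c0\<^sup>2)"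
        using M2 g c0 ge1 K1p
        by (intro frac_le[OF _ mult_left_mono _ mult_left_mono[OF power_mono]]) auto
      also have "\<dots> = ((\<nu> / c0)\<^sup>2 * K1 / (c0 * R0\<^sup>2)) * R0\<^sup>2 / q"
        using c0 R0 ge1 by (simp add: field_simps power2_eq_square)
      also have "\<dots> \<le> q * R0\<^sup>2 / q"
        using False ge1 by (intro divide_right_mono mult_right_mono) (auto simp: Q_def)
      also have "\<dots> = R0\<^sup>2" using ge1 by simp
      finally show "\<rho>\<^sup>2 \<le> R0\<^sup>2" .
    qed (use R0 in auto)
    then obtain n where "\<beta> ^ Suc n < \<rho> / R0" "\<rho> / R0 \<le> \<beta> ^ n"
      using geometric_bracket[OF \<beta>, of "\<rho> / R0"] \<rho>0 R0 by auto
    then have n: "R (Suc n) < \<rho>" "\<rho> \<le> R (Suc n) / \<beta>"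
      using R0 \<beta> by (auto simp: R_def field_simps)
    have "cls m (Suc n) k x v t c"
      unfolding cls_def aq[symmetric] g_def[symmetric] \<rho>_def[symmetric]
      using 2 c g k1 n by (auto simp: aq)
    then show ?thesis by (rule that(2))
  qed
qed

text \<open>At a fixed scale \<open>q\<close> is at most of order \<open>2 ^ k\<close>, through
  \<open>M m k\<close>, but at least of order \<open>16 ^ k\<close>, because \<open>G x c\<close> is
  bounded below. So only finitely many classes occur, uniformly in \<open>m\<close>.\<close>

lemma cls_bounded: "\<exists>N. \<forall>m k x v t c. cls m n k x v t c \<longrightarrow> k < N"
proof -
  define B1 where "B1 = K1 * \<nu> / (R n * c0\<^sup>2)"
  obtain N where N: "B1 < 8 ^ N" using real_arch_pow[of 8 B1] by auto
  have "k < N" if c: "cls m n k x v t c" for m k x v t c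
  proof (rule ccontr)
    assume "\<not> k < N"
    then have kN: "(8::real) ^ N \<le> 8 ^ k" by (intro power_increasing) auto
    define a b q g where aq: "a = exp (l1 * t)" "b = exp (l2 * t)" "q = exp ((l1 + l2) * t)" "g = G x c"
    have qab: "q = a * b" by (simp add: aq exp_add[symmetric] algebra_simps)
    note c' = c[unfolded cls_def, folded aq]
    have ge1: "1 \<le> a" "1 \<le> b" "1 \<le> q" using c' l by (auto simp: aq)
    have g: "c0 \<le> g" "0 < g" using c' c0 by auto
    have K1p: "1 \<le> K1" by (rule K1)
    have "R n * (q * g) < \<nu> * M m k" using c' g ge1 by (simp add: pos_less_divide_eq)
    moreover have "R n * (q * c0) \<le> R n * (q * g)" using g ge1 R_pos[of n] by (intro mult_left_mono) auto
    moreover have "\<nu> * M m k \<le> \<nu> * 2 ^ k" using M_le \<nu> by (intro mult_left_mono) auto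
    ultimately have q1: "R n * c0 * q \<le> \<nu> * 2 ^ k" by (simp add: mult_ac)
    have "g * 16 ^ k \<le> K1 * a" using c' ge1 by (simp add: field_simps)
    moreover have "c0 * 16 ^ k \<le> g * 16 ^ k" using g by (intro mult_right_mono) auto
    moreover have "K1 * a \<le> K1 * q" unfolding qab using ge1 K1p by (intro mult_left_mono) auto
    ultimately have "c0 * 16 ^ k \<le> K1 * q" by linarith
    then have "(R n * c0) * (c0 * 16 ^ k) \<le> (R n * c0) * (K1 * q)"
      using R_pos[of n] c0 by (intro mult_left_mono) auto
    also have "\<dots> = K1 * (R n * c0 * q)" by simp
    also have "\<dots> \<le> K1 * (\<nu> * 2 ^ k)" using q1 K1p by (intro mult_left_mono) auto
    finally have "(R n * c0\<^sup>2 * 8 ^ k) * 2 ^ k \<le> (K1 * \<nu>) * 2 ^ k"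
      by (simp add: power2_eq_square mult_ac power_mult_distrib[symmetric])
    then have "R n * c0\<^sup>2 * 8 ^ k \<le> K1 * \<nu>" by (subst (asm) mult_le_cancel_right_pos) auto
    then have "8 ^ k \<le> B1" using R_pos[of n] c0 by (simp add: B1_def pos_le_divide_eq mult_ac)
    then show False using N kN by linarith
  qed
  then show ?thesis by blast
qed

lemma W_pos: "0 < W" using \<Theta> K1 K3 \<beta> \<nu> by (auto simp: W_def intro!: divide_pos_pos mult_pos_pos add_nonneg_pos)

lemma eventually_small: "eventually small sequentially"
proof -
  have e: "eps \<longlonglongrightarrow> 0" unfolding eps_def
    using LIMSEQ_power_zero[of "1/2::real"] by (simp add: power_divide)
  have *: "eventually (\<lambda>m. A * eps m \<le> B) sequentially" if "0 < B" for A B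
  proof -
    have "(\<lambda>m. A * eps m) \<longlonglongrightarrow> A * 0" by (intro tendsto_intros e)
    then show ?thesis using order_tendstoD(2)[of "\<lambda>m. A * eps m" "A * 0" sequentially B] that
      by (auto elim: eventually_mono)
  qed
  have "eventually (\<lambda>m. 8 * K1 * eps m \<le> 1 \<and> (K1 * \<Theta> + K3 + 2 * \<Theta> * K1) * eps m \<le> 1/2 \<and>
   K9 ^ 3 * K1 * eps m \<le> 1 \<and> K9 * K1 * eps m \<le> c0 \<and> 2 * eps m \<le> c0) sequentially"
    using c0 by (intro eventually_conj *) auto
  then show ?thesis by (rule eventually_mono) (simp add: small_def mult.commute)
qed

text \<open>The terms before \<open>2 * m\<close> equal 1; the others form a geometric
  series.\<close>

lemma sum_M_powr:
  assumes "0 < \<gamma>"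
  shows "(\<Sum>k<N. (1 / M m k) powr \<gamma>) \<le> 2 * real m + 1 / (1 - 2 powr - \<gamma>)"
proof -
  define \<theta> where "\<theta> = 2 powr - \<gamma>"
  have \<theta>: "0 < \<theta>" "\<theta> < 1" using assms by (auto simp: \<theta>_def powr_less_one)
  have eq: "(1 / M m k) powr \<gamma> = \<theta> ^ (k - 2 * m)" for k
  proof -
    have "(1 / M m k) = 2 powr (- real (k - 2 * m))" by (simp add: M_def powr_minus powr_realpow divide_inverse)
    then have "(1 / M m k) powr \<gamma> = (2 powr - \<gamma>) powr real (k - 2 * m)" by (simp add: powr_powr mult.commute)
    then show ?thesis using \<theta> by (simp add: \<theta>_def powr_realpow)
  qed
  have "(\<Sum>k<N. (1 / M m k) powr \<gamma>) \<le> (\<Sum>k<2 * m + N. \<theta> ^ (k - 2 * m))"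
    unfolding eq using \<theta> by (intro sum_mono2) auto
  also have "\<dots> = (\<Sum>k<2 * m. \<theta> ^ (k - 2 * m)) + (\<Sum>k<N. \<theta> ^ k)"
  proof -
    have "{..<2 * m + N} = {..<2 * m} \<union> {2 * m..<2 * m + N}" by auto
    then have "(\<Sum>k<2 * m + N. \<theta> ^ (k - 2 * m)) = (\<Sum>k<2 * m. \<theta> ^ (k - 2 * m)) + (\<Sum>k=2 * m..<2 * m + N. \<theta> ^ (k - 2 * m))"
      by (simp add: sum.union_disjoint ivl_disj_int)
    moreover have "(\<Sum>k=2 * m..<2 * m + N. \<theta> ^ (k - 2 * m)) = (\<Sum>k<N. \<theta> ^ k)"
      by (rule sum.reindex_bij_witness[of _ "\<lambda>k. k + 2 * m" "\<lambda>k. k - 2 * m"]) auto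
    ultimately show ?thesis by simp
  qed
  also have "\<dots> \<le> 2 * real m + 1 / (1 - \<theta>)"
  proof -
    have "(\<Sum>k<2 * m. \<theta> ^ (k - 2 * m)) = 2 * real m" by simp
    moreover have "(\<Sum>k<N. \<theta> ^ k) \<le> 1 / (1 - \<theta>)"
      using \<theta> by (simp add: sum_gp_strict divide_right_mono)
    ultimately show ?thesis by linarith
  qed
  finally show ?thesis by (simp add: \<theta>_def)
qed

text \<open>All reference to time disappears here: danger at any moment puts the point into one of
  countably many classes, and on a set of diameter \<open>2 * R n\<close> each class is confined to
  a neighbourhood of the surface of a single dual vector. This is the input for the potential game,
  with \<open>\<gamma>\<close> and \<open>\<eta>\<close> prescribed by the game and
  \<open>\<epsilon>\<close> adapted to them.\<close>

lemma danger_cover: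
  assumes \<gamma>: "0 < \<gamma>" and \<eta>: "0 < \<eta>"
  obtains \<epsilon> and Cls :: "nat \<Rightarrow> nat \<Rightarrow> 'a set" and N :: "nat \<Rightarrow> nat" and w :: "nat \<Rightarrow> nat \<Rightarrow> real"
  where "0 < \<epsilon>" "\<epsilon> \<le> 1" "\<And>n k. 0 < w n k"
    "\<And>n. (\<Sum>k<N n. w n k powr \<gamma>) \<le> (\<eta> * R n) powr \<gamma>"
    "\<And>x s. x \<in> X \<Longrightarrow> 0 \<le> s \<Longrightarrow> danger \<epsilon> x s \<Longrightarrow> \<exists>n. \<exists>k<N n. x \<in> Cls n k"
    "\<And>n k Y. Y \<subseteq> X \<Longrightarrow> (\<And>x y. x \<in> Y \<Longrightarrow> y \<in> Y \<Longrightarrow> dist x y \<le> 2 * R n) \<Longrightarrow>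
       \<exists>c. integral_vec c \<and> c \<noteq> 0 \<and> (\<forall>x\<in>Y \<inter> Cls n k. \<bar>C x c $ 3\<bar> \<le> w n k * G x c)"
proof -
  define Vs where "Vs = {v. integral_vec v \<and> (\<exists>x\<in>X. \<forall>i. \<bar>V x v $ i\<bar> \<le> Q)} - {0}"
  have "finite Vs" unfolding Vs_def using finite_bounded_V by blast
  then obtain vs where vs: "set vs = Vs" using finite_list by blast
  have Q1: "1 \<le> Q" by (simp add: Q_def)
  define \<theta> where "\<theta> = 2 powr - \<gamma>"
  have \<theta>: "0 < \<theta>" "\<theta> < 1" using \<gamma> by (auto simp: \<theta>_def powr_less_one)
  have eps\<gamma>: "eps m powr \<gamma> = \<theta> ^ m" for m
  proof -
    have "eps m = 2 powr (- real m)" by (simp add: eps_def powr_minus powr_realpow divide_inverse)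
    then have "eps m powr \<gamma> = (2 powr - \<gamma>) powr real m" by (simp add: powr_powr mult.commute)
    then show ?thesis using \<theta> by (simp add: \<theta>_def powr_realpow)
  qed
  define c1 where "c1 = 1 / (1 - \<theta>)"
  have c1: "0 < c1" using \<theta> by (simp add: c1_def)
  \<comment> \<open>The exponential decay of \<open>eps m powr \<gamma> = \<theta> ^ m\<close> beats
    the \<open>2 * m\<close> classes of full width.\<close>
  have "eventually (\<lambda>m. W powr \<gamma> * (\<theta> ^ m * (2 * real m + c1)) < \<eta> powr \<gamma>) sequentially"
  proof -
    have "(\<lambda>m. W powr \<gamma> * (\<theta> ^ m * (2 * real m + c1))) \<longlonglongrightarrow> W powr \<gamma> * 0"
      by (intro tendsto_intros nat_times_power_tendsto_0 \<theta>)
    then show ?thesis by (rule order_tendstoD(2)) (use \<eta> in auto)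
  qed
  moreover have "eventually (\<lambda>m. real (length vs) * (2 / c0) powr \<gamma> * \<theta> ^ m < (\<eta> * R0) powr \<gamma>) sequentially"
  proof -
    have "(\<lambda>m. real (length vs) * (2 / c0) powr \<gamma> * \<theta> ^ m) \<longlonglongrightarrow> real (length vs) * (2 / c0) powr \<gamma> * 0"
      using \<theta> by (intro tendsto_intros LIMSEQ_power_zero) auto
    then show ?thesis by (rule order_tendstoD(2)) (use \<eta> R0 in auto)
  qed
  ultimately have "eventually (\<lambda>m. small m \<and> W powr \<gamma> * (\<theta> ^ m * (2 * real m + c1)) < \<eta> powr \<gamma> \<and>
      real (length vs) * (2 / c0) powr \<gamma> * \<theta> ^ m < (\<eta> * R0) powr \<gamma>) sequentially"
    using eventually_small by eventually_elim auto
  then obtain m where sm: "small m" and m1: "W powr \<gamma> * (\<theta> ^ m * (2 * real m + c1)) < \<eta> powr \<gamma>"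
    and m2: "real (length vs) * (2 / c0) powr \<gamma> * \<theta> ^ m < (\<eta> * R0) powr \<gamma>"
    using eventually_happens'[OF sequentially_bot] by blast
  obtain N' where N': "\<And>n m k x v t c. cls m n k x v t c \<Longrightarrow> k < N' n"
    using cls_bounded by metis
  define N where "N n = (if n = 0 then length vs else N' n)" for n
  define w where "w n k = (if n = 0 then 2 / c0 * eps m else W * eps m * R n * (1 / M m k))" for n k
  define Cls where "Cls n k = (if n = 0 then {x. \<bar>V x (vs ! k) $ 1\<bar> \<le> eps m \<and> \<bar>V x (vs ! k) $ 2\<bar> \<le> eps m \<and> k < length vs}
    else {x. \<exists>v t c. cls m n k x v t c})" for n k
  have Mpos: "0 < M m k" for k using M_ge1[of m k] by simp
  show ?thesis
  proof (rule that[of "eps m" w N Cls])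
    show "0 < eps m" "eps m \<le> 1" by (rule eps_pos)+
    show "0 < w n k" for n k using c0 eps_pos W_pos R_pos Mpos by (auto simp: w_def)
    show "(\<Sum>k<N n. w n k powr \<gamma>) \<le> (\<eta> * R n) powr \<gamma>" for n
    proof (cases "n = 0")
      case True
      have "(\<Sum>k<N n. w n k powr \<gamma>) = real (length vs) * ((2 / c0) powr \<gamma> * \<theta> ^ m)"
        using True powr_mult[of "2 / c0" "eps m" \<gamma>] c0 eps_pos[of m] unfolding N_def w_def eps\<gamma> by simp
      then show ?thesis using m2 True by (simp add: R_def)
    next
      case False
      have "(\<Sum>k<N n. w n k powr \<gamma>) = (\<Sum>k<N n. (W powr \<gamma> * \<theta> ^ m * R n powr \<gamma>) * (1 / M m k) powr \<gamma>)"
      proof (intro sum.cong refl)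
        fix k
        have "w n k = ((W * eps m) * R n) * (1 / M m k)" using False by (simp add: w_def)
        then show "w n k powr \<gamma> = (W powr \<gamma> * \<theta> ^ m * R n powr \<gamma>) * (1 / M m k) powr \<gamma>"
          by (simp only: powr_mult eps\<gamma>)
      qed
      also have "\<dots> = (W powr \<gamma> * \<theta> ^ m * R n powr \<gamma>) * (\<Sum>k<N n. (1 / M m k) powr \<gamma>)"
        by (simp add: sum_distrib_left)
      also have "\<dots> \<le> (W powr \<gamma> * \<theta> ^ m * R n powr \<gamma>) * (2 * real m + c1)"
        using sum_M_powr[OF \<gamma>, of m "N n"] \<theta> unfolding c1_def \<theta>_def by (intro mult_left_mono) auto
      also have "\<dots> = (W powr \<gamma> * (\<theta> ^ m * (2 * real m + c1))) * R n powr \<gamma>" by simp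
      also have "\<dots> \<le> \<eta> powr \<gamma> * R n powr \<gamma>" using m1 by (intro mult_right_mono) auto
      also have "\<dots> = (\<eta> * R n) powr \<gamma>" using \<eta> R_pos[of n] by (simp add: powr_mult)
      finally show ?thesis .
    qed
    show "\<exists>n. \<exists>k<N n. x \<in> Cls n k" if x: "x \<in> X" and s: "0 \<le> s" "danger (eps m) x s" for x s
      using danger_cases[OF x s sm]
    proof cases
      case (1 v)
      have "\<bar>V x v $ i\<bar> \<le> Q" for i using 1 Q1 eps_pos[of m] exhaust_3[of i] by auto
      then have "v \<in> set vs" using 1 x by (auto simp: vs Vs_def)
      then obtain k where "k < length vs" "vs ! k = v" by (auto simp: in_set_conv_nth)
      then show ?thesis using 1 by (intro exI[of _ 0] exI[of _ k]) (auto simp: N_def Cls_def)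
    next
      case (2 n k v t c)
      then show ?thesis using N'[OF 2] by (intro exI[of _ "Suc n"] exI[of _ k]) (auto simp: N_def Cls_def)
    qed
    show "\<exists>c. integral_vec c \<and> c \<noteq> 0 \<and> (\<forall>x\<in>Y \<inter> Cls n k. \<bar>C x c $ 3\<bar> \<le> w n k * G x c)"
      if Y: "Y \<subseteq> X" "\<And>x y. x \<in> Y \<Longrightarrow> y \<in> Y \<Longrightarrow> dist x y \<le> 2 * R n" for Y n k
    proof (cases "Y \<inter> Cls n k = {}")
      case True
      then show ?thesis by (intro exI[of _ "axis 1 1"]) (auto simp: integral_vec_def axis_def vec_eq_iff)
    next
      case False
      then obtain x0 where x0: "x0 \<in> Y" "x0 \<in> Cls n k" by blast
      show ?thesis
      proof (cases "n = 0")
        case True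
        define v where "v = vs ! k"
        have "v \<in> Vs" using x0 True unfolding vs[symmetric] v_def by (auto simp: Cls_def)
        then have v: "integral_vec v" "v \<noteq> 0" by (auto simp: Vs_def)
        \<comment> \<open>For an initial vector any integral \<open>c\<close> orthogonal to it will
          do: its first two coordinates are small, so the third is at least \<open>c0\<close>, and
          orthogonality bounds \<open>C x c $ 3\<close> by the gradient.\<close>
        obtain c where c: "c \<noteq> 0" "integral_vec c" "c \<bullet> v = 0" using integral_orthogonal_exists[OF v(1)] .
        have "\<bar>C x c $ 3\<bar> \<le> w n k * G x c" if x: "x \<in> Y" "x \<in> Cls n k" for x
        proof -
          have xX: "x \<in> X" using x Y by auto
          have V12: "\<bar>V x v $ 1\<bar> \<le> eps m" "\<bar>V x v $ 2\<bar> \<le> eps m" using x True by (auto simp: Cls_def v_def)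
          obtain i where i: "c0 \<le> \<bar>V x v $ i\<bar>" using V_lower[OF xX v] .
          have e: "eps m * 2 \<le> c0" using sm by (simp add: small_def)
          then have "i = 3" using V12 i c0 exhaust_3[of i] eps_pos[of m] by auto
          then have V3: "c0 \<le> \<bar>V x v $ 3\<bar>" using i by simp
          have p: "C x c $ 1 * V x v $ 1 + C x c $ 2 * V x v $ 2 + C x c $ 3 * V x v $ 3 = 0"
            using pairing[OF xX, of c v] c by (simp add: inner_vec_def sum_3)
          have "\<bar>C x c $ 1 * V x v $ 1\<bar> \<le> G x c * eps m" "\<bar>C x c $ 2 * V x v $ 2\<bar> \<le> G x c * eps m"
            unfolding abs_mult using V12 by (auto intro!: mult_mono simp: G_def max_def)
          then have "\<bar>C x c $ 3 * V x v $ 3\<bar> \<le> 2 * (G x c * eps m)" using p by linarith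
          moreover have "\<bar>C x c $ 3\<bar> * c0 \<le> \<bar>C x c $ 3\<bar> * \<bar>V x v $ 3\<bar>" using V3 by (intro mult_left_mono) auto
          ultimately have "\<bar>C x c $ 3\<bar> * c0 \<le> 2 * (G x c * eps m)" by (simp add: abs_mult)
          then show ?thesis using True c0 by (simp add: w_def field_simps)
        qed
        then show ?thesis using c by (intro exI[of _ c]) auto
      next
        case False
        obtain v t c where c: "cls m n k x0 v t c" using x0 False by (auto simp: Cls_def)
        have "\<bar>C x c $ 3\<bar> \<le> w n k * G x c" if x: "x \<in> Y" "x \<in> Cls n k" for x
        proof -
          obtain v' t' c' where "cls m n k x v' t' c'" using x False by (auto simp: Cls_def)
          then have "\<bar>C x c $ 3\<bar> \<le> (W * eps m * R n / M m k) * G x c"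
            using cls_same_plane(2)[OF _ _ Y(2)[OF x0(1) x(1)] sm c] x x0 Y by blast
          then show ?thesis using False by (simp add: w_def)
        qed
        then show ?thesis using c by (intro exI[of _ c]) (auto simp: cls_def)
      qed
    qed
  qed
qed

end

section \<open>The hyperplane absolute game\<close>

definition hyper :: "'a::euclidean_space set \<Rightarrow> 'a \<times> real \<Rightarrow> 'a set" where
  "hyper V h = {x \<in> V. fst h \<bullet> x = snd h}"

lemma hyperplane_in_hyper:
  assumes V: "subspace V" and n: "n \<in> V" "norm n = 1"
  shows "hyperplane_in V (hyper V (n, b))"
proof -
  let ?H = "{y \<in> V. \<forall>x \<in> span {n}. orthogonal x y}"
  have "dim ?H + dim (span {n}) = dim V"
    by (rule dim_subspace_orthogonal_to_vectors) (use V n in \<open>auto simp: span_minimal\<close>)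
  moreover have "dim (span {n}) = 1" using n by (auto simp: dim_insert)
  moreover have eq: "?H = {y \<in> V. n \<bullet> y = 0}"
    by (auto simp: span_singleton orthogonal_def)
  ultimately have d: "dim {y \<in> V. n \<bullet> y = 0} + 1 = dim V" by simp
  have sub: "subspace {y \<in> V. n \<bullet> y = 0}"
    using V by (auto simp: subspace_def inner_add_right)
  have nn: "n \<bullet> n = 1" using n(2) by (simp add: norm_eq_1)
  have tr: "hyper V (n, b) = (+) (b *\<^sub>R n) ` {y \<in> V. n \<bullet> y = 0}"
  proof
    show "hyper V (n, b) \<subseteq> (+) (b *\<^sub>R n) ` {y \<in> V. n \<bullet> y = 0}"
    proof
      fix x assume x: "x \<in> hyper V (n, b)"
      then have "x - b *\<^sub>R n \<in> {y \<in> V. n \<bullet> y = 0}"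
        using V n nn by (auto simp: hyper_def inner_diff_right subspace_diff subspace_scale)
      moreover have "x = b *\<^sub>R n + (x - b *\<^sub>R n)" by simp
      ultimately show "x \<in> (+) (b *\<^sub>R n) ` {y \<in> V. n \<bullet> y = 0}" by blast
    qed
    show "(+) (b *\<^sub>R n) ` {y \<in> V. n \<bullet> y = 0} \<subseteq> hyper V (n, b)"
      using V n nn by (auto simp: hyper_def inner_add_right subspace_add subspace_scale)
  qed
  have "aff_dim (hyper V (n, b)) = int (dim {y \<in> V. n \<bullet> y = 0})"
    unfolding tr by (simp add: aff_dim_translation_eq aff_dim_subspace[OF sub])
  moreover have "affine (hyper V (n, b))"
    unfolding tr by (simp add: affine_translation[symmetric] subspace_imp_affine[OF sub])
  ultimately show ?thesis using d by (auto simp: hyperplane_in_def hyper_def)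
qed

lemma nbhd_in_hyper:
  assumes V: "subspace V" and n: "n \<in> V" "norm n = 1" and x: "x \<in> V" "\<bar>n \<bullet> x - b\<bar> < r"
  shows "x \<in> nbhd_in V (hyper V (n, b)) r"
proof -
  let ?y = "x - (n \<bullet> x - b) *\<^sub>R n"
  have nn: "n \<bullet> n = 1" using n(2) by (simp add: norm_eq_1)
  have "?y \<in> hyper V (n, b)"
    using V n x nn by (simp add: hyper_def subspace_diff subspace_scale inner_diff_right)
  moreover have "dist x ?y < r" using x(2) n(2) by (simp add: dist_norm)
  ultimately show ?thesis using x(1) unfolding nbhd_in_def by blast
qed

lemma unit_vector_exists:
  fixes V :: "'a::euclidean_space set"
  assumes "subspace V" "dim V > 0"
  obtains n where "n \<in> V" "norm n = 1"
proof -
  have "\<not> V \<subseteq> {0}" using assms(2) dim_eq_0 by (metis less_irrefl)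
  then obtain v where "v \<in> V" "v \<noteq> 0" by auto
  then show ?thesis using assms(1) by (intro that[of "(1 / norm v) *\<^sub>R v"]) (auto simp: subspace_scale)
qed

lemma exists_alice_strategy:
  fixes V :: "'a::euclidean_space set"
  assumes V: "subspace V" and \<beta>: "0 < \<beta>"
  shows "\<exists>\<sigma>. alice_strategy V \<beta> \<sigma>"
proof -
  have "\<exists>L. hyperplane_in V L"
  proof (cases "dim V = 0")
    case True
    then show ?thesis by (intro exI[of _ "{}"]) (simp add: hyperplane_in_def)
  next
    case False
    then obtain n where "n \<in> V" "norm n = 1" using unit_vector_exists[OF V] by blast
    then show ?thesis using hyperplane_in_hyper[OF V] by blast
  qed
  then obtain L where "hyperplane_in V L" ..
  then show ?thesis using \<beta>
    by (intro exI[of _ "\<lambda>Bs. (L, \<beta> * snd (last Bs))"]) (auto simp: alice_strategy_def)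
qed

text \<open>The inclusion is tested at the point of the smaller ball farthest from \<open>x\<close>.
  If the centres coincide, a unit vector of \<open>V\<close> supplies the direction; this is where
  positive dimension enters.\<close>

lemma cball_subset_subspace:
  fixes V :: "'a::euclidean_space set"
  assumes V: "subspace V" "dim V > 0" and xy: "x \<in> V" "y \<in> V" "0 \<le> s"
    and sub: "cball y s \<inter> V \<subseteq> cball x r"
  shows "dist x y \<le> r - s"
proof (cases "x = y")
  case True
  obtain u where u: "u \<in> V" "norm u = 1" using unit_vector_exists[OF V] .
  have "y + s *\<^sub>R u \<in> cball y s \<inter> V" using u V xy by (auto simp: dist_norm subspace_add subspace_scale)
  then have "y + s *\<^sub>R u \<in> cball x r" using sub by blast
  then show ?thesis using True u xy by (simp add: dist_norm)
next
  case False
  define u where "u = (1 / dist x y) *\<^sub>R (y - x)"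
  have u: "norm u = 1" "u \<in> V" using False V xy by (auto simp: u_def dist_norm norm_minus_commute subspace_scale subspace_diff)
  have "y + s *\<^sub>R u \<in> cball y s \<inter> V" using u V xy by (auto simp: dist_norm subspace_add subspace_scale)
  then have "y + s *\<^sub>R u \<in> cball x r" using sub by blast
  then have "norm (x - (y + s *\<^sub>R u)) \<le> r" by (simp add: dist_norm)
  moreover have "x - (y + s *\<^sub>R u) = - (dist x y + s) *\<^sub>R u"
    using False by (simp add: u_def algebra_simps)
  ultimately show ?thesis using u xy by (simp add: dist_norm)
qed

text \<open>A hyperplane is given by a unit normal and an offset, and the slab removed always has
  the largest admissible half-width \<open>\<beta> * snd (B i)\<close>.\<close>

definition legal_play :: "'a::euclidean_space set \<Rightarrow> real \<Rightarrow> (nat \<Rightarrow> 'a \<times> real) \<Rightarrow> (nat \<Rightarrow> 'a \<times> real) \<Rightarrow> bool" where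
  "legal_play V \<beta> h B \<longleftrightarrow> (\<forall>i. fst (B i) \<in> V \<and> 0 < snd (B i) \<and> \<beta> * snd (B i) \<le> snd (B (Suc i)) \<and>
     ball_of V (B (Suc i)) \<subseteq> ball_of V (B i) \<and>
     (\<forall>z \<in> ball_of V (B (Suc i)). \<beta> * snd (B i) \<le> \<bar>fst (h i) \<bullet> z - snd (h i)\<bar>))"

text \<open>The history is passed as an infinite sequence; the second clause makes the answer depend
  only on the moves already made.\<close>

definition strategy :: "'a::euclidean_space set \<Rightarrow> ((nat \<Rightarrow> 'a \<times> real) \<Rightarrow> nat \<Rightarrow> 'a \<times> real) \<Rightarrow> bool" where
  "strategy V \<tau> \<longleftrightarrow> (\<forall>B i. fst (\<tau> B i) \<in> V \<and> norm (fst (\<tau> B i)) = 1) \<and>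
     (\<forall>B B' i. (\<forall>j\<le>i. B j = B' j) \<longrightarrow> \<tau> B i = \<tau> B' i)"

text \<open>Plays whose radii stay away from 0 are left out here; the passage to \<open>HAW\<close>
  deals with them once and for all.\<close>

definition wins :: "'a::euclidean_space set \<Rightarrow> real \<Rightarrow> 'a set \<Rightarrow> ((nat \<Rightarrow> 'a \<times> real) \<Rightarrow> nat \<Rightarrow> 'a \<times> real) \<Rightarrow> 'a \<times> real \<Rightarrow> bool" where
  "wins V \<beta> S \<tau> B0 \<longleftrightarrow> (\<forall>B. B 0 = B0 \<longrightarrow> legal_play V \<beta> (\<tau> B) B \<longrightarrow> (\<lambda>i. snd (B i)) \<longlonglongrightarrow> 0 \<longrightarrow>
     (\<exists>x\<in>S. \<forall>i. x \<in> ball_of V (B i)))"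

lemma ball_of_nested:
  assumes "\<And>i. ball_of V (B (Suc i)) \<subseteq> ball_of V (B i)" "i \<le> j"
  shows "ball_of V (B j) \<subseteq> ball_of V (B i)"
  using assms(2) by (induction rule: dec_induct) (use assms(1) in blast)+

lemma legal_play_radius_le:
  assumes V: "subspace V" "dim V > 0" and B: "legal_play V \<beta> h B" and ij: "i \<le> j"
  shows "dist (fst (B i)) (fst (B j)) \<le> snd (B i) - snd (B j)" "snd (B j) \<le> snd (B i)"
proof -
  have "ball_of V (B j) \<subseteq> ball_of V (B i)"
    using ball_of_nested[OF _ ij] B by (auto simp: legal_play_def)
  then have "cball (fst (B j)) (snd (B j)) \<inter> V \<subseteq> cball (fst (B i)) (snd (B i))" by (auto simp: ball_of_def)
  then show 1: "dist (fst (B i)) (fst (B j)) \<le> snd (B i) - snd (B j)"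
    by (intro cball_subset_subspace[OF V]) (use B in \<open>auto simp: legal_play_def less_imp_le\<close>)
  show "snd (B j) \<le> snd (B i)" using 1 zero_le_dist[of "fst (B i)" "fst (B j)"] by linarith
qed

text \<open>The new ball is pushed to the boundary of the old one, away from the hyperplane. Its
  points then keep the distance \<open>(1 - 2 * \<beta>) * \<rho>\<close>, which is at least
  \<open>\<beta> * \<rho>\<close> because \<open>\<beta> < 1/3\<close>.\<close>

lemma bob_can_answer:
  assumes V: "subspace V" and \<beta>: "0 < \<beta>" "\<beta> < 1/3" and n: "n \<in> V" "norm n = 1" and B: "fst B \<in> V" "0 < snd B"
  shows "\<exists>B'. fst B' \<in> V \<and> snd B' = \<beta> * snd B \<and> ball_of V B' \<subseteq> ball_of V B \<and>
     (\<forall>z \<in> ball_of V B'. \<beta> * snd B \<le> \<bar>n \<bullet> z - b\<bar>)"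
proof -
  define s where "s = (if n \<bullet> fst B \<ge> b then 1 else -1 :: real)"
  define \<rho> where "\<rho> = snd B"
  define x' where "x' = fst B + (s * (1 - \<beta>) * \<rho>) *\<^sub>R n"
  have s: "\<bar>s\<bar> = 1" "s * (n \<bullet> fst B - b) \<ge> 0" by (auto simp: s_def)
  have \<rho>: "\<rho> > 0" using B by (simp add: \<rho>_def)
  have nn: "n \<bullet> n = 1" using n(2) by (simp add: norm_eq_1)
  have d: "norm (x' - fst B) = (1 - \<beta>) * \<rho>"
    using s \<rho> \<beta> n by (simp add: x'_def abs_mult)
  have x'V: "x' \<in> V" using V B n by (auto simp: x'_def subspace_add subspace_scale)
  have z: "norm (z - fst B) \<le> \<rho>" "\<beta> * \<rho> \<le> \<bar>n \<bullet> z - b\<bar>" if "norm (x' - z) \<le> \<beta> * \<rho>" for z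
  proof -
    have "z - fst B = (x' - fst B) - (x' - z)" by simp
    then have "norm (z - fst B) \<le> (1 - \<beta>) * \<rho> + \<beta> * \<rho>"
      using norm_triangle_ineq4[of "x' - fst B" "x' - z"] d that by simp
    then show "norm (z - fst B) \<le> \<rho>" by (simp add: algebra_simps)
    have "\<bar>n \<bullet> (x' - z)\<bar> \<le> norm n * norm (x' - z)" by (rule Cauchy_Schwarz_ineq2)
    then have 1: "\<bar>n \<bullet> (x' - z)\<bar> \<le> \<beta> * \<rho>" using n that by simp
    have "s * s = 1" by (simp add: s_def)
    have "s * (n \<bullet> z - b) = s * (n \<bullet> fst B - b) + s * s * ((1 - \<beta>) * \<rho>) - s * (n \<bullet> (x' - z))"
      by (simp add: x'_def inner_add_right inner_diff_right nn algebra_simps)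
    moreover have "s * (n \<bullet> (x' - z)) \<le> \<beta> * \<rho>"
      using 1 s by (metis abs_ge_self abs_mult mult_1 order_trans)
    ultimately have "(1 - \<beta>) * \<rho> - \<beta> * \<rho> \<le> s * (n \<bullet> z - b)" using s \<open>s * s = 1\<close> by simp
    moreover have "\<beta> * \<rho> \<le> (1 - \<beta>) * \<rho> - \<beta> * \<rho>"
    proof -
      have "3 * \<beta> * \<rho> \<le> 1 * \<rho>" using \<beta> \<rho> by (intro mult_right_mono) auto
      then show ?thesis by (simp add: algebra_simps)
    qed
    moreover have "s * (n \<bullet> z - b) \<le> \<bar>n \<bullet> z - b\<bar>" using s by (metis abs_ge_self abs_mult mult_1)
    ultimately show "\<beta> * \<rho> \<le> \<bar>n \<bullet> z - b\<bar>" by linarith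
  qed
  show ?thesis
    using z x'V by (intro exI[of _ "(x', \<beta> * \<rho>)"])
      (auto simp: ball_of_def dist_norm \<rho>_def norm_minus_commute[of "fst B"])
qed

text \<open>Bob may keep the radii bounded away from zero.  Then the intersection of his balls contains a ball,
  and the outcome of an auxiliary game played inside that ball lies in the target set.\<close>

lemma HAW_from_strategies:
  fixes V W S :: "'a::euclidean_space set"
  assumes V: "subspace V" "dim V > 0"
    and ex: "\<And>\<beta> B0. 0 < \<beta> \<Longrightarrow> \<beta> < 1/3 \<Longrightarrow> fst B0 \<in> V \<Longrightarrow> 0 < snd B0 \<Longrightarrow> ball_of V B0 \<subseteq> W \<Longrightarrow>
      \<exists>\<tau>. strategy V \<tau> \<and> wins V \<beta> S \<tau> B0"
  shows "HAW V W S"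
  unfolding HAW_def
proof (intro allI impI)
  fix \<beta> :: real assume "0 < \<beta> \<and> \<beta> < 1/3"
  then have \<beta>: "0 < \<beta>" "\<beta> < 1/3" by auto
  obtain n0 where n0: "n0 \<in> V" "norm n0 = 1" using unit_vector_exists[OF V] .
  define ok where "ok B0 \<longleftrightarrow> fst B0 \<in> V \<and> 0 < snd B0 \<and> ball_of V B0 \<subseteq> W" for B0
  \<comment> \<open>A strategy is also fixed for inadmissible first balls, because Alice's answers
    must be legal after every list of balls.\<close>
  have "\<exists>\<tau>. strategy V \<tau> \<and> (ok B0 \<longrightarrow> wins V \<beta> S \<tau> B0)" for B0
  proof (cases "ok B0")
    case True
    then show ?thesis using ex[OF \<beta>] by (auto simp: ok_def)
  next
    case False
    then show ?thesis using n0 by (intro exI[of _ "\<lambda>B i. (n0, 0)"]) (auto simp: strategy_def)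
  qed
  then obtain T where T: "\<And>B0. strategy V (T B0)" "\<And>B0. ok B0 \<Longrightarrow> wins V \<beta> S (T B0) B0" by metis
  have Tn: "fst (T B0 B i) \<in> V" "norm (fst (T B0 B i)) = 1" for B0 B i using T(1)[of B0] by (auto simp: strategy_def)
  define \<sigma> where "\<sigma> Bs = (hyper V (T (hd Bs) (\<lambda>i. Bs ! i) (length Bs - 1)), \<beta> * snd (last Bs))" for Bs
  have "alice_strategy V \<beta> \<sigma>"
    unfolding alice_strategy_def
  proof (intro allI impI)
    fix Bs :: "('a \<times> real) list" assume Bs: "Bs \<noteq> [] \<and> (\<forall>B\<in>set Bs. fst B \<in> V \<and> 0 < snd B)"
    then have "0 < snd (last Bs)" using last_in_set by blast
    moreover have "hyperplane_in V (hyper V (T (hd Bs) (\<lambda>i. Bs ! i) (length Bs - 1)))"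
      using hyperplane_in_hyper[OF V(1) Tn] by (metis prod.collapse)
    ultimately show "hyperplane_in V (fst (\<sigma> Bs)) \<and> 0 < snd (\<sigma> Bs) \<and> snd (\<sigma> Bs) \<le> \<beta> * snd (last Bs)"
      using \<beta> by (simp add: \<sigma>_def)
  qed
  moreover have "(\<Inter>i. ball_of V (B i)) \<inter> S \<noteq> {}" if B: "bob_play V W \<beta> \<sigma> B" for B
  proof -
    define h where "h = T (B 0) B"
    have pre: "\<sigma> (map B [0..<Suc i]) = (hyper V (h i), \<beta> * snd (B i))" for i
    proof -
      have hd: "hd (map B [0..<Suc i]) = B 0" by (simp add: upt_conv_Cons del: upt_Suc)
      have "T (B 0) (\<lambda>j. map B [0..<Suc i] ! j) i = T (B 0) B i"
        using T(1)[of "B 0"] unfolding strategy_def by (auto simp: nth_map[symmetric] simp del: upt_Suc)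
      then show ?thesis by (simp add: \<sigma>_def hd h_def del: upt_Suc) simp
    qed
    have ok0: "ok (B 0)" using B by (auto simp: bob_play_def ok_def)
    have leg: "legal_play V \<beta> h B"
      unfolding legal_play_def
    proof (intro allI conjI ballI)
      fix i
      have bi: "ball_of V (B (Suc i)) \<subseteq> ball_of V (B i) - nbhd_in V (hyper V (h i)) (\<beta> * snd (B i))"
        "\<beta> * snd (B i) \<le> snd (B (Suc i))"
      proof -
        have "let (L, r) = \<sigma> (map B [0..<Suc i]) in
            ball_of V (B (Suc i)) \<subseteq> ball_of V (B i) - nbhd_in V L r \<and> \<beta> * snd (B i) \<le> snd (B (Suc i))"
          using B unfolding bob_play_def by blast
        then show "ball_of V (B (Suc i)) \<subseteq> ball_of V (B i) - nbhd_in V (hyper V (h i)) (\<beta> * snd (B i))"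
          "\<beta> * snd (B i) \<le> snd (B (Suc i))" unfolding pre by simp_all
      qed
      show "fst (B i) \<in> V" "0 < snd (B i)" using B by (auto simp: bob_play_def)
      show "\<beta> * snd (B i) \<le> snd (B (Suc i))" "ball_of V (B (Suc i)) \<subseteq> ball_of V (B i)" using bi by auto
      fix z assume z: "z \<in> ball_of V (B (Suc i))"
      then have zV: "z \<in> V" by (simp add: ball_of_def)
      have nz: "z \<notin> nbhd_in V (hyper V (h i)) (\<beta> * snd (B i))" using z bi by auto
      have hi: "fst (h i) \<in> V" "norm (fst (h i)) = 1" using Tn by (auto simp: h_def)
      show "\<beta> * snd (B i) \<le> \<bar>fst (h i) \<bullet> z - snd (h i)\<bar>"
        using nbhd_in_hyper[OF V(1) hi zV, of "snd (h i)" "\<beta> * snd (B i)"] nz by (metis not_le prod.collapse)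
    qed
    show ?thesis
    proof (cases "(\<lambda>i. snd (B i)) \<longlonglongrightarrow> 0")
      case True
      then show ?thesis using T(2)[OF ok0] leg unfolding wins_def h_def by blast
    next
      case False
      note rad = legal_play_radius_le[OF V leg]
      have pos: "0 < snd (B i)" "fst (B i) \<in> V" for i using leg by (auto simp: legal_play_def)
      have "decseq (\<lambda>i. snd (B i))" using rad(2) by (simp add: decseq_def)
      then obtain \<rho> where \<rho>: "(\<lambda>i. snd (B i)) \<longlonglongrightarrow> \<rho>" "\<And>i. \<rho> \<le> snd (B i)"
        using decseq_convergent[of "\<lambda>i. snd (B i)" 0] pos(1) by (metis less_imp_le)
      have "0 \<le> \<rho>" using \<rho>(1) pos(1) by (intro LIMSEQ_le_const) (auto intro: less_imp_le)
      then have \<rho>0: "0 < \<rho>" using \<rho>(1) False by (cases "\<rho> = 0") auto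
      have "Cauchy (\<lambda>i. fst (B i))"
      proof (rule metric_CauchyI)
        fix e :: real assume "0 < e"
        then obtain N where N: "\<And>i. i \<ge> N \<Longrightarrow> \<bar>snd (B i) - \<rho>\<bar> < e"
          using \<rho>(1) unfolding LIMSEQ_iff by fastforce
        have "dist (fst (B i)) (fst (B j)) < e" if "i \<ge> N" "i \<le> j" for i j
          using rad(1)[OF that(2)] N[OF that(1)] \<rho>(2)[of j] by linarith
        then show "\<exists>N. \<forall>i\<ge>N. \<forall>j\<ge>N. dist (fst (B i)) (fst (B j)) < e"
          by (metis dist_commute nat_le_linear)
      qed
      then obtain x where x: "(\<lambda>i. fst (B i)) \<longlonglongrightarrow> x" using Cauchy_convergent convergent_def by blast
      have xV: "x \<in> V" using closed_sequentially[OF closed_subspace[OF V(1)] _ x] pos(2) by auto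
      have dx: "dist (fst (B i)) x \<le> snd (B i) - \<rho>" for i
      proof (rule LIMSEQ_le)
        show "(\<lambda>j. dist (fst (B i)) (fst (B j))) \<longlonglongrightarrow> dist (fst (B i)) x" by (intro tendsto_intros x)
        show "(\<lambda>j. snd (B i) - snd (B j)) \<longlonglongrightarrow> snd (B i) - \<rho>" by (intro tendsto_intros \<rho>)
        show "\<exists>N. \<forall>j\<ge>N. dist (fst (B i)) (fst (B j)) \<le> snd (B i) - snd (B j)" using rad(1) by blast
      qed
      have sub: "ball_of V (x, \<rho>) \<subseteq> ball_of V (B i)" for i
      proof
        fix z assume "z \<in> ball_of V (x, \<rho>)"
        then have "dist x z \<le> \<rho>" "z \<in> V" by (auto simp: ball_of_def)
        then show "z \<in> ball_of V (B i)" using dx[of i] dist_triangle[of "fst (B i)" z x] by (auto simp: ball_of_def)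
      qed
      have okx: "ok (x, \<rho>)" using xV \<rho>0 sub[of 0] ok0 by (auto simp: ok_def)
      \<comment> \<open>The opponent in the auxiliary play shrinks by exactly \<open>\<beta>\<close>
        in every move, so its radii tend to 0 and \<open>wins\<close> applies.\<close>
      define \<tau> where "\<tau> = T (x, \<rho>)"
      have "\<forall>b m c. \<exists>b'. fst b \<in> V \<and> 0 < snd b \<and> m \<in> V \<and> norm m = 1 \<longrightarrow> fst b' \<in> V \<and> snd b' = \<beta> * snd b \<and>
         ball_of V b' \<subseteq> ball_of V b \<and> (\<forall>z \<in> ball_of V b'. \<beta> * snd b \<le> \<bar>m \<bullet> z - c\<bar>)"
        using bob_can_answer[OF V(1) \<beta>] by blast
      then obtain resp where resp: "\<And>b m c. fst b \<in> V \<Longrightarrow> 0 < snd b \<Longrightarrow> m \<in> V \<Longrightarrow> norm m = 1 \<Longrightarrow>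
         fst (resp b m c) \<in> V \<and> snd (resp b m c) = \<beta> * snd b \<and>
         ball_of V (resp b m c) \<subseteq> ball_of V b \<and> (\<forall>z \<in> ball_of V (resp b m c). \<beta> * snd b \<le> \<bar>m \<bullet> z - c\<bar>)"
        by metis
      \<comment> \<open>The play is built as a growing list because each answer depends on the whole
        prefix. Entries of \<open>\<lambda>j. L ! j\<close> beyond the end of the list are
        unspecified, but a strategy ignores them.\<close>
      define Ls where "Ls = rec_nat [(x, \<rho>)] (\<lambda>i L. L @ [resp (L ! i) (fst (\<tau> (\<lambda>j. L ! j) i)) (snd (\<tau> (\<lambda>j. L ! j) i))])"
      have Ls0: "Ls 0 = [(x, \<rho>)]" by (simp add: Ls_def)
      have LsS: "Ls (Suc i) = Ls i @ [resp (Ls i ! i) (fst (\<tau> (\<lambda>j. Ls i ! j) i)) (snd (\<tau> (\<lambda>j. Ls i ! j) i))]" for i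
        by (simp add: Ls_def)
      have len: "length (Ls i) = Suc i" for i by (induction i) (simp_all add: Ls0 LsS)
      define C where "C i = Ls i ! i" for i
      have LC: "Ls i ! j = C j" if "j \<le> i" for i j
        using that
      proof (induction i)
        case 0
        then show ?case by (simp add: C_def)
      next
        case (Suc i)
        then show ?case
        proof (cases "j = Suc i")
          case False
          then have "j \<le> i" using Suc by simp
          then show ?thesis using Suc.IH LsS len by (simp add: nth_append)
        qed (simp add: C_def)
      qed
      have \<tau>C: "\<tau> (\<lambda>j. Ls i ! j) i = \<tau> C i" for i
        using T(1)[of "(x, \<rho>)"] LC unfolding strategy_def \<tau>_def by blast
      have CS: "C (Suc i) = resp (C i) (fst (\<tau> C i)) (snd (\<tau> C i))" for i
        unfolding C_def[of "Suc i"] LsS using len[of i] LC[of i i] \<tau>C[of i] by (simp add: nth_append)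
      have C0: "C 0 = (x, \<rho>)" by (simp add: C_def Ls0)
      have \<tau>n: "fst (\<tau> C i) \<in> V" "norm (fst (\<tau> C i)) = 1" for i using Tn by (auto simp: \<tau>_def)
      have CV: "fst (C i) \<in> V \<and> snd (C i) = \<rho> * \<beta> ^ i" for i
      proof (induction i)
        case 0
        then show ?case using xV by (simp add: C0)
      next
        case (Suc i)
        then have "0 < snd (C i)" using \<rho>0 \<beta> by simp
        then show ?case using Suc resp[of "C i" "fst (\<tau> C i)" "snd (\<tau> C i)"] \<tau>n[of i] by (simp add: CS)
      qed
      have Cp: "0 < snd (C i)" for i using CV \<rho>0 \<beta> by simp
      have "legal_play V \<beta> (\<tau> C) C"
        unfolding legal_play_def
      proof
        fix i
        show "fst (C i) \<in> V \<and> 0 < snd (C i) \<and> \<beta> * snd (C i) \<le> snd (C (Suc i)) \<and>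
           ball_of V (C (Suc i)) \<subseteq> ball_of V (C i) \<and>
           (\<forall>z \<in> ball_of V (C (Suc i)). \<beta> * snd (C i) \<le> \<bar>fst (\<tau> C i) \<bullet> z - snd (\<tau> C i)\<bar>)"
          using CV[of i] Cp[of i] resp[of "C i" "fst (\<tau> C i)" "snd (\<tau> C i)"] \<tau>n[of i] unfolding CS by auto
      qed
      moreover have "(\<lambda>i. snd (C i)) \<longlonglongrightarrow> 0"
      proof -
        have "(\<lambda>i. \<rho> * \<beta> ^ i) \<longlonglongrightarrow> \<rho> * 0" using \<beta> by (intro tendsto_intros LIMSEQ_power_zero) auto
        then show ?thesis using CV by simp
      qed
      ultimately obtain y where y: "y \<in> S" "\<And>i. y \<in> ball_of V (C i)"
        using T(2)[OF okx] C0 unfolding wins_def \<tau>_def by blast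
      then have "y \<in> (\<Inter>i. ball_of V (B i))" using sub y(2)[of 0] by (auto simp: C0)
      then show ?thesis using y by blast
    qed
  qed
  ultimately show "\<exists>\<sigma>. alice_strategy V \<beta> \<sigma> \<and> (\<forall>B. bob_play V W \<beta> \<sigma> B \<longrightarrow> (\<Inter>i. ball_of V (B i)) \<inter> S \<noteq> {})"
    by blast
qed

section \<open>The potential game\<close>

text \<open>\<open>w n k\<close> is the width of the set \<open>E n k b\<close>: once it is at most
  \<open>\<kappa> * r\<close>, the set looks like a slab in any ball of radius \<open>r\<close>. A
  slab from the finite set \<open>F\<close> approximates it within \<open>3 * \<kappa> * r\<close>,
  which is less than Alice's \<open>\<beta> * r\<close>. The condition on \<open>\<gamma>\<close>
  says that losing the share \<open>1 / card F\<close> of the weight, and regaining half of that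
  share, keeps pace with a radius that shrinks by \<open>\<beta>\<close>. The condition on
  \<open>\<eta>\<close> turns a bound on the total weight into flatness of every single set.\<close>

locale potential_game =
  fixes V :: "'a::euclidean_space set" and \<beta> \<kappa> \<gamma> \<eta> R0 \<rho>0 :: real and x0 :: 'a
    and N :: "nat \<Rightarrow> nat" and w :: "nat \<Rightarrow> nat \<Rightarrow> real" and E :: "nat \<Rightarrow> nat \<Rightarrow> 'a \<times> real \<Rightarrow> 'a set"
    and F :: "('a \<times> real) set"
  assumes V: "subspace V" "dim V > 0" and \<beta>: "0 < \<beta>" "\<beta> < 1/3" and \<kappa>: "0 < \<kappa>" "4 * \<kappa> \<le> \<beta>"
    and F: "finite F" "F \<noteq> {}" "\<And>f. f \<in> F \<Longrightarrow> fst f \<in> V \<and> norm (fst f) = 1"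
    and net: "\<And>m a. m \<in> V \<Longrightarrow> norm m = 1 \<Longrightarrow> \<bar>a\<bar> \<le> 2 \<Longrightarrow> \<exists>f\<in>F. norm (m - fst f) \<le> \<kappa> \<and> \<bar>a - snd f\<bar> \<le> \<kappa>"
    and \<gamma>: "0 < \<gamma>" "1 - 1 / (2 * real (card F)) \<le> \<beta> powr \<gamma>"
    and \<eta>: "0 < \<eta>" "\<eta> \<le> \<kappa> * \<beta>"
    and x0: "x0 \<in> V" and R0: "0 < R0" "R0 \<le> \<rho>0"
    and w: "\<And>n k. 0 < w n k"
    and wsum: "\<And>n. (\<Sum>k<N n. w n k powr \<gamma>) \<le> 1 / (2 * real (card F)) * (\<eta> * (R0 * \<beta> ^ n)) powr \<gamma>"
    and flat: "\<And>n k b y r. fst b \<in> V \<Longrightarrow> dist x0 (fst b) \<le> \<rho>0 \<Longrightarrow> R0 * \<beta> ^ Suc n < snd b \<Longrightarrow> snd b \<le> R0 * \<beta> ^ n \<Longrightarrow>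
       y \<in> V \<Longrightarrow> dist x0 y \<le> \<rho>0 \<Longrightarrow> 0 < r \<Longrightarrow> r \<le> R0 \<Longrightarrow> w n k \<le> \<kappa> * r \<Longrightarrow>
       \<exists>m a. m \<in> V \<and> norm m = 1 \<and> (\<forall>z \<in> E n k b \<inter> ball_of V (y, r). \<bar>m \<bullet> z - a\<bar> \<le> \<kappa> * r)"
begin

definition R where "R n = R0 * \<beta> ^ n" for n :: nat

text \<open>When the radius first drops to \<open>R j\<close>, Bob's ball determines the sets \<open>E j k\<close> of stage \<open>j\<close>, which
  then stay fixed.  A pair \<open>(j, k)\<close> is active while its set meets Bob's ball, and caught by a direction
  \<open>f\<close> of the finite net if deleting the corresponding slab makes it inactive.\<close>

definition stage where "stage B i j \<longleftrightarrow> snd (B i) \<le> R j \<and> (\<forall>l<i. R j < snd (B l))"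
  for B :: "nat \<Rightarrow> 'a \<times> real" and i j :: nat
definition Est where "Est B i j k = {z. \<exists>i'\<le>i. stage B i' j \<and> z \<in> E j k (B i')}" for B i j k
definition active where "active B i = {(j, k). k < N j \<and> Est B i j k \<inter> ball_of V (B i) \<noteq> {}}" for B i
definition caught where "caught B i f = {(j, k) \<in> active B i. \<forall>z \<in> Est B i j k \<inter> ball_of V (B i).
   \<bar>fst f \<bullet> (z - fst (B i)) - snd (B i) * snd f\<bar> \<le> 3 * \<kappa> * snd (B i)}" for B i and f :: "'a \<times> real"
definition weight where "weight A = (\<Sum>(j, k)\<in>A. w j k powr \<gamma>)" for A
definition good where "good B i f \<longleftrightarrow> weight (active B i) \<le> real (card F) * weight (caught B i f)" for B i f
text \<open>The fallback makes \<open>\<tau>\<close> a strategy on all histories, including those in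
  which no slab is good.\<close>

definition choice where "choice B i = (if \<exists>f\<in>F. good B i f then SOME f. f \<in> F \<and> good B i f else SOME f. f \<in> F)" for B i
definition \<tau> where "\<tau> B i = (fst (choice B i), fst (choice B i) \<bullet> fst (B i) + snd (B i) * snd (choice B i))" for B i

lemma choice_F: "choice B i \<in> F"
proof (cases "\<exists>f\<in>F. good B i f")
  case True
  then have "\<exists>f. f \<in> F \<and> good B i f" by blast
  from someI_ex[OF this] show ?thesis using True by (simp add: choice_def)
next
  case False
  have "\<exists>f. f \<in> F" using F(2) by blast
  from someI_ex[OF this] show ?thesis using False by (simp add: choice_def)
qed

lemma choice_good: assumes "\<exists>f\<in>F. good B i f" shows "good B i (choice B i)"
proof -
  have "\<exists>f. f \<in> F \<and> good B i f" using assms by blast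
  from someI_ex[OF this] show ?thesis using assms by (simp add: choice_def)
qed

lemma strategy_\<tau>: "strategy V \<tau>"
  unfolding strategy_def
proof (intro conjI allI impI)
  show "fst (\<tau> B i) \<in> V" "norm (fst (\<tau> B i)) = 1" for B i using F(3)[OF choice_F] by (auto simp: \<tau>_def)
  fix B B' :: "nat \<Rightarrow> 'a \<times> real" and i assume eq: "\<forall>j\<le>i. B j = B' j"
  have st: "stage B i' j = stage B' i' j" if "i' \<le> i" for i' j
    using eq that by (auto simp: stage_def)
  have E: "Est B i j k = Est B' i j k" for j k
    using eq st by (auto simp: Est_def)
  have a: "active B i = active B' i" using eq by (simp add: active_def E)
  have c: "caught B i f = caught B' i f" for f using eq by (simp add: caught_def E a)
  have "good B i f = good B' i f" for f by (simp add: good_def a c)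
  then have "choice B i = choice B' i" by (simp add: choice_def)
  then show "\<tau> B i = \<tau> B' i" using eq by (simp add: \<tau>_def)
qed

lemma R_pos: "0 < R n" using R0 \<beta> by (simp add: R_def)
lemma R_Suc: "R (Suc n) = \<beta> * R n" by (simp add: R_def)
lemma R_antimono: "m \<le> n \<Longrightarrow> R n \<le> R m" using R0 \<beta> by (simp add: R_def power_decreasing)
lemma R_0: "R 0 = R0" by (simp add: R_def)
lemma card_F: "1 \<le> real (card F)" using F by (simp add: Suc_leI card_gt_0_iff)

lemma weight_nonneg: "0 \<le> weight A" by (auto simp: weight_def intro!: sum_nonneg)
lemma weight_mono: "A \<subseteq> A' \<Longrightarrow> finite A' \<Longrightarrow> weight A \<le> weight A'"
  unfolding weight_def by (intro sum_mono2) auto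

lemma weight_Un: "finite A \<Longrightarrow> finite A' \<Longrightarrow> weight (A \<union> A') \<le> weight A + weight A'"
  using weight_nonneg[of "A \<inter> A'"] unfolding weight_def by (simp add: sum_Un)

lemma weight_UN_le:
  assumes "finite I" "\<And>i. i \<in> I \<Longrightarrow> finite (A i)"
  shows "weight (\<Union>i\<in>I. A i) \<le> (\<Sum>i\<in>I. weight (A i))"
  using assms
proof (induction I)
  case empty
  then show ?case by (simp add: weight_def)
next
  case (insert i I)
  then have "weight (\<Union>i\<in>insert i I. A i) \<le> weight (A i) + weight (\<Union>i\<in>I. A i)"
    using weight_Un[of "A i" "\<Union>i\<in>I. A i"] by simp
  then show ?case using insert by simp
qed

lemma bracket:
  assumes "0 < z" "z \<le> R0" obtains n where "R (Suc n) < z" "z \<le> R n"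
proof -
  obtain n where "\<beta> ^ Suc n < z / R0" "z / R0 \<le> \<beta> ^ n"
    using geometric_bracket[of \<beta> "z / R0"] \<beta> assms R0 by auto
  then show ?thesis using that[of n] R0 by (simp add: R_def field_simps)
qed

lemma stage_unique: "stage B i j \<Longrightarrow> stage B i' j \<Longrightarrow> i = i'"
  unfolding stage_def by (metis not_less_iff_gr_or_eq leD)

lemma Est_eq: "stage B i' j \<Longrightarrow> i' \<le> i \<Longrightarrow> Est B i j k = E j k (B i')"
  unfolding Est_def using stage_unique by blast

section \<open>The weight of the active pairs along a legal play\<close>

context
  fixes B :: "nat \<Rightarrow> 'a \<times> real"
  assumes B0: "B 0 = (x0, \<rho>0)" and leg: "legal_play V \<beta> (\<tau> B) B"
begin

lemma Bpos: "0 < snd (B i)" "fst (B i) \<in> V" "\<beta> * snd (B i) \<le> snd (B (Suc i))"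
  using leg by (auto simp: legal_play_def)

lemma Bmono: "i \<le> j \<Longrightarrow> snd (B j) \<le> snd (B i)"
  using legal_play_radius_le(2)[OF V leg] .

lemma Bsub: "i \<le> j \<Longrightarrow> ball_of V (B j) \<subseteq> ball_of V (B i)"
  using ball_of_nested[of V B] leg by (auto simp: legal_play_def)

lemma Bdist: "dist x0 (fst (B i)) \<le> \<rho>0"
  using legal_play_radius_le(1)[OF V leg, of 0 i] Bpos(1)[of i] B0 by simp

text \<open>A move shrinks the radius by at most \<open>\<beta>\<close>, so no scale is skipped on
  the way down.\<close>

lemma stage_lower: assumes "stage B i j" shows "R (Suc j) < snd (B i)"
proof (cases i)
  case 0
  then have "R0 \<le> R j" using assms B0 R0 by (simp add: stage_def)
  moreover have "R (Suc j) < R j" using R_pos[of j] \<beta> by (simp add: R_Suc)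
  moreover have "R j \<le> snd (B i)" using R_antimono[of 0 j] R0 B0 0 by (simp add: R_0)
  ultimately show ?thesis by linarith
next
  case (Suc l)
  then have "R j < snd (B l)" using assms by (auto simp: stage_def)
  then have "\<beta> * R j < \<beta> * snd (B l)" using \<beta> by simp
  also have "\<dots> \<le> snd (B i)" using Bpos(3)[of l] Suc by simp
  finally show ?thesis by (simp add: R_Suc)
qed

lemma active_stage: assumes "(j, k) \<in> active B i" obtains i' where "i' \<le> i" "stage B i' j" "k < N j"
  using assms by (auto simp: active_def Est_def)

lemma finite_active: assumes "R (Suc n) < snd (B i)" shows "active B i \<subseteq> Sigma {..n} (\<lambda>j. {..<N j})" "finite (active B i)"
proof -
  show "active B i \<subseteq> Sigma {..n} (\<lambda>j. {..<N j})"
  proof clarify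
    fix j k assume "(j, k) \<in> active B i"
    then obtain i' where i': "i' \<le> i" "stage B i' j" "k < N j" by (rule active_stage)
    have "snd (B i) \<le> R j" using Bmono[OF i'(1)] i'(2) by (simp add: stage_def)
    then have "R (Suc n) < R j" using assms by simp
    then have "\<not> Suc n \<le> j" using R_antimono[of "Suc n" j] by linarith
    then show "j \<in> {..n} \<and> k \<in> {..<N j}" using i' by simp
  qed
  then show "finite (active B i)" by (rule finite_subset) auto
qed

text \<open>Pigeonhole: every active pair is caught by some element of the net, so one element
  catches at least the share \<open>1 / card F\<close> of the weight.\<close>

lemma exists_good:
  assumes n: "snd (B i) \<le> R n" "R (Suc n) < snd (B i)" and inv: "weight (active B i) \<le> (\<eta> * R n) powr \<gamma>"
  shows "\<exists>f\<in>F. good B i f"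
proof (rule ccontr)
  assume none: "\<not> ?thesis"
  let ?A = "active B i" and ?y = "fst (B i)" and ?r = "snd (B i)"
  have fin: "finite ?A" using finite_active[OF n(2)] by simp
  have cov: "?A \<subseteq> (\<Union>f\<in>F. caught B i f)"
  proof clarify
    fix j k assume jk: "(j, k) \<in> ?A"
    then obtain i' where i': "i' \<le> i" "stage B i' j" "k < N j" by (rule active_stage)
    \<comment> \<open>The total weight bounds each single width, and
      \<open>\<eta> \<le> \<kappa> * \<beta>\<close> brings it below \<open>\<kappa>\<close> times
      the current radius, where flatness applies.\<close>
    have "w j k powr \<gamma> \<le> weight ?A"
      unfolding weight_def using member_le_sum[OF jk, of "\<lambda>(j, k). w j k powr \<gamma>"] fin by (auto simp: split_beta)
    then have "w j k powr \<gamma> \<le> (\<eta> * R n) powr \<gamma>" using inv by simp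
    then have "w j k \<le> \<eta> * R n"
      using \<gamma>(1) w[of j k] R_pos[of n] \<eta> by (meson linorder_not_le mult_pos_pos less_imp_le powr_less_mono2)
    also have "\<dots> \<le> \<kappa> * \<beta> * R n" using \<eta> R_pos[of n] by (intro mult_right_mono) auto
    also have "\<dots> = \<kappa> * R (Suc n)" by (simp add: R_Suc)
    also have "\<dots> \<le> \<kappa> * ?r" using n(2) \<kappa> by (intro mult_left_mono) auto
    finally have wr: "w j k \<le> \<kappa> * ?r" .
    have rR: "?r \<le> R0" using n(1) R_antimono[of 0 n] by (simp add: R_0)
    have "\<exists>m a. m \<in> V \<and> norm m = 1 \<and> (\<forall>z \<in> E j k (B i') \<inter> ball_of V (?y, ?r). \<bar>m \<bullet> z - a\<bar> \<le> \<kappa> * ?r)"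
    proof (rule flat)
      show "R0 * \<beta> ^ Suc j < snd (B i')" using stage_lower[OF i'(2)] by (simp add: R_def)
      show "snd (B i') \<le> R0 * \<beta> ^ j" using i'(2) by (simp add: stage_def R_def)
    qed (fact Bpos Bdist wr rR)+
    then obtain m a where ma: "m \<in> V" "norm m = 1" "\<And>z. z \<in> E j k (B i') \<Longrightarrow> z \<in> ball_of V (B i) \<Longrightarrow> \<bar>m \<bullet> z - a\<bar> \<le> \<kappa> * ?r"
      by (metis IntI prod.collapse)
    have Es: "Est B i j k = E j k (B i')" using Est_eq i' by blast
    obtain z0 where z0: "z0 \<in> E j k (B i')" "z0 \<in> ball_of V (B i)"
      using jk Es by (auto simp: active_def)
    have zy: "\<bar>m \<bullet> (z - ?y)\<bar> \<le> ?r" "norm (z - ?y) \<le> ?r" if "z \<in> ball_of V (B i)" for z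
    proof -
      show 1: "norm (z - ?y) \<le> ?r" using that by (auto simp: ball_of_def dist_norm norm_minus_commute)
      show "\<bar>m \<bullet> (z - ?y)\<bar> \<le> ?r" using Cauchy_Schwarz_ineq2[of m "z - ?y"] 1 ma(2) by simp
    qed
    \<comment> \<open>The offset relative to the centre, in units of the radius. The slab meets the
      ball, so \<open>a'\<close> is at most \<open>1 + \<kappa>\<close> in size and lies in the
      range covered by the net.\<close>
    define a' where "a' = (a - m \<bullet> ?y) / ?r"
    have r: "0 < ?r" using Bpos by simp
    have aa: "a - m \<bullet> ?y = ?r * a'" using r by (simp add: a'_def)
    have "\<bar>m \<bullet> (z0 - ?y) - ?r * a'\<bar> \<le> \<kappa> * ?r" using ma(3)[OF z0] aa by (simp add: inner_diff_right algebra_simps)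
    then have "?r * \<bar>a'\<bar> \<le> (1 + \<kappa>) * ?r" using zy(1)[OF z0(2)] r by (simp add: abs_mult algebra_simps abs_le_iff split: abs_split)
    moreover have "(1 + \<kappa>) * ?r \<le> ?r * 2" using \<kappa> \<beta> r by simp
    ultimately have "?r * \<bar>a'\<bar> \<le> ?r * 2" by linarith
    then have "\<bar>a'\<bar> \<le> 2" using r by simp
    then obtain f where f: "f \<in> F" "norm (m - fst f) \<le> \<kappa>" "\<bar>a' - snd f\<bar> \<le> \<kappa>" using net[OF ma(1,2)] by blast
    \<comment> \<open>Three errors of size \<open>\<kappa> * ?r\<close> add up: the width of the
      slab, the change of direction and the change of offset.\<close>
    have "\<bar>fst f \<bullet> (z - ?y) - ?r * snd f\<bar> \<le> 3 * \<kappa> * ?r" if z: "z \<in> Est B i j k" "z \<in> ball_of V (B i)" for z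
    proof -
      have "\<bar>m \<bullet> (z - ?y) - ?r * a'\<bar> \<le> \<kappa> * ?r"
        using ma(3)[of z] z Es aa by (simp add: inner_diff_right algebra_simps)
      moreover have "\<bar>(m - fst f) \<bullet> (z - ?y)\<bar> \<le> \<kappa> * ?r"
      proof -
        have "\<bar>(m - fst f) \<bullet> (z - ?y)\<bar> \<le> norm (m - fst f) * norm (z - ?y)" by (rule Cauchy_Schwarz_ineq2)
        also have "\<dots> \<le> \<kappa> * ?r" using f zy(2)[OF z(2)] \<kappa> by (intro mult_mono) auto
        finally show ?thesis .
      qed
      moreover have "\<bar>?r * (a' - snd f)\<bar> \<le> \<kappa> * ?r"
      proof -
        have "\<bar>?r * (a' - snd f)\<bar> = ?r * \<bar>a' - snd f\<bar>" using r by (simp add: abs_mult)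
        also have "\<dots> \<le> ?r * \<kappa>" using f r by (intro mult_left_mono) auto
        finally show ?thesis by (simp add: mult.commute)
      qed
      moreover have "fst f \<bullet> (z - ?y) - ?r * snd f = (m \<bullet> (z - ?y) - ?r * a') - (m - fst f) \<bullet> (z - ?y) + ?r * (a' - snd f)"
        by (simp add: algebra_simps inner_diff_left)
      ultimately show ?thesis by linarith
    qed
    then have "(j, k) \<in> caught B i f" using jk by (auto simp: caught_def)
    then show "(j, k) \<in> (\<Union>f\<in>F. caught B i f)" using f(1) by blast
  qed
  have finc: "finite (caught B i f)" for f using fin by (rule finite_subset[rotated]) (auto simp: caught_def)
  have "weight ?A \<le> weight (\<Union>f\<in>F. caught B i f)" by (rule weight_mono[OF cov]) (use F finc in auto)
  also have "\<dots> \<le> (\<Sum>f\<in>F. weight (caught B i f))"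
    using F(1) finc by (intro weight_UN_le) auto
  finally have le: "weight ?A \<le> (\<Sum>f\<in>F. weight (caught B i f))" .
  have "(\<Sum>f\<in>F. real (card F) * weight (caught B i f)) < (\<Sum>f\<in>F. weight ?A)"
    using none F by (intro sum_strict_mono) (auto simp: good_def)
  then have "real (card F) * (\<Sum>f\<in>F. weight (caught B i f)) < real (card F) * weight ?A"
    by (simp add: sum_distrib_left)
  then show False using le card_F by (simp add: mult_less_cancel_left)
qed

text \<open>The slab removed has relative half-width \<open>\<beta> > 3 * \<kappa>\<close>, so the
  caught pairs do not meet the next ball.\<close>

lemma weight_step:
  assumes n: "snd (B i) \<le> R n" "R (Suc n) < snd (B i)" and inv: "weight (active B i) \<le> (\<eta> * R n) powr \<gamma>"
  shows "weight {(j, k) \<in> active B i. Est B i j k \<inter> ball_of V (B (Suc i)) \<noteq> {}} \<le> (1 - 1 / real (card F)) * weight (active B i)"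
    (is "weight ?A' \<le> _")
proof -
  let ?f = "choice B i" and ?A = "active B i"
  have fin: "finite ?A" using finite_active[OF n(2)] by simp
  have cA: "caught B i ?f \<subseteq> ?A" by (auto simp: caught_def)
  have g: "weight ?A \<le> real (card F) * weight (caught B i ?f)"
    using choice_good[OF exists_good[OF assms]] by (simp add: good_def)
  have "p \<in> ?A - caught B i ?f" if pA: "p \<in> ?A'" for p
  proof -
    obtain j k z where p: "p = (j, k)" and jk: "(j, k) \<in> ?A" and z: "z \<in> Est B i j k" "z \<in> ball_of V (B (Suc i))"
      using pA by (cases p) blast
    have "z \<in> ball_of V (B i)" using z Bsub[of i "Suc i"] by auto
    moreover have "\<beta> * snd (B i) \<le> \<bar>fst (\<tau> B i) \<bullet> z - snd (\<tau> B i)\<bar>"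
      using leg z(2) unfolding legal_play_def by blast
    then have "\<beta> * snd (B i) \<le> \<bar>fst ?f \<bullet> (z - fst (B i)) - snd (B i) * snd ?f\<bar>"
      by (simp add: \<tau>_def inner_diff_right algebra_simps)
    moreover have "3 * \<kappa> * snd (B i) < \<beta> * snd (B i)" using \<kappa> Bpos(1)[of i] by (intro mult_strict_right_mono) auto
    ultimately have "(j, k) \<notin> caught B i ?f" using z(1) by (force simp: caught_def)
    then show "p \<in> ?A - caught B i ?f" using jk p by blast
  qed
  then have "?A' \<subseteq> ?A - caught B i ?f" by (rule subsetI)
  then have "weight ?A' \<le> weight (?A - caught B i ?f)" using fin by (intro weight_mono) auto
  also have "\<dots> = weight ?A - weight (caught B i ?f)"
    unfolding weight_def using fin cA by (simp add: sum_diff)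
  also have "\<dots> \<le> (1 - 1 / real (card F)) * weight ?A" using g card_F by (simp add: field_simps)
  finally show ?thesis .
qed

lemma active_Suc:
  "active B (Suc i) \<subseteq> {(j, k) \<in> active B i. Est B i j k \<inter> ball_of V (B (Suc i)) \<noteq> {}} \<union>
     {(j, k). k < N j \<and> stage B (Suc i) j}"
proof clarify
  fix j k assume jk: "(j, k) \<in> active B (Suc i)" and ns: "\<not> (k < N j \<and> stage B (Suc i) j)"
  then have "k < N j" by (auto simp: active_def)
  with ns have "\<not> stage B (Suc i) j" by simp
  then have "Est B (Suc i) j k = Est B i j k" unfolding Est_def using le_Suc_eq by auto
  then show "(j, k) \<in> active B i \<and> Est B i j k \<inter> ball_of V (B (Suc i)) \<noteq> {}"
    using jk Bsub[of i "Suc i"] by (auto simp: active_def)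
qed

lemma weight_stage: "weight (Pair n ` {..<N n}) \<le> 1 / (2 * real (card F)) * (\<eta> * R n) powr \<gamma>"
  using wsum[of n] by (simp add: weight_def sum.reindex inj_on_def R_def)

text \<open>Between two scales the weight cannot grow. On passing to the next scale the share
  \<open>1 / card F\<close> is lost and at most half of that share is added by the new stage, while
  the permitted bound shrinks by \<open>\<beta> powr \<gamma>\<close>.\<close>

lemma invariant:
  "(R0 < snd (B i) \<longrightarrow> active B i = {}) \<and>
   (\<forall>n. snd (B i) \<le> R n \<and> R (Suc n) < snd (B i) \<longrightarrow> weight (active B i) \<le> (\<eta> * R n) powr \<gamma>)"
proof (induction i)
  case 0
  have sub: "active B 0 \<subseteq> {(j, k). k < N j \<and> stage B 0 j}" by (auto simp: active_def Est_def)
  have st: "\<rho>0 \<le> R j" if "stage B 0 j" for j using that B0 by (simp add: stage_def)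
  show ?case
  proof (intro conjI allI impI)
    assume "R0 < snd (B 0)"
    then have "R0 < \<rho>0" using B0 by simp
    then have "\<not> stage B 0 j" for j using st[of j] R_antimono[of 0 j] by (auto simp: R_0)
    then show "active B 0 = {}" using sub by auto
  next
    fix n assume n: "snd (B 0) \<le> R n \<and> R (Suc n) < snd (B 0)"
    then have "R0 \<le> R n" using B0 R0 by simp
    have n0: "n = 0"
    proof (rule ccontr)
      assume "n \<noteq> 0"
      then have "R n \<le> R (Suc 0)" by (intro R_antimono) auto
      also have "\<dots> < R0" using \<beta> R0 by (simp add: R_Suc R_0)
      finally show False using \<open>R0 \<le> R n\<close> by simp
    qed
    have "j = 0" if "stage B 0 j" for j
    proof (rule ccontr)
      assume "j \<noteq> 0"
      then have "R j \<le> R (Suc 0)" by (intro R_antimono) auto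
      also have "\<dots> < R0" using \<beta> R0 by (simp add: R_Suc R_0)
      finally show False using st[OF that] R0 by simp
    qed
    then have "{(j, k). k < N j \<and> stage B 0 j} \<subseteq> Pair n ` {..<N n}" using n0 by fastforce
    then have "active B 0 \<subseteq> Pair n ` {..<N n}" using sub by blast
    then have "weight (active B 0) \<le> weight (Pair n ` {..<N n})" by (rule weight_mono) auto
    also have "\<dots> \<le> 1 / (2 * real (card F)) * (\<eta> * R n) powr \<gamma>" by (rule weight_stage)
    also have "\<dots> \<le> 1 * (\<eta> * R n) powr \<gamma>" using card_F by (intro mult_right_mono) auto
    finally show "weight (active B 0) \<le> (\<eta> * R n) powr \<gamma>" by simp
  qed
next
  case (Suc i)
  let ?A' = "{(j, k) \<in> active B i. Est B i j k \<inter> ball_of V (B (Suc i)) \<noteq> {}}"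
  have st: "snd (B (Suc i)) \<le> R j" "R j < snd (B i)" if "stage B (Suc i) j" for j
    using that by (auto simp: stage_def)
  have mono: "snd (B (Suc i)) \<le> snd (B i)" by (intro Bmono) simp
  show ?case
  proof (intro conjI allI impI)
    assume big: "R0 < snd (B (Suc i))"
    then have "active B i = {}" using Suc mono by auto
    moreover have "\<not> stage B (Suc i) j" for j using st(1)[of j] R_antimono[of 0 j] big by (auto simp: R_0)
    ultimately show "active B (Suc i) = {}" using active_Suc[of i] by auto
  next
    fix n assume n: "snd (B (Suc i)) \<le> R n \<and> R (Suc n) < snd (B (Suc i))"
    have jn: "j \<le> n" if "stage B (Suc i) j" for j
    proof (rule ccontr)
      assume "\<not> j \<le> n"
      then have "R j \<le> R (Suc n)" by (intro R_antimono) auto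
      then show False using st(1)[OF that] n by simp
    qed
    show "weight (active B (Suc i)) \<le> (\<eta> * R n) powr \<gamma>"
    proof (cases "snd (B i) \<le> R n")
      case True
      have "\<not> stage B (Suc i) j" for j
        using jn[of j] st(2)[of j] R_antimono[of j n] True by auto
      then have "active B (Suc i) \<subseteq> active B i" using active_Suc[of i] by auto
      moreover have "R (Suc n) < snd (B i)" using n mono by simp
      ultimately show ?thesis using Suc True weight_mono[of "active B (Suc i)" "active B i"] finite_active[of n i] by force
    next
      case False
      show ?thesis
      proof (cases n)
        case 0
        then have "active B i = {}" using Suc False by (simp add: R_0)
        moreover have "{(j, k). k < N j \<and> stage B (Suc i) j} \<subseteq> Pair n ` {..<N n}" using jn 0 by fastforce
        ultimately have "active B (Suc i) \<subseteq> Pair n ` {..<N n}" using active_Suc[of i] by blast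
        then have "weight (active B (Suc i)) \<le> weight (Pair n ` {..<N n})" by (rule weight_mono) auto
        also have "\<dots> \<le> 1 / (2 * real (card F)) * (\<eta> * R n) powr \<gamma>" by (rule weight_stage)
        also have "\<dots> \<le> 1 * (\<eta> * R n) powr \<gamma>" using card_F by (intro mult_right_mono) auto
        finally show ?thesis by simp
      next
        case (Suc n')
        have up: "snd (B i) \<le> R n'"
        proof -
          have "\<beta> * snd (B i) \<le> \<beta> * R n'" using Bpos(3)[of i] n Suc by (simp add: R_Suc)
          then show ?thesis using \<beta> by simp
        qed
        have lo: "R (Suc n') < snd (B i)" using False Suc by simp
        have inv: "weight (active B i) \<le> (\<eta> * R n') powr \<gamma>" using Suc.IH up lo by blast
        have "j = n" if "stage B (Suc i) j" for j
        proof (rule ccontr)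
          assume "j \<noteq> n"
          then have "j \<le> n'" using jn[OF that] Suc by simp
          then show False using R_antimono[of j n'] up st(2)[OF that] by simp
        qed
        then have "{(j, k). k < N j \<and> stage B (Suc i) j} \<subseteq> Pair n ` {..<N n}" by fastforce
        then have "active B (Suc i) \<subseteq> ?A' \<union> Pair n ` {..<N n}" using active_Suc[of i] by blast
        moreover have finA: "finite ?A'" using finite_active(2)[OF lo] by (rule finite_subset[rotated]) auto
        ultimately have "weight (active B (Suc i)) \<le> weight (?A' \<union> Pair n ` {..<N n})" by (intro weight_mono) auto
        also have "\<dots> \<le> weight ?A' + weight (Pair n ` {..<N n})"
          using finA by (intro weight_Un) auto
        also have "\<dots> \<le> (1 - 1 / real (card F)) * weight (active B i) + 1 / (2 * real (card F)) * (\<eta> * R n) powr \<gamma>"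
          by (intro add_mono weight_step[OF up lo inv] weight_stage)
        also have "\<dots> \<le> (1 - 1 / real (card F)) * (\<eta> * R n') powr \<gamma> + 1 / (2 * real (card F)) * (\<eta> * R n') powr \<gamma>"
        proof (intro add_mono mult_left_mono inv)
          show "0 \<le> 1 - 1 / real (card F)" using card_F by simp
          have "\<eta> * R n \<le> \<eta> * R n'" using \<eta> R_antimono[of n' n] Suc by simp
          then show "(\<eta> * R n) powr \<gamma> \<le> (\<eta> * R n') powr \<gamma>"
            using \<eta> \<gamma> R_pos[of n] by (intro powr_mono2) auto
        qed auto
        also have "\<dots> = (1 - 1 / (2 * real (card F))) * (\<eta> * R n') powr \<gamma>" by (simp add: algebra_simps)
        also have "\<dots> \<le> \<beta> powr \<gamma> * (\<eta> * R n') powr \<gamma>" using \<gamma> by (intro mult_right_mono) auto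
        also have "\<dots> = (\<eta> * R n) powr \<gamma>"
          using \<beta> \<eta> R_pos[of n'] by (simp add: Suc R_Suc powr_mult[symmetric] mult_ac)
        finally show ?thesis .
      qed
    qed
  qed
qed

text \<open>A point of \<open>E n k\<close> lying in all balls would keep the pair active for ever
  with the same weight, whereas the invariant forces the weight to 0.\<close>

lemma outcome:
  assumes lim: "(\<lambda>i. snd (B i)) \<longlonglongrightarrow> 0"
  obtains x where "\<And>i. x \<in> ball_of V (B i)"
    "\<And>n. \<exists>b. fst b \<in> V \<and> dist x0 (fst b) \<le> \<rho>0 \<and> R (Suc n) < snd b \<and> snd b \<le> R n \<and> x \<in> ball_of V b \<and> (\<forall>k<N n. x \<notin> E n k b)"
proof -
  have "\<Inter> (range (\<lambda>i. ball_of V (B i))) \<noteq> {}"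
  proof (rule compact_nest)
    show "compact (ball_of V (B i))" for i
      unfolding ball_of_def by (rule compact_Int_closed[OF compact_cball closed_subspace[OF V(1)]])
    show "ball_of V (B i) \<noteq> {}" for i
    proof -
      have "fst (B i) \<in> ball_of V (B i)" using Bpos[of i] by (simp add: ball_of_def)
      then show ?thesis by blast
    qed
    show "ball_of V (B j) \<subseteq> ball_of V (B i)" if "i \<le> j" for i j using Bsub that .
  qed
  then obtain x where x: "\<And>i. x \<in> ball_of V (B i)" by auto
  have small: "\<exists>i\<ge>i0. snd (B i) \<le> R n" for n i0
  proof -
    have "eventually (\<lambda>i. snd (B i) < R n) sequentially" using lim R_pos[of n] by (rule order_tendstoD)
    then obtain i1 where "\<And>i. i \<ge> i1 \<Longrightarrow> snd (B i) < R n" by (auto simp: eventually_sequentially)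
    then show ?thesis by (intro exI[of _ "max i0 i1"]) (auto intro: less_imp_le)
  qed
  have "\<exists>b. fst b \<in> V \<and> dist x0 (fst b) \<le> \<rho>0 \<and> R (Suc n) < snd b \<and> snd b \<le> R n \<and> x \<in> ball_of V b \<and> (\<forall>k<N n. x \<notin> E n k b)" for n
  proof -
    define i where "i = (LEAST i. snd (B i) \<le> R n)"
    have ex: "\<exists>i. snd (B i) \<le> R n" using small[of 0 n] by blast
    have "snd (B i) \<le> R n" unfolding i_def by (rule LeastI_ex[OF ex])
    moreover have "R n < snd (B l)" if "l < i" for l
      using not_less_Least[of l "\<lambda>i. snd (B i) \<le> R n"] that unfolding i_def by (simp add: not_le)
    ultimately have "stage B i n" by (simp add: stage_def)
    have "x \<notin> E n k (B i)" if k: "k < N n" for k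
    proof
      assume xE: "x \<in> E n k (B i)"
      obtain n2 where n2: "\<eta> * R n2 < w n k"
      proof -
        have "0 < w n k / (\<eta> * R0)" using w \<eta> R0 by simp
        moreover have "\<beta> < 1" using \<beta> by simp
        ultimately obtain n2 where "\<beta> ^ n2 < w n k / (\<eta> * R0)" using real_arch_pow_inv by blast
        then show ?thesis using that[of n2] \<eta> R0 by (simp add: R_def field_simps)
      qed
      obtain i2 where i2: "i \<le> i2" "snd (B i2) \<le> R n2" using small[of i n2] by blast
      have "snd (B i2) \<le> R0" using i2 R_antimono[of 0 n2] by (simp add: R_0)
      then obtain n3 where n3: "R (Suc n3) < snd (B i2)" "snd (B i2) \<le> R n3" using bracket[OF Bpos(1)] by blast
      have n23: "n2 \<le> n3"
      proof (rule ccontr)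
        assume "\<not> n2 \<le> n3"
        then have "R n2 \<le> R (Suc n3)" by (intro R_antimono) auto
        then show False using n3 i2 by simp
      qed
      have act: "(n, k) \<in> active B i2"
        using k Est_eq[OF \<open>stage B i n\<close> i2(1)] xE x[of i2] by (auto simp: active_def)
      have "w n k powr \<gamma> \<le> weight (active B i2)"
        unfolding weight_def using member_le_sum[OF act, of "\<lambda>(j, k). w j k powr \<gamma>"] finite_active[OF n3(1)]
        by (auto simp: split_beta)
      also have "\<dots> \<le> (\<eta> * R n3) powr \<gamma>" using invariant n3 by blast
      finally have "w n k \<le> \<eta> * R n3"
        using \<gamma>(1) w[of n k] R_pos[of n3] \<eta> by (meson linorder_not_le mult_pos_pos less_imp_le powr_less_mono2)
      also have "\<dots> \<le> \<eta> * R n2" using R_antimono[OF n23] \<eta> by simp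
      finally show False using n2 by simp
    qed
    then show ?thesis
      using \<open>stage B i n\<close> stage_lower[OF \<open>stage B i n\<close>] Bpos Bdist x by (intro exI[of _ "B i"]) (auto simp: stage_def)
  qed
  then show ?thesis using that x by blast
qed

end

lemma wins_\<tau>:
  assumes "\<And>x. x \<in> ball_of V (x0, \<rho>0) \<Longrightarrow> (\<And>n. \<exists>b. fst b \<in> V \<and> dist x0 (fst b) \<le> \<rho>0 \<and> R0 * \<beta> ^ Suc n < snd b \<and>
     snd b \<le> R0 * \<beta> ^ n \<and> x \<in> ball_of V b \<and> (\<forall>k<N n. x \<notin> E n k b)) \<Longrightarrow> x \<in> S"
  shows "wins V \<beta> S \<tau> (x0, \<rho>0)"
  unfolding wins_def
proof (intro allI impI)
  fix B assume B: "B 0 = (x0, \<rho>0)" "legal_play V \<beta> (\<tau> B) B" "(\<lambda>i. snd (B i)) \<longlonglongrightarrow> 0"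
  obtain x where x: "\<And>i. x \<in> ball_of V (B i)"
    "\<And>n. \<exists>b. fst b \<in> V \<and> dist x0 (fst b) \<le> \<rho>0 \<and> R (Suc n) < snd b \<and> snd b \<le> R n \<and> x \<in> ball_of V b \<and> (\<forall>k<N n. x \<notin> E n k b)"
    using outcome[OF B] by blast
  then have "x \<in> S" using assms[of x] x(1)[of 0] B(1) unfolding R_def by simp
  then show "\<exists>x\<in>S. \<forall>i. x \<in> ball_of V (B i)" using x by blast
qed

end

section \<open>A finite net of slabs and the constants that it determines\<close>

lemma exists_hyperplane_net:
  fixes V :: "'a::euclidean_space set"
  assumes V: "subspace V" "dim V > 0" and \<kappa>: "0 < \<kappa>"
  obtains F where "finite F" "F \<noteq> {}" "\<And>f. f \<in> F \<Longrightarrow> fst f \<in> V \<and> norm (fst f) = 1"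
    "\<And>m a. m \<in> V \<Longrightarrow> norm m = 1 \<Longrightarrow> \<bar>a::real\<bar> \<le> 2 \<Longrightarrow> \<exists>f\<in>F. norm (m - fst f) \<le> \<kappa> \<and> \<bar>a - snd f\<bar> \<le> \<kappa>"
proof -
  let ?S = "(V \<inter> sphere 0 1) \<times> {-2..2::real}"
  have "compact ?S"
    by (rule compact_Times[OF closed_Int_compact[OF closed_subspace[OF V(1)] compact_sphere] compact_Icc])
  then have sc: "seq_compact ?S" by (rule compact_imp_seq_compact)
  obtain F where F: "finite F" "F \<subseteq> ?S" "?S \<subseteq> (\<Union>x\<in>F. ball x \<kappa>)"
    using seq_compact_imp_totally_bounded[OF sc, rule_format, OF \<kappa>]
    by (elim exE conjE) (rule that)
  have near: "\<exists>f\<in>F. norm (m - fst f) \<le> \<kappa> \<and> \<bar>a - snd f\<bar> \<le> \<kappa>" if "m \<in> V" "norm m = 1" "\<bar>a\<bar> \<le> 2" for m a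
  proof -
    have "(m, a) \<in> ?S" using that by (auto simp: abs_le_iff)
    then have "(m, a) \<in> (\<Union>f\<in>F. ball f \<kappa>)" using F(3) by blast
    then obtain f where f: "f \<in> F" "dist f (m, a) < \<kappa>" unfolding UN_iff mem_ball by blast
    have "dist (fst f) m \<le> dist f (m, a)" "dist (snd f) a \<le> dist f (m, a)"
      using dist_fst_le[of f "(m, a)"] dist_snd_le[of f "(m, a)"] by auto
    then have "norm (m - fst f) \<le> \<kappa>" "\<bar>a - snd f\<bar> \<le> \<kappa>" using f(2)
      by (auto simp: dist_norm norm_minus_commute abs_minus_commute)
    then show ?thesis using f(1) by blast
  qed
  obtain n where "n \<in> V" "norm n = 1" using unit_vector_exists[OF V] .
  then have "F \<noteq> {}" using near[of n 0] by auto
  show ?thesis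
  proof (rule that[OF F(1) \<open>F \<noteq> {}\<close> _ near])
    fix f assume "f \<in> F"
    then have "f \<in> ?S" using F(2) by blast
    then show "fst f \<in> V \<and> norm (fst f) = 1" by (cases f) simp
  qed
qed

text \<open>The constants depend on \<open>V\<close> and \<open>\<beta>\<close> alone and are
  obtained before the scales, widths and sets, so that the cover of the dangerous points can be
  adapted to them.\<close>

lemma potential_strategy:
  fixes V :: "'a::euclidean_space set"
  assumes V: "subspace V" "dim V > 0" and \<beta>: "0 < \<beta>" "\<beta> < 1/3"
  obtains \<kappa> \<gamma> \<eta> where "0 < \<kappa>" "0 < \<gamma>" "0 < \<eta>"
    "\<And>R0 \<rho>0 x0 (N :: nat \<Rightarrow> nat) (w :: nat \<Rightarrow> nat \<Rightarrow> real) (E :: nat \<Rightarrow> nat \<Rightarrow> 'a \<times> real \<Rightarrow> 'a set) S. x0 \<in> V \<Longrightarrow> 0 < R0 \<Longrightarrow> R0 \<le> \<rho>0 \<Longrightarrow> (\<And>n k. 0 < w n k) \<Longrightarrow>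
      (\<And>n. (\<Sum>k<N n. w n k powr \<gamma>) \<le> (\<eta> * (R0 * \<beta> ^ n)) powr \<gamma>) \<Longrightarrow>
      (\<And>n k b y r. fst b \<in> V \<Longrightarrow> dist x0 (fst b) \<le> \<rho>0 \<Longrightarrow> R0 * \<beta> ^ Suc n < snd b \<Longrightarrow> snd b \<le> R0 * \<beta> ^ n \<Longrightarrow>
       y \<in> V \<Longrightarrow> dist x0 y \<le> \<rho>0 \<Longrightarrow> 0 < r \<Longrightarrow> r \<le> R0 \<Longrightarrow> w n k \<le> \<kappa> * r \<Longrightarrow>
       \<exists>m a. m \<in> V \<and> norm m = 1 \<and> (\<forall>z \<in> E n k b \<inter> ball_of V (y, r). \<bar>m \<bullet> z - a\<bar> \<le> \<kappa> * r)) \<Longrightarrow>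
      (\<And>x. x \<in> ball_of V (x0, \<rho>0) \<Longrightarrow> (\<And>n. \<exists>b. fst b \<in> V \<and> dist x0 (fst b) \<le> \<rho>0 \<and> R0 * \<beta> ^ Suc n < snd b \<and>
        snd b \<le> R0 * \<beta> ^ n \<and> x \<in> ball_of V b \<and> (\<forall>k<N n. x \<notin> E n k b)) \<Longrightarrow> x \<in> S) \<Longrightarrow>
      \<exists>\<tau>. strategy V \<tau> \<and> wins V \<beta> S \<tau> (x0, \<rho>0)"
proof -
  define \<kappa> where "\<kappa> = \<beta> / 4"
  have \<kappa>: "0 < \<kappa>" "4 * \<kappa> \<le> \<beta>" using \<beta> by (auto simp: \<kappa>_def)
  obtain F :: "('a \<times> real) set" where F: "finite F" "F \<noteq> {}" "\<And>f. f \<in> F \<Longrightarrow> fst f \<in> V \<and> norm (fst f) = 1"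
    "\<And>m a. m \<in> V \<Longrightarrow> norm m = 1 \<Longrightarrow> \<bar>a::real\<bar> \<le> 2 \<Longrightarrow> \<exists>f\<in>F. norm (m - fst f) \<le> \<kappa> \<and> \<bar>a - snd f\<bar> \<le> \<kappa>"
    using exists_hyperplane_net[OF V \<kappa>(1)] by blast
  define c where "c = real (card F)"
  have c: "1 \<le> c" using F by (simp add: c_def Suc_leI card_gt_0_iff)
  define \<theta> where "\<theta> = 1 - 1 / (2 * c)"
  have \<theta>: "0 < \<theta>" "\<theta> < 1" using c by (auto simp: \<theta>_def field_simps)
  \<comment> \<open>The solution of \<open>\<beta> powr \<gamma> = 1 - 1 / (2 * c)\<close>, which
    makes the condition on the exponent an equality.\<close>
  define \<gamma> where "\<gamma> = ln \<theta> / ln \<beta>"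
  have \<gamma>: "0 < \<gamma>" using \<theta> \<beta> by (simp add: \<gamma>_def divide_neg_neg)
  have \<beta>\<gamma>: "\<beta> powr \<gamma> = \<theta>" using \<beta> \<theta> by (simp add: powr_def \<gamma>_def)
  define \<eta>1 where "\<eta>1 = \<kappa> * \<beta>"
  \<comment> \<open>The extra factor becomes \<open>1 / (2 * c)\<close> after raising to the power
    \<open>\<gamma>\<close>, as the summability condition of the locale requires.\<close>
  define \<eta> where "\<eta> = \<eta>1 * (1 / (2 * c)) powr (1 / \<gamma>)"
  have \<eta>: "0 < \<eta>1" "0 < \<eta>" using \<kappa> \<beta> c by (auto simp: \<eta>1_def \<eta>_def)
  show ?thesis
  proof (rule that[OF \<kappa>(1) \<gamma> \<eta>(2)])
    fix R0 \<rho>0 :: real and x0 and N :: "nat \<Rightarrow> nat" and w :: "nat \<Rightarrow> nat \<Rightarrow> real"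
      and E :: "nat \<Rightarrow> nat \<Rightarrow> 'a \<times> real \<Rightarrow> 'a set" and S :: "'a set"
    assume a: "x0 \<in> V" "0 < R0" "R0 \<le> \<rho>0" "\<And>n k. 0 < w n k"
      and s: "\<And>n. (\<Sum>k<N n. w n k powr \<gamma>) \<le> (\<eta> * (R0 * \<beta> ^ n)) powr \<gamma>"
      and f: "\<And>n k b y r. fst b \<in> V \<Longrightarrow> dist x0 (fst b) \<le> \<rho>0 \<Longrightarrow> R0 * \<beta> ^ Suc n < snd b \<Longrightarrow> snd b \<le> R0 * \<beta> ^ n \<Longrightarrow>
       y \<in> V \<Longrightarrow> dist x0 y \<le> \<rho>0 \<Longrightarrow> 0 < r \<Longrightarrow> r \<le> R0 \<Longrightarrow> w n k \<le> \<kappa> * r \<Longrightarrow>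
       \<exists>m a. m \<in> V \<and> norm m = 1 \<and> (\<forall>z \<in> E n k b \<inter> ball_of V (y, r). \<bar>m \<bullet> z - a\<bar> \<le> \<kappa> * r)"
      and t: "\<And>x. x \<in> ball_of V (x0, \<rho>0) \<Longrightarrow> (\<And>n. \<exists>b. fst b \<in> V \<and> dist x0 (fst b) \<le> \<rho>0 \<and> R0 * \<beta> ^ Suc n < snd b \<and>
        snd b \<le> R0 * \<beta> ^ n \<and> x \<in> ball_of V b \<and> (\<forall>k<N n. x \<notin> E n k b)) \<Longrightarrow> x \<in> S"
    have s': "(\<Sum>k<N n. w n k powr \<gamma>) \<le> 1 / (2 * real (card F)) * (\<eta>1 * (R0 * \<beta> ^ n)) powr \<gamma>" for n
    proof -
      have "(\<eta> * (R0 * \<beta> ^ n)) = ((1 / (2 * c)) powr (1 / \<gamma>)) * (\<eta>1 * (R0 * \<beta> ^ n))" by (simp add: \<eta>_def)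
      then have "(\<eta> * (R0 * \<beta> ^ n)) powr \<gamma> = (1 / (2 * c)) * (\<eta>1 * (R0 * \<beta> ^ n)) powr \<gamma>"
        using \<gamma> c by (simp only: powr_mult powr_powr) simp
      then show ?thesis using s[of n] by (simp add: c_def)
    qed
    have g2: "1 - 1 / (2 * real (card F)) \<le> \<beta> powr \<gamma>" using \<beta>\<gamma> by (simp add: \<theta>_def c_def)
    have e2: "\<eta>1 \<le> \<kappa> * \<beta>" by (simp add: \<eta>1_def)
    interpret potential_game V \<beta> \<kappa> \<gamma> \<eta>1 R0 \<rho>0 x0 N w E F
      by (rule potential_game.intro[OF V \<beta> \<kappa> F \<gamma> g2 \<eta>(1) e2 a s' f])
    show "\<exists>\<tau>. strategy V \<tau> \<and> wins V \<beta> S \<tau> (x0, \<rho>0)"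
      using strategy_\<tau> wins_\<tau>[OF t] by blast
  qed
qed

section \<open>Normal form of a diagonalizable matrix\<close>

definition dg :: "real \<Rightarrow> real \<Rightarrow> real \<Rightarrow> real^3^3" where
  "dg a b c = vector [vector [a, 0, 0], vector [0, b, 0], vector [0, 0, c]]"

lemma matrix_inv_cancel:
  fixes P :: "'a::semiring_1^'n^'n"
  assumes "invertible P"
  shows "P ** matrix_inv P = mat 1" "matrix_inv P ** P = mat 1"
  using someI_ex[OF assms[unfolded invertible_def]] unfolding matrix_inv_def by auto

lemma dg_components [simp]:
  "dg a b c $ 1 $ 1 = a" "dg a b c $ 1 $ 2 = 0" "dg a b c $ 1 $ 3 = 0"
  "dg a b c $ 2 $ 1 = 0" "dg a b c $ 2 $ 2 = b" "dg a b c $ 2 $ 3 = 0"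
  "dg a b c $ 3 $ 1 = 0" "dg a b c $ 3 $ 2 = 0" "dg a b c $ 3 $ 3 = c"
  by (simp_all add: dg_def)

definition cols :: "real^3 \<Rightarrow> real^3 \<Rightarrow> real^3 \<Rightarrow> real^3^3" where
  "cols u v w = transpose (vector [u, v, w])"

lemma cols_components [simp]: "cols u v w $ i $ 1 = u $ i" "cols u v w $ i $ 2 = v $ i" "cols u v w $ i $ 3 = w $ i"
  by (simp_all add: cols_def transpose_def)

lemma det_cols: "det (cols u v w) = u \<bullet> cross3 v w"
  by (simp add: det_3 cross3_simps)

lemma det_cols_perm:
  "det (cols u w v) = - det (cols u v w)" "det (cols v u w) = - det (cols u v w)" "det (cols w v u) = - det (cols u v w)"
  "det (cols v w u) = det (cols u v w)" "det (cols w u v) = det (cols u v w)"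
  by (simp_all add: det_3 algebra_simps)

text \<open>The moduli of the eigenvalues go into the diagonal factor and their phases into
  \<open>K\<close>. As \<open>K\<close> is orthogonal and commutes with the diagonal factor, complex
  eigenvalues have no influence on growth.\<close>

definition normal_form :: "real^3^3 \<Rightarrow> real^3^3 \<Rightarrow> real \<Rightarrow> real \<Rightarrow> real \<Rightarrow> real^3^3 \<Rightarrow> bool" where
  "normal_form A P l1 l2 l3 K \<longleftrightarrow> det P \<noteq> 0 \<and> l2 \<le> l1 \<and> l3 \<le> l2 \<and> l1 + l2 + l3 = 0 \<and> orthogonal_matrix K \<and>
     dg (exp l1) (exp l2) (exp l3) ** K = K ** dg (exp l1) (exp l2) (exp l3) \<and>
     A ** P = P ** dg (exp l1) (exp l2) (exp l3) ** K"

lemma orthogonal_matrix_dg: "\<bar>a\<bar> = 1 \<Longrightarrow> \<bar>b\<bar> = 1 \<Longrightarrow> \<bar>c\<bar> = 1 \<Longrightarrow> orthogonal_matrix (dg a b c)"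
  unfolding orthogonal_matrix
  by (auto simp: vec_eq_iff forall_3 matrix_matrix_mult_def sum_3 transpose_def mat_def abs_if split: if_splits)

lemma normal_form_real:
  assumes det: "det A = 1" and P: "det (cols u v w) \<noteq> 0"
    and ev: "A *v u = a *\<^sub>R u" "A *v v = b *\<^sub>R v" "A *v w = c *\<^sub>R w"
    and ord: "\<bar>b\<bar> \<le> \<bar>a\<bar>" "\<bar>c\<bar> \<le> \<bar>b\<bar>"
  shows "\<exists>P l1 l2 l3 K. normal_form A P l1 l2 l3 K"
proof -
  let ?P = "cols u v w"
  have comp: "(A *v x) $ i = A $ i $ 1 * x $ 1 + A $ i $ 2 * x $ 2 + A $ i $ 3 * x $ 3" for x i
    by (simp add: matrix_vector_mult_def sum_3)
  have AP: "A ** ?P = ?P ** dg a b c"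
    using ev by (simp add: vec_eq_iff forall_3 matrix_matrix_mult_def sum_3 comp mult.commute)
  have "det (dg a b c) = a * b * c" by (simp add: det_3)
  then have "det A * det ?P = det ?P * (a * b * c)"
    using arg_cong[OF AP, of det] by (simp only: det_mul)
  then have abc: "a * b * c = 1" using det P by simp
  then have nz: "a \<noteq> 0" "b \<noteq> 0" "c \<noteq> 0" by auto
  have "ln \<bar>a\<bar> + ln \<bar>b\<bar> + ln \<bar>c\<bar> = ln \<bar>a * b * c\<bar>" using nz by (simp add: ln_mult abs_mult)
  then have s: "ln \<bar>a\<bar> + ln \<bar>b\<bar> + ln \<bar>c\<bar> = 0" by (simp add: abc)
  have sg: "\<bar>sgn a\<bar> = 1" "\<bar>sgn b\<bar> = 1" "\<bar>sgn c\<bar> = 1" using nz by (auto simp: abs_sgn_eq)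
  have D: "dg a b c = dg \<bar>a\<bar> \<bar>b\<bar> \<bar>c\<bar> ** dg (sgn a) (sgn b) (sgn c)"
    by (simp add: vec_eq_iff forall_3 matrix_matrix_mult_def sum_3 abs_mult_sgn)
  have "normal_form A ?P (ln \<bar>a\<bar>) (ln \<bar>b\<bar>) (ln \<bar>c\<bar>) (dg (sgn a) (sgn b) (sgn c))"
    unfolding normal_form_def
  proof (intro conjI)
    show "det ?P \<noteq> 0" by (rule P)
    show "ln \<bar>b\<bar> \<le> ln \<bar>a\<bar>" "ln \<bar>c\<bar> \<le> ln \<bar>b\<bar>" using ord nz by auto
    show "ln \<bar>a\<bar> + ln \<bar>b\<bar> + ln \<bar>c\<bar> = 0" by (rule s)
    show "orthogonal_matrix (dg (sgn a) (sgn b) (sgn c))" by (rule orthogonal_matrix_dg[OF sg])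
    show "dg (exp (ln \<bar>a\<bar>)) (exp (ln \<bar>b\<bar>)) (exp (ln \<bar>c\<bar>)) ** dg (sgn a) (sgn b) (sgn c) =
      dg (sgn a) (sgn b) (sgn c) ** dg (exp (ln \<bar>a\<bar>)) (exp (ln \<bar>b\<bar>)) (exp (ln \<bar>c\<bar>))"
      by (simp add: vec_eq_iff forall_3 matrix_matrix_mult_def sum_3)
    show "A ** ?P = ?P ** dg (exp (ln \<bar>a\<bar>)) (exp (ln \<bar>b\<bar>)) (exp (ln \<bar>c\<bar>)) ** dg (sgn a) (sgn b) (sgn c)"
      using AP nz by (simp add: matrix_mul_assoc[symmetric] D)
  qed
  then show ?thesis by blast
qed

text \<open>\<open>p\<close> and \<open>q\<close> span the plane of a conjugate pair of eigenvalues
  of modulus \<open>\<rho>\<close>, on which \<open>A\<close> is a rotation times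
  \<open>\<rho>\<close> in a suitable basis. The two cases place the double exponent after or before
  that of \<open>\<nu>\<close> to keep the order decreasing.\<close>

lemma normal_form_complex:
  assumes det: "det A = 1" and P: "det (cols r p q) \<noteq> 0" and y: "y \<noteq> 0"
    and ev: "A *v r = \<nu> *\<^sub>R r" "A *v p = x *\<^sub>R p - y *\<^sub>R q" "A *v q = y *\<^sub>R p + x *\<^sub>R q"
  shows "\<exists>P l1 l2 l3 K. normal_form A P l1 l2 l3 K"
proof -
  define \<rho> where "\<rho> = sqrt (x\<^sup>2 + y\<^sup>2)"
  have \<rho>2: "\<rho>\<^sup>2 = x\<^sup>2 + y\<^sup>2" by (simp add: \<rho>_def)
  have \<rho>: "0 < \<rho>" using y by (simp add: \<rho>_def sum_power2_gt_zero_iff)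
  define x' y' where "x' = x / \<rho>" and "y' = y / \<rho>"
  have x': "x = \<rho> * x'" "y = \<rho> * y'" using \<rho> by (auto simp: x'_def y'_def)
  have "x'\<^sup>2 + y'\<^sup>2 = (x\<^sup>2 + y\<^sup>2) / \<rho>\<^sup>2" by (simp add: x'_def y'_def power_divide add_divide_distrib)
  then have "x'\<^sup>2 + y'\<^sup>2 = 1" unfolding \<rho>2[symmetric] using \<rho> by simp
  then have one: "x' * x' + y' * y' = 1" by (simp add: power2_eq_square)
  have comp: "(A *v x) $ i = A $ i $ 1 * x $ 1 + A $ i $ 2 * x $ 2 + A $ i $ 3 * x $ 3" for x i
    by (simp add: matrix_vector_mult_def sum_3)
  define T where "T = (vector [vector [\<nu>, 0, 0], vector [0, x, y], vector [0, - y, x]] :: real^3^3)"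
  have AT: "A ** cols r p q = cols r p q ** T"
    using ev by (simp add: vec_eq_iff forall_3 matrix_matrix_mult_def sum_3 comp T_def mult.commute)
  have "det T = \<nu> * (x\<^sup>2 + y\<^sup>2)" by (simp add: det_3 T_def power2_eq_square algebra_simps)
  then have "det A * det (cols r p q) = det (cols r p q) * (\<nu> * (x\<^sup>2 + y\<^sup>2))"
    using arg_cong[OF AT, of det] by (simp only: det_mul)
  then have d: "\<nu> * \<rho>\<^sup>2 = 1" using det P \<rho>2 by simp
  then have \<nu>: "0 < \<nu>" using \<rho> by (metis zero_less_mult_pos2 zero_less_one zero_less_power)
  have "ln \<nu> + (ln \<rho> + ln \<rho>) = ln (\<nu> * \<rho>\<^sup>2)" using \<nu> \<rho> by (simp add: ln_mult power2_eq_square)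
  then have s: "ln \<nu> + ln \<rho> + ln \<rho> = 0" by (simp add: d)
  show ?thesis
  proof (cases "\<rho> \<le> \<nu>")
    case True
    let ?K = "vector [vector [1, 0, 0], vector [0, x', y'], vector [0, - y', x']] :: real^3^3"
    have "normal_form A (cols r p q) (ln \<nu>) (ln \<rho>) (ln \<rho>) ?K"
      unfolding normal_form_def
    proof (intro conjI)
      show "det (cols r p q) \<noteq> 0" by (rule P)
      show "ln \<rho> \<le> ln \<nu>" using True \<rho> by simp
      show "orthogonal_matrix ?K" unfolding orthogonal_matrix
        using one by (simp add: vec_eq_iff forall_3 matrix_matrix_mult_def sum_3 transpose_def mat_def add.commute)
      show "dg (exp (ln \<nu>)) (exp (ln \<rho>)) (exp (ln \<rho>)) ** ?K = ?K ** dg (exp (ln \<nu>)) (exp (ln \<rho>)) (exp (ln \<rho>))"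
        by (simp add: vec_eq_iff forall_3 matrix_matrix_mult_def sum_3)
      have "T = dg \<nu> \<rho> \<rho> ** ?K"
        by (simp add: vec_eq_iff forall_3 matrix_matrix_mult_def sum_3 T_def x')
      then show "A ** cols r p q = cols r p q ** dg (exp (ln \<nu>)) (exp (ln \<rho>)) (exp (ln \<rho>)) ** ?K"
        using AT \<nu> \<rho> by (simp add: matrix_mul_assoc[symmetric])
    qed (use s in auto)
    then show ?thesis by blast
  next
    case False
    let ?K = "vector [vector [x', y', 0], vector [- y', x', 0], vector [0, 0, 1]] :: real^3^3"
    let ?T = "vector [vector [x, y, 0], vector [- y, x, 0], vector [0, 0, \<nu>]] :: real^3^3"
    have AT': "A ** cols p q r = cols p q r ** ?T"
      using ev by (simp add: vec_eq_iff forall_3 matrix_matrix_mult_def sum_3 comp mult.commute)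
    have "normal_form A (cols p q r) (ln \<rho>) (ln \<rho>) (ln \<nu>) ?K"
      unfolding normal_form_def
    proof (intro conjI)
      show "det (cols p q r) \<noteq> 0" using P det_cols_perm(4)[of p q r] by simp
      show "ln \<nu> \<le> ln \<rho>" using False \<nu> by simp
      show "orthogonal_matrix ?K" unfolding orthogonal_matrix
        using one by (simp add: vec_eq_iff forall_3 matrix_matrix_mult_def sum_3 transpose_def mat_def add.commute)
      show "dg (exp (ln \<rho>)) (exp (ln \<rho>)) (exp (ln \<nu>)) ** ?K = ?K ** dg (exp (ln \<rho>)) (exp (ln \<rho>)) (exp (ln \<nu>))"
        by (simp add: vec_eq_iff forall_3 matrix_matrix_mult_def sum_3)
      have "?T = dg \<rho> \<rho> \<nu> ** ?K"
        by (simp add: vec_eq_iff forall_3 matrix_matrix_mult_def sum_3 x')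
      then show "A ** cols p q r = cols p q r ** dg (exp (ln \<rho>)) (exp (ln \<rho>)) (exp (ln \<nu>)) ** ?K"
        using AT' \<nu> \<rho> by (simp add: matrix_mul_assoc[symmetric])
    qed (use s in auto)
    then show ?thesis by blast
  qed
qed

lemma normal_form_real_unordered:
  assumes det: "det A = 1" and P: "det (cols u v w) \<noteq> 0"
    and ev: "A *v u = a *\<^sub>R u" "A *v v = b *\<^sub>R v" "A *v w = c *\<^sub>R w"
  shows "\<exists>P l1 l2 l3 K. normal_form A P l1 l2 l3 K"
proof -
  note N = normal_form_real[OF det]
  have perm: "det (cols u w v) \<noteq> 0" "det (cols v u w) \<noteq> 0" "det (cols w v u) \<noteq> 0" "det (cols v w u) \<noteq> 0" "det (cols w u v) \<noteq> 0"
    using P det_cols_perm[of u w v] det_cols_perm[of v u w] by auto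
  consider "\<bar>b\<bar> \<le> \<bar>a\<bar>" "\<bar>c\<bar> \<le> \<bar>b\<bar>" | "\<bar>c\<bar> \<le> \<bar>a\<bar>" "\<bar>b\<bar> \<le> \<bar>c\<bar>" | "\<bar>a\<bar> \<le> \<bar>b\<bar>" "\<bar>c\<bar> \<le> \<bar>a\<bar>"
    | "\<bar>c\<bar> \<le> \<bar>b\<bar>" "\<bar>a\<bar> \<le> \<bar>c\<bar>" | "\<bar>a\<bar> \<le> \<bar>c\<bar>" "\<bar>b\<bar> \<le> \<bar>a\<bar>" | "\<bar>b\<bar> \<le> \<bar>c\<bar>" "\<bar>a\<bar> \<le> \<bar>b\<bar>"
    by linarith
  then show ?thesis
  proof cases
    case 1 then show ?thesis by (rule N[OF P ev])
  next
    case 2 then show ?thesis by (rule N[OF perm(1) ev(1,3,2)])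
  next
    case 3 then show ?thesis by (rule N[OF perm(2) ev(2,1,3)])
  next
    case 4 then show ?thesis by (rule N[OF perm(4) ev(2,3,1)])
  next
    case 5 then show ?thesis by (rule N[OF perm(5) ev(3,1,2)])
  next
    case 6 then show ?thesis by (rule N[OF perm(3) ev(3,2,1)])
  qed
qed

lemma orthogonal_to_cross_imp_span:
  fixes p q r :: "real^3"
  assumes "r \<bullet> cross3 p q = 0" "cross3 p q \<noteq> 0"
  obtains \<alpha> \<beta> where "r = \<alpha> *\<^sub>R p + \<beta> *\<^sub>R q"
proof -
  let ?n = "cross3 p q"
  let ?w = "cross3 r ?n"
  have "(?n \<bullet> ?n) *\<^sub>R r = (r \<bullet> ?n) *\<^sub>R ?n + (p \<bullet> ?w) *\<^sub>R q - (q \<bullet> ?w) *\<^sub>R p"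
    by (simp add: cross3_simps forall_3)
  then have e: "(?n \<bullet> ?n) *\<^sub>R r = (p \<bullet> ?w) *\<^sub>R q - (q \<bullet> ?w) *\<^sub>R p" using assms(1) by simp
  have "r = (1 / (?n \<bullet> ?n)) *\<^sub>R ((?n \<bullet> ?n) *\<^sub>R r)" using assms(2) by simp
  also have "\<dots> = (- (q \<bullet> ?w) / (?n \<bullet> ?n)) *\<^sub>R p + ((p \<bullet> ?w) / (?n \<bullet> ?n)) *\<^sub>R q"
    unfolding e by (simp add: scaleR_diff_right)
  finally show ?thesis by (rule that)
qed

text \<open>With all eigenvalues real, real and imaginary parts of eigenvectors are again zero or
  eigenvectors. Otherwise the parts of one non-real eigenvector span an invariant plane; the
  remaining real eigenvector is not sought among the columns of \<open>P\<close> but obtained from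
  the normal of this plane.\<close>

lemma diagonalizable_normal_form:
  fixes A :: mat3
  assumes det: "det A = 1" and dia: "diagonalizable_over_C A"
  shows "\<exists>P l1 l2 l3 K. normal_form A P l1 l2 l3 K"
proof -
  obtain P D :: "complex^3^3" where P: "invertible P" and D: "\<And>i j. i \<noteq> j \<Longrightarrow> D $ i $ j = 0"
    and AP: "(\<chi> i j. complex_of_real (A $ i $ j)) = P ** D ** matrix_inv P"
    using dia unfolding diagonalizable_over_C_def by blast
  define X Y where "X j = (\<chi> i. Re (P $ i $ j))" and "Y j = (\<chi> i. Im (P $ i $ j))" for j :: 3
  define d where "d j = D $ j $ j" for j
  have "(\<chi> i j. complex_of_real (A $ i $ j)) ** P = P ** D"
    unfolding AP using P by (metis matrix_inv_cancel(2) matrix_mul_assoc matrix_mul_rid)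
  then have E: "(\<Sum>k\<in>UNIV. complex_of_real (A $ i $ k) * P $ k $ j) = P $ i $ j * d j" for i j
    using exhaust_3[of j] D by (auto simp: vec_eq_iff matrix_matrix_mult_def sum_3 d_def)
  have AX: "A *v X j = Re (d j) *\<^sub>R X j - Im (d j) *\<^sub>R Y j" for j
    unfolding vec_eq_iff
  proof
    fix i
    show "(A *v X j) $ i = (Re (d j) *\<^sub>R X j - Im (d j) *\<^sub>R Y j) $ i"
      using arg_cong[OF E[of i j], of Re] by (simp add: X_def Y_def matrix_vector_mult_def sum_3 mult.commute)
  qed
  have AY: "A *v Y j = Im (d j) *\<^sub>R X j + Re (d j) *\<^sub>R Y j" for j
    unfolding vec_eq_iff
  proof
    fix i
    show "(A *v Y j) $ i = (Im (d j) *\<^sub>R X j + Re (d j) *\<^sub>R Y j) $ i"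
      using arg_cong[OF E[of i j], of Im] by (simp add: X_def Y_def matrix_vector_mult_def sum_3 mult.commute)
  qed
  have detP: "det P \<noteq> 0" using P by (simp add: invertible_det_nz)
  show ?thesis
  proof (cases "\<forall>j. Im (d j) = 0")
    case True
    have evX: "A *v X j = Re (d j) *\<^sub>R X j" "A *v Y j = Re (d j) *\<^sub>R Y j" for j
      using AX[of j] AY[of j] True by auto
    \<comment> \<open>Expanding the determinant by multilinearity over the real and imaginary parts
      of the columns shows that some choice of one part from each column is a real basis.\<close>
    have R: "Re (det P) = det (cols (X 1) (X 2) (X 3)) - det (cols (X 1) (Y 2) (Y 3))
        - det (cols (Y 1) (X 2) (Y 3)) - det (cols (Y 1) (Y 2) (X 3))"
      by (simp add: det_3 X_def Y_def algebra_simps)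
    have I: "Im (det P) = det (cols (Y 1) (X 2) (X 3)) + det (cols (X 1) (Y 2) (X 3))
        + det (cols (X 1) (X 2) (Y 3)) - det (cols (Y 1) (Y 2) (Y 3))"
      by (simp add: det_3 X_def Y_def algebra_simps)
    have "\<exists>u\<in>{X 1, Y 1}. \<exists>v\<in>{X 2, Y 2}. \<exists>w\<in>{X 3, Y 3}. det (cols u v w) \<noteq> 0"
    proof (rule ccontr)
      assume "\<not> ?thesis"
      then have "Re (det P) = 0" "Im (det P) = 0" unfolding R I by auto
      then show False using detP by (simp add: complex_eq_iff)
    qed
    then obtain u v w where uvw: "u \<in> {X 1, Y 1}" "v \<in> {X 2, Y 2}" "w \<in> {X 3, Y 3}" "det (cols u v w) \<noteq> 0" by blast
    have "A *v u = Re (d 1) *\<^sub>R u" "A *v v = Re (d 2) *\<^sub>R v" "A *v w = Re (d 3) *\<^sub>R w" using uvw(1-3) evX by auto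
    then show ?thesis using normal_form_real_unordered[OF det uvw(4)] by blast
  next
    case False
    then obtain j where y: "Im (d j) \<noteq> 0" by blast
    define p q x y where "p = X j" and "q = Y j" and "x = Re (d j)" and "y = Im (d j)"
    have Ap: "A *v p = x *\<^sub>R p - y *\<^sub>R q" and Aq: "A *v q = y *\<^sub>R p + x *\<^sub>R q" and y0: "y \<noteq> 0"
      using AX[of j] AY[of j] y by (auto simp: p_def q_def x_def y_def)
    have nz: "p \<noteq> 0 \<or> q \<noteq> 0"
    proof (rule ccontr)
      assume "\<not> ?thesis"
      then have "column j P = 0" by (auto simp: p_def q_def X_def Y_def column_def vec_eq_iff complex_eq_iff)
      then show False using detP det_zero_column(2)[of j P] by simp
    qed
    \<comment> \<open>Applying \<open>A\<close> to a relation yields, as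
      \<open>y \<noteq> 0\<close>, the same relation rotated by a right angle; the two together
      annihilate \<open>p\<close> and \<open>q\<close>.\<close>
    have indep: "\<alpha> = 0 \<and> \<beta> = 0" if e: "\<alpha> *\<^sub>R p + \<beta> *\<^sub>R q = 0" for \<alpha> \<beta>
    proof (rule ccontr)
      assume n: "\<not> ?thesis"
      have "A *v (\<alpha> *\<^sub>R p + \<beta> *\<^sub>R q) = x *\<^sub>R (\<alpha> *\<^sub>R p + \<beta> *\<^sub>R q) + y *\<^sub>R (\<beta> *\<^sub>R p - \<alpha> *\<^sub>R q)"
        by (simp add: matrix_vector_right_distrib matrix_vector_mult_scaleR Ap Aq algebra_simps)
      then have "\<beta> *\<^sub>R p - \<alpha> *\<^sub>R q = 0" using e y0 by simp
      then have 1: "\<beta> *\<^sub>R p = \<alpha> *\<^sub>R q" by simp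
      have 2: "\<alpha> *\<^sub>R p = - \<beta> *\<^sub>R q" using e by (simp add: eq_neg_iff_add_eq_0)
      have "(\<alpha>\<^sup>2 + \<beta>\<^sup>2) *\<^sub>R p = \<alpha> *\<^sub>R (\<alpha> *\<^sub>R p) + \<beta> *\<^sub>R (\<beta> *\<^sub>R p)" by (simp add: power2_eq_square scaleR_add_left)
      then have p0: "(\<alpha>\<^sup>2 + \<beta>\<^sup>2) *\<^sub>R p = 0" unfolding 1 2 by (simp add: mult.commute)
      have "(\<alpha>\<^sup>2 + \<beta>\<^sup>2) *\<^sub>R q = \<alpha> *\<^sub>R (\<alpha> *\<^sub>R q) - \<beta> *\<^sub>R (- \<beta> *\<^sub>R q)" by (simp add: power2_eq_square scaleR_add_left)
      then have q0: "(\<alpha>\<^sup>2 + \<beta>\<^sup>2) *\<^sub>R q = 0" unfolding 1[symmetric] 2[symmetric] by (simp add: mult.commute)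
      have "\<alpha>\<^sup>2 + \<beta>\<^sup>2 \<noteq> 0" using n by (simp add: sum_power2_eq_zero_iff)
      then show False using p0 q0 nz by (metis scaleR_eq_0_iff)
    qed
    define n where "n = cross3 p q"
    have n0: "n \<noteq> 0"
    proof
      assume "n = 0"
      then have "p = 0 \<or> q = 0 \<or> (\<exists>c. q = c *\<^sub>R p)" by (simp add: n_def cross_eq_0 collinear_lemma)
      then show False using indep[of 1 0] indep[of 0 1] indep[of _ "-1"] by auto
    qed
    \<comment> \<open>The plane of \<open>p\<close> and \<open>q\<close> is invariant under
      \<open>A\<close>, so its normal is an eigenvector of the transpose, and its eigenvalue
      \<open>\<nu>\<close> is a real eigenvalue of \<open>A\<close> as well.\<close>
    define m where "m = transpose A *v n"
    have tr: "m \<bullet> z = n \<bullet> (A *v z)" for z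
      unfolding m_def by (metis dot_lmul_matrix transpose_matrix_vector)
    have pn: "n \<bullet> p = 0" "n \<bullet> q = 0" by (simp_all add: n_def dot_cross_self)
    have mp: "m \<bullet> p = 0" "m \<bullet> q = 0" using pn by (simp_all add: tr Ap Aq inner_diff_right inner_add_right)
    have "cross3 m n = 0"
    proof -
      have "cross3 m n = (m \<bullet> q) *\<^sub>R p - (m \<bullet> p) *\<^sub>R q" unfolding n_def by (simp add: cross3_simps forall_3)
      then show ?thesis using mp by simp
    qed
    then have "cross3 n m = 0" by (metis cross_skew neg_0_equal_iff_equal)
    then have "m = 0 \<or> (\<exists>c. m = c *\<^sub>R n)" using n0 by (simp add: cross_eq_0 collinear_lemma)
    then obtain \<nu> where \<nu>: "m = \<nu> *\<^sub>R n" by (metis scaleR_zero_left)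
    have "(transpose A - mat \<nu>) *v n = 0"
      using \<nu> unfolding m_def
      by (simp add: vec_eq_iff forall_3 matrix_vector_mult_def sum_3 mat_def algebra_simps)
    then have "\<not> invertible (transpose A - mat \<nu>)"
      using n0 by (metis invertible_def matrix_vector_mul_assoc matrix_vector_mul_lid matrix_vector_mult_0_right)
    then have "det (transpose A - mat \<nu>) = 0" by (simp add: invertible_det_nz)
    moreover have "transpose A - mat \<nu> = transpose (A - mat \<nu>)"
      by (simp add: vec_eq_iff transpose_def mat_def)
    ultimately have "det (A - mat \<nu>) = 0" by (simp add: det_transpose)
    then obtain r where r: "r \<noteq> 0" "(A - mat \<nu>) *v r = 0"
      using invertible_det_nz[of "A - mat \<nu>"] invertible_left_inverse[of "A - mat \<nu>"]
        matrix_left_invertible_ker[of "A - mat \<nu>"] by blast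
    then have Ar: "A *v r = \<nu> *\<^sub>R r"
      by (simp add: vec_eq_iff forall_3 matrix_vector_mult_def sum_3 mat_def algebra_simps)
    \<comment> \<open>On the plane of \<open>p\<close> and \<open>q\<close> the eigenvalues of
      \<open>A\<close> are not real, so a real eigenvector must lie outside it.\<close>
    have "r \<bullet> n \<noteq> 0"
    proof
      assume "r \<bullet> n = 0"
      then obtain \<alpha> \<beta> where ab: "r = \<alpha> *\<^sub>R p + \<beta> *\<^sub>R q" using orthogonal_to_cross_imp_span n0 unfolding n_def by blast
      have "A *v r - \<nu> *\<^sub>R r = (\<alpha> * x + \<beta> * y - \<nu> * \<alpha>) *\<^sub>R p + (\<beta> * x - \<alpha> * y - \<nu> * \<beta>) *\<^sub>R q"
        unfolding ab by (simp add: matrix_vector_right_distrib matrix_vector_mult_scaleR Ap Aq algebra_simps)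
      then have "(\<alpha> * x + \<beta> * y - \<nu> * \<alpha>) *\<^sub>R p + (\<beta> * x - \<alpha> * y - \<nu> * \<beta>) *\<^sub>R q = 0" using Ar by simp
      then have e: "\<alpha> * x + \<beta> * y - \<nu> * \<alpha> = 0" "\<beta> * x - \<alpha> * y - \<nu> * \<beta> = 0" using indep by blast+
      have "\<beta> * (\<alpha> * x + \<beta> * y - \<nu> * \<alpha>) - \<alpha> * (\<beta> * x - \<alpha> * y - \<nu> * \<beta>) = (\<alpha>\<^sup>2 + \<beta>\<^sup>2) * y"
        by (simp add: algebra_simps power2_eq_square)
      then have "(\<alpha>\<^sup>2 + \<beta>\<^sup>2) * y = 0" using e by simp
      then have "\<alpha> = 0 \<and> \<beta> = 0" using y0 by (simp add: sum_power2_eq_zero_iff)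
      then show False using ab r(1) by simp
    qed
    then have "det (cols r p q) \<noteq> 0" by (simp add: det_cols n_def)
    then show ?thesis using normal_form_complex[OF det _ y0 Ar Ap Aq] by blast
  qed
qed

section \<open>The expanding horospherical subgroup\<close>

lemma norm_column_transpose: "norm (transpose M) = norm (M :: real^3^3)"
proof -
  have "(norm (transpose M))\<^sup>2 = (norm M)\<^sup>2"
    by (simp add: power2_norm_eq_inner inner_vec_def transpose_def sum_3 algebra_simps)
  then show ?thesis by (simp add: power2_eq_iff_nonneg)
qed

lemma norm_orthogonal_mult_vec:
  fixes K :: "real^3^3"
  assumes "orthogonal_matrix K"
  shows "norm (K *v v) = norm v"
proof -
  have "(K *v v) \<bullet> (K *v v) = (transpose K *v (K *v v)) \<bullet> v"
    by (metis dot_lmul_matrix transpose_matrix_vector)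
  also have "\<dots> = v \<bullet> v" using assms by (simp add: matrix_vector_mul_assoc orthogonal_matrix)
  finally show ?thesis by (simp add: norm_eq)
qed

lemma norm_orthogonal_mult:
  fixes K M :: "real^3^3"
  assumes "orthogonal_matrix K"
  shows "norm (K ** M) = norm M" "norm (M ** K) = norm M"
proof -
  have l: "norm (K ** M) = norm M" if "orthogonal_matrix K" for K M :: "real^3^3"
  proof -
    have c: "column j (K ** M) = K *v column j M" for j
      by (simp add: column_def vec_eq_iff matrix_matrix_mult_def matrix_vector_mult_def)
    have "(norm (K ** M))\<^sup>2 = (norm M)\<^sup>2"
      unfolding norm_matrix3_columns c norm_orthogonal_mult_vec[OF that] ..
    then show ?thesis by (simp add: power2_eq_iff_nonneg)
  qed
  show "norm (K ** M) = norm M" by (rule l[OF assms])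
  have "norm (M ** K) = norm (transpose K ** transpose M)"
    by (metis matrix_transpose_mul norm_column_transpose)
  also have "\<dots> = norm M" using l[of "transpose K"] assms by (simp add: orthogonal_matrix_transpose norm_column_transpose)
  finally show "norm (M ** K) = norm M" .
qed

definition dgn :: "real \<Rightarrow> real \<Rightarrow> real \<Rightarrow> real \<Rightarrow> real^3^3" where
  "dgn l1 l2 l3 t = dg (exp (t * l1)) (exp (t * l2)) (exp (t * l3))"

lemma dg_mult: "dg a b c ** dg a' b' c' = dg (a * a') (b * b') (c * c')"
  by (simp add: vec_eq_iff forall_3 matrix_matrix_mult_def sum_3)

lemma dgn_add: "dgn l1 l2 l3 (s + t) = dgn l1 l2 l3 s ** dgn l1 l2 l3 t"
  by (simp add: dgn_def dg_mult exp_add[symmetric] algebra_simps)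

lemma dgn_0: "dgn l1 l2 l3 0 = mat 1"
  by (simp add: dgn_def vec_eq_iff forall_3 mat_def)

lemma dgn_commute:
  assumes "dg (exp l1) (exp l2) (exp l3) ** K = K ** dg (exp l1) (exp l2) (exp l3)"
  shows "dgn l1 l2 l3 t ** K = K ** dgn l1 l2 l3 t"
  using assms by (auto simp: dgn_def vec_eq_iff forall_3 matrix_matrix_mult_def sum_3 mult.commute)

text \<open>The normal form is taken at time 1 and yields all integer times with the same
  \<open>P\<close>. Other times differ from an integer by a bounded amount, and \<open>g\<close> is
  bounded on bounded intervals.\<close>

locale diag_flow =
  fixes g :: "real \<Rightarrow> mat3" and P Pi K :: mat3 and l1 l2 l3 :: real
  assumes g: "one_parameter_subgroup g" and nf: "normal_form (g 1) P l1 l2 l3 K" and Pi: "Pi ** P = mat 1"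
begin

abbreviation "a t \<equiv> dgn l1 l2 l3 t"

lemma l: "l2 \<le> l1" "l3 \<le> l2" "l1 + l2 + l3 = 0" using nf by (auto simp: normal_form_def)

lemma Pi': "P ** Pi = mat 1" using Pi matrix_left_right_inverse by blast

lemma g_add: "g (s + t) = g s ** g t" and g_SL: "det (g t) = 1" and g_cont: "continuous_on UNIV g"
  using g by (auto simp: one_parameter_subgroup_def SL3R_def)

lemma g_0: "g 0 = mat 1"
proof -
  have "g 0 ** g 0 = g 0" using g_add[of 0 0] by simp
  moreover obtain B where "B ** g 0 = mat 1"
    using g_SL[of 0] invertible_det_nz[of "g 0"] invertible_left_inverse[of "g 0"] by auto
  ultimately show ?thesis by (metis matrix_mul_assoc matrix_mul_lid)
qed

lemma g_minus: "g (- t) ** g t = mat 1" "g t ** g (- t) = mat 1"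
  using g_add[of "- t" t] g_add[of t "- t"] g_0 by simp_all

lemma matrix_inv_g: "matrix_inv (g t) = g (- t)"
proof -
  have "invertible (g t)" using g_SL[of t] by (simp add: invertible_det_nz)
  then have "matrix_inv (g t) ** g t = mat 1" by (rule matrix_inv_cancel)
  then show ?thesis by (metis g_minus(2) matrix_mul_assoc matrix_mul_lid matrix_mul_rid)
qed

lemma a_minus: "a (- t) ** a t = mat 1" "a t ** a (- t) = mat 1"
  using dgn_add[of l1 l2 l3 "- t" t] dgn_add[of l1 l2 l3 t "- t"] by (simp_all add: dgn_0)

lemma g_nat: "\<exists>Kn. orthogonal_matrix Kn \<and> g (real n) ** P = P ** a (real n) ** Kn \<and> (\<forall>t. a t ** Kn = Kn ** a t)"
proof (induction n)
  case 0
  show ?case by (intro exI[of _ "mat 1"]) (simp add: g_0 dgn_0 orthogonal_matrix_id)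
next
  case (Suc n)
  then obtain Kn where Kn: "orthogonal_matrix Kn" "g (real n) ** P = P ** a (real n) ** Kn" "\<And>t. a t ** Kn = Kn ** a t" by blast
  have K: "orthogonal_matrix K" "g 1 ** P = P ** a 1 ** K" "\<And>t. a t ** K = K ** a t"
    using nf dgn_commute[of l1 l2 l3 K] by (auto simp: normal_form_def dgn_def)
  have "g (real (Suc n)) ** P = g 1 ** (g (real n) ** P)"
    using g_add[of 1 "real n"] by (simp add: matrix_mul_assoc add.commute)
  also have "\<dots> = (g 1 ** P) ** a (real n) ** Kn" by (simp add: Kn(2) matrix_mul_assoc)
  also have "\<dots> = P ** a 1 ** (K ** a (real n)) ** Kn" by (simp add: K(2) matrix_mul_assoc)
  also have "\<dots> = P ** (a 1 ** a (real n)) ** (K ** Kn)" by (simp add: K(3)[symmetric] matrix_mul_assoc)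
  also have "\<dots> = P ** a (real (Suc n)) ** (K ** Kn)" by (simp add: dgn_add[symmetric] add.commute)
  finally have "g (real (Suc n)) ** P = P ** a (real (Suc n)) ** (K ** Kn)" .
  moreover have "a t ** (K ** Kn) = K ** Kn ** a t" for t by (metis K(3) Kn(3) matrix_mul_assoc)
  ultimately show ?case using orthogonal_matrix_mul[OF K(1) Kn(1)] by blast
qed

text \<open>At integer times, in the coordinates of \<open>P\<close>, conjugation by the flow is
  conjugation by the diagonal flow followed by an orthogonal one, which preserves the distance to
  the identity.\<close>

lemma conj_g_nat:
  obtains Kn where "orthogonal_matrix Kn"
    "Pi ** (g (- real n) ** h ** g (real n)) ** P = transpose Kn ** (a (- real n) ** (Pi ** h ** P) ** a (real n)) ** Kn"
proof -
  obtain Kn where Kn: "orthogonal_matrix Kn" "g (real n) ** P = P ** a (real n) ** Kn" using g_nat by blast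
  have KK: "transpose Kn ** Kn = mat 1" using Kn(1) by (simp add: orthogonal_matrix)
  have gn: "g (real n) = P ** a (real n) ** Kn ** Pi" using Kn(2) Pi' by (metis matrix_mul_assoc matrix_mul_rid)
  have "(transpose Kn ** a (- real n) ** Pi) ** g (real n) = transpose Kn ** a (- real n) ** (Pi ** P) ** a (real n) ** Kn ** Pi"
    unfolding gn by (simp add: matrix_mul_assoc)
  also have "\<dots> = transpose Kn ** (a (- real n) ** a (real n)) ** Kn ** Pi" by (simp add: Pi matrix_mul_assoc)
  also have "\<dots> = Pi" by (simp add: a_minus KK)
  finally have "Pi ** g (- real n) = transpose Kn ** a (- real n) ** Pi"
    using g_minus(2) by (metis matrix_mul_assoc matrix_mul_rid)
  then have "Pi ** (g (- real n) ** h ** g (real n)) ** P = (transpose Kn ** a (- real n) ** Pi) ** h ** (P ** a (real n) ** Kn)"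
    using Kn(2) by (metis matrix_mul_assoc)
  then show ?thesis using that[OF Kn(1)] by (simp add: matrix_mul_assoc)
qed

lemma conj_a_component: "(a (- t) ** M ** a t) $ i $ j = M $ i $ j * exp (t * ((vector [l1, l2, l3] :: real^3) $ j - (vector [l1, l2, l3] :: real^3) $ i))"
  using exhaust_3[of i] exhaust_3[of j]
  by (auto simp: dgn_def matrix_matrix_mult_def sum_3 right_diff_distrib exp_diff exp_minus divide_inverse)

text \<open>Conjugation multiplies an entry by the exponential of \<open>t\<close> times the
  exponent of its column minus that of its row. Off the diagonal only a strictly negative difference
  gives decay; hence the zeros for equal exponents.\<close>

definition hshape :: "mat3 \<Rightarrow> bool" where
  "hshape M \<longleftrightarrow> (\<exists>p r s. M = unip p r s \<and> (l1 = l2 \<longrightarrow> p = 0) \<and> (l2 = l3 \<longrightarrow> s = 0) \<and> (l1 = l3 \<longrightarrow> r = 0))"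

lemma norm_conj_bound: "\<exists>c>0. \<forall>(A::mat3) (M::mat3) (B::mat3). norm (A ** M ** B) \<le> c * norm A * norm B * norm M"
proof -
  obtain c where c: "c > 0" "\<forall>(A::mat3) (B::mat3). norm (A ** B) \<le> norm A * norm B * c"
    using bounded_bilinear.pos_bounded[OF bounded_bilinear_matrix_mult3] by blast
  have "norm (A ** M ** B) \<le> (c * c) * norm A * norm B * norm M" for A :: mat3 and M :: mat3 and B :: mat3
  proof -
    have "norm (A ** M ** B) \<le> norm (A ** M) * norm B * c" using c by blast
    also have "\<dots> \<le> (norm A * norm M * c) * norm B * c" using c by (intro mult_right_mono) auto
    finally show ?thesis by (simp add: mult_ac)
  qed
  then show ?thesis using c(1) by (intro exI[of _ "c * c"]) simp
qed

lemma tendsto_conj: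
  fixes A B :: mat3
  assumes "(Y \<longlongrightarrow> mat 1) F" "A ** B = mat 1"
  shows "((\<lambda>t. A ** Y t ** B) \<longlongrightarrow> (mat 1 :: mat3)) F"
proof -
  interpret mm: bounded_bilinear "(**) :: mat3 \<Rightarrow> mat3 \<Rightarrow> mat3" by (rule bounded_bilinear_matrix_mult3)
  have "((\<lambda>t. A ** Y t ** B) \<longlongrightarrow> A ** mat 1 ** B) F"
    by (rule mm.tendsto[OF mm.tendsto[OF tendsto_const assms(1)] tendsto_const])
  then show ?thesis using assms(2) by simp
qed

lemma conj_diff_1: "A ** B = mat 1 \<Longrightarrow> A ** M ** B - mat 1 = A ** (M - mat 1) ** (B :: mat3)"
proof -
  assume "A ** B = mat 1"
  interpret mm: bounded_bilinear "(**) :: mat3 \<Rightarrow> mat3 \<Rightarrow> mat3" by (rule bounded_bilinear_matrix_mult3)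
  show ?thesis using \<open>A ** B = mat 1\<close> by (simp add: mm.diff_left mm.diff_right)
qed

lemma expanding_imp_hshape:
  assumes h: "h \<in> expanding_horospherical g"
  shows "hshape (Pi ** h ** P)"
proof -
  define h' where "h' = Pi ** h ** P"
  have "((\<lambda>t. g (- t) ** h ** g t) \<longlongrightarrow> mat 1) at_top"
    using h by (simp add: expanding_horospherical_def matrix_inv_g)
  then have Y: "(\<lambda>n. g (- real n) ** h ** g (real n)) \<longlonglongrightarrow> mat 1"
    by (rule filterlim_compose[OF _ filterlim_real_sequentially])
  have X: "(\<lambda>n. a (- real n) ** h' ** a (real n)) \<longlonglongrightarrow> mat 1"
  proof (rule LIM_zero_cancel, rule Lim_null_comparison)
    show "(\<lambda>n. norm (Pi ** (g (- real n) ** h ** g (real n)) ** P - mat 1)) \<longlonglongrightarrow> 0"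
      using tendsto_conj[OF Y Pi] by (simp add: LIM_zero tendsto_norm_zero)
    show "\<forall>\<^sub>F n in sequentially. norm (a (- real n) ** h' ** a (real n) - mat 1)
       \<le> norm (Pi ** (g (- real n) ** h ** g (real n)) ** P - mat 1)"
    proof (intro always_eventually allI)
      fix n
      obtain Kn where Kn: "orthogonal_matrix Kn"
        "Pi ** (g (- real n) ** h ** g (real n)) ** P = transpose Kn ** (a (- real n) ** (Pi ** h ** P) ** a (real n)) ** Kn"
        by (rule conj_g_nat)
      have "norm (Pi ** (g (- real n) ** h ** g (real n)) ** P - mat 1) =
         norm (transpose Kn ** (a (- real n) ** h' ** a (real n) - mat 1) ** Kn)"
        unfolding Kn(2) h'_def[symmetric] using Kn(1) by (subst conj_diff_1) (auto simp: orthogonal_matrix)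
      also have "\<dots> = norm (a (- real n) ** h' ** a (real n) - mat 1)"
        using Kn(1) by (simp add: norm_orthogonal_mult orthogonal_matrix_transpose)
      finally show "norm (a (- real n) ** h' ** a (real n) - mat 1)
       \<le> norm (Pi ** (g (- real n) ** h ** g (real n)) ** P - mat 1)" by simp
    qed
  qed
  let ?l = "\<lambda>i. (vector [l1, l2, l3] :: real^3) $ i"
  have lim: "(\<lambda>n. h' $ i $ j * exp (real n * (?l j - ?l i))) \<longlonglongrightarrow> (if i = j then 1 else 0)" for i j
    using tendsto_vec_nth[OF tendsto_vec_nth[OF X, of i], of j] unfolding conj_a_component by (simp add: mat_def)
  have diag: "h' $ i $ i = 1" for i
    using lim[of i i] LIMSEQ_unique tendsto_const by (fastforce simp: LIMSEQ_const_iff)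
  have off: "h' $ i $ j = 0" if "i \<noteq> j" "?l i \<le> ?l j" for i j
  proof -
    have "(\<lambda>n. \<bar>h' $ i $ j * exp (real n * (?l j - ?l i))\<bar>) \<longlonglongrightarrow> 0"
      using tendsto_rabs[OF lim[of i j]] that by simp
    moreover have "\<bar>h' $ i $ j\<bar> \<le> \<bar>h' $ i $ j * exp (real n * (?l j - ?l i))\<bar>" for n
      using that mult_left_mono[of 1 "exp (real n * (?l j - ?l i))" "\<bar>h' $ i $ j\<bar>"] by (simp add: abs_mult)
    ultimately have "\<bar>h' $ i $ j\<bar> \<le> 0" by (intro LIMSEQ_le_const) auto
    then show ?thesis by simp
  qed
  have z: "h' $ 2 $ 1 = 0" "h' $ 3 $ 1 = 0" "h' $ 3 $ 2 = 0"
    using off[of 2 1] off[of 3 1] off[of 3 2] l by auto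
  have "h' = unip (h' $ 1 $ 2) (h' $ 1 $ 3) (h' $ 2 $ 3)"
    using z diag by (simp add: vec_eq_iff forall_3)
  moreover have "l1 = l2 \<longrightarrow> h' $ 1 $ 2 = 0" "l2 = l3 \<longrightarrow> h' $ 2 $ 3 = 0" "l1 = l3 \<longrightarrow> h' $ 1 $ 3 = 0"
    using off[of 1 2] off[of 2 3] off[of 1 3] by auto
  ultimately show ?thesis unfolding hshape_def h'_def by blast
qed

lemma g_bounded_unit: "\<exists>c>0. \<forall>s. \<bar>s\<bar> \<le> 1 \<longrightarrow> norm (g s) \<le> c"
proof -
  have "compact (g ` {-1..1})" using g_cont continuous_on_subset by (intro compact_continuous_image) auto
  then obtain c where "\<And>s. s \<in> {-1..1} \<Longrightarrow> norm (g s) \<le> c"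
    using compact_imp_bounded bounded_iff by (metis (no_types, lifting) imageI)
  then show ?thesis by (intro exI[of _ "max c 1"]) (auto simp: abs_le_iff le_max_iff_disj)
qed

lemma hshape_imp_expanding:
  assumes h: "hshape (Pi ** h ** P)"
  shows "h \<in> expanding_horospherical g"
proof -
  define h' where "h' = Pi ** h ** P"
  obtain p r s where prs: "h' = unip p r s" "l1 = l2 \<longrightarrow> p = 0" "l2 = l3 \<longrightarrow> s = 0" "l1 = l3 \<longrightarrow> r = 0"
    using h by (auto simp: hshape_def h'_def)
  have "det h' = 1" by (simp add: prs det_3)
  moreover have "det Pi * det P = 1" using arg_cong[OF Pi, of det] by (simp add: det_mul)
  moreover have "det h' = (det Pi * det P) * det h" by (simp add: h'_def det_mul)
  ultimately have hSL: "h \<in> SL3R" by (simp add: SL3R_def)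
  let ?l = "\<lambda>i. (vector [l1, l2, l3] :: real^3) $ i"
  have decay: "(\<lambda>n. c * exp (real n * (b - a))) \<longlonglongrightarrow> 0" if "b \<le> a" "a = b \<longrightarrow> c = 0" for a b c :: real
  proof (cases "a = b")
    case True
    then show ?thesis using that by simp
  next
    case False
    then have e: "exp (b - a) < 1" using that by simp
    have "(\<lambda>n. c * exp (b - a) ^ n) \<longlonglongrightarrow> c * 0"
      using e by (intro tendsto_intros LIMSEQ_power_zero) auto
    then show ?thesis by (simp add: exp_of_nat_mult)
  qed
  have X: "(\<lambda>n. a (- real n) ** h' ** a (real n)) \<longlonglongrightarrow> mat 1"
  proof (intro vec_tendstoI)
    fix i j
    show "(\<lambda>n. (a (- real n) ** h' ** a (real n)) $ i $ j) \<longlonglongrightarrow> mat 1 $ i $ j"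
      unfolding conj_a_component prs(1)
      using exhaust_3[of i] exhaust_3[of j] decay[of l2 l1 p] decay[of l3 l2 s] decay[of l3 l1 r] l prs(2-4)
      by (auto simp: mat_def)
  qed
  obtain c where c: "0 < c" "\<And>(A::mat3) (M::mat3) (B::mat3). norm (A ** M ** B) \<le> c * norm A * norm B * norm M" using norm_conj_bound by blast
  obtain k where k: "0 < k" "\<And>s. \<bar>s\<bar> \<le> 1 \<Longrightarrow> norm (g s) \<le> k" using g_bounded_unit by blast
  define x where "x n = norm (a (- real n) ** h' ** a (real n) - mat 1)" for n
  have x0: "x \<longlonglongrightarrow> 0" unfolding x_def using X by (simp add: LIM_zero tendsto_norm_zero)
  \<comment> \<open>Real times are split into an integer and a remainder below 1. The remainder
    conjugates by bounded matrices, so convergence along the integers suffices.\<close>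
  have bound: "norm (g (- t) ** h ** g t - mat 1) \<le> (c * k * k * (c * norm P * norm Pi)) * x (nat \<lfloor>t\<rfloor>)" if "t \<ge> 0" for t
  proof -
    define n where "n = nat \<lfloor>t\<rfloor>"
    define s where "s = t - real n"
    have "real n \<le> t" "t \<le> real n + 1" using that unfolding n_def by linarith+
    then have s: "\<bar>s\<bar> \<le> 1" "\<bar>- s\<bar> \<le> 1" by (simp_all add: s_def)
    have "g (- t) = g (- s) ** g (- real n)" "g t = g (real n) ** g s" by (simp_all add: g_add[symmetric] s_def)
    then have e: "g (- t) ** h ** g t = g (- s) ** (g (- real n) ** h ** g (real n)) ** g s" by (simp add: matrix_mul_assoc)
    obtain Kn where Kn: "orthogonal_matrix Kn"
      "Pi ** (g (- real n) ** h ** g (real n)) ** P = transpose Kn ** (a (- real n) ** h' ** a (real n)) ** Kn"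
      unfolding h'_def by (rule conj_g_nat)
    have "P ** (Pi ** (g (- real n) ** h ** g (real n)) ** P) ** Pi = g (- real n) ** h ** g (real n)"
      by (metis Pi' matrix_mul_assoc matrix_mul_lid matrix_mul_rid)
    then have e2: "g (- real n) ** h ** g (real n) = P ** (transpose Kn ** (a (- real n) ** h' ** a (real n)) ** Kn) ** Pi"
      using Kn(2) by simp
    have KK: "transpose Kn ** Kn = mat 1" using Kn(1) by (simp add: orthogonal_matrix)
    have "norm (g (- real n) ** h ** g (real n) - mat 1) \<le> c * norm P * norm Pi * x n"
    proof -
      have "norm (g (- real n) ** h ** g (real n) - mat 1) = norm (P ** (transpose Kn ** (a (- real n) ** h' ** a (real n)) ** Kn - mat 1) ** Pi)"
        unfolding e2 using conj_diff_1[OF Pi'] by simp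
      also have "\<dots> \<le> c * norm P * norm Pi * norm (transpose Kn ** (a (- real n) ** h' ** a (real n)) ** Kn - mat 1)" by (rule c)
      also have "norm (transpose Kn ** (a (- real n) ** h' ** a (real n)) ** Kn - mat 1) = x n"
        unfolding conj_diff_1[OF KK] x_def using Kn(1) by (simp add: norm_orthogonal_mult orthogonal_matrix_transpose)
      finally show ?thesis .
    qed
    then have *: "c * norm (g (- s)) * norm (g s) * norm (g (- real n) ** h ** g (real n) - mat 1)
        \<le> c * k * k * (c * norm P * norm Pi * x n)"
      using c(1) k s by (intro mult_mono) (auto intro!: mult_nonneg_nonneg simp: x_def)
    have "norm (g (- t) ** h ** g t - mat 1) = norm (g (- s) ** (g (- real n) ** h ** g (real n) - mat 1) ** g s)"
      unfolding e using conj_diff_1[OF g_minus(1)] by simp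
    also have "\<dots> \<le> c * norm (g (- s)) * norm (g s) * norm (g (- real n) ** h ** g (real n) - mat 1)" by (rule c)
    also note *
    finally show ?thesis by (simp add: n_def mult_ac)
  qed
  have "((\<lambda>t. g (- t) ** h ** g t) \<longlongrightarrow> mat 1) at_top"
  proof (rule LIM_zero_cancel, rule Lim_null_comparison)
    have "filterlim (\<lambda>t::real. nat \<lfloor>t\<rfloor>) sequentially at_top"
      by (rule filterlim_compose[OF filterlim_nat_sequentially filterlim_floor_sequentially])
    then have xl: "((\<lambda>t::real. x (nat \<lfloor>t\<rfloor>)) \<longlongrightarrow> 0) at_top" by (rule filterlim_compose[OF x0])
    show "((\<lambda>t::real. (c * k * k * (c * norm P * norm Pi)) * x (nat \<lfloor>t\<rfloor>)) \<longlongrightarrow> 0) at_top"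
      using tendsto_mult[OF tendsto_const xl, of "c * k * k * (c * norm P * norm Pi)"] by simp
    show "\<forall>\<^sub>F t in at_top. norm (g (- t) ** h ** g t - mat 1) \<le> (c * k * k * (c * norm P * norm Pi)) * x (nat \<lfloor>t\<rfloor>)"
      by (rule eventually_mono[OF eventually_ge_at_top[of "0::real"] bound])
  qed
  then show ?thesis using hSL by (simp add: expanding_horospherical_def matrix_inv_g)
qed

lemma expanding_iff: "h \<in> expanding_horospherical g \<longleftrightarrow> hshape (Pi ** h ** P)"
  using expanding_imp_hshape hshape_imp_expanding by blast

end

section \<open>Bounded orbits\<close>

text \<open>The cross products of the columns are the rows of the adjugate, which is integral and
  equals the inverse for determinant 1.\<close>

lemma SL3Z_inverse:
  assumes "\<gamma> \<in> SL3Z"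
  obtains \<gamma>' where "\<gamma>' \<in> SL3Z" "\<gamma> ** \<gamma>' = mat 1" "\<gamma>' ** \<gamma> = mat 1"
proof -
  define \<gamma>' :: mat3 where "\<gamma>' = vector [cross3 (column 2 \<gamma>) (column 3 \<gamma>), cross3 (column 3 \<gamma>) (column 1 \<gamma>), cross3 (column 1 \<gamma>) (column 2 \<gamma>)]"
  have det: "det \<gamma> = 1" and int: "\<And>i j. \<gamma> $ i $ j \<in> \<int>" using assms by (auto simp: SL3Z_def SL3R_def)
  have 1: "\<gamma>' ** \<gamma> = mat 1"
    using det by (simp add: vec_eq_iff forall_3 matrix_matrix_mult_def sum_3 mat_def \<gamma>'_def cross3_def column_def det_3 algebra_simps)
  then have "det \<gamma>' = 1" using arg_cong[OF 1, of det] det unfolding det_mul det_I by simp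
  moreover have "\<gamma>' $ i $ j \<in> \<int>" for i j
    using int exhaust_3[of i] exhaust_3[of j] by (auto simp: \<gamma>'_def cross3_def column_def intro!: Ints_diff Ints_mult)
  ultimately have "\<gamma>' \<in> SL3Z" by (simp add: SL3Z_def SL3R_def)
  then show ?thesis using that 1 matrix_left_right_inverse by blast
qed

lemma left_coset_mult_SL3Z:
  assumes "\<gamma> \<in> SL3Z"
  shows "left_coset (M ** \<gamma>) = left_coset M"
proof -
  obtain \<gamma>' where \<gamma>': "\<gamma>' \<in> SL3Z" "\<gamma> ** \<gamma>' = mat 1" using SL3Z_inverse[OF assms] by blast
  have "left_coset (M ** \<gamma>) \<subseteq> left_coset M"
    using SL3Z_mult[OF assms] by (auto simp: left_coset_def matrix_mul_assoc[symmetric])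
  moreover have "left_coset M \<subseteq> left_coset (M ** \<gamma>)"
  proof
    fix X assume "X \<in> left_coset M"
    then obtain c where c: "c \<in> SL3Z" "X = M ** c" by (auto simp: left_coset_def)
    then have "X = (M ** \<gamma>) ** (\<gamma>' ** c)" using \<gamma>'(2) by (metis matrix_mul_assoc matrix_mul_rid)
    then show "X \<in> left_coset (M ** \<gamma>)" using SL3Z_mult[OF \<gamma>'(1) c(1)] by (auto simp: left_coset_def)
  qed
  ultimately show ?thesis by blast
qed

lemma bounded_in_X3_of_norm_le:
  assumes "\<S> \<subseteq> left_coset ` (SL3R \<inter> cball 0 c)"
  shows "bounded_in_X3 \<S>"
proof -
  have "closed SL3R"
    unfolding SL3R_def by (intro closed_Collect_eq) (auto simp: det_3 intro!: continuous_intros)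
  then have "compact (SL3R \<inter> cball 0 c)" by (intro closed_Int_compact compact_cball)
  then have "compactin (top_of_set SL3R) (SL3R \<inter> cball 0 c)" by (simp add: compactin_subtopology)
  then have "compactin X3_topology (left_coset ` (SL3R \<inter> cball 0 c))"
    using image_compactin quotient_imp_continuous_map[OF quotient_map_left_coset] by blast
  then show ?thesis using assms unfolding bounded_in_X3_def by blast
qed

text \<open>One direction of Mahler's compactness criterion.\<close>

lemma bounded_in_X3_of_systole:
  assumes M: "\<M> \<subseteq> SL3R" and \<epsilon>: "0 < \<epsilon>"
    and sys: "\<And>M v. M \<in> \<M> \<Longrightarrow> integral_vec v \<Longrightarrow> v \<noteq> 0 \<Longrightarrow> \<epsilon> \<le> norm (M *v v)"
  shows "bounded_in_X3 (left_coset ` \<M>)"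
proof (rule bounded_in_X3_of_norm_le)
  define c where "c = sqrt (3 * (4 / \<epsilon>\<^sup>2)\<^sup>2)"
  show "left_coset ` \<M> \<subseteq> left_coset ` (SL3R \<inter> cball 0 c)"
  proof
    fix \<Lambda> assume "\<Lambda> \<in> left_coset ` \<M>"
    then obtain M where M1: "M \<in> \<M>" "\<Lambda> = left_coset M" by blast
    then have det: "det M = 1" using M by (auto simp: SL3R_def)
    obtain \<gamma> where \<gamma>: "\<gamma> \<in> SL3Z" and
      pr: "norm (column 1 (M ** \<gamma>)) * norm (column 2 (M ** \<gamma>)) * norm (column 3 (M ** \<gamma>)) \<le> 4"
      using exists_minimal_basis[of M] det by auto
    have "\<epsilon> \<le> norm (column i (M ** \<gamma>))" for i
    proof -
      have c: "column i (M ** \<gamma>) = M *v column i \<gamma>"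
        by (simp add: column_def vec_eq_iff matrix_matrix_mult_def matrix_vector_mult_def)
      have "integral_vec (column i \<gamma>)" using \<gamma> by (simp add: SL3Z_def column_def integral_vec_def)
      moreover have "column i \<gamma> \<noteq> 0"
      proof
        assume "column i \<gamma> = 0"
        then have "det \<gamma> = 0" using det_zero_column(2)[of i \<gamma>] by simp
        then show False using \<gamma> by (simp add: SL3Z_def SL3R_def)
      qed
      ultimately show ?thesis unfolding c by (rule sys[OF M1(1)])
    qed
    note low = this
    \<comment> \<open>Lower bounds for two factors of a bounded product give an upper bound for the
      third one.\<close>
    have up: "x \<le> 4 / \<epsilon>\<^sup>2" if "x * y * z \<le> 4" "\<epsilon> \<le> y" "\<epsilon> \<le> z" "0 \<le> x" for x y z :: real
    proof -
      have "x * (\<epsilon> * \<epsilon>) \<le> x * (y * z)" using that \<epsilon> by (intro mult_left_mono mult_mono) auto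
      then show ?thesis using that \<epsilon> by (simp add: pos_le_divide_eq power2_eq_square mult.assoc)
    qed
    have le: "norm (column i (M ** \<gamma>)) \<le> 4 / \<epsilon>\<^sup>2" for i
      using exhaust_3[of i] pr low
        up[of "norm (column 1 (M ** \<gamma>))" "norm (column 2 (M ** \<gamma>))" "norm (column 3 (M ** \<gamma>))"]
        up[of "norm (column 2 (M ** \<gamma>))" "norm (column 1 (M ** \<gamma>))" "norm (column 3 (M ** \<gamma>))"]
        up[of "norm (column 3 (M ** \<gamma>))" "norm (column 1 (M ** \<gamma>))" "norm (column 2 (M ** \<gamma>))"]
      by (auto simp: mult_ac)
    have "(norm (M ** \<gamma>))\<^sup>2 \<le> (\<Sum>j\<in>(UNIV::3 set). (4 / \<epsilon>\<^sup>2)\<^sup>2)"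
      unfolding norm_matrix3_columns by (intro sum_mono power_mono le) auto
    then have "norm (M ** \<gamma>) \<le> c" unfolding c_def by (intro real_le_rsqrt) simp
    moreover have "det (M ** \<gamma>) = 1" using det \<gamma> by (simp add: det_mul SL3Z_def SL3R_def)
    moreover have "\<Lambda> = left_coset (M ** \<gamma>)" using left_coset_mult_SL3Z[OF \<gamma>] M1 by simp
    ultimately show "\<Lambda> \<in> left_coset ` (SL3R \<inter> cball 0 c)" by (auto simp: SL3R_def)
  qed
qed

text \<open>A transference argument: some member of a reduced basis of the dual lattice has a
  nonzero, hence at least unit, integral pairing with \<open>v\<close>. That member is not long,
  because the other two are not short, so \<open>v\<close> cannot be short either.\<close>

lemma systole_of_dual:
  fixes M N :: "real^3^3"
  assumes det: "det N \<noteq> 0" and pair: "\<And>c v. (N *v c) \<bullet> (M *v v) = c \<bullet> v"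
    and \<epsilon>: "0 < \<epsilon>" and sys: "\<And>c. integral_vec c \<Longrightarrow> c \<noteq> 0 \<Longrightarrow> \<epsilon> \<le> norm (N *v c)"
    and v: "integral_vec v" "v \<noteq> 0"
  shows "\<epsilon>\<^sup>2 / (4 * \<bar>det N\<bar>) \<le> norm (M *v v)"
proof -
  obtain \<gamma> where \<gamma>: "\<gamma> \<in> SL3Z" and
    pr: "norm (column 1 (N ** \<gamma>)) * norm (column 2 (N ** \<gamma>)) * norm (column 3 (N ** \<gamma>)) \<le> 4 * \<bar>det N\<bar>"
    using exists_minimal_basis[OF det] .
  have c: "column i (N ** \<gamma>) = N *v column i \<gamma>" for i
    by (simp add: column_def vec_eq_iff matrix_matrix_mult_def matrix_vector_mult_def)
  have ci: "integral_vec (column i \<gamma>)" for i using \<gamma> by (simp add: SL3Z_def column_def integral_vec_def)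
  have low: "\<epsilon> \<le> norm (column i (N ** \<gamma>))" for i
  proof -
    have "column i \<gamma> \<noteq> 0"
    proof
      assume "column i \<gamma> = 0"
      then have "det \<gamma> = 0" using det_zero_column(2)[of i \<gamma>] by simp
      then show False using \<gamma> by (simp add: SL3Z_def SL3R_def)
    qed
    then show ?thesis unfolding c by (rule sys[OF ci])
  qed
  have "\<exists>i. column i \<gamma> \<bullet> v \<noteq> 0"
  proof (rule ccontr)
    assume "\<not> ?thesis"
    then have "transpose \<gamma> *v v = 0"
      by (simp add: vec_eq_iff matrix_vector_mult_def transpose_def inner_vec_def column_def)
    moreover obtain \<gamma>' where "\<gamma> ** \<gamma>' = mat 1" using SL3Z_inverse[OF \<gamma>] by blast
    then have "transpose \<gamma>' ** transpose \<gamma> = mat 1" by (metis matrix_transpose_mul transpose_mat)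
    ultimately show False using v(2) by (metis matrix_vector_mul_assoc matrix_vector_mul_lid matrix_vector_mult_0_right)
  qed
  then obtain i where i: "column i \<gamma> \<bullet> v \<noteq> 0" by blast
  have "column i \<gamma> \<bullet> v \<in> \<int>"
    using ci v(1) by (auto simp: inner_vec_def integral_vec_def intro!: Ints_sum Ints_mult)
  then have "1 \<le> \<bar>column i \<gamma> \<bullet> v\<bar>" using i by (rule Ints_nonzero_abs_ge1)
  also have "\<dots> = \<bar>column i (N ** \<gamma>) \<bullet> (M *v v)\<bar>" unfolding c pair ..
  also have "\<dots> \<le> norm (column i (N ** \<gamma>)) * norm (M *v v)" by (rule Cauchy_Schwarz_ineq2)
  finally have 1: "1 \<le> norm (column i (N ** \<gamma>)) * norm (M *v v)" .
  have up: "x * \<epsilon>\<^sup>2 \<le> 4 * \<bar>det N\<bar>" if "x * y * z \<le> 4 * \<bar>det N\<bar>" "\<epsilon> \<le> y" "\<epsilon> \<le> z" "0 \<le> x" for x y z :: real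
  proof -
    have "x * (\<epsilon> * \<epsilon>) \<le> x * (y * z)" using that \<epsilon> by (intro mult_left_mono mult_mono) auto
    then show ?thesis using that by (simp add: power2_eq_square mult.assoc)
  qed
  have le: "norm (column i (N ** \<gamma>)) * \<epsilon>\<^sup>2 \<le> 4 * \<bar>det N\<bar>"
    using exhaust_3[of i] pr low
      up[of "norm (column 1 (N ** \<gamma>))" "norm (column 2 (N ** \<gamma>))" "norm (column 3 (N ** \<gamma>))"]
      up[of "norm (column 2 (N ** \<gamma>))" "norm (column 1 (N ** \<gamma>))" "norm (column 3 (N ** \<gamma>))"]
      up[of "norm (column 3 (N ** \<gamma>))" "norm (column 1 (N ** \<gamma>))" "norm (column 2 (N ** \<gamma>))"]
    by (auto simp: mult_ac)
  have "\<epsilon>\<^sup>2 * 1 \<le> \<epsilon>\<^sup>2 * (norm (column i (N ** \<gamma>)) * norm (M *v v))" by (intro mult_left_mono 1) simp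
  also have "\<dots> = (norm (column i (N ** \<gamma>)) * \<epsilon>\<^sup>2) * norm (M *v v)" by (simp add: mult_ac)
  also have "\<dots> \<le> (4 * \<bar>det N\<bar>) * norm (M *v v)" using le by (intro mult_right_mono) auto
  finally show ?thesis using det by (simp add: pos_divide_le_eq mult.commute)
qed

context diag_flow
begin

text \<open>The hypothesis concerns integer times and the diagonal flow. The orthogonal factor does
  not change norms, and the remaining unit of time and the change of coordinates distort them by
  bounded factors.\<close>

lemma bounded_orbit_of_systole:
  assumes h: "h \<in> SL3R" and A0: "A0 \<in> SL3R" and \<epsilon>: "0 < \<epsilon>"
    and sys: "\<And>n v. integral_vec v \<Longrightarrow> v \<noteq> 0 \<Longrightarrow> \<epsilon> \<le> norm (a (real n) *v ((Pi ** h ** A0) *v v))"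
  shows "act h (left_coset A0) \<in> bounded_orbit_points (g ` {0..})"
proof -
  obtain c where c: "c > 0" "\<forall>(A::mat3) (v::real^3). norm (A *v v) \<le> norm A * norm v * c"
    using bounded_bilinear.pos_bounded[OF bounded_bilinear_matrix_vector_mult3] by blast
  obtain k where k: "0 < k" "\<And>s. \<bar>s\<bar> \<le> 1 \<Longrightarrow> norm (g s) \<le> k" using g_bounded_unit by blast
  define \<epsilon>' where "\<epsilon>' = \<epsilon> / (norm Pi * c) / (k * c)"
  have "Pi \<noteq> 0"
  proof
    assume "Pi = 0"
    then have "(Pi ** P) $ 1 $ 1 = 0" by (simp add: matrix_matrix_mult_def)
    then show False using Pi by (simp add: mat_def)
  qed
  then have Pi0: "0 < norm Pi" by simp
  have \<epsilon>': "0 < \<epsilon>'" using \<epsilon> c k Pi0 by (simp add: \<epsilon>'_def)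
  let ?M = "(\<lambda>t. g t ** h ** A0) ` {0..}"
  have "bounded_in_X3 (left_coset ` ?M)"
  proof (rule bounded_in_X3_of_systole[OF _ \<epsilon>'])
    show "?M \<subseteq> SL3R" using h A0 g_SL by (auto simp: SL3R_def det_mul)
    fix M v assume "M \<in> ?M" and v: "integral_vec v" "v \<noteq> (0::real^3)"
    then obtain t where t: "t \<ge> 0" "M = g t ** h ** A0" by auto
    define n where "n = nat \<lfloor>t\<rfloor>"
    define s where "s = real n - t"
    have "real n \<le> t" "t \<le> real n + 1" using t unfolding n_def by linarith+
    then have s: "\<bar>s\<bar> \<le> 1" by (simp add: s_def)
    obtain Kn where Kn: "orthogonal_matrix Kn" "g (real n) ** P = P ** a (real n) ** Kn" "\<And>t. a t ** Kn = Kn ** a t"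
      using g_nat by blast
    have "Pi ** g (real n) = Pi ** (g (real n) ** P) ** Pi" using Pi' by (metis matrix_mul_assoc matrix_mul_rid)
    also have "\<dots> = Kn ** a (real n) ** Pi" unfolding Kn(2) by (metis Kn(3) Pi matrix_mul_assoc matrix_mul_lid)
    finally have Pg: "Pi ** g (real n) = Kn ** a (real n) ** Pi" .
    have "g (real n) = g s ** g t" by (simp add: g_add[symmetric] s_def)
    then have "Pi *v (g s *v (M *v v)) = (Pi ** g (real n)) *v ((h ** A0) *v v)"
      by (simp add: t(2) matrix_vector_mul_assoc matrix_mul_assoc)
    also have "\<dots> = Kn *v (a (real n) *v ((Pi ** h ** A0) *v v))"
      unfolding Pg by (simp add: matrix_vector_mul_assoc matrix_mul_assoc)
    finally have "norm (Pi *v (g s *v (M *v v))) = norm (a (real n) *v ((Pi ** h ** A0) *v v))"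
      by (simp add: norm_orthogonal_mult_vec[OF Kn(1)])
    then have "\<epsilon> \<le> norm (Pi *v (g s *v (M *v v)))" using sys[OF v] by simp
    also have "\<dots> \<le> norm Pi * norm (g s *v (M *v v)) * c" using c by blast
    also have "\<dots> \<le> norm Pi * (norm (g s) * norm (M *v v) * c) * c"
      using c by (intro mult_right_mono mult_left_mono) auto
    also have "\<dots> \<le> norm Pi * (k * norm (M *v v) * c) * c"
      using c k(2)[OF s] by (intro mult_right_mono mult_left_mono) auto
    also have "\<dots> = norm (M *v v) * (k * c) * (norm Pi * c)" by simp
    finally have "\<epsilon> \<le> norm (M *v v) * (k * c) * (norm Pi * c)" .
    then show "\<epsilon>' \<le> norm (M *v v)"
      unfolding \<epsilon>'_def pos_divide_le_eq[OF mult_pos_pos[OF k(1) c(1)]] pos_divide_le_eq[OF mult_pos_pos[OF Pi0 c(1)]] .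
  qed
  moreover have "(\<lambda>A. act A (act h (left_coset A0))) ` g ` {0..} = left_coset ` ?M"
    by (simp add: act_left_coset image_image matrix_mul_assoc)
  moreover have "act h (left_coset A0) \<in> X3" using h A0 by (auto simp: act_left_coset X3_def SL3R_def det_mul)
  ultimately show ?thesis by (simp add: bounded_orbit_points_def)
qed

text \<open>The degenerate case of eigenvalues of modulus 1: nothing is contracted, and the systole
  of one fixed lattice bounds the whole orbit.\<close>

lemma orbit_points_trivial:
  assumes "l1 = 0" "l2 = 0" "l3 = 0"
  shows "expanding_horospherical g = {mat 1}"
    and "A0 \<in> SL3R \<Longrightarrow> act (mat 1) (left_coset A0) \<in> bounded_orbit_points (g ` {0..})"
proof -
  have hs: "hshape M \<longleftrightarrow> M = mat 1" for M
  proof -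
    have "unip 0 0 0 = mat 1" by (simp add: vec_eq_iff forall_3 mat_def)
    then show ?thesis unfolding hshape_def using assms by auto
  qed
  have "Pi ** h ** P = mat 1 \<longleftrightarrow> h = mat 1" for h
    by (metis Pi Pi' matrix_mul_assoc matrix_mul_lid matrix_mul_rid)
  then show "expanding_horospherical g = {mat 1}" using expanding_iff hs by auto
  assume A0: "A0 \<in> SL3R"
  have a1: "a t = mat 1" for t using assms by (simp add: dgn_def vec_eq_iff forall_3 mat_def)
  have detPi: "det Pi * det P = 1" using arg_cong[OF Pi, of det] by (simp add: det_mul)
  have "det (Pi ** A0) \<noteq> 0" using A0 detPi by (auto simp: det_mul SL3R_def)
  then obtain B where B: "B ** (Pi ** A0) = mat 1"
    using invertible_det_nz invertible_left_inverse by blast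
  obtain c where c: "c > 0" "\<forall>(A::mat3) (v::real^3). norm (A *v v) \<le> norm A * norm v * c"
    using bounded_bilinear.pos_bounded[OF bounded_bilinear_matrix_vector_mult3] by blast
  show "act (mat 1) (left_coset A0) \<in> bounded_orbit_points (g ` {0..})"
  proof (rule bounded_orbit_of_systole[where \<epsilon> = "1 / ((norm B + 1) * c)"])
    show "mat 1 \<in> SL3R" by (simp add: SL3R_def)
    show "A0 \<in> SL3R" by (rule A0)
    show "0 < 1 / ((norm B + 1) * c)" using c by (simp add: add_nonneg_pos)
    fix n and v :: "real^3" assume v: "integral_vec v" "v \<noteq> 0"
    obtain j where "v $ j \<noteq> 0" using v(2) by (auto simp: vec_eq_iff)
    then have "1 \<le> \<bar>v $ j\<bar>" using v(1) Ints_nonzero_abs_ge1 integral_vec_def by blast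
    also have "\<dots> \<le> norm v" by (rule component_le_norm_cart)
    also have "v = B *v ((Pi ** A0) *v v)" by (simp add: matrix_vector_mul_assoc B)
    then have "norm v \<le> norm B * norm ((Pi ** A0) *v v) * c" using c(2) by metis
    also have "\<dots> \<le> (norm B + 1) * norm ((Pi ** A0) *v v) * c"
      using c by (intro mult_right_mono) auto
    finally show "1 / ((norm B + 1) * c) \<le> norm (a (real n) *v ((Pi ** mat 1 ** A0) *v v))"
      using c by (simp add: a1 pos_divide_le_eq add_nonneg_pos mult_ac)
  qed
qed

end

section \<open>Charts\<close>

text \<open>The dual frame \<open>\<xi>1\<close>, \<open>\<xi>2\<close> of length at most
  \<open>M\<close> shows that the gradient along \<open>V\<close> has size at least
  \<open>G / M\<close>. So a bound \<open>G * \<delta>\<close> on the affine function confines the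
  points to a slab of half-width \<open>M * \<delta>\<close>.\<close>

lemma slab_of_affine_bound:
  fixes V Z :: "'a::euclidean_space set" and \<Lambda>1 \<Lambda>2 :: "'a \<Rightarrow> real"
  assumes V: "subspace V" and lin: "linear \<Lambda>1" "linear \<Lambda>2"
    and \<xi>: "\<xi>1 \<in> V" "\<xi>2 \<in> V" "norm \<xi>1 \<le> M" "norm \<xi>2 \<le> M"
      "\<Lambda>1 \<xi>1 = 1" "\<Lambda>2 \<xi>1 = 0" "\<Lambda>1 \<xi>2 = 0" "\<Lambda>2 \<xi>2 = 1"
    and G: "G = max \<bar>\<alpha>1\<bar> \<bar>\<alpha>2\<bar>" "0 < G" and y: "y \<in> V" and Z: "Z \<subseteq> V" and \<delta>: "0 \<le> \<delta>"
    and bound: "\<And>z. z \<in> Z \<Longrightarrow> \<bar>\<alpha>0 + \<alpha>1 * \<Lambda>1 (z - y) + \<alpha>2 * \<Lambda>2 (z - y)\<bar> \<le> G * \<delta>"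
  shows "\<exists>m a. m \<in> V \<and> norm m = 1 \<and> (\<forall>z\<in>Z. \<bar>m \<bullet> z - a\<bar> \<le> M * \<delta>)"
proof -
  define \<Phi> where "\<Phi> \<xi> = (\<alpha>1 * \<Lambda>1 \<xi> + \<alpha>2 * \<Lambda>2 \<xi>) / G" for \<xi>
  have lin': "linear \<Phi>" unfolding \<Phi>_def
    using lin by (intro linearI) (auto simp: linear_add linear_scale add_divide_distrib algebra_simps)
  \<comment> \<open>The vector representing \<open>\<Phi>\<close>; its orthogonal projection
    \<open>n\<close> to \<open>V\<close> represents the same functional there and is an admissible
    normal.\<close>
  define u where "u = adjoint \<Phi> 1"
  have u: "\<Phi> \<xi> = u \<bullet> \<xi>" for \<xi>
    using adjoint_works[OF lin', of \<xi> 1] by (simp add: u_def inner_commute)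
  obtain n w where nw: "n \<in> span V" "\<And>v. v \<in> span V \<Longrightarrow> orthogonal w v" "u = n + w"
    using orthogonal_subspace_decomp_exists[of V u] by blast
  have nV: "n \<in> V" using nw(1) V by (metis span_eq_iff)
  have n: "\<Phi> \<xi> = n \<bullet> \<xi>" if "\<xi> \<in> V" for \<xi>
    using nw(2)[of \<xi>] that by (simp add: u nw(3) inner_add_left orthogonal_def span_base)
  have Mpos: "0 < M"
  proof -
    have "\<xi>1 \<noteq> 0" using \<xi>(5) linear_0[OF lin(1)] by auto
    then show ?thesis using \<xi>(3) by (metis less_le_trans zero_less_norm_iff)
  qed
  have big: "1 \<le> M * norm n"
  proof -
    have "\<exists>\<xi>\<in>V. norm \<xi> \<le> M \<and> \<bar>\<Phi> \<xi>\<bar> = 1"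
    proof (cases "G = \<bar>\<alpha>1\<bar>")
      case True
      then show ?thesis using \<xi> G(2) by (intro bexI[of _ \<xi>1]) (auto simp: \<Phi>_def)
    next
      case False
      then have "G = \<bar>\<alpha>2\<bar>" using G(1) by (auto simp: max_def split: if_splits)
      then show ?thesis using \<xi> G(2) by (intro bexI[of _ \<xi>2]) (auto simp: \<Phi>_def)
    qed
    then obtain \<xi> where x: "\<xi> \<in> V" "norm \<xi> \<le> M" "\<bar>\<Phi> \<xi>\<bar> = 1" by blast
    have "1 = \<bar>n \<bullet> \<xi>\<bar>" using x n by simp
    also have "\<dots> \<le> norm n * norm \<xi>" by (rule Cauchy_Schwarz_ineq2)
    also have "\<dots> \<le> norm n * M" using x by (intro mult_left_mono) auto
    finally show ?thesis by (simp add: mult.commute)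
  qed
  then have n0: "0 < norm n" using Mpos by (metis mult_zero_right norm_ge_zero not_one_le_zero order_le_less)
  have "\<bar>(1 / norm n) * (n \<bullet> z - (n \<bullet> y - \<alpha>0 / G))\<bar> \<le> M * \<delta>" if "z \<in> Z" for z
  proof -
    have "n \<bullet> z - n \<bullet> y = \<Phi> (z - y)"
      using n[of "z - y"] that Z y V by (auto simp: subspace_diff inner_diff_right)
    then have "n \<bullet> z - (n \<bullet> y - \<alpha>0 / G) = (\<alpha>0 + \<alpha>1 * \<Lambda>1 (z - y) + \<alpha>2 * \<Lambda>2 (z - y)) / G"
      by (simp add: \<Phi>_def add_divide_distrib)
    then have "\<bar>n \<bullet> z - (n \<bullet> y - \<alpha>0 / G)\<bar> \<le> \<delta>"
      using bound[OF that] G(2) by (simp add: pos_divide_le_eq mult.commute)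
    then have "\<bar>(1 / norm n) * (n \<bullet> z - (n \<bullet> y - \<alpha>0 / G))\<bar> \<le> \<delta> / norm n"
      using n0 by (simp add: abs_mult divide_right_mono)
    also have "\<dots> \<le> M * \<delta>"
    proof -
      have "\<delta> * 1 \<le> \<delta> * (M * norm n)" using big \<delta> by (intro mult_left_mono) auto
      then show ?thesis using n0 by (simp add: pos_divide_le_eq mult_ac)
    qed
    finally show ?thesis .
  qed
  moreover have "((1 / norm n) *\<^sub>R n) \<bullet> z - (n \<bullet> y - \<alpha>0 / G) / norm n = (1 / norm n) * (n \<bullet> z - (n \<bullet> y - \<alpha>0 / G))" for z
    by (simp add: diff_divide_distrib)
  ultimately have "\<forall>z\<in>Z. \<bar>((1 / norm n) *\<^sub>R n) \<bullet> z - (n \<bullet> y - \<alpha>0 / G) / norm n\<bar> \<le> M * \<delta>"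
    by simp
  moreover have "(1 / norm n) *\<^sub>R n \<in> V" using nV V by (simp add: subspace_scale)
  moreover have "norm ((1 / norm n) *\<^sub>R n) = 1" using n0 by simp
  ultimately show ?thesis by blast
qed

text \<open>\<open>W\<close> is open in \<open>V\<close> only, so the derivative is tested along a
  short segment in the direction \<open>v\<close> and against the vectors normal to
  \<open>T\<close>.\<close>

lemma derivative_in_subspace:
  fixes V W :: "'a::euclidean_space set" and T :: "'b::euclidean_space set"
  assumes W: "openin (top_of_set V) W" and V: "subspace V" and T: "subspace T"
    and im: "\<And>x. x \<in> W \<Longrightarrow> \<psi> x - b \<in> T" and y: "y \<in> W"
    and D: "(\<psi> has_derivative D) (at y within W)" and v: "v \<in> V"
  shows "D v \<in> T"
proof -
  have yV: "y \<in> V" using W y openin_subset by fastforce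
  obtain e where e: "e > 0" "ball y e \<inter> V \<subseteq> W"
    using W y by (auto simp: openin_contains_ball)
  define \<delta> where "\<delta> = e / (norm v + 1)"
  have \<delta>: "\<delta> > 0" using e by (simp add: \<delta>_def add_nonneg_pos)
  have inW: "y + t *\<^sub>R v \<in> W" if "t \<in> ball 0 \<delta>" for t
  proof -
    have "\<bar>t\<bar> * (norm v + 1) < e" using that by (simp add: \<delta>_def pos_less_divide_eq add_nonneg_pos)
    moreover have "\<bar>t\<bar> * norm v \<le> \<bar>t\<bar> * (norm v + 1)" by (intro mult_left_mono) auto
    ultimately have "y + t *\<^sub>R v \<in> ball y e" by (simp add: dist_norm)
    moreover have "y + t *\<^sub>R v \<in> V" using V yV v by (simp add: subspace_add subspace_scale)
    ultimately show ?thesis using e by blast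
  qed
  have d1: "((\<lambda>t. y + t *\<^sub>R v) has_derivative (\<lambda>t. t *\<^sub>R v)) (at 0 within ball 0 \<delta>)"
    by (auto intro!: derivative_eq_intros)
  have d2: "(\<psi> has_derivative D) (at (y + 0 *\<^sub>R v) within (\<lambda>t. y + t *\<^sub>R v) ` ball 0 \<delta>)"
  proof -
    have "(\<lambda>t. y + t *\<^sub>R v) ` ball 0 \<delta> \<subseteq> W" using inW by blast
    from has_derivative_subset[OF D this] show ?thesis by simp
  qed
  have d3: "((\<lambda>t. \<psi> (y + t *\<^sub>R v)) has_derivative (\<lambda>t. D (t *\<^sub>R v))) (at 0 within ball 0 \<delta>)"
    using diff_chain_within[OF d1 d2] by (simp add: o_def)
  have "at (0::real) within ball 0 \<delta> = at 0" using \<delta> by (intro at_within_open) auto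
  with d3 have d4: "((\<lambda>t. \<psi> (y + t *\<^sub>R v)) has_derivative (\<lambda>t. D (t *\<^sub>R v))) (at 0)" by simp
  have orth: "w \<bullet> D v = 0" if w: "\<And>x. x \<in> T \<Longrightarrow> w \<bullet> x = 0" for w
  proof -
    have "((\<lambda>t. w \<bullet> (\<psi> (y + t *\<^sub>R v) - b)) has_derivative (\<lambda>t. w \<bullet> D (t *\<^sub>R v))) (at 0)"
      by (auto intro!: derivative_eq_intros d4)
    moreover have "((\<lambda>t. w \<bullet> (\<psi> (y + t *\<^sub>R v) - b)) has_derivative (\<lambda>t. 0)) (at 0)"
    proof (rule has_derivative_transform_within[OF has_derivative_const \<delta>])
      show "0 = w \<bullet> (\<psi> (y + t *\<^sub>R v) - b)" if "t \<in> UNIV" "dist t 0 < \<delta>" for t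
        using w[OF im[OF inW[of t]]] that by (simp add: dist_commute)
    qed simp
    ultimately have "(\<lambda>t. w \<bullet> D (t *\<^sub>R v)) = (\<lambda>t. 0)" by (rule has_derivative_unique)
    then have "w \<bullet> D (1 *\<^sub>R v) = 0" by (rule fun_cong)
    then show ?thesis by simp
  qed
  obtain p w where pw: "p \<in> span T" "\<And>x. x \<in> span T \<Longrightarrow> orthogonal w x" "D v = p + w"
    using orthogonal_subspace_decomp_exists[of T "D v"] by blast
  have pT: "p \<in> T" using pw(1) T by (metis span_eq_iff)
  have wT: "w \<bullet> x = 0" if "x \<in> T" for x using pw(2)[of x] that by (simp add: orthogonal_def span_base)
  have "w \<bullet> w = 0" using orth[OF wT] wT[OF pT] by (simp add: pw(3) inner_add_right)
  then show ?thesis using pw(3) pT by simp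
qed

text \<open>On a compact convex piece all constants are uniform: the Lipschitz constant, the modulus
  of differentiability and the norm of a right inverse of the derivative. Equality of dimensions
  makes the injective derivative onto \<open>T\<close>.\<close>

lemma C1_immersion_uniform:
  fixes V W :: "'a::euclidean_space set" and T :: "'b::euclidean_space set"
  assumes W: "openin (top_of_set V) W" and V: "subspace V" and T: "subspace T" and dim: "dim V = dim T"
    and im: "\<And>x. x \<in> W \<Longrightarrow> \<psi> x - b \<in> T" and C1: "C1_immersion_on V W \<psi>"
    and X: "compact X" "convex X" "X \<subseteq> W"
  obtains D L M where "\<And>y. y \<in> X \<Longrightarrow> linear (D y)" "0 \<le> L" "0 \<le> M"
    "\<And>x y. x \<in> X \<Longrightarrow> y \<in> X \<Longrightarrow> norm (\<psi> x - \<psi> y) \<le> L * norm (x - y)"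
    "\<And>\<omega>. 0 < \<omega> \<Longrightarrow> \<exists>r>0. \<forall>y\<in>X. \<forall>z\<in>X. norm (z - y) \<le> r \<longrightarrow> norm (\<psi> z - \<psi> y - D y (z - y)) \<le> \<omega> * norm (z - y)"
    "\<And>y e. y \<in> X \<Longrightarrow> e \<in> T \<Longrightarrow> \<exists>\<xi>\<in>V. D y \<xi> = e \<and> norm \<xi> \<le> M * norm e"
proof -
  obtain D0 where D0: "\<And>x. x \<in> W \<Longrightarrow> (\<psi> has_derivative D0 x) (at x within W)" "\<And>x. x \<in> W \<Longrightarrow> inj_on (D0 x) V"
    "\<And>v. v \<in> V \<Longrightarrow> continuous_on W (\<lambda>x. D0 x v)"
    using C1 unfolding C1_immersion_on_def by blast
  obtain Bs where Bs: "Bs \<subseteq> V" "pairwise orthogonal Bs" "\<And>x. x \<in> Bs \<Longrightarrow> norm x = 1" "independent Bs"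
      "card Bs = dim V" "span Bs = V"
    using orthonormal_basis_subspace[OF V] by blast
  have finB: "finite Bs" using Bs(4) independent_imp_finite by blast
  have WV: "W \<subseteq> V" using W openin_subset by fastforce
  \<comment> \<open>Continuity of the given derivative in the base point is known only on vectors of
    \<open>V\<close>. Composing with the orthogonal projection to \<open>V\<close> yields operators
    on the whole space whose norms are controlled by finitely many continuous functions.\<close>
  define D where "D y \<xi> = (\<Sum>c\<in>Bs. (\<xi> \<bullet> c) *\<^sub>R D0 y c)" for y \<xi>
  have linD: "linear (D y)" for y
    unfolding D_def by (intro linearI) (auto simp: inner_add_left sum.distrib scaleR_add_left scaleR_sum_right)
  have expand: "\<xi> = (\<Sum>c\<in>Bs. (\<xi> \<bullet> c) *\<^sub>R c)" if "\<xi> \<in> V" for \<xi>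
  proof -
    have "\<xi> \<in> range (\<lambda>u. \<Sum>c\<in>Bs. u c *\<^sub>R c)" using that Bs(6) span_finite[OF finB] by simp
    then obtain u where u: "\<xi> = (\<Sum>c\<in>Bs. u c *\<^sub>R c)" by blast
    have "\<xi> \<bullet> c = u c" if c: "c \<in> Bs" for c
    proof -
      have "\<xi> \<bullet> c = (\<Sum>d\<in>Bs. u d * (d \<bullet> c))" by (simp add: u inner_sum_left)
      also have "\<dots> = (\<Sum>d\<in>Bs. if d = c then u c else 0)"
      proof (rule sum.cong)
        fix d assume d: "d \<in> Bs"
        have "c \<bullet> c = 1" using Bs(3)[OF c] by (simp add: norm_eq_1)
        then show "u d * (d \<bullet> c) = (if d = c then u c else 0)"
          using Bs(2) c d by (auto simp: pairwise_def orthogonal_def)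
      qed simp
      finally show ?thesis using finB c by simp
    qed
    then show ?thesis using u by simp
  qed
  have DD0: "D y \<xi> = D0 y \<xi>" if "y \<in> W" "\<xi> \<in> V" for y \<xi>
  proof -
    have lin: "linear (D0 y)" using D0(1)[OF that(1)] has_derivative_linear by blast
    have "D0 y \<xi> = D0 y (\<Sum>c\<in>Bs. (\<xi> \<bullet> c) *\<^sub>R c)" using expand[OF that(2)] by simp
    also have "\<dots> = D y \<xi>" by (simp add: D_def linear_sum[OF lin] linear_scale[OF lin])
    finally show ?thesis by simp
  qed
  have der: "(\<psi> has_derivative D y) (at y within W)" if "y \<in> W" for y
    using D0(1)[OF that] that unfolding has_derivative_within
  proof (elim conjE, intro conjI)
    show "bounded_linear (D y)" using linD by (simp add: linear_conv_bounded_linear)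
    assume lim: "((\<lambda>x. (1 / norm (x - y)) *\<^sub>R (\<psi> x - (\<psi> y + D0 y (x - y)))) \<longlongrightarrow> 0) (at y within W)"
    show "((\<lambda>x. (1 / norm (x - y)) *\<^sub>R (\<psi> x - (\<psi> y + D y (x - y)))) \<longlongrightarrow> 0) (at y within W)"
    proof (rule Lim_transform_within[OF lim zero_less_one])
      fix x assume "x \<in> W"
      then have "x - y \<in> V" using subspace_diff[OF V, of x y] WV that by blast
      then show "(1 / norm (x - y)) *\<^sub>R (\<psi> x - (\<psi> y + D0 y (x - y))) = (1 / norm (x - y)) *\<^sub>R (\<psi> x - (\<psi> y + D y (x - y)))"
        using DD0[OF that] by simp
    qed
  qed
  have contB: "continuous_on X (\<lambda>x. D0 x c)" if "c \<in> Bs" for c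
    using D0(3)[of c] Bs(1) that X(3) continuous_on_subset by blast
  have onb: "onorm (\<lambda>\<xi>. \<Sum>c\<in>Bs. (\<xi> \<bullet> c) *\<^sub>R F c) \<le> (\<Sum>c\<in>Bs. norm (F c))" for F :: "'a \<Rightarrow> 'b"
  proof (rule onorm_bound)
    show "0 \<le> (\<Sum>c\<in>Bs. norm (F c))" by (intro sum_nonneg) auto
    fix \<xi> :: 'a
    have "norm (\<Sum>c\<in>Bs. (\<xi> \<bullet> c) *\<^sub>R F c) \<le> (\<Sum>c\<in>Bs. norm ((\<xi> \<bullet> c) *\<^sub>R F c))" by (rule norm_sum)
    also have "\<dots> \<le> (\<Sum>c\<in>Bs. norm \<xi> * norm (F c))"
    proof (rule sum_mono)
      fix c assume "c \<in> Bs"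
      then have "\<bar>\<xi> \<bullet> c\<bar> \<le> norm \<xi>" using Cauchy_Schwarz_ineq2[of \<xi> c] Bs(3) by simp
      then show "norm ((\<xi> \<bullet> c) *\<^sub>R F c) \<le> norm \<xi> * norm (F c)" by (simp add: mult_right_mono)
    qed
    finally show "norm (\<Sum>c\<in>Bs. (\<xi> \<bullet> c) *\<^sub>R F c) \<le> (\<Sum>c\<in>Bs. norm (F c)) * norm \<xi>"
      by (simp add: sum_distrib_left mult.commute)
  qed
  have "compact ((\<lambda>x. \<Sum>c\<in>Bs. norm (D0 x c)) ` X)"
    using contB by (intro compact_continuous_image X continuous_on_sum continuous_on_norm)
  then have "bounded ((\<lambda>x. \<Sum>c\<in>Bs. norm (D0 x c)) ` X)" by (rule compact_imp_bounded)
  then obtain L0 where L0': "\<forall>s\<in>(\<lambda>x. \<Sum>c\<in>Bs. norm (D0 x c)) ` X. \<bar>s\<bar> \<le> L0" unfolding bounded_real by blast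
  then have L0: "\<bar>\<Sum>c\<in>Bs. norm (D0 x c)\<bar> \<le> L0" if "x \<in> X" for x using that by blast
  define L where "L = max L0 0"
  have derX: "(\<psi> has_derivative D y) (at y within X)" if "y \<in> X" for y
    using der[of y] that X(3) has_derivative_subset by blast
  have lip: "norm (\<psi> x - \<psi> y) \<le> L * norm (x - y)" if "x \<in> X" "y \<in> X" for x y
  proof (rule differentiable_bound[OF X(2) derX _ that])
    show "onorm (D z) \<le> L" if "z \<in> X" for z
    proof -
      have "onorm (D z) \<le> (\<Sum>c\<in>Bs. norm (D0 z c))" unfolding D_def by (rule onb)
      then show ?thesis using L0[OF that] by (simp add: L_def)
    qed
  qed
  have unif: "\<exists>r>0. \<forall>y\<in>X. \<forall>z\<in>X. norm (z - y) \<le> r \<longrightarrow> norm (\<psi> z - \<psi> y - D y (z - y)) \<le> \<omega> * norm (z - y)"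
    if \<omega>: "0 < \<omega>" for \<omega>
  proof -
    define \<omega>' where "\<omega>' = \<omega> / (real (card Bs) + 1)"
    have \<omega>': "0 < \<omega>'" using \<omega> by (simp add: \<omega>'_def)
    have "\<exists>r>0. \<forall>y\<in>X. \<forall>z\<in>X. dist z y < r \<longrightarrow> dist (D0 z c) (D0 y c) < \<omega>'" if "c \<in> Bs" for c
      using compact_uniformly_continuous[OF contB[OF that] X(1)] \<omega>' unfolding uniformly_continuous_on_def by blast
    then obtain rr where rr: "\<And>c. c \<in> Bs \<Longrightarrow> rr c > 0"
      "\<And>c y z. c \<in> Bs \<Longrightarrow> y \<in> X \<Longrightarrow> z \<in> X \<Longrightarrow> dist z y < rr c \<Longrightarrow> dist (D0 z c) (D0 y c) < \<omega>'" by metis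
    define r where "r = Min (insert 1 (rr ` Bs)) / 2"
    have rpos: "0 < r" using finB rr(1) by (simp add: r_def)
    have rlt: "r < rr c" if "c \<in> Bs" for c
    proof -
      have "Min (insert 1 (rr ` Bs)) \<le> rr c" using finB that by (intro Min_le) auto
      then show ?thesis using rr(1)[OF that] by (simp add: r_def)
    qed
    have "norm (\<psi> z - \<psi> y - D y (z - y)) \<le> \<omega> * norm (z - y)" if yz: "y \<in> X" "z \<in> X" "norm (z - y) \<le> r" for y z
    proof -
      define S where "S = X \<inter> cball y r"
      have cS: "convex S" unfolding S_def by (intro convex_Int X(2) convex_cball)
      have yS: "y \<in> S" "z \<in> S" using yz rpos by (auto simp: S_def dist_norm norm_minus_commute)
      have "norm (\<psi> z - \<psi> y - D y (z - y)) \<le> norm (z - y) * \<omega>"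
      proof (rule differentiable_bound_linearization)
        show "y + t *\<^sub>R (z - y) \<in> S" if "t \<in> {0..1}" for t
        proof -
          have "y + t *\<^sub>R (z - y) = (1 - t) *\<^sub>R y + t *\<^sub>R z" by (simp add: algebra_simps)
          then show ?thesis using convexD[OF cS yS(1) yS(2), of "1 - t" t] that by simp
        qed
        show "(\<psi> has_derivative D x) (at x within S)" if "x \<in> S" for x
          using derX[of x] that by (auto simp: S_def intro: has_derivative_subset)
        show "y \<in> S" by (rule yS)
        fix x assume x: "x \<in> S"
        have "D x - D y = (\<lambda>\<xi>. \<Sum>c\<in>Bs. (\<xi> \<bullet> c) *\<^sub>R (D0 x c - D0 y c))"
          by (simp add: fun_eq_iff D_def sum_subtractf scaleR_diff_right)
        then have "onorm (D x - D y) \<le> (\<Sum>c\<in>Bs. norm (D0 x c - D0 y c))" using onb by simp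
        also have "\<dots> \<le> (\<Sum>c\<in>Bs. \<omega>')"
        proof (rule sum_mono)
          fix c assume c: "c \<in> Bs"
          have "dist x y < rr c" using x rlt[OF c] by (auto simp: S_def dist_commute)
          then show "norm (D0 x c - D0 y c) \<le> \<omega>'"
            using rr(2)[OF c, of y x] x yz by (simp add: S_def dist_norm)
        qed
        also have "\<dots> \<le> \<omega>" using \<omega> by (simp add: \<omega>'_def field_simps)
        finally show "onorm (D x - D y) \<le> \<omega>" .
      qed
      then show ?thesis by (simp add: mult.commute)
    qed
    then show ?thesis using rpos by blast
  qed
  have DT: "D y v \<in> T" if "y \<in> W" "v \<in> V" for y v
    using derivative_in_subspace[OF W V T im that(1) der[OF that(1)] that(2)] .
  have surj: "D y ` V = T" if y: "y \<in> W" for y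
  proof (rule subspace_dim_equal)
    show "subspace (D y ` V)" by (rule linear_subspace_image[OF linD V])
    have inj: "inj_on (D y) V" using D0(2)[OF y] DD0[OF y] by (metis inj_on_cong)
    then have "dim (D y ` V) = dim V"
      using dim_image_eq[OF linD, of y V] V by (metis span_eq_iff)
    then show "dim T \<le> dim (D y ` V)" using dim by simp
    show "D y ` V \<subseteq> T" using DT[OF y] by blast
  qed (rule T)
  \<comment> \<open>\<open>M\<close> is the reciprocal of the minimum of
    \<open>norm (D y \<xi>)\<close> over the compact set of base points and unit vectors of
    \<open>V\<close>.\<close>
  have "\<exists>M\<ge>0. \<forall>y\<in>X. \<forall>\<xi>\<in>V. norm \<xi> \<le> M * norm (D y \<xi>)"
  proof (cases "X \<times> (V \<inter> sphere 0 1) = {}")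
    case True
    have "norm \<xi> \<le> 0 * norm (D y \<xi>)" if "y \<in> X" "\<xi> \<in> V" for y \<xi>
    proof (rule ccontr)
      assume "\<not> ?thesis"
      then have "(1 / norm \<xi>) *\<^sub>R \<xi> \<in> V \<inter> sphere 0 1" using that V by (simp add: subspace_scale)
      then show False using True that by blast
    qed
    then show ?thesis by blast
  next
    case False
    let ?K = "X \<times> (V \<inter> sphere 0 1)"
    have cK: "compact ?K"
      by (rule compact_Times[OF X(1) closed_Int_compact[OF closed_subspace[OF V] compact_sphere]])
    have "continuous_on ?K (\<lambda>p. norm (D (fst p) (snd p)))"
      unfolding D_def
    proof (intro continuous_on_norm continuous_on_sum continuous_on_scaleR continuous_on_inner continuous_on_snd continuous_on_id continuous_on_const)
      fix c assume "c \<in> Bs"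
      then show "continuous_on ?K (\<lambda>p. D0 (fst p) c)"
        by (intro continuous_on_compose2[OF contB continuous_on_fst[OF continuous_on_id]]) auto
    qed
    then obtain p where p: "p \<in> ?K" "\<And>q. q \<in> ?K \<Longrightarrow> norm (D (fst p) (snd p)) \<le> norm (D (fst q) (snd q))"
      using continuous_attains_inf[OF cK False] by blast
    define \<mu> where "\<mu> = norm (D (fst p) (snd p))"
    have "\<mu> > 0"
    proof -
      have 1: "fst p \<in> W" "snd p \<in> V" "snd p \<noteq> 0" using p(1) X(3) by auto
      have "D0 (fst p) (snd p) \<noteq> D0 (fst p) 0"
        using D0(2)[OF 1(1)] 1 subspace_0[OF V] by (auto simp: inj_on_def)
      then have "D (fst p) (snd p) \<noteq> D (fst p) 0" using DD0 1 subspace_0[OF V] by simp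
      then show ?thesis by (simp add: \<mu>_def linear_0[OF linD])
    qed
    have "norm \<xi> \<le> (1 / \<mu>) * norm (D y \<xi>)" if "y \<in> X" "\<xi> \<in> V" for y \<xi>
    proof (cases "\<xi> = 0")
      case False
      have "\<mu> \<le> norm (D y ((1 / norm \<xi>) *\<^sub>R \<xi>))"
        using p(2)[of "(y, (1 / norm \<xi>) *\<^sub>R \<xi>)"] that False V by (simp add: \<mu>_def subspace_scale)
      also have "\<dots> = norm (D y \<xi>) / norm \<xi>" by (simp add: linear_scale[OF linD])
      finally show ?thesis using False \<open>\<mu> > 0\<close> by (simp add: field_simps)
    qed (use \<open>\<mu> > 0\<close> in simp)
    then show ?thesis using \<open>\<mu> > 0\<close> by (intro exI[of _ "1 / \<mu>"]) auto
  qed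
  then obtain M where M: "0 \<le> M" "\<And>y \<xi>. y \<in> X \<Longrightarrow> \<xi> \<in> V \<Longrightarrow> norm \<xi> \<le> M * norm (D y \<xi>)" by blast
  have "\<exists>\<xi>\<in>V. D y \<xi> = e \<and> norm \<xi> \<le> M * norm e" if "y \<in> X" "e \<in> T" for y e
  proof -
    have "e \<in> D y ` V" using surj[of y] that X(3) by blast
    then obtain \<xi> where "\<xi> \<in> V" "e = D y \<xi>" by blast
    then show ?thesis using M(2)[OF that(1)] by blast
  qed
  then show ?thesis
    using that[of D L M] linD lip unif M(1) by (auto simp: L_def)
qed

section \<open>Winning against a unipotent family\<close>

text \<open>On a small ball \<open>f\<close> is affine up to the width \<open>\<omega>\<close>, the
  linearization error and a quadratic term, all in units of the gradient. Shrinking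
  \<open>r0\<close> handles the last two, so \<open>Kf\<close> is independent of
  \<open>\<kappa>\<close>. This independence allows the radius to be fixed before the
  widths.\<close>

lemma flat_family:
  fixes V X :: "'a::euclidean_space set" and U1 U2 \<Lambda>1 \<Lambda>2 :: "'a \<Rightarrow> 'a \<Rightarrow> real"
    and f Gf \<alpha>0 \<alpha>1 \<alpha>2 :: "'a \<Rightarrow> 'c \<Rightarrow> real" and Q :: "'c set"
  assumes V: "subspace V" "dim V > 0" and X: "X \<subseteq> V"
    and lin: "\<And>y. y \<in> X \<Longrightarrow> linear (\<Lambda>1 y)" "\<And>y. y \<in> X \<Longrightarrow> linear (\<Lambda>2 y)"
    and approx: "\<And>\<omega>. 0 < \<omega> \<Longrightarrow> \<exists>r>0. \<forall>y\<in>X. \<forall>z\<in>X. norm (z - y) \<le> r \<longrightarrow>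
        \<bar>U1 z y - \<Lambda>1 y (z - y)\<bar> \<le> \<omega> * norm (z - y) \<and> \<bar>U2 z y - \<Lambda>2 y (z - y)\<bar> \<le> \<omega> * norm (z - y)"
    and \<xi>: "\<And>y. y \<in> X \<Longrightarrow> \<exists>\<xi>1\<in>V. \<exists>\<xi>2\<in>V. norm \<xi>1 \<le> M \<and> norm \<xi>2 \<le> M \<and>
        \<Lambda>1 y \<xi>1 = 1 \<and> \<Lambda>2 y \<xi>1 = 0 \<and> \<Lambda>1 y \<xi>2 = 0 \<and> \<Lambda>2 y \<xi>2 = 1"
    and M: "0 \<le> M" and q: "0 \<le> q"
    and Gf: "\<And>y c. y \<in> X \<Longrightarrow> Gf y c = max \<bar>\<alpha>1 y c\<bar> \<bar>\<alpha>2 y c\<bar>"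
    and err: "\<And>y z c. y \<in> X \<Longrightarrow> z \<in> X \<Longrightarrow>
        \<bar>f z c - (\<alpha>0 y c + \<alpha>1 y c * U1 z y + \<alpha>2 y c * U2 z y)\<bar> \<le> Gf y c * (q * (norm (z - y))\<^sup>2)"
    and Gz: "\<And>y z c. y \<in> X \<Longrightarrow> z \<in> X \<Longrightarrow> Gf z c \<le> Gf y c * (1 + q * norm (z - y))"
    and nz: "\<And>z c. z \<in> X \<Longrightarrow> c \<in> Q \<Longrightarrow> Gf z c = 0 \<Longrightarrow> f z c \<noteq> 0"
  shows "\<exists>Kf>0. \<forall>\<kappa>>0. \<exists>r0>0. \<forall>y\<in>X. \<forall>r c \<omega>. 0 < r \<longrightarrow> r \<le> r0 \<longrightarrow> c \<in> Q \<longrightarrow> 0 \<le> \<omega> \<longrightarrow> Kf * \<omega> \<le> \<kappa> * r \<longrightarrow>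
     (\<exists>m a. m \<in> V \<and> norm m = 1 \<and> (\<forall>z\<in>X \<inter> cball y r. \<bar>f z c\<bar> \<le> \<omega> * Gf z c \<longrightarrow> \<bar>m \<bullet> z - a\<bar> \<le> \<kappa> * r))"
proof -
  have main: "\<exists>r0>0. \<forall>y\<in>X. \<forall>r c \<omega>. 0 < r \<longrightarrow> r \<le> r0 \<longrightarrow> c \<in> Q \<longrightarrow> 0 \<le> \<omega> \<longrightarrow> (4 * M + 1) * \<omega> \<le> \<kappa> * r \<longrightarrow>
     (\<exists>m a. m \<in> V \<and> norm m = 1 \<and> (\<forall>z\<in>X \<inter> cball y r. \<bar>f z c\<bar> \<le> \<omega> * Gf z c \<longrightarrow> \<bar>m \<bullet> z - a\<bar> \<le> \<kappa> * r))"
    if \<kappa>: "0 < \<kappa>" for \<kappa>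
  proof -
  \<comment> \<open>Of the budget \<open>\<kappa> * r\<close>, one half goes to the width and one
    quarter each to the linearization and to the quadratic error.\<close>
  define \<omega>0 where "\<omega>0 = \<kappa> / (8 * (M + 1))"
  have \<omega>0: "0 < \<omega>0" using \<kappa> M by (simp add: \<omega>0_def)
  have \<omega>0M: "2 * M * \<omega>0 \<le> \<kappa> / 4"
  proof -
    have "2 * M * \<omega>0 \<le> 2 * (M + 1) * \<omega>0" using \<omega>0 by (intro mult_right_mono) auto
    also have "\<dots> = \<kappa> / 4" using M by (simp add: \<omega>0_def field_simps)
    finally show ?thesis .
  qed
  obtain r1 where r1: "r1 > 0" "\<And>y z. y \<in> X \<Longrightarrow> z \<in> X \<Longrightarrow> norm (z - y) \<le> r1 \<Longrightarrow>
        \<bar>U1 z y - \<Lambda>1 y (z - y)\<bar> \<le> \<omega>0 * norm (z - y) \<and> \<bar>U2 z y - \<Lambda>2 y (z - y)\<bar> \<le> \<omega>0 * norm (z - y)"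
    using approx[OF \<omega>0] by blast
  define r0 where "r0 = min r1 (min (1 / (q + 1)) (\<kappa> / (4 * (M + 1) * (q + 1))))"
  have r0: "0 < r0" "r0 \<le> r1" using r1 q M \<kappa> by (auto simp: r0_def)
  have qr: "q * r \<le> 1" "M * q * r \<le> \<kappa> / 4" if "0 < r" "r \<le> r0" for r
  proof -
    have "r \<le> 1 / (q + 1)" using that by (simp add: r0_def)
    then have "(q + 1) * r \<le> 1" using q by (simp add: pos_le_divide_eq mult.commute)
    then show "q * r \<le> 1" using that by (simp add: algebra_simps)
    have "r \<le> \<kappa> / (4 * (M + 1) * (q + 1))" using that by (simp add: r0_def)
    moreover have "0 < 4 * (M + 1) * (q + 1)" using q M by simp
    ultimately have "r * (4 * (M + 1) * (q + 1)) \<le> \<kappa>" by (simp only: pos_le_divide_eq)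
    moreover have "r * (4 * (M + 1) * (q + 1)) = 4 * ((M + 1) * (q + 1) * r)" by simp
    ultimately have "4 * ((M + 1) * (q + 1) * r) \<le> \<kappa>" by linarith
    moreover have "M * q * r \<le> (M + 1) * (q + 1) * r" using that M q by (intro mult_right_mono mult_mono) auto
    ultimately show "M * q * r \<le> \<kappa> / 4" by linarith
  qed
  have "\<exists>m a. m \<in> V \<and> norm m = 1 \<and> (\<forall>z\<in>X \<inter> cball y r. \<bar>f z c\<bar> \<le> \<omega> * Gf z c \<longrightarrow> \<bar>m \<bullet> z - a\<bar> \<le> \<kappa> * r)"
    if y: "y \<in> X" and r: "0 < r" "r \<le> r0" and c: "c \<in> Q" and \<omega>: "0 \<le> \<omega>" "(4 * M + 1) * \<omega> \<le> \<kappa> * r" for y r c \<omega>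
  proof (cases "Gf y c = 0")
    \<comment> \<open>A gradient vanishing at \<open>y\<close> vanishes on all of \<open>X\<close>,
      so no point satisfies the inequality and any slab will do.\<close>
    case True
    have "\<not> \<bar>f z c\<bar> \<le> \<omega> * Gf z c" if z: "z \<in> X" for z
    proof -
      have "Gf z c \<le> 0" using Gz[OF y z, of c] True by simp
      moreover have "0 \<le> Gf z c" using Gf[OF z, of c] by simp
      ultimately have "Gf z c = 0" by simp
      then show ?thesis using nz[OF z c] by simp
    qed
    moreover obtain m where "m \<in> V" "norm m = 1" using unit_vector_exists[OF V] .
    ultimately show ?thesis by blast
  next
    case False
    then have G0: "0 < Gf y c" using Gf[OF y, of c] by (simp add: max_def abs_if split: if_splits)
    define Z where "Z = {z \<in> X \<inter> cball y r. \<bar>f z c\<bar> \<le> \<omega> * Gf z c}"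
    define \<delta> where "\<delta> = 2 * \<omega> + 2 * \<omega>0 * r + q * r * r"
    obtain \<xi>1 \<xi>2 where x: "\<xi>1 \<in> V" "\<xi>2 \<in> V" "norm \<xi>1 \<le> M" "norm \<xi>2 \<le> M"
        "\<Lambda>1 y \<xi>1 = 1" "\<Lambda>2 y \<xi>1 = 0" "\<Lambda>1 y \<xi>2 = 0" "\<Lambda>2 y \<xi>2 = 1"
      using \<xi>[OF y] by blast
    have bound: "\<bar>\<alpha>0 y c + \<alpha>1 y c * \<Lambda>1 y (z - y) + \<alpha>2 y c * \<Lambda>2 y (z - y)\<bar> \<le> Gf y c * \<delta>" if "z \<in> Z" for z
    proof -
      have z: "z \<in> X" "norm (z - y) \<le> r" "\<bar>f z c\<bar> \<le> \<omega> * Gf z c"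
        using that by (auto simp: Z_def dist_norm norm_minus_commute)
      let ?d = "norm (z - y)"
      have \<alpha>: "\<bar>\<alpha>1 y c\<bar> \<le> Gf y c" "\<bar>\<alpha>2 y c\<bar> \<le> Gf y c" using Gf[OF y, of c] by auto
      have u: "\<bar>U1 z y - \<Lambda>1 y (z - y)\<bar> \<le> \<omega>0 * r" "\<bar>U2 z y - \<Lambda>2 y (z - y)\<bar> \<le> \<omega>0 * r"
      proof -
        have "?d \<le> r1" using z(2) r r0 by linarith
        moreover have "\<omega>0 * ?d \<le> \<omega>0 * r" using z(2) \<omega>0 by (intro mult_left_mono) auto
        ultimately show "\<bar>U1 z y - \<Lambda>1 y (z - y)\<bar> \<le> \<omega>0 * r" "\<bar>U2 z y - \<Lambda>2 y (z - y)\<bar> \<le> \<omega>0 * r"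
          using r1(2)[OF y z(1)] by linarith+
      qed
      have p1: "\<bar>\<alpha>1 y c * (U1 z y - \<Lambda>1 y (z - y))\<bar> \<le> Gf y c * (\<omega>0 * r)"
        unfolding abs_mult using \<alpha> u G0 by (intro mult_mono) auto
      have p2: "\<bar>\<alpha>2 y c * (U2 z y - \<Lambda>2 y (z - y))\<bar> \<le> Gf y c * (\<omega>0 * r)"
        unfolding abs_mult using \<alpha> u G0 by (intro mult_mono) auto
      have "q * ?d \<le> q * r" using z(2) q by (intro mult_left_mono) auto
      then have "1 + q * ?d \<le> 2" using qr(1)[OF r] by simp
      then have "Gf z c \<le> Gf y c * 2" using Gz[OF y z(1), of c] G0 by (meson mult_left_mono less_imp_le order_trans)
      then have "\<omega> * Gf z c \<le> \<omega> * (Gf y c * 2)" using \<omega> by (intro mult_left_mono) auto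
      then have f1: "\<bar>f z c\<bar> \<le> Gf y c * (2 * \<omega>)" using z(3) by (simp add: mult_ac)
      have "Gf y c * (q * ?d\<^sup>2) \<le> Gf y c * (q * r\<^sup>2)"
        using z(2) q G0 r by (intro mult_left_mono power_mono) auto
      then have f2: "\<bar>f z c - (\<alpha>0 y c + \<alpha>1 y c * U1 z y + \<alpha>2 y c * U2 z y)\<bar> \<le> Gf y c * (q * r * r)"
        using err[OF y z(1), of c] by (simp add: power2_eq_square mult_ac)
      have "\<alpha>0 y c + \<alpha>1 y c * \<Lambda>1 y (z - y) + \<alpha>2 y c * \<Lambda>2 y (z - y) =
        f z c - (f z c - (\<alpha>0 y c + \<alpha>1 y c * U1 z y + \<alpha>2 y c * U2 z y))
        - \<alpha>1 y c * (U1 z y - \<Lambda>1 y (z - y)) - \<alpha>2 y c * (U2 z y - \<Lambda>2 y (z - y))"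
        by (simp add: algebra_simps)
      then have "\<bar>\<alpha>0 y c + \<alpha>1 y c * \<Lambda>1 y (z - y) + \<alpha>2 y c * \<Lambda>2 y (z - y)\<bar> \<le>
        Gf y c * (2 * \<omega>) + Gf y c * (q * r * r) + Gf y c * (\<omega>0 * r) + Gf y c * (\<omega>0 * r)"
        using f1 f2 p1 p2 by linarith
      also have "\<dots> = Gf y c * \<delta>" by (simp add: \<delta>_def algebra_simps)
      finally show ?thesis .
    qed
    have \<delta>0: "0 \<le> \<delta>" using \<omega> \<omega>0 r q by (simp add: \<delta>_def)
    have ZV: "Z \<subseteq> V" "y \<in> V" using X y by (auto simp: Z_def)
    obtain m a where ma: "m \<in> V" "norm m = 1" "\<And>z. z \<in> Z \<Longrightarrow> \<bar>m \<bullet> z - a\<bar> \<le> M * \<delta>"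
      using slab_of_affine_bound[OF V(1) lin(1)[OF y] lin(2)[OF y] x Gf[OF y, of c] G0 ZV(2,1) \<delta>0 bound] by blast
    have "M * \<delta> \<le> \<kappa> * r"
    proof -
      have "M * \<delta> = 2 * M * \<omega> + (2 * M * \<omega>0) * r + (M * q * r) * r" by (simp add: \<delta>_def algebra_simps)
      also have "\<dots> \<le> \<kappa> * r / 2 + \<kappa> / 4 * r + \<kappa> / 4 * r"
      proof (intro add_mono mult_right_mono \<omega>0M qr(2)[OF r])
        have "4 * M * \<omega> \<le> (4 * M + 1) * \<omega>" using \<omega> by (intro mult_right_mono) auto
        then show "2 * M * \<omega> \<le> \<kappa> * r / 2" using \<omega> by linarith
      qed (use r in auto)
      also have "\<dots> = \<kappa> * r" by simp
      finally show ?thesis .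
    qed
    then have "\<forall>z\<in>X \<inter> cball y r. \<bar>f z c\<bar> \<le> \<omega> * Gf z c \<longrightarrow> \<bar>m \<bullet> z - a\<bar> \<le> \<kappa> * r"
      using ma(3) by (force simp: Z_def)
    then show ?thesis using ma by blast
  qed
  then show ?thesis using r0(1) by blast
  qed
  have "0 < 4 * M + 1" using M by simp
  then show ?thesis using main by blast
qed

text \<open>Flatness supplies the radius \<open>R0\<close> from which the scales start. The
  potential game is played with the widths multiplied by \<open>Kf\<close>, so the cover is
  requested with \<open>\<eta> / Kf\<close>.\<close>

lemma family_strategy:
  fixes V :: "'a::euclidean_space set" and B Bi :: "'a \<Rightarrow> real^3^3"
  assumes V: "subspace V" "dim V > 0" and \<beta>: "0 < \<beta>" "\<beta> < 1/3" and x0: "x0 \<in> V" "0 < \<rho>0"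
    and fam: "unipotent_family (ball_of V (x0, \<rho>0)) B Bi D0 L bd m1 m2"
    and flat: "\<exists>Kf>0. \<forall>\<kappa>>0. \<exists>r0>0. \<forall>y\<in>ball_of V (x0, \<rho>0). \<forall>r c \<omega>. 0 < r \<longrightarrow> r \<le> r0 \<longrightarrow>
      c \<in> {c. integral_vec c \<and> c \<noteq> 0} \<longrightarrow> 0 \<le> \<omega> \<longrightarrow> Kf * \<omega> \<le> \<kappa> * r \<longrightarrow>
     (\<exists>m a. m \<in> V \<and> norm m = 1 \<and> (\<forall>z\<in>ball_of V (x0, \<rho>0) \<inter> cball y r.
        \<bar>unipotent_family.C Bi z c $ 3\<bar> \<le> \<omega> * unipotent_family.G Bi z c \<longrightarrow> \<bar>m \<bullet> z - a\<bar> \<le> \<kappa> * r))"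
    and good: "\<And>x \<epsilon>. x \<in> ball_of V (x0, \<rho>0) \<Longrightarrow> 0 < \<epsilon> \<Longrightarrow> \<epsilon> \<le> 1 \<Longrightarrow>
      (\<And>s. 0 \<le> s \<Longrightarrow> \<not> unipotent_family.danger B m1 m2 \<epsilon> x s) \<Longrightarrow> x \<in> S"
  shows "\<exists>\<tau>. strategy V \<tau> \<and> wins V \<beta> S \<tau> (x0, \<rho>0)"
proof -
  let ?X = "ball_of V (x0, \<rho>0)"
  interpret unipotent_family ?X B Bi D0 L bd m1 m2 by (rule fam)
  show ?thesis
  proof (rule potential_strategy[OF V \<beta>])
    fix \<kappa> \<gamma> \<eta> :: real
    assume \<kappa>: "0 < \<kappa>" and \<gamma>: "0 < \<gamma>" and \<eta>: "0 < \<eta>"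
      and pot: "\<And>R0 \<rho>0 x0 (N :: nat \<Rightarrow> nat) (w :: nat \<Rightarrow> nat \<Rightarrow> real) (E :: nat \<Rightarrow> nat \<Rightarrow> 'a \<times> real \<Rightarrow> 'a set) S.
      x0 \<in> V \<Longrightarrow> 0 < R0 \<Longrightarrow> R0 \<le> \<rho>0 \<Longrightarrow> (\<And>n k. 0 < w n k) \<Longrightarrow>
      (\<And>n. (\<Sum>k<N n. w n k powr \<gamma>) \<le> (\<eta> * (R0 * \<beta> ^ n)) powr \<gamma>) \<Longrightarrow>
      (\<And>n k b y r. fst b \<in> V \<Longrightarrow> dist x0 (fst b) \<le> \<rho>0 \<Longrightarrow> R0 * \<beta> ^ Suc n < snd b \<Longrightarrow> snd b \<le> R0 * \<beta> ^ n \<Longrightarrow>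
       y \<in> V \<Longrightarrow> dist x0 y \<le> \<rho>0 \<Longrightarrow> 0 < r \<Longrightarrow> r \<le> R0 \<Longrightarrow> w n k \<le> \<kappa> * r \<Longrightarrow>
       \<exists>m a. m \<in> V \<and> norm m = 1 \<and> (\<forall>z \<in> E n k b \<inter> ball_of V (y, r). \<bar>m \<bullet> z - a\<bar> \<le> \<kappa> * r)) \<Longrightarrow>
      (\<And>x. x \<in> ball_of V (x0, \<rho>0) \<Longrightarrow> (\<And>n. \<exists>b. fst b \<in> V \<and> dist x0 (fst b) \<le> \<rho>0 \<and> R0 * \<beta> ^ Suc n < snd b \<and>
        snd b \<le> R0 * \<beta> ^ n \<and> x \<in> ball_of V b \<and> (\<forall>k<N n. x \<notin> E n k b)) \<Longrightarrow> x \<in> S) \<Longrightarrow>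
      \<exists>\<tau>. strategy V \<tau> \<and> wins V \<beta> S \<tau> (x0, \<rho>0)"
    obtain Kf where Kf: "Kf > 0" and Kf2: "\<forall>\<kappa>>0. \<exists>r0>0. \<forall>y\<in>?X. \<forall>r c \<omega>. 0 < r \<longrightarrow> r \<le> r0 \<longrightarrow>
        c \<in> {c. integral_vec c \<and> c \<noteq> 0} \<longrightarrow> 0 \<le> \<omega> \<longrightarrow> Kf * \<omega> \<le> \<kappa> * r \<longrightarrow>
       (\<exists>m a. m \<in> V \<and> norm m = 1 \<and> (\<forall>z\<in>?X \<inter> cball y r. \<bar>C z c $ 3\<bar> \<le> \<omega> * G z c \<longrightarrow> \<bar>m \<bullet> z - a\<bar> \<le> \<kappa> * r))"
      using flat by blast
    obtain r0 where r0: "r0 > 0" and r02: "\<forall>y\<in>?X. \<forall>r c \<omega>. 0 < r \<longrightarrow> r \<le> r0 \<longrightarrow>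
        c \<in> {c. integral_vec c \<and> c \<noteq> 0} \<longrightarrow> 0 \<le> \<omega> \<longrightarrow> Kf * \<omega> \<le> \<kappa> * r \<longrightarrow>
       (\<exists>m a. m \<in> V \<and> norm m = 1 \<and> (\<forall>z\<in>?X \<inter> cball y r. \<bar>C z c $ 3\<bar> \<le> \<omega> * G z c \<longrightarrow> \<bar>m \<bullet> z - a\<bar> \<le> \<kappa> * r))"
      using Kf2[rule_format, OF \<kappa>] by blast
    define R0 where "R0 = min \<rho>0 (min r0 (1 / (4 * L)))"
    have R0b: "0 < R0" "R0 \<le> \<rho>0" "R0 \<le> r0" "R0 \<le> 1 / (4 * L)" using x0 r0 L by (auto simp: R0_def)
    have R0L: "2 * L * R0 \<le> 1/2" using R0b(4) L by (simp add: pos_le_divide_eq mult_ac)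
    interpret game_scales ?X B Bi D0 L bd m1 m2 \<beta> R0
      by unfold_locales (use \<beta> R0b R0L in auto)
    have \<eta>Kf: "0 < \<eta> / Kf" using \<eta> Kf by simp
    show ?thesis
    proof (rule danger_cover[OF \<gamma> \<eta>Kf])
      fix \<epsilon> and Cls :: "nat \<Rightarrow> nat \<Rightarrow> 'a set" and N :: "nat \<Rightarrow> nat" and w :: "nat \<Rightarrow> nat \<Rightarrow> real"
      assume \<epsilon>: "0 < \<epsilon>" "\<epsilon> \<le> 1" and w: "\<And>n k. 0 < w n k"
      and wsum: "\<And>n. (\<Sum>k<N n. w n k powr \<gamma>) \<le> (\<eta> / Kf * R n) powr \<gamma>"
      and cov: "\<And>x s. x \<in> ?X \<Longrightarrow> 0 \<le> s \<Longrightarrow> danger \<epsilon> x s \<Longrightarrow> \<exists>n. \<exists>k<N n. x \<in> Cls n k"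
      and surf: "\<And>n k Y. Y \<subseteq> ?X \<Longrightarrow> (\<And>x y. x \<in> Y \<Longrightarrow> y \<in> Y \<Longrightarrow> dist x y \<le> 2 * R n) \<Longrightarrow>
       \<exists>c. integral_vec c \<and> c \<noteq> 0 \<and> (\<forall>x\<in>Y \<inter> Cls n k. \<bar>C x c $ 3\<bar> \<le> w n k * G x c)"
    \<comment> \<open>The sets are cut down to the ball of their stage, whose diameter is at most
      \<open>2 * R n\<close>; this is what makes a single dual vector serve the whole set.\<close>
    show ?thesis
    proof (rule pot[of x0 R0 \<rho>0 "\<lambda>n k. Kf * w n k" N "\<lambda>n k b. ?X \<inter> ball_of V b \<inter> Cls n k" S])
      show "x0 \<in> V" "0 < R0" "R0 \<le> \<rho>0" using x0 R0b by auto
      show "0 < Kf * w n k" for n k using Kf w by simp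
      show "(\<Sum>k<N n. (Kf * w n k) powr \<gamma>) \<le> (\<eta> * (R0 * \<beta> ^ n)) powr \<gamma>" for n
      proof -
        have "(\<Sum>k<N n. (Kf * w n k) powr \<gamma>) = Kf powr \<gamma> * (\<Sum>k<N n. w n k powr \<gamma>)"
          by (simp add: powr_mult sum_distrib_left)
        also have "\<dots> \<le> Kf powr \<gamma> * (\<eta> / Kf * R n) powr \<gamma>" using wsum by (intro mult_left_mono) auto
        also have "\<dots> = (Kf * (\<eta> / Kf * R n)) powr \<gamma>" by (simp only: powr_mult)
        also have "Kf * (\<eta> / Kf * R n) = \<eta> * (R0 * \<beta> ^ n)" using Kf by (simp add: R_def)
        finally show ?thesis .
      qed
    next
      fix n k b y and r :: real
      assume b: "fst b \<in> V" "dist x0 (fst b) \<le> \<rho>0" "R0 * \<beta> ^ Suc n < snd b" "snd b \<le> R0 * \<beta> ^ n"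
        and y: "y \<in> V" "dist x0 y \<le> \<rho>0" and r: "0 < r" "r \<le> R0" "Kf * w n k \<le> \<kappa> * r"
      have yX: "y \<in> ?X" using y by (simp add: ball_of_def)
      obtain c where c: "integral_vec c" "c \<noteq> 0" "\<And>x. x \<in> ?X \<inter> ball_of V b \<inter> Cls n k \<Longrightarrow> \<bar>C x c $ 3\<bar> \<le> w n k * G x c"
      proof -
        have "dist x z \<le> 2 * R n" if "x \<in> ?X \<inter> ball_of V b" "z \<in> ?X \<inter> ball_of V b" for x z
        proof -
          have "dist (fst b) x \<le> snd b" "dist (fst b) z \<le> snd b" using that by (auto simp: ball_of_def)
          then have "dist x z \<le> 2 * snd b" using dist_triangle3[of x z "fst b"] by linarith
          then show ?thesis using b(4) by (simp add: R_def)
        qed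
        then show ?thesis using surf[of "?X \<inter> ball_of V b" n k] that by blast
      qed
      have "\<exists>m a. m \<in> V \<and> norm m = 1 \<and> (\<forall>z\<in>?X \<inter> cball y r. \<bar>C z c $ 3\<bar> \<le> w n k * G z c \<longrightarrow> \<bar>m \<bullet> z - a\<bar> \<le> \<kappa> * r)"
      proof (rule r02[rule_format, OF yX r(1) _ _ _ r(3)])
        show "r \<le> r0" using r(2) R0b(3) by simp
        show "c \<in> {c. integral_vec c \<and> c \<noteq> 0}" using c by simp
        show "0 \<le> w n k" using w[of n k] by simp
      qed
      then obtain m a where ma: "m \<in> V" "norm m = 1" "\<And>z. z \<in> ?X \<inter> cball y r \<Longrightarrow> \<bar>C z c $ 3\<bar> \<le> w n k * G z c \<Longrightarrow> \<bar>m \<bullet> z - a\<bar> \<le> \<kappa> * r"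
        by blast
      have "\<bar>m \<bullet> z - a\<bar> \<le> \<kappa> * r" if z: "z \<in> ?X \<inter> ball_of V b \<inter> Cls n k \<inter> ball_of V (y, r)" for z
        using ma(3)[of z] c(3)[of z] z by (auto simp: ball_of_def)
      then show "\<exists>m a. m \<in> V \<and> norm m = 1 \<and>
          (\<forall>z \<in> ?X \<inter> ball_of V b \<inter> Cls n k \<inter> ball_of V (y, r). \<bar>m \<bullet> z - a\<bar> \<le> \<kappa> * r)"
        using ma(1,2) by blast
    next
      fix x assume x: "x \<in> ?X" and nob: "\<And>n. \<exists>b. fst b \<in> V \<and> dist x0 (fst b) \<le> \<rho>0 \<and> R0 * \<beta> ^ Suc n < snd b \<and>
        snd b \<le> R0 * \<beta> ^ n \<and> x \<in> ball_of V b \<and> (\<forall>k<N n. x \<notin> ?X \<inter> ball_of V b \<inter> Cls n k)"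
      have "x \<notin> Cls n k" if "k < N n" for n k using nob[of n] x that by blast
      then have "\<not> danger \<epsilon> x s" if "0 \<le> s" for s using cov[OF x that] by blast
      then show "x \<in> S" using good[OF x \<epsilon>] by blast
    qed
    qed
  qed
qed

lemma abs_entry_mult_le:
  fixes Z Y :: "real^3^3"
  assumes "\<And>i j. \<bar>Z $ i $ j\<bar> \<le> z" "\<And>i j. \<bar>Y $ i $ j\<bar> \<le> y" "0 \<le> z"
  shows "\<bar>(Z ** Y) $ i $ j\<bar> \<le> 3 * z * y"
proof -
  have "\<bar>(Z ** Y) $ i $ j\<bar> \<le> (\<Sum>k\<in>UNIV. \<bar>Z $ i $ k * Y $ k $ j\<bar>)" by (simp add: matrix_matrix_mult_def sum_abs)
  also have "\<dots> \<le> (\<Sum>k\<in>(UNIV::3 set). z * y)" unfolding abs_mult using assms by (intro sum_mono mult_mono) auto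
  finally show ?thesis by simp
qed

lemma abs_entry_le_norm: "\<bar>(M :: real^3^3) $ i $ j\<bar> \<le> norm M"
  by (rule order_trans[OF component_le_norm_cart Finite_Cartesian_Product.norm_nth_le])

lemma norm_unip_diff: "norm (unip p r s - mat 1) \<le> \<bar>p\<bar> + \<bar>r\<bar> + \<bar>s\<bar>"
proof (rule power2_le_imp_le)
  have "(norm (unip p r s - mat 1))\<^sup>2 = p * p + r * r + s * s"
    by (simp add: power2_norm_eq_inner inner_vec_def sum_3 mat_def)
  also have "\<dots> = \<bar>p\<bar> * \<bar>p\<bar> + \<bar>r\<bar> * \<bar>r\<bar> + \<bar>s\<bar> * \<bar>s\<bar>" by simp
  also have "\<dots> \<le> (\<bar>p\<bar> + \<bar>r\<bar> + \<bar>s\<bar>)\<^sup>2"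
    unfolding power2_eq_square distrib_left distrib_right
    using mult_nonneg_nonneg[of "\<bar>p\<bar>" "\<bar>r\<bar>"] mult_nonneg_nonneg[of "\<bar>p\<bar>" "\<bar>s\<bar>"] mult_nonneg_nonneg[of "\<bar>r\<bar>" "\<bar>s\<bar>"]
    by (simp add: mult.commute)
  finally show "(norm (unip p r s - mat 1))\<^sup>2 \<le> (\<bar>p\<bar> + \<bar>r\<bar> + \<bar>s\<bar>)\<^sup>2" .
qed simp

section \<open>Duality and reversal of the coordinates\<close>

definition reversal :: "real^3^3" where
  "reversal = vector [vector [0, 0, 1], vector [0, 1, 0], vector [1, 0, 0]]"

lemma reversal_components [simp]:
  "reversal $ 1 $ 1 = 0" "reversal $ 1 $ 2 = 0" "reversal $ 1 $ 3 = 1"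
  "reversal $ 2 $ 1 = 0" "reversal $ 2 $ 2 = 1" "reversal $ 2 $ 3 = 0"
  "reversal $ 3 $ 1 = 1" "reversal $ 3 $ 2 = 0" "reversal $ 3 $ 3 = 0"
  by (simp_all add: reversal_def)

lemma reversal_reversal: "reversal ** reversal = mat 1"
  by (simp add: vec_eq_iff forall_3 matrix_matrix_mult_def sum_3 mat_def)

lemma reversal_vec: "(reversal *v x) $ 1 = x $ 3" "(reversal *v x) $ 2 = x $ 2" "(reversal *v x) $ 3 = x $ 1"
  by (simp_all add: matrix_vector_mult_def sum_3)

text \<open>Passing to the dual lattices and reversing the order of the coordinates preserves the
  unipotent families and exchanges the exponents \<open>(l1, l2, l3)\<close> and \<open>(- l3, - l2, - l1)\<close>, so
  that the middle exponent may be taken nonnegative.\<close>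

lemma unipotent_family_dual:
  fixes B Bi :: "'a::metric_space \<Rightarrow> real^3^3"
  assumes inv: "\<And>x. x \<in> X \<Longrightarrow> Bi x ** B x = mat 1" and det: "\<And>x. x \<in> X \<Longrightarrow> det (B x) = D0" and D0: "D0 \<noteq> 0"
    and bdB: "\<And>x i j. x \<in> X \<Longrightarrow> \<bar>B x $ i $ j\<bar> \<le> bd" and bdBi: "\<And>x i j. x \<in> X \<Longrightarrow> \<bar>Bi x $ i $ j\<bar> \<le> bd" and bd: "bd \<ge> 1"
    and rel: "\<And>x y. x \<in> X \<Longrightarrow> y \<in> X \<Longrightarrow> \<bar>p x y\<bar> \<le> L * dist x y \<and> \<bar>r x y\<bar> \<le> L * dist x y \<and> \<bar>s x y\<bar> \<le> L * dist x y
           \<and> B x = unip (p x y) (r x y) (s x y) ** B y"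
    and L: "L \<ge> 1" and diam: "\<And>x y. x \<in> X \<Longrightarrow> y \<in> X \<Longrightarrow> dist x y \<le> d" "0 \<le> d"
    and l: "0 \<le> m2" "m2 \<le> m1" "0 < m1"
  defines "B' \<equiv> \<lambda>x. reversal ** transpose (Bi x)" and "Bi' \<equiv> \<lambda>x. transpose (B x) ** reversal"
  shows "unipotent_family X B' Bi' (- (1 / D0)) (L * (1 + L * d)) bd m1 m2"
    and "\<And>x y. x \<in> X \<Longrightarrow> y \<in> X \<Longrightarrow> B' x = unip (- s x y) (p x y * s x y - r x y) (- p x y) ** B' y"
proof -
  show rel': "B' x = unip (- s x y) (p x y * s x y - r x y) (- p x y) ** B' y" if xy: "x \<in> X" "y \<in> X" for x y
  proof -
    let ?U = "unip (p x y) (r x y) (s x y)"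
    let ?Ui = "unip (- p x y) (p x y * s x y - r x y) (- s x y)"
    have B: "B x = ?U ** B y" using rel[OF xy] by blast
    have BB: "B x ** Bi x = mat 1" using inv[OF xy(1)] matrix_left_right_inverse by blast
    have "Bi y ** ?Ui ** B x = mat 1"
      unfolding B by (metis inv[OF xy(2)] matrix_mul_assoc matrix_mul_lid unip_inverse)
    then have "Bi x = Bi y ** ?Ui" using BB by (metis matrix_mul_assoc matrix_mul_lid matrix_mul_rid)
    then have "B' x = reversal ** transpose ?Ui ** transpose (Bi y)"
      by (simp add: B'_def matrix_transpose_mul matrix_mul_assoc)
    also have "reversal ** transpose ?Ui = unip (- s x y) (p x y * s x y - r x y) (- p x y) ** reversal"
      by (simp add: vec_eq_iff forall_3 matrix_matrix_mult_def sum_3 transpose_def)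
    finally show ?thesis by (simp add: B'_def matrix_mul_assoc)
  qed
  show "unipotent_family X B' Bi' (- (1 / D0)) (L * (1 + L * d)) bd m1 m2"
  proof
    fix x assume x: "x \<in> X"
    have "Bi' x ** B' x = transpose (B x) ** (reversal ** reversal) ** transpose (Bi x)"
      by (simp add: Bi'_def B'_def matrix_mul_assoc)
    also have "\<dots> = transpose (Bi x ** B x)" by (simp add: reversal_reversal matrix_transpose_mul)
    finally show "Bi' x ** B' x = mat 1" using inv[OF x] by simp
    have "det (Bi x) * D0 = 1" using arg_cong[OF inv[OF x], of det] det[OF x] by (simp add: det_mul)
    moreover have "det reversal = -1" by (simp add: det_3)
    ultimately show "det (B' x) = - (1 / D0)" using D0 by (simp add: B'_def det_mul field_simps)
    fix i j
    show "\<bar>B' x $ i $ j\<bar> \<le> bd" using exhaust_3[of i] bdBi[OF x]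
      by (auto simp: B'_def matrix_matrix_mult_def sum_3 transpose_def)
    show "\<bar>Bi' x $ i $ j\<bar> \<le> bd" using exhaust_3[of j] bdB[OF x]
      by (auto simp: Bi'_def matrix_matrix_mult_def sum_3 transpose_def)
  next
    fix x y assume xy: "x \<in> X" "y \<in> X"
    have b: "\<bar>p x y\<bar> \<le> L * dist x y" "\<bar>r x y\<bar> \<le> L * dist x y" "\<bar>s x y\<bar> \<le> L * dist x y" using rel[OF xy] by auto
    have Ld: "L * dist x y \<le> L * d" using diam(1)[OF xy] L by (intro mult_left_mono) auto
    have LL: "L * dist x y \<le> L * (1 + L * d) * dist x y"
      using L diam(2) mult_nonneg_nonneg[of "L * (L * d)" "dist x y"] by (simp add: algebra_simps)
    \<comment> \<open>The corner entry of the inverse unipotent matrix contains a product, which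
      accounts for the factor \<open>1 + L * d\<close> in the new Lipschitz constant.\<close>
    have "\<bar>p x y * s x y\<bar> \<le> (L * d) * (L * dist x y)" unfolding abs_mult using b Ld by (intro mult_mono) auto
    then have "\<bar>p x y * s x y - r x y\<bar> \<le> L * (1 + L * d) * dist x y" using b by (simp add: algebra_simps)
    then show "\<exists>p r s. \<bar>p\<bar> \<le> L * (1 + L * d) * dist x y \<and> \<bar>r\<bar> \<le> L * (1 + L * d) * dist x y \<and> \<bar>s\<bar> \<le> L * (1 + L * d) * dist x y
         \<and> B' x = unip p r s ** B' y"
      using b LL rel'[OF xy] by (intro exI[of _ "- s x y"] exI[of _ "p x y * s x y - r x y"] exI[of _ "- p x y"]) auto
  next
    have "1 * 1 \<le> L * (1 + L * d)" using L diam(2) by (intro mult_mono) auto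
    then show "1 \<le> L * (1 + L * d)" by simp
  qed (use D0 bd l in auto)
qed

context diag_flow
begin

text \<open>The tangent space at the identity. The conditions on the conjugated matrix are linear in
  its difference from 1, so \<open>H\<close> is the translate of \<open>T\<close> and a chart can be
  treated as a map into a linear space.\<close>

definition T where "T = {e. mat 1 + e \<in> expanding_horospherical g}"

lemma conj_add_1: "Pi ** (mat 1 + e) ** P = mat 1 + Pi ** e ** P"
proof -
  interpret mm: bounded_bilinear "(**) :: mat3 \<Rightarrow> mat3 \<Rightarrow> mat3" by (rule bounded_bilinear_matrix_mult3)
  show ?thesis by (simp add: mm.add_left mm.add_right Pi)
qed

lemma linear_conj: "linear (\<lambda>e. Pi ** e ** P)"
proof -
  interpret mm: bounded_bilinear "(**) :: mat3 \<Rightarrow> mat3 \<Rightarrow> mat3" by (rule bounded_bilinear_matrix_mult3)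
  show ?thesis by (intro linearI) (simp_all add: mm.add_left mm.add_right mm.scaleR_left mm.scaleR_right)
qed

lemma T_iff: "e \<in> T \<longleftrightarrow> hshape (mat 1 + Pi ** e ** P)"
  by (simp add: T_def expanding_iff conj_add_1)

lemma hshape_add_1: "hshape (mat 1 + N) \<longleftrightarrow> (\<forall>i. N $ i $ i = 0) \<and> N $ 2 $ 1 = 0 \<and> N $ 3 $ 1 = 0 \<and> N $ 3 $ 2 = 0 \<and>
   (l1 = l2 \<longrightarrow> N $ 1 $ 2 = 0) \<and> (l2 = l3 \<longrightarrow> N $ 2 $ 3 = 0) \<and> (l1 = l3 \<longrightarrow> N $ 1 $ 3 = 0)" (is "_ \<longleftrightarrow> ?R")
proof
  assume "hshape (mat 1 + N)"
  then obtain p r s where N: "mat 1 + N = unip p r s" "l1 = l2 \<longrightarrow> p = 0" "l2 = l3 \<longrightarrow> s = 0" "l1 = l3 \<longrightarrow> r = 0"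
    by (auto simp: hshape_def)
  have "(mat 1 + N) $ i $ j = unip p r s $ i $ j" for i j using N by simp
  from this[of 1 1] this[of 2 2] this[of 3 3] this[of 2 1] this[of 3 1] this[of 3 2] this[of 1 2] this[of 2 3] this[of 1 3]
  show ?R using N(2-4) by (auto simp: mat_def forall_3)
next
  assume R: ?R
  then have "mat 1 + N = unip (N $ 1 $ 2) (N $ 1 $ 3) (N $ 2 $ 3)"
    by (simp add: vec_eq_iff forall_3 mat_def)
  then show "hshape (mat 1 + N)" unfolding hshape_def using R by blast
qed

lemma subspace_T: "subspace T"
proof -
  have lin: "Pi ** (x + y) ** P = Pi ** x ** P + Pi ** y ** P" "Pi ** (c *\<^sub>R x) ** P = c *\<^sub>R (Pi ** x ** P)" for x y c
    using linear_add[OF linear_conj] linear_scale[OF linear_conj] by auto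
  have z: "Pi ** 0 ** P = 0" using linear_0[OF linear_conj] .
  show ?thesis
    unfolding subspace_def
  proof (intro conjI ballI allI)
    show "0 \<in> T" unfolding T_iff hshape_add_1 z by simp
    show "x + y \<in> T" if "x \<in> T" "y \<in> T" for x y
      using that unfolding T_iff hshape_add_1 lin by simp
    show "c *\<^sub>R x \<in> T" if "x \<in> T" for x c
      using that unfolding T_iff hshape_add_1 lin by simp
  qed
qed

lemma unip_in_T:
  assumes "l1 = l2 \<longrightarrow> p = 0" "l2 = l3 \<longrightarrow> s = 0" "l1 = l3 \<longrightarrow> r = 0"
  shows "P ** (unip p r s - mat 1) ** Pi \<in> T" "Pi ** (P ** (unip p r s - mat 1) ** Pi) ** P = unip p r s - mat 1"
proof -
  show e: "Pi ** (P ** (unip p r s - mat 1) ** Pi) ** P = unip p r s - mat 1"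
    using Pi by (metis matrix_mul_assoc matrix_mul_lid matrix_mul_rid)
  show "P ** (unip p r s - mat 1) ** Pi \<in> T"
    unfolding T_iff e using assms by (auto simp: hshape_def)
qed

lemma expanding_eq: "expanding_horospherical g = (+) (mat 1) ` T"
proof -
  have "x = mat 1 + (x - mat 1)" for x :: mat3 by simp
  then show ?thesis unfolding T_def by (auto simp: image_iff) (metis add_diff_cancel_left' add.commute diff_add_cancel)
qed

lemma no_danger_imp_bounded:
  assumes B: "B = Pi ** h ** A0" and h: "h \<in> SL3R" and A0: "A0 \<in> SL3R" and \<epsilon>: "0 < \<epsilon>" "\<epsilon> \<le> 1"
    and nd: "\<And>n v. integral_vec v \<Longrightarrow> v \<noteq> 0 \<Longrightarrow> \<not> (exp (l1 * real n) * \<bar>(B *v v) $ 1\<bar> \<le> \<epsilon> \<and>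
       exp (l2 * real n) * \<bar>(B *v v) $ 2\<bar> \<le> \<epsilon> \<and> \<bar>(B *v v) $ 3\<bar> \<le> exp ((l1 + l2) * real n))"
  shows "act h (left_coset A0) \<in> bounded_orbit_points (g ` {0..})"
proof (rule bounded_orbit_of_systole[OF h A0 \<epsilon>(1)])
  fix n v assume v: "integral_vec v" "v \<noteq> (0 :: real^3)"
  show "\<epsilon> \<le> norm (a (real n) *v ((Pi ** h ** A0) *v v))"
  proof (rule ccontr)
    assume "\<not> ?thesis"
    then have lt: "norm (a (real n) *v (B *v v)) < \<epsilon>" by (simp add: B)
    have c: "\<bar>(a (real n) *v (B *v v)) $ i\<bar> \<le> \<epsilon>" for i
      using component_le_norm_cart[of "a (real n) *v (B *v v)" i] lt by simp
    have e: "(a (real n) *v w) $ 1 = exp (l1 * real n) * w $ 1" "(a (real n) *v w) $ 2 = exp (l2 * real n) * w $ 2"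
      "(a (real n) *v w) $ 3 = exp (- ((l1 + l2) * real n)) * w $ 3" for w
    proof -
      have l3: "l3 = - (l1 + l2)" using l(3) by simp
      show "(a (real n) *v w) $ 1 = exp (l1 * real n) * w $ 1" "(a (real n) *v w) $ 2 = exp (l2 * real n) * w $ 2"
        "(a (real n) *v w) $ 3 = exp (- ((l1 + l2) * real n)) * w $ 3"
        unfolding dgn_def l3 by (simp_all add: matrix_vector_mult_def sum_3 algebra_simps)
    qed
    have "exp (- ((l1 + l2) * real n)) * \<bar>(B *v v) $ 3\<bar> \<le> 1" using c[of 3] \<epsilon> by (simp add: e abs_mult)
    then have "\<bar>(B *v v) $ 3\<bar> \<le> exp ((l1 + l2) * real n)" by (simp add: exp_minus divide_simps)
    then show False using nd[OF v, of n] c[of 1] c[of 2] by (simp add: e abs_mult)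
  qed
qed

text \<open>Absence of danger for the dual family bounds the systole of the dual lattice under the
  inverse diagonal flow; transference carries the bound over to the lattice itself.\<close>

lemma no_dual_danger_imp_bounded:
  assumes B: "B = Pi ** h ** A0" and Bi: "Bi ** B = mat 1" and h: "h \<in> SL3R" and A0: "A0 \<in> SL3R" and \<epsilon>: "0 < \<epsilon>" "\<epsilon> \<le> 1"
    and nd: "\<And>n v. integral_vec v \<Longrightarrow> v \<noteq> 0 \<Longrightarrow> \<not> (exp (- l3 * real n) * \<bar>((reversal ** transpose Bi) *v v) $ 1\<bar> \<le> \<epsilon> \<and>
       exp (- l2 * real n) * \<bar>((reversal ** transpose Bi) *v v) $ 2\<bar> \<le> \<epsilon> \<and>
       \<bar>((reversal ** transpose Bi) *v v) $ 3\<bar> \<le> exp ((- l3 + - l2) * real n))"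
  shows "act h (left_coset A0) \<in> bounded_orbit_points (g ` {0..})"
proof -
  have dB: "det Bi * det B = 1" using arg_cong[OF Bi, of det] by (simp add: det_mul)
  define \<delta> where "\<delta> = \<epsilon>\<^sup>2 / (4 * \<bar>det Bi\<bar>)"
  have detBi: "det Bi \<noteq> 0" using dB by auto
  have \<delta>: "0 < \<delta>" using \<epsilon> detBi by (simp add: \<delta>_def)
  show ?thesis
  proof (rule bounded_orbit_of_systole[OF h A0 \<delta>])
    fix n v assume v: "integral_vec v" "v \<noteq> (0 :: real^3)"
    define N where "N = a (- real n) ** transpose Bi"
    have deta: "det (a (- real n)) = 1"
    proof -
      have "det (a (- real n)) = exp (- real n * (l1 + l2 + l3))"
        by (simp add: dgn_def det_3 exp_add[symmetric] algebra_simps)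
      then show ?thesis using l(3) by simp
    qed
    have detN: "det N = det Bi" by (simp add: N_def det_mul deta)
    have pair: "(N *v c) \<bullet> ((a (real n) ** B) *v v) = c \<bullet> v" for c v
    proof -
      have d: "(a (- real n) *v x) \<bullet> (a (real n) *v y) = x \<bullet> y" for x y
        by (simp add: dgn_def matrix_vector_mult_def sum_3 inner_vec_def exp_minus field_simps)
      have "(N *v c) \<bullet> ((a (real n) ** B) *v v) = (transpose Bi *v c) \<bullet> (B *v v)"
        unfolding N_def by (simp only: matrix_vector_mul_assoc[symmetric] d)
      also have "\<dots> = c \<bullet> (Bi *v (B *v v))" by (metis dot_lmul_matrix transpose_matrix_vector)
      finally show ?thesis by (simp add: matrix_vector_mul_assoc Bi)
    qed
    have sys: "\<epsilon> \<le> norm (N *v c)" if c: "integral_vec c" "c \<noteq> 0" for c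
    proof (rule ccontr)
      assume "\<not> ?thesis"
      then have lt: "norm (N *v c) < \<epsilon>" by simp
      let ?w = "transpose Bi *v c"
      have cc: "\<bar>(N *v c) $ i\<bar> \<le> \<epsilon>" for i
        using component_le_norm_cart[of "N *v c" i] lt by simp
      have e: "(N *v c) $ 1 = exp (- (l1 * real n)) * ?w $ 1" "(N *v c) $ 2 = exp (- l2 * real n) * ?w $ 2"
        "(N *v c) $ 3 = exp (- l3 * real n) * ?w $ 3"
        unfolding N_def matrix_vector_mul_assoc[symmetric]
        by (simp_all add: dgn_def matrix_vector_mult_def[of "dg _ _ _"] sum_3 mult.commute)
      have r: "((reversal ** transpose Bi) *v c) $ 1 = ?w $ 3" "((reversal ** transpose Bi) *v c) $ 2 = ?w $ 2"
        "((reversal ** transpose Bi) *v c) $ 3 = ?w $ 1"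
        unfolding matrix_vector_mul_assoc[symmetric] by (rule reversal_vec)+
      have "exp (- (l1 * real n)) * \<bar>?w $ 1\<bar> \<le> 1" using cc[of 1] \<epsilon> unfolding e abs_mult by simp
      then have "\<bar>?w $ 1\<bar> \<le> exp (l1 * real n)" by (simp add: exp_minus divide_simps)
      moreover have "l1 = - l3 + - l2" using l(3) by simp
      ultimately show False using nd[OF c, of n] cc[of 2] cc[of 3] unfolding r e abs_mult by simp
    qed
    have "\<delta> \<le> norm ((a (real n) ** B) *v v)"
      using systole_of_dual[of N "a (real n) ** B", OF _ pair \<epsilon>(1) sys v] detBi by (simp add: detN \<delta>_def)
    then show "\<delta> \<le> norm (a (real n) *v ((Pi ** h ** A0) *v v))" by (simp add: B matrix_vector_mul_assoc)
  qed
qed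

end

text \<open>In the change of \<open>C x c $ 3\<close> the coordinates \<open>r\<close> and
  \<open>s\<close> enter to first order, while \<open>p\<close> occurs only in the product
  \<open>p * s\<close>, a quadratic error. A frame for \<open>r\<close> and \<open>s\<close>
  therefore suffices for flatness, even when \<open>p\<close> is forced to vanish.\<close>

lemma unipotent_strategy:
  fixes V :: "'a::euclidean_space set" and B Bi :: "'a \<Rightarrow> real^3^3" and p r s \<Lambda>r \<Lambda>s :: "'a \<Rightarrow> 'a \<Rightarrow> real"
  assumes V: "subspace V" "dim V > 0" and \<beta>: "0 < \<beta>" "\<beta> < 1/3" and x0: "x0 \<in> V" "0 < \<rho>0"
    and fam: "unipotent_family (ball_of V (x0, \<rho>0)) B Bi D0 L bd m1 m2"
    and Brel: "\<And>x y. x \<in> ball_of V (x0, \<rho>0) \<Longrightarrow> y \<in> ball_of V (x0, \<rho>0) \<Longrightarrow> B x = unip (p x y) (r x y) (s x y) ** B y"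
    and lin: "\<And>y. y \<in> ball_of V (x0, \<rho>0) \<Longrightarrow> linear (\<Lambda>r y)" "\<And>y. y \<in> ball_of V (x0, \<rho>0) \<Longrightarrow> linear (\<Lambda>s y)"
    and approx: "\<And>\<omega>. 0 < \<omega> \<Longrightarrow> \<exists>d>0. \<forall>y\<in>ball_of V (x0, \<rho>0). \<forall>z\<in>ball_of V (x0, \<rho>0). norm (z - y) \<le> d \<longrightarrow>
        \<bar>r z y - \<Lambda>r y (z - y)\<bar> \<le> \<omega> * norm (z - y) \<and> \<bar>s z y - \<Lambda>s y (z - y)\<bar> \<le> \<omega> * norm (z - y)"
    and \<xi>: "\<And>y. y \<in> ball_of V (x0, \<rho>0) \<Longrightarrow> \<exists>\<xi>1\<in>V. \<exists>\<xi>2\<in>V. norm \<xi>1 \<le> M \<and> norm \<xi>2 \<le> M \<and>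
        \<Lambda>r y \<xi>1 = 1 \<and> \<Lambda>s y \<xi>1 = 0 \<and> \<Lambda>r y \<xi>2 = 0 \<and> \<Lambda>s y \<xi>2 = 1"
    and M: "0 \<le> M"
    and good: "\<And>x \<epsilon>. x \<in> ball_of V (x0, \<rho>0) \<Longrightarrow> 0 < \<epsilon> \<Longrightarrow> \<epsilon> \<le> 1 \<Longrightarrow>
      (\<And>s. 0 \<le> s \<Longrightarrow> \<not> unipotent_family.danger B m1 m2 \<epsilon> x s) \<Longrightarrow> x \<in> S"
  shows "\<exists>\<tau>. strategy V \<tau> \<and> wins V \<beta> S \<tau> (x0, \<rho>0)"
proof -
  let ?X = "ball_of V (x0, \<rho>0)"
  interpret unipotent_family ?X B Bi D0 L bd m1 m2 by (rule fam)
  \<comment> \<open>The unipotent factor is determined by the two bases, so the Lipschitz bounds of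
    the locale hold for the given \<open>p\<close> and \<open>s\<close>.\<close>
  have lip: "\<bar>p x y\<bar> \<le> L * norm (x - y)" "\<bar>s x y\<bar> \<le> L * norm (x - y)" if xy: "x \<in> ?X" "y \<in> ?X" for x y
  proof -
    obtain p' r' s' where u: "\<bar>p'\<bar> \<le> L * dist x y" "\<bar>s'\<bar> \<le> L * dist x y" "B x = unip p' r' s' ** B y"
      using unipotent_family.rel[OF fam xy] by blast
    have "unip (p x y) (r x y) (s x y) ** (B y ** Bi y) = unip p' r' s' ** (B y ** Bi y)"
      using u(3) Brel[OF xy] by (metis matrix_mul_assoc)
    then have "unip (p x y) (r x y) (s x y) = unip p' r' s'" using inv'[OF xy(2)] by simp
    then have "p x y = p'" "s x y = s'" by (metis unip_components)+
    then show "\<bar>p x y\<bar> \<le> L * norm (x - y)" "\<bar>s x y\<bar> \<le> L * norm (x - y)" using u by (simp_all add: dist_norm)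
  qed
  have LL: "L \<le> L * L" using L by simp
  have flat: "\<exists>Kf>0. \<forall>\<kappa>>0. \<exists>r0>0. \<forall>y\<in>?X. \<forall>r c \<omega>. 0 < r \<longrightarrow> r \<le> r0 \<longrightarrow>
      c \<in> {c. integral_vec c \<and> c \<noteq> 0} \<longrightarrow> 0 \<le> \<omega> \<longrightarrow> Kf * \<omega> \<le> \<kappa> * r \<longrightarrow>
     (\<exists>m a. m \<in> V \<and> norm m = 1 \<and> (\<forall>z\<in>?X \<inter> cball y r. \<bar>C z c $ 3\<bar> \<le> \<omega> * G z c \<longrightarrow> \<bar>m \<bullet> z - a\<bar> \<le> \<kappa> * r))"
  proof (rule flat_family[where f = "\<lambda>z c. C z c $ 3" and Gf = G and q = "L * L" and M = M and ?U1.0 = r and ?U2.0 = s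
      and ?\<Lambda>1.0 = \<Lambda>r and ?\<Lambda>2.0 = \<Lambda>s and ?\<alpha>0.0 = "\<lambda>y c. C y c $ 3" and ?\<alpha>1.0 = "\<lambda>y c. - C y c $ 1" and ?\<alpha>2.0 = "\<lambda>y c. - C y c $ 2"])
    show "?X \<subseteq> V" by (auto simp: ball_of_def)
    show "0 \<le> L * L" using L by simp
    show "G y c = max \<bar>- C y c $ 1\<bar> \<bar>- C y c $ 2\<bar>" for y c by (simp add: G_def)
    fix y z c assume y: "y \<in> ?X" and z: "z \<in> ?X"
    let ?d = "norm (z - y)"
    note Cz = C_unip[OF z y Brel[OF z y], of c]
    have C1: "\<bar>C y c $ 1\<bar> \<le> G y c" "\<bar>C y c $ 2\<bar> \<le> G y c" by (auto simp: G_def)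
    have ps: "\<bar>p z y * s z y\<bar> \<le> (L * ?d) * (L * ?d)"
      unfolding abs_mult using lip[OF z y] L by (intro mult_mono) auto
    have "\<bar>C z c $ 3 - (C y c $ 3 + (- C y c $ 1) * r z y + (- C y c $ 2) * s z y)\<bar> = \<bar>C y c $ 1\<bar> * \<bar>p z y * s z y\<bar>"
      unfolding Cz(3) by (simp add: abs_mult[symmetric] algebra_simps)
    also have "\<dots> \<le> G y c * ((L * ?d) * (L * ?d))" using C1 ps by (intro mult_mono) auto
    also have "\<dots> = G y c * (L * L * ?d\<^sup>2)" by (simp add: power2_eq_square mult_ac)
    finally show "\<bar>C z c $ 3 - (C y c $ 3 + (- C y c $ 1) * r z y + (- C y c $ 2) * s z y)\<bar> \<le> G y c * (L * L * ?d\<^sup>2)" .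
    have "L * ?d \<le> L * L * ?d" using LL by (intro mult_right_mono) auto
    then have "\<bar>p z y\<bar> \<le> L * L * ?d" using lip(1)[OF z y] by linarith
    then have "\<bar>p z y * C y c $ 1\<bar> \<le> (L * L * ?d) * G y c" unfolding abs_mult using C1 L by (intro mult_mono) auto
    then have "\<bar>C z c $ 2\<bar> \<le> G y c * (1 + L * L * ?d)" using C1(2) unfolding Cz(2) by (simp add: algebra_simps)
    moreover have "\<bar>C z c $ 1\<bar> \<le> G y c * (1 + L * L * ?d)"
    proof -
      have "0 \<le> G y c" using C1(1) by linarith
      then have "0 \<le> G y c * (L * L * ?d)" using L by simp
      then show ?thesis using C1(1) unfolding Cz(1) by (simp add: algebra_simps)
    qed
    ultimately show "G z c \<le> G y c * (1 + L * L * ?d)" by (simp add: G_def[of z])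
  next
    fix z c assume z: "z \<in> ?X" and c: "c \<in> {c. integral_vec c \<and> c \<noteq> 0}" and G: "G z c = 0"
    obtain i where i: "c0 \<le> \<bar>C z c $ i\<bar>" using C_lower[OF z, of c] c by blast
    have "C z c $ 1 = 0" "C z c $ 2 = 0" using G by (auto simp: G_def max_def split: if_splits)
    then show "C z c $ 3 \<noteq> 0" using i c0 exhaust_3[of i] by auto
  qed (use V lin approx \<xi> M in auto)
  show ?thesis by (rule family_strategy[OF V \<beta> x0 fam flat good])
qed

section \<open>Strategies for the game in a single chart\<close>

context diag_flow
begin

text \<open>For \<open>0 \<le> l2\<close> the exponents satisfy \<open>l3 < l2\<close>, so the
  entries \<open>r\<close> and \<open>s\<close> of \<open>H\<close> vary freely. For
  \<open>l2 < 0\<close> they satisfy \<open>l2 < l1\<close>, so \<open>p\<close> and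
  \<open>r\<close> vary freely, and duality puts \<open>p\<close> in the place of
  \<open>s\<close>.\<close>

lemma HAW_chart:
  fixes V W :: "'a::euclidean_space set"
  assumes A0: "A0 \<in> SL3R" and l13: "l3 < l1" and V: "subspace V" "dim V > 0" and dimV: "dim V = dim T"
    and W: "openin (top_of_set V) W" and im: "\<And>x. x \<in> W \<Longrightarrow> \<psi> x \<in> expanding_horospherical g"
    and C1: "C1_immersion_on V W \<psi>"
  shows "HAW V W {x \<in> W. act (\<psi> x) (left_coset A0) \<in> bounded_orbit_points (g ` {0..})}" (is "HAW V W ?S")
proof (rule HAW_from_strategies[OF V])
  fix \<beta> :: real and B0 :: "'a \<times> real"
  assume \<beta>: "0 < \<beta>" "\<beta> < 1/3" and B0: "fst B0 \<in> V" "0 < snd B0" "ball_of V B0 \<subseteq> W"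
  obtain x0 \<rho>0 where B0_eq: "B0 = (x0, \<rho>0)" by (cases B0)
  have x0: "x0 \<in> V" "0 < \<rho>0" using B0 by (auto simp: B0_eq)
  define X where "X = ball_of V (x0, \<rho>0)"
  have XW: "X \<subseteq> W" using B0(3) by (simp add: X_def B0_eq)
  have x0X: "x0 \<in> X" using x0 by (simp add: X_def ball_of_def)
  have X: "compact X" "convex X"
    using V(1) by (auto simp: X_def ball_of_def closed_subspace subspace_imp_convex intro: compact_Int_closed convex_Int)
  have diam: "dist x y \<le> 2 * \<rho>0" if "x \<in> X" "y \<in> X" for x y
    using that dist_triangle3[of x y x0] by (auto simp: X_def ball_of_def)
  have imT: "\<psi> x - mat 1 \<in> T" if "x \<in> W" for x using im[OF that] by (simp add: T_def)
  obtain D L0 M where linD: "\<And>y. y \<in> X \<Longrightarrow> linear (D y)" and L0: "0 \<le> L0" and M: "0 \<le> M"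
    and lip: "\<And>x y. x \<in> X \<Longrightarrow> y \<in> X \<Longrightarrow> norm (\<psi> x - \<psi> y) \<le> L0 * norm (x - y)"
    and unif: "\<And>\<omega>. 0 < \<omega> \<Longrightarrow> \<exists>r>0. \<forall>y\<in>X. \<forall>z\<in>X. norm (z - y) \<le> r \<longrightarrow> norm (\<psi> z - \<psi> y - D y (z - y)) \<le> \<omega> * norm (z - y)"
    and surj: "\<And>y e. y \<in> X \<Longrightarrow> e \<in> T \<Longrightarrow> \<exists>\<xi>\<in>V. D y \<xi> = e \<and> norm \<xi> \<le> M * norm e"
    using C1_immersion_uniform[OF W V(1) subspace_T dimV imT C1 X XW] by blast
  obtain c where c: "c > 0" "\<And>(A::mat3) (M::mat3) (B::mat3). norm (A ** M ** B) \<le> c * norm A * norm B * norm M"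
    using norm_conj_bound by blast
  define k1 where "k1 = c * norm Pi * norm P"
  have k1: "0 \<le> k1" using c by (simp add: k1_def)
  have cP: "norm (Pi ** e ** P) \<le> k1 * norm e" "norm (P ** e ** Pi) \<le> k1 * norm e" for e
    using c(2)[of Pi e P] c(2)[of P e Pi] by (simp_all add: k1_def mult_ac)
  define N where "N x = Pi ** \<psi> x ** P" for x
  define pp where "pp x = N x $ 1 $ 2" for x
  define rr where "rr x = N x $ 1 $ 3" for x
  define ss where "ss x = N x $ 2 $ 3" for x
  have N: "N x = unip (pp x) (rr x) (ss x)" if "x \<in> X" for x
  proof -
    have "hshape (N x)" using im XW that expanding_iff by (auto simp: N_def)
    then obtain p r s where "N x = unip p r s" by (auto simp: hshape_def)
    then show ?thesis by (simp add: pp_def rr_def ss_def)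
  qed
  define Lam where "Lam y \<xi> = Pi ** D y \<xi> ** P" for y \<xi>
  have linLam: "linear (\<lambda>\<xi>. Lam y \<xi> $ i $ j)" if "y \<in> X" for y i j
  proof -
    have "linear (\<lambda>\<xi>. Pi ** D y \<xi> ** P)" using linear_compose[OF linD[OF that] linear_conj] by (simp add: o_def)
    then show ?thesis by (auto simp: linear_iff Lam_def)
  qed
  have conj_diff: "Pi ** (e - e') ** P = Pi ** e ** P - Pi ** e' ** P" for e e' by (rule linear_diff[OF linear_conj])
  have Nlip: "\<bar>N x $ i $ j - N y $ i $ j\<bar> \<le> k1 * L0 * norm (x - y)" if "x \<in> X" "y \<in> X" for x y i j
  proof -
    have "N x $ i $ j - N y $ i $ j = (Pi ** (\<psi> x - \<psi> y) ** P) $ i $ j" by (simp add: conj_diff N_def)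
    then have "\<bar>N x $ i $ j - N y $ i $ j\<bar> \<le> norm (Pi ** (\<psi> x - \<psi> y) ** P)" using abs_entry_le_norm by metis
    also have "\<dots> \<le> k1 * norm (\<psi> x - \<psi> y)" by (rule cP)
    also have "\<dots> \<le> k1 * (L0 * norm (x - y))" using lip[OF that] k1 by (intro mult_left_mono) auto
    finally show ?thesis by (simp add: mult_ac)
  qed
  have Napp: "\<exists>d>0. \<forall>y\<in>X. \<forall>z\<in>X. norm (z - y) \<le> d \<longrightarrow>
     (\<forall>i j. \<bar>N z $ i $ j - N y $ i $ j - Lam y (z - y) $ i $ j\<bar> \<le> \<omega> * norm (z - y))" if \<omega>: "0 < \<omega>" for \<omega>
  proof -
    have w: "0 < \<omega> / (k1 + 1)" using \<omega> k1 by simp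
    obtain d where d: "d > 0" "\<And>y z. y \<in> X \<Longrightarrow> z \<in> X \<Longrightarrow> norm (z - y) \<le> d \<Longrightarrow>
        norm (\<psi> z - \<psi> y - D y (z - y)) \<le> \<omega> / (k1 + 1) * norm (z - y)"
      using unif[OF w] by blast
    have "\<bar>N z $ i $ j - N y $ i $ j - Lam y (z - y) $ i $ j\<bar> \<le> \<omega> * norm (z - y)"
      if yz: "y \<in> X" "z \<in> X" "norm (z - y) \<le> d" for y z i j
    proof -
      have "N z $ i $ j - N y $ i $ j - Lam y (z - y) $ i $ j = (Pi ** (\<psi> z - \<psi> y - D y (z - y)) ** P) $ i $ j"
        by (simp add: conj_diff N_def Lam_def)
      then have "\<bar>N z $ i $ j - N y $ i $ j - Lam y (z - y) $ i $ j\<bar> \<le> norm (Pi ** (\<psi> z - \<psi> y - D y (z - y)) ** P)"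
        using abs_entry_le_norm by metis
      also have "\<dots> \<le> k1 * norm (\<psi> z - \<psi> y - D y (z - y))" by (rule cP)
      also have "\<dots> \<le> (k1 + 1) * (\<omega> / (k1 + 1) * norm (z - y))" using d(2)[OF yz] k1 by (intro mult_mono) auto
      also have "\<dots> = \<omega> * norm (z - y)" using k1 by simp
      finally show ?thesis .
    qed
    then show ?thesis using d(1) by blast
  qed
  define K where "K = norm (\<psi> x0) + L0 * \<rho>0"
  have K: "norm (\<psi> x) \<le> K" if "x \<in> X" for x
  proof -
    have "norm (x - x0) \<le> \<rho>0" using that by (simp add: X_def ball_of_def dist_norm norm_minus_commute)
    then have "L0 * norm (x - x0) \<le> L0 * \<rho>0" using L0 by (rule mult_left_mono)
    then show ?thesis using lip[OF that x0X] norm_triangle_sub[of "\<psi> x" "\<psi> x0"] by (simp add: K_def)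
  qed
  have K0: "0 \<le> K" using K[OF x0X] norm_ge_zero order_trans by blast
  define b where "b = k1 * K"
  have b0: "0 \<le> b" using k1 K0 by (simp add: b_def)
  have Nb: "\<bar>N x $ i $ j\<bar> \<le> b" if "x \<in> X" for x i j
  proof -
    have "\<bar>N x $ i $ j\<bar> \<le> k1 * norm (\<psi> x)" using abs_entry_le_norm[of "N x" i j] cP(1)[of "\<psi> x"] unfolding N_def by linarith
    also have "\<dots> \<le> b" unfolding b_def using K[OF that] k1 by (rule mult_left_mono)
    finally show ?thesis .
  qed
  have pb: "\<bar>pp x\<bar> \<le> b" "\<bar>rr x\<bar> \<le> b" "\<bar>ss x\<bar> \<le> b" if "x \<in> X" for x
    using Nb[OF that] by (auto simp: pp_def rr_def ss_def)
  define p where "p x y = pp x - pp y" for x y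
  define s where "s x y = ss x - ss y" for x y
  \<comment> \<open>The solution of \<open>N x = unip (p x y) (r x y) (s x y) ** N y\<close>; the
    correction is the product term in the group law.\<close>
  define r where "r x y = rr x - rr y - ss y * (pp x - pp y)" for x y
  define L where "L = max 1 (k1 * L0 * (1 + b))"
  have L1: "1 \<le> L" by (simp add: L_def)
  have lips: "\<bar>p x y\<bar> \<le> L * dist x y" "\<bar>r x y\<bar> \<le> L * dist x y" "\<bar>s x y\<bar> \<le> L * dist x y" if xy: "x \<in> X" "y \<in> X" for x y
  proof -
    let ?e = "k1 * L0 * norm (x - y)"
    have e0: "0 \<le> ?e" using k1 L0 by simp
    have e: "\<bar>pp x - pp y\<bar> \<le> ?e" "\<bar>rr x - rr y\<bar> \<le> ?e" "\<bar>ss x - ss y\<bar> \<le> ?e"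
      using Nlip[OF xy] by (auto simp: pp_def rr_def ss_def)
    have m: "\<bar>ss y * (pp x - pp y)\<bar> \<le> b * ?e" unfolding abs_mult using pb[OF xy(2)] e b0 by (intro mult_mono) auto
    have "k1 * L0 * (1 + b) * norm (x - y) \<le> L * norm (x - y)" by (intro mult_right_mono) (auto simp: L_def)
    then have eL: "?e + b * ?e \<le> L * dist x y" by (simp add: dist_norm algebra_simps)
    moreover have "0 \<le> b * ?e" using b0 e0 by simp
    ultimately show "\<bar>p x y\<bar> \<le> L * dist x y" "\<bar>r x y\<bar> \<le> L * dist x y" "\<bar>s x y\<bar> \<le> L * dist x y"
      using e m unfolding p_def r_def s_def by linarith+
  qed
  have Nrel: "N x = unip (p x y) (r x y) (s x y) ** N y" if "x \<in> X" "y \<in> X" for x y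
    unfolding N[OF that(1)] N[OF that(2)] p_def r_def s_def
    by (simp add: vec_eq_iff forall_3 matrix_matrix_mult_def sum_3 algebra_simps)
  have dA0: "det A0 = 1" using A0 by (simp add: SL3R_def)
  define A0i where "A0i = matrix_inv A0"
  have A0i: "A0i ** A0 = mat 1"
    unfolding A0i_def by (rule matrix_inv_cancel(2)) (simp add: invertible_det_nz dA0)
  define B where "B x = Pi ** \<psi> x ** A0" for x
  define Bi where "Bi x = (A0i ** P) ** unip (- pp x) (pp x * ss x - rr x) (- ss x)" for x
  have BN: "B x = N x ** (Pi ** A0)" for x
    unfolding B_def N_def by (metis Pi' matrix_mul_assoc matrix_mul_rid)
  have rel: "B x = unip (p x y) (r x y) (s x y) ** B y" if "x \<in> X" "y \<in> X" for x y
    unfolding BN Nrel[OF that] by (simp add: matrix_mul_assoc)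
  have inv: "Bi x ** B x = mat 1" if "x \<in> X" for x
  proof -
    have "Bi x ** B x = A0i ** (P ** ((unip (- pp x) (pp x * ss x - rr x) (- ss x) ** N x) ** Pi)) ** A0"
      by (simp add: Bi_def BN matrix_mul_assoc)
    then show ?thesis unfolding N[OF that] unip_inverse by (simp add: Pi' A0i)
  qed
  have det: "det (B x) = det Pi" if "x \<in> X" for x
  proof -
    have "det (\<psi> x) = 1" using im XW that by (auto simp: expanding_horospherical_def SL3R_def)
    then show ?thesis using dA0 by (simp add: B_def det_mul)
  qed
  have dPi: "det Pi \<noteq> 0" using arg_cong[OF Pi, of det] by (auto simp: det_mul)
  define bd where "bd = max 1 (max (c * norm Pi * norm A0 * K) (3 * norm (A0i ** P) * (1 + b)\<^sup>2))"
  have bd1: "1 \<le> bd" by (simp add: bd_def)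
  have bdB: "\<bar>B x $ i $ j\<bar> \<le> bd" if "x \<in> X" for x i j
  proof -
    have "\<bar>B x $ i $ j\<bar> \<le> c * norm Pi * norm A0 * norm (\<psi> x)"
      unfolding B_def by (rule order_trans[OF abs_entry_le_norm c(2)])
    also have "\<dots> \<le> c * norm Pi * norm A0 * K" using K[OF that] c(1) by (intro mult_left_mono) auto
    finally show ?thesis by (simp add: bd_def)
  qed
  have bdBi: "\<bar>Bi x $ i $ j\<bar> \<le> bd" if "x \<in> X" for x i j
  proof -
    let ?U = "unip (- pp x) (pp x * ss x - rr x) (- ss x)"
    have "\<bar>pp x * ss x\<bar> \<le> b * b" unfolding abs_mult using pb[OF that] b0 by (intro mult_mono) auto
    then have e: "\<bar>pp x * ss x - rr x\<bar> \<le> b * b + b" using pb(2)[OF that] by linarith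
    have sq: "(1 + b)\<^sup>2 = 1 + 2 * b + b * b" by (simp add: power2_eq_square algebra_simps)
    have bb: "0 \<le> b * b" using b0 by simp
    have "\<bar>?U $ i $ j\<bar> \<le> (1 + b)\<^sup>2" for i j
      using exhaust_3[of i] exhaust_3[of j] pb[OF that] e b0 bb unfolding sq by (elim disjE) simp_all
    then have "\<bar>Bi x $ i $ j\<bar> \<le> 3 * norm (A0i ** P) * (1 + b)\<^sup>2"
      unfolding Bi_def by (intro abs_entry_mult_le abs_entry_le_norm) auto
    then show ?thesis by (simp add: bd_def)
  qed
  \<comment> \<open>Prescribed first-order entries are realized by bounded vectors of
    \<open>V\<close>. The bound \<open>1 + b\<close> leaves room for the entry \<open>- ss y\<close>
    that occurs in the dual case.\<close>
  have frame: "\<exists>\<xi>\<in>V. Lam y \<xi> $ 1 $ 2 = p' \<and> Lam y \<xi> $ 1 $ 3 = r' \<and> Lam y \<xi> $ 2 $ 3 = s' \<and> norm \<xi> \<le> M * (k1 * (1 + b))"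
    if y: "y \<in> X" and h: "l1 = l2 \<longrightarrow> p' = 0" "l2 = l3 \<longrightarrow> s' = 0" and le: "\<bar>p'\<bar> + \<bar>r'\<bar> + \<bar>s'\<bar> \<le> 1 + b" for y p' r' s'
  proof -
    let ?e = "P ** (unip p' r' s' - mat 1) ** Pi"
    have e: "?e \<in> T" "Pi ** ?e ** P = unip p' r' s' - mat 1" using unip_in_T h l13 by auto
    obtain \<xi> where \<xi>: "\<xi> \<in> V" "D y \<xi> = ?e" "norm \<xi> \<le> M * norm ?e" using surj[OF y e(1)] by blast
    have "norm ?e \<le> k1 * norm (unip p' r' s' - mat 1)" by (rule cP)
    also have "\<dots> \<le> k1 * (1 + b)" using norm_unip_diff[of p' r' s'] le k1 by (intro mult_left_mono) auto
    finally have "norm \<xi> \<le> M * (k1 * (1 + b))" using \<xi>(3) M by (meson mult_left_mono order_trans)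
    moreover have "Lam y \<xi> = unip p' r' s' - mat 1" unfolding Lam_def \<xi>(2) by (rule e(2))
    ultimately show ?thesis using \<xi>(1) by (intro bexI[of _ \<xi>]) (auto simp: mat_def)
  qed
  define M' where "M' = M * (k1 * (1 + b))"
  have M': "0 \<le> M'" using M k1 b0 by (simp add: M'_def)
  \<comment> \<open>The first-order part of \<open>r\<close> at \<open>y\<close>, including the
    correction from the group law.\<close>
  define \<Lambda>r where "\<Lambda>r y \<xi> = Lam y \<xi> $ 1 $ 3 - ss y * Lam y \<xi> $ 1 $ 2" for y \<xi>
  have lin\<Lambda>r: "linear (\<Lambda>r y)" if "y \<in> X" for y
    unfolding \<Lambda>r_def using linLam[OF that, of 1 3] linLam[OF that, of 1 2] by (auto simp: linear_iff algebra_simps)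
  have app: "\<exists>d>0. \<forall>y\<in>X. \<forall>z\<in>X. norm (z - y) \<le> d \<longrightarrow> \<bar>p z y - Lam y (z - y) $ 1 $ 2\<bar> \<le> \<omega> * norm (z - y) \<and>
       \<bar>r z y - \<Lambda>r y (z - y)\<bar> \<le> \<omega> * norm (z - y) \<and> \<bar>s z y - Lam y (z - y) $ 2 $ 3\<bar> \<le> \<omega> * norm (z - y)"
    if \<omega>: "0 < \<omega>" for \<omega>
  proof -
    have "0 < \<omega> / (1 + b)" using \<omega> b0 by simp
    then obtain d where d: "d > 0" "\<And>y z i j. y \<in> X \<Longrightarrow> z \<in> X \<Longrightarrow> norm (z - y) \<le> d \<Longrightarrow>
       \<bar>N z $ i $ j - N y $ i $ j - Lam y (z - y) $ i $ j\<bar> \<le> \<omega> / (1 + b) * norm (z - y)"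
      using Napp[of "\<omega> / (1 + b)"] by blast
    have "\<bar>p z y - Lam y (z - y) $ 1 $ 2\<bar> \<le> \<omega> * norm (z - y) \<and>
       \<bar>r z y - \<Lambda>r y (z - y)\<bar> \<le> \<omega> * norm (z - y) \<and> \<bar>s z y - Lam y (z - y) $ 2 $ 3\<bar> \<le> \<omega> * norm (z - y)"
      if yz: "y \<in> X" "z \<in> X" "norm (z - y) \<le> d" for y z
    proof -
      let ?e = "\<omega> / (1 + b) * norm (z - y)"
      have e0: "0 \<le> ?e" using \<omega> b0 by simp
      have es: "?e + b * ?e = \<omega> * norm (z - y)"
      proof -
        have "?e + b * ?e = (1 + b) * (\<omega> / (1 + b)) * norm (z - y)" by (simp only: distrib_right mult_1_left mult.assoc)
        then show ?thesis using b0 by simp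
      qed
      have q: "\<bar>pp z - pp y - Lam y (z - y) $ 1 $ 2\<bar> \<le> ?e" "\<bar>rr z - rr y - Lam y (z - y) $ 1 $ 3\<bar> \<le> ?e"
        "\<bar>ss z - ss y - Lam y (z - y) $ 2 $ 3\<bar> \<le> ?e"
        using d(2)[OF yz] by (auto simp: pp_def rr_def ss_def)
      have m: "\<bar>ss y * (pp z - pp y - Lam y (z - y) $ 1 $ 2)\<bar> \<le> b * ?e"
        unfolding abs_mult using pb[OF yz(1)] q b0 by (intro mult_mono) auto
      have be: "0 \<le> b * ?e" using b0 e0 by (rule mult_nonneg_nonneg)
      have rd: "r z y - \<Lambda>r y (z - y) = (rr z - rr y - Lam y (z - y) $ 1 $ 3) - ss y * (pp z - pp y - Lam y (z - y) $ 1 $ 2)"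
        by (simp add: r_def \<Lambda>r_def algebra_simps)
      show ?thesis unfolding rd p_def s_def es[symmetric] using q m be by linarith
    qed
    then show ?thesis using d(1) by blast
  qed
  have expSL: "\<psi> x \<in> SL3R" if "x \<in> X" for x using im XW that by (auto simp: expanding_horospherical_def)
  have "\<exists>\<tau>. strategy V \<tau> \<and> wins V \<beta> ?S \<tau> (x0, \<rho>0)"
  proof (cases "0 \<le> l2")
    case True
    have l23: "l2 \<noteq> l3" using l l13 True by linarith
    have fam: "unipotent_family X B Bi (det Pi) L bd l1 l2"
    proof
      show "\<exists>p r s. \<bar>p\<bar> \<le> L * dist x y \<and> \<bar>r\<bar> \<le> L * dist x y \<and> \<bar>s\<bar> \<le> L * dist x y \<and> B x = unip p r s ** B y"
        if "x \<in> X" "y \<in> X" for x y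
        using lips[OF that] rel[OF that] by blast
      show "0 < l1" using l l13 True by linarith
    qed (use inv det dPi bdB bdBi bd1 L1 True l in auto)
    show ?thesis
    proof (rule unipotent_strategy[OF V \<beta> x0 fam[unfolded X_def], folded X_def, where p = p and r = r and s = s
        and ?\<Lambda>r = \<Lambda>r and ?\<Lambda>s = "\<lambda>y \<xi>. Lam y \<xi> $ 2 $ 3" and M = M'])
      show "\<exists>d>0. \<forall>y\<in>X. \<forall>z\<in>X. norm (z - y) \<le> d \<longrightarrow>
        \<bar>r z y - \<Lambda>r y (z - y)\<bar> \<le> \<omega> * norm (z - y) \<and> \<bar>s z y - Lam y (z - y) $ 2 $ 3\<bar> \<le> \<omega> * norm (z - y)"
        if "0 < \<omega>" for \<omega> using app[OF that] by blast
      show "\<exists>\<xi>1\<in>V. \<exists>\<xi>2\<in>V. norm \<xi>1 \<le> M' \<and> norm \<xi>2 \<le> M' \<and>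
        \<Lambda>r y \<xi>1 = 1 \<and> Lam y \<xi>1 $ 2 $ 3 = 0 \<and> \<Lambda>r y \<xi>2 = 0 \<and> Lam y \<xi>2 $ 2 $ 3 = 1" if y: "y \<in> X" for y
      proof -
        obtain \<xi>1 where "\<xi>1 \<in> V" "Lam y \<xi>1 $ 1 $ 2 = 0" "Lam y \<xi>1 $ 1 $ 3 = 1" "Lam y \<xi>1 $ 2 $ 3 = 0" "norm \<xi>1 \<le> M'"
          using frame[OF y, of 0 0 1] b0 unfolding M'_def by auto
        moreover obtain \<xi>2 where "\<xi>2 \<in> V" "Lam y \<xi>2 $ 1 $ 2 = 0" "Lam y \<xi>2 $ 1 $ 3 = 0" "Lam y \<xi>2 $ 2 $ 3 = 1" "norm \<xi>2 \<le> M'"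
          using frame[OF y, of 0 1 0] b0 l23 unfolding M'_def by auto
        ultimately show ?thesis by (intro bexI[of _ \<xi>1] bexI[of _ \<xi>2]) (auto simp: \<Lambda>r_def)
      qed
      fix x \<epsilon> assume x: "x \<in> X" and \<epsilon>: "0 < \<epsilon>" "\<epsilon> \<le> 1" and nd: "\<And>s. 0 \<le> s \<Longrightarrow> \<not> unipotent_family.danger B l1 l2 \<epsilon> x s"
      have "act (\<psi> x) (left_coset A0) \<in> bounded_orbit_points (g ` {0..})"
      proof (rule no_danger_imp_bounded[OF B_def expSL[OF x] A0 \<epsilon>])
        show "\<not> (exp (l1 * real n) * \<bar>(B x *v v) $ 1\<bar> \<le> \<epsilon> \<and> exp (l2 * real n) * \<bar>(B x *v v) $ 2\<bar> \<le> \<epsilon> \<and>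
           \<bar>(B x *v v) $ 3\<bar> \<le> exp ((l1 + l2) * real n))" if "integral_vec v" "v \<noteq> 0" for n v
          using nd[of "real n"] that unfolding unipotent_family.danger_def[OF fam] unipotent_family.V_def[OF fam] by auto
      qed
      then show "x \<in> ?S" using x XW by blast
    qed (fact rel lin\<Lambda>r linLam M')+
  next
    case False
    have l12: "l1 \<noteq> l2" using l l13 False by linarith
    define B' where "B' x = reversal ** transpose (Bi x)" for x
    define Bi' where "Bi' x = transpose (B x) ** reversal" for x
    let ?L = "L * (1 + L * (2 * \<rho>0))"
    have m: "0 \<le> - l2" "- l2 \<le> - l3" "0 < - l3" using False l by auto
    have lrel: "\<bar>p x y\<bar> \<le> L * dist x y \<and> \<bar>r x y\<bar> \<le> L * dist x y \<and> \<bar>s x y\<bar> \<le> L * dist x y \<and> B x = unip (p x y) (r x y) (s x y) ** B y"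
      if "x \<in> X" "y \<in> X" for x y using lips[OF that] rel[OF that] by blast
    have \<rho>2: "0 \<le> 2 * \<rho>0" using x0 by simp
    have fam: "unipotent_family X B' Bi' (- (1 / det Pi)) ?L bd (- l3) (- l2)"
      and rel': "\<And>x y. x \<in> X \<Longrightarrow> y \<in> X \<Longrightarrow> B' x = unip (- s x y) (p x y * s x y - r x y) (- p x y) ** B' y"
      using unipotent_family_dual[of X Bi B "det Pi" bd p L r s "2 * \<rho>0" "- l2" "- l3", OF inv det dPi bdB bdBi bd1 lrel L1 diam \<rho>2 m]
      unfolding B'_def Bi'_def by blast+
    show ?thesis
    proof (rule unipotent_strategy[OF V \<beta> x0 fam[unfolded X_def], folded X_def, where p = "\<lambda>x y. - s x y"
        and r = "\<lambda>x y. p x y * s x y - r x y" and s = "\<lambda>x y. - p x y"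
        and ?\<Lambda>r = "\<lambda>y \<xi>. - \<Lambda>r y \<xi>" and ?\<Lambda>s = "\<lambda>y \<xi>. - Lam y \<xi> $ 1 $ 2" and M = M'])
      show "\<exists>d>0. \<forall>y\<in>X. \<forall>z\<in>X. norm (z - y) \<le> d \<longrightarrow>
        \<bar>p z y * s z y - r z y - - \<Lambda>r y (z - y)\<bar> \<le> \<omega> * norm (z - y) \<and> \<bar>- p z y - - Lam y (z - y) $ 1 $ 2\<bar> \<le> \<omega> * norm (z - y)"
        if \<omega>: "0 < \<omega>" for \<omega>
      proof -
        obtain d where d: "d > 0" "\<And>y z. y \<in> X \<Longrightarrow> z \<in> X \<Longrightarrow> norm (z - y) \<le> d \<Longrightarrow> \<bar>p z y - Lam y (z - y) $ 1 $ 2\<bar> \<le> \<omega> / 2 * norm (z - y) \<and>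
          \<bar>r z y - \<Lambda>r y (z - y)\<bar> \<le> \<omega> / 2 * norm (z - y)"
          using app[of "\<omega> / 2"] \<omega> by (metis half_gt_zero)
        define d' where "d' = min d (\<omega> / (2 * (L * L)))"
        have LL: "0 < L * L" using L1 by simp
        have d': "0 < d'" "d' \<le> d" "L * L * d' \<le> \<omega> / 2"
        proof -
          show "0 < d'" "d' \<le> d" using d(1) \<omega> LL by (auto simp: d'_def)
          have "d' \<le> \<omega> / (2 * (L * L))" by (simp add: d'_def)
          then show "L * L * d' \<le> \<omega> / 2" using LL by (simp add: pos_le_divide_eq mult_ac)
        qed
        have "\<bar>p z y * s z y - r z y - - \<Lambda>r y (z - y)\<bar> \<le> \<omega> * norm (z - y) \<and> \<bar>- p z y - - Lam y (z - y) $ 1 $ 2\<bar> \<le> \<omega> * norm (z - y)"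
          if yz: "y \<in> X" "z \<in> X" "norm (z - y) \<le> d'" for y z
        proof -
          let ?n = "norm (z - y)"
          have "\<bar>p z y * s z y\<bar> \<le> (L * ?n) * (L * ?n)"
            unfolding abs_mult using lips[OF yz(2,1)] L1 by (intro mult_mono) (auto simp: dist_norm)
          also have "\<dots> = L * L * ?n * ?n" by simp
          also have "\<dots> \<le> L * L * d' * ?n" using yz(3) LL by (intro mult_right_mono mult_left_mono) auto
          also have "\<dots> \<le> \<omega> / 2 * ?n" using d'(3) by (intro mult_right_mono) auto
          finally have 1: "\<bar>p z y * s z y\<bar> \<le> \<omega> / 2 * ?n" .
          have 2: "\<bar>p z y - Lam y (z - y) $ 1 $ 2\<bar> \<le> \<omega> / 2 * ?n" "\<bar>r z y - \<Lambda>r y (z - y)\<bar> \<le> \<omega> / 2 * ?n"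
            using d(2)[OF yz(1,2)] yz(3) d'(2) by auto
          have "\<omega> * ?n = \<omega> / 2 * ?n + \<omega> / 2 * ?n" "0 \<le> \<omega> / 2 * ?n" using \<omega> by auto
          then show ?thesis using 1 2 by linarith
        qed
        then show ?thesis using d'(1) by blast
      qed
      show "\<exists>\<xi>1\<in>V. \<exists>\<xi>2\<in>V. norm \<xi>1 \<le> M' \<and> norm \<xi>2 \<le> M' \<and>
        - \<Lambda>r y \<xi>1 = 1 \<and> - Lam y \<xi>1 $ 1 $ 2 = 0 \<and> - \<Lambda>r y \<xi>2 = 0 \<and> - Lam y \<xi>2 $ 1 $ 2 = 1" if y: "y \<in> X" for y
      proof -
        obtain \<xi>1 where "\<xi>1 \<in> V" "Lam y \<xi>1 $ 1 $ 2 = 0" "Lam y \<xi>1 $ 1 $ 3 = -1" "Lam y \<xi>1 $ 2 $ 3 = 0" "norm \<xi>1 \<le> M'"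
          using frame[OF y, of 0 0 "-1"] b0 unfolding M'_def by auto
        \<comment> \<open>The corner entry \<open>- ss y\<close> compensates the correction term in
          \<open>\<Lambda>r\<close>, so that \<open>\<Lambda>r\<close> vanishes on
          \<open>\<xi>2\<close>.\<close>
        moreover obtain \<xi>2 where "\<xi>2 \<in> V" "Lam y \<xi>2 $ 1 $ 2 = -1" "Lam y \<xi>2 $ 1 $ 3 = - ss y" "Lam y \<xi>2 $ 2 $ 3 = 0" "norm \<xi>2 \<le> M'"
          using frame[OF y, of "-1" 0 "- ss y"] pb(3)[OF y] l12 unfolding M'_def by auto
        ultimately show ?thesis by (intro bexI[of _ \<xi>1] bexI[of _ \<xi>2]) (auto simp: \<Lambda>r_def)
      qed
      fix x \<epsilon> assume x: "x \<in> X" and \<epsilon>: "0 < \<epsilon>" "\<epsilon> \<le> 1" and nd: "\<And>s. 0 \<le> s \<Longrightarrow> \<not> unipotent_family.danger B' (- l3) (- l2) \<epsilon> x s"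
      have "act (\<psi> x) (left_coset A0) \<in> bounded_orbit_points (g ` {0..})"
      proof (rule no_dual_danger_imp_bounded[OF B_def inv[OF x] expSL[OF x] A0 \<epsilon>])
        show "\<not> (exp (- l3 * real n) * \<bar>((reversal ** transpose (Bi x)) *v v) $ 1\<bar> \<le> \<epsilon> \<and>
           exp (- l2 * real n) * \<bar>((reversal ** transpose (Bi x)) *v v) $ 2\<bar> \<le> \<epsilon> \<and>
           \<bar>((reversal ** transpose (Bi x)) *v v) $ 3\<bar> \<le> exp ((- l3 + - l2) * real n))" if "integral_vec v" "v \<noteq> 0" for n v
          using nd[of "real n"] that
          unfolding unipotent_family.danger_def[OF fam] unipotent_family.V_def[OF fam] B'_def by (simp only: of_nat_0_le_iff) blast
      qed
      then show "x \<in> ?S" using x XW by blast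
    next
      show "linear (\<lambda>\<xi>. - \<Lambda>r y \<xi>)" "linear (\<lambda>\<xi>. - Lam y \<xi> $ 1 $ 2)" if "y \<in> X" for y
        using lin\<Lambda>r[OF that] linLam[OF that, of 1 2] by (auto simp: linear_iff)
    qed (fact rel' M')+
  qed
  then show "\<exists>\<tau>. strategy V \<tau> \<and> wins V \<beta> ?S \<tau> B0" by (simp add: B0_eq)
qed

end

section \<open>The main theorem\<close>

text \<open>Nested nonempty compact balls have a common point. This settles charts all of whose
  points belong to the target, including those of dimension 0.\<close>

lemma HAW_self:
  fixes V W :: "'a::euclidean_space set"
  assumes V: "subspace V"
  shows "HAW V W W"
  unfolding HAW_def
proof (intro allI impI)
  fix \<beta> :: real
  assume \<beta>: "0 < \<beta> \<and> \<beta> < 1/3"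
  obtain \<sigma> :: "('a \<times> real) list \<Rightarrow> 'a set \<times> real" where \<sigma>: "alice_strategy V \<beta> \<sigma>"
    using exists_alice_strategy[OF V] \<beta> by blast
  have "(\<Inter>i. ball_of V (B i)) \<inter> W \<noteq> {}" if play: "bob_play V W \<beta> \<sigma> B" for B
  proof -
    have B: "\<And>i. fst (B i) \<in> V \<and> 0 < snd (B i)" "ball_of V (B 0) \<subseteq> W"
      "\<And>i. ball_of V (B (Suc i)) \<subseteq> ball_of V (B i)"
      using play unfolding bob_play_def Let_def case_prod_beta by blast+
    have "(\<Inter>i. ball_of V (B i)) \<noteq> {}"
    proof (rule compact_nest)
      show "compact (ball_of V (B n))" for n
        unfolding ball_of_def by (intro compact_Int_closed closed_subspace V compact_cball)
      have "fst (B n) \<in> ball_of V (B n)" for n using B(1)[of n] by (simp add: ball_of_def)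
      then show "ball_of V (B n) \<noteq> {}" for n by blast
      show "ball_of V (B n) \<subseteq> ball_of V (B m)" if "m \<le> n" for m n by (rule ball_of_nested[of V B, OF B(3) that])
    qed
    moreover have "(\<Inter>i. ball_of V (B i)) \<subseteq> W" using B(2) by blast
    ultimately show ?thesis by blast
  qed
  then show "\<exists>\<sigma>. alice_strategy V \<beta> \<sigma> \<and> (\<forall>B. bob_play V W \<beta> \<sigma> B \<longrightarrow> (\<Inter>i. ball_of V (B i)) \<inter> W \<noteq> {})"
    using \<sigma> by blast
qed

lemma C1_atlas_translate:
  fixes T :: "'a::euclidean_space set"
  assumes "subspace T"
  shows "C1_atlas T ((+) a ` T) {((+) a ` T, \<lambda>x. x - a)}"
proof -
  have im: "(\<lambda>x. x - a) ` (+) a ` T = T" by (auto simp: image_image)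
  have "C1_immersion_on T T ((+) a)"
    unfolding C1_immersion_on_def
    by (intro exI[of _ "\<lambda>x v. v"]) (auto intro!: derivative_eq_intros)
  moreover have "homeomorphism ((+) a ` T) T (\<lambda>x. x - a) ((+) a)"
    by (auto simp: homeomorphism_def image_image intro!: continuous_intros)
  ultimately show ?thesis using assms unfolding C1_atlas_def C1_chart_def by (auto simp: im)
qed

text \<open>The model space of an arbitrary atlas is not fixed in advance; invariance of domain,
  applied in both directions, gives its dimension.\<close>

lemma C1_chart_dim:
  fixes V :: "'a::euclidean_space set" and T :: "'b::euclidean_space set"
  assumes "subspace V" "subspace T" "C1_chart V ((+) a ` T) U \<phi>" "U \<noteq> {}"
  shows "dim V = dim T"
proof -
  obtain \<psi> where U: "openin (top_of_set ((+) a ` T)) U" "openin (top_of_set V) (\<phi> ` U)" and h: "homeomorphism U (\<phi> ` U) \<phi> \<psi>"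
    using assms(3) unfolding C1_chart_def by blast
  have sub: "U \<subseteq> (+) a ` T" "\<phi> ` U \<subseteq> V" using U openin_imp_subset by blast+
  have aff: "affine V" "affine ((+) a ` T)"
    using assms(1,2) subspace_imp_affine affine_translation by blast+
  have "aff_dim ((+) a ` T) \<le> aff_dim V"
    using h sub assms(4)
    by (intro invariance_of_dimension_affine_sets[OF U(1) aff(2,1), of \<phi>])
      (auto simp: homeomorphism_def intro: inj_on_inverseI)
  moreover have "aff_dim V \<le> aff_dim ((+) a ` T)"
    using h sub assms(4)
    by (intro invariance_of_dimension_affine_sets[OF U(2) aff(1,2), of \<psi>])
      (auto simp: homeomorphism_def intro: inj_on_inverseI)
  ultimately have "aff_dim V = aff_dim T" by (simp add: aff_dim_translation_eq)
  then show ?thesis using assms(1,2) by (simp add: aff_dim_subspace)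
qed

context diag_flow
begin

lemma dim_T_pos:
  assumes "l3 < l1"
  shows "dim T > 0"
proof -
  let ?e = "P ** (unip 0 1 0 - mat 1) ** Pi"
  have e: "?e \<in> T" "Pi ** ?e ** P = unip 0 1 0 - mat 1" using unip_in_T[of 0 0 1] assms by auto
  have "(Pi ** ?e ** P) $ 1 $ 3 = 1" unfolding e(2) by (simp add: mat_def)
  moreover have "Pi ** 0 ** P = 0" by (rule linear_0[OF linear_conj])
  ultimately have "?e \<noteq> 0" by (metis zero_index zero_neq_one)
  then have "\<not> T \<subseteq> {0}" using e(1) by blast
  then show ?thesis by (metis dim_eq_0 gr0I)
qed

lemma HAW_on_expanding_horospherical:
  assumes A0: "A0 \<in> SL3R"
  shows "HAW_on_manifold (expanding_horospherical g)
     {h \<in> expanding_horospherical g. act h (left_coset A0) \<in> bounded_orbit_points (g ` {0..})}"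
    (is "HAW_on_manifold ?H ?S")
proof -
  have atlas: "\<exists>(V :: mat3 set) \<A>. C1_atlas V ?H \<A>"
    using C1_atlas_translate[OF subspace_T] unfolding expanding_eq by blast
  have haw: "HAW V (\<phi> ` U) (\<phi> ` (?S \<inter> U))" if V: "subspace V" and chart: "C1_chart V ?H U \<phi>" for V U and \<phi> :: "mat3 \<Rightarrow> mat3"
  proof -
    have UH: "U \<subseteq> ?H" using chart openin_imp_subset unfolding C1_chart_def by blast
    \<comment> \<open>The first alternative covers both the trivial subgroup and an empty chart
      domain.\<close>
    consider "?S \<inter> U = U" | "U \<noteq> {}" "l3 < l1"
    proof (cases "l3 < l1")
      case False
      then have "l1 = 0" "l2 = 0" "l3 = 0" using l by linarith+
      then have "?H \<subseteq> ?S" using orbit_points_trivial A0 by auto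
      then show ?thesis using UH that(1) by blast
    qed (use that in blast)
    then show ?thesis
    proof cases
      case 1
      then show ?thesis using HAW_self[OF V] by simp
    next
      case 2
      obtain \<psi> where W: "openin (top_of_set V) (\<phi> ` U)" and h: "homeomorphism U (\<phi> ` U) \<phi> \<psi>"
        and C1: "C1_immersion_on V (\<phi> ` U) \<psi>"
        using chart unfolding C1_chart_def by blast
      have dim: "dim V = dim T" using C1_chart_dim[OF V subspace_T _ 2(1)] chart unfolding expanding_eq by blast
      have inv: "\<psi> (\<phi> x) = x" if "x \<in> U" for x using h that by (simp add: homeomorphism_def)
      have "HAW V (\<phi> ` U) {x \<in> \<phi> ` U. act (\<psi> x) (left_coset A0) \<in> bounded_orbit_points (g ` {0..})}"
        using UH inv dim_T_pos[OF 2(2)] by (intro HAW_chart[OF A0 2(2) V _ dim W _ C1]) (auto simp: dim)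
      moreover have "{x \<in> \<phi> ` U. act (\<psi> x) (left_coset A0) \<in> bounded_orbit_points (g ` {0..})} = \<phi> ` (?S \<inter> U)"
        using UH inv by auto
      ultimately show ?thesis by simp
    qed
  qed
  show ?thesis
    unfolding HAW_on_manifold_def
  proof (intro conjI allI impI atlas)
    fix V :: "mat3 set" and \<A> assume \<A>: "C1_atlas V ?H \<A>"
    show "\<forall>(U, \<phi>)\<in>\<A>. HAW V (\<phi> ` U) (\<phi> ` (?S \<inter> U))"
    proof (rule ballI, rule prod.case_eq_if[THEN iffD2])
      fix u assume u: "u \<in> \<A>"
      have "C1_chart V ?H (fst u) (snd u)" using \<A> u unfolding C1_atlas_def by auto
      moreover have "subspace V" using \<A> unfolding C1_atlas_def by (elim conjE)
      ultimately show "HAW V (snd u ` fst u) (snd u ` (?S \<inter> fst u))" using haw by simp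
    qed
  qed
qed

end

theorem theorem1p3:
  fixes g :: "real \<Rightarrow> real^3^3" and \<Lambda> :: "(real^3^3) set"
  assumes "one_parameter_subgroup g"
    and "\<forall>t. diagonalizable_over_C (g t)"
    and "\<Lambda> \<in> X3"
  shows "HAW_on_manifold (expanding_horospherical g)
           {h \<in> expanding_horospherical g. act h \<Lambda> \<in> bounded_orbit_points (g ` {0..})}"
proof -
  have "det (g 1) = 1" using assms(1) by (auto simp: one_parameter_subgroup_def SL3R_def)
  then obtain P l1 l2 l3 K where nf: "normal_form (g 1) P l1 l2 l3 K"
    using diagonalizable_normal_form assms(2) by blast
  have "matrix_inv P ** P = mat 1"
    using nf by (intro matrix_inv_cancel(2)) (simp add: normal_form_def invertible_det_nz)
  then interpret diag_flow g P "matrix_inv P" K l1 l2 l3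
    by (rule diag_flow.intro[OF assms(1) nf])
  obtain A0 where A0: "A0 \<in> SL3R" "\<Lambda> = left_coset A0" using assms(3) by (auto simp: X3_def)
  show ?thesis unfolding A0(2) by (rule HAW_on_expanding_horospherical[OF A0(1)])
qed

end
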